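(* Let $(\Omega,\mathcal F,m)$ be a $\sigma$-finite measure space and $1\le p<\infty$. Let $S,T$ be positive $C_0$-semigroups on $L_2(m)$ with generators $A_S,A_T$, respectively. Let $S$ also act on $L_p(m)$ and have a kernel $k^S$ on $L_2(m)\cap L_p(m)$, and let $T$ also act on $L_1(m)$, with $M\ge1$ and $\omega\in\mathbb R$ such that $\|T(t)u\|_1\le Me^{\omega t}\|u\|_1$ for all $t\ge0$ and $u\in L_1(m)$. Assume there exist $0\le f\in L_p(m)$ and $C_0\ge0$ such that $$\langle A_Tu,v'\rangle_{2,2}\le\langle u,A_S^\sigma v'\rangle_{2,2}+C_0\,\|u\|_1\,\langle f,v'\rangle_{p,p'}$$ for all $0\le u\in D(A_T)\cap L_1(m)$ and $0\le v'\in D(A_S^\sigma)\cap L_{p'}(m)$. Then $T$ has a kernel $k^T\colon(0,\infty)\times\Omega^2\to\mathbb R$ on $L_2(m)\cap L_1(m)$, and there exists $C\ge0$ such that $$k^T(t,x,y)\le k^S(t,x,y)+C\int_0^te^{\omega(t-s)}\int_\Omega k^S(s,x,z)\,f(z)\,dm(z)\,ds$$ for all $t>0$ and $m^2$-a.a. $(x,y)\in\Omega^2$.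
   Context: All vector spaces are over $\mathbb R$; $m^2$ is the product measure on $\Omega^2$. For $1\le p<\infty$, $p'$ is the dual exponent, $\frac1p+\frac1{p'}=1$ (with $\frac1\infty=0$). For $\varphi\in L_p(m)$, $\psi\in L_{p'}(m)=L_p(m)'$, $\langle\varphi,\psi\rangle_{p,p'}:=\int_\Omega\varphi\psi\,dm$. A semigroup is positive if it maps nonnegative functions to nonnegative functions. A $C_0$-semigroup $T$ on $L_2(m)$ also acts on $L_q(m)$ ($1\le q<\infty$) if there are $M\ge1$, $\omega\in\mathbb R$ with $\|T(t)u\|_q\le Me^{\omega t}\|u\|_q$ for all $u\in L_2(m)\cap L_q(m)$, $t\ge0$; then $T$ extends to a $C_0$-semigroup on $L_q(m)$, again denoted by $T$. $S$ has a kernel $k^S\colon(0,\infty)\times\Omega^2\to\mathbb R$ on $L_2(m)\cap L_p(m)$ if $k^S$ is an integral kernel for $S$ there, i.e. $S(t)u=\int_\Omega k^S(t,\cdot,y)u(y)\,dm(y)$ for all $u\in L_2(m)\cap L_p(m)$, $t>0$; similarly for $T$ on $L_2(m)\cap L_1(m)$. For a $C_0$-semigroup $S$ with generator $A$ on a Banach space $X$, the weak$^*$-generator of $S(\cdot)'$ is $A^\sigma:=\{(x',y')\in X'\times X':\ \text{w}^*\text{-}\lim_{t\downarrow0}\frac1t(S(t)'x'-x')=y'\}$ (which equals the dual operator $A'$). Here $A_S^\sigma$ is formed for $S$ on $X=L_2(m)$, with $L_2(m)'=L_2(m)$. *)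

theory Defs
  imports "HOL-Analysis.Analysis"
begin

text \<open>
  Elements of \<open>L\<^sub>q(m)\<close> are represented by real-valued measurable functions; every notion
  below is invariant under changing such functions on \<open>m\<close>-null sets, and equalities and
  inequalities between elements of \<open>L\<^sub>q(m)\<close> are required almost everywhere only.
  The exponent \<open>q\<close> ranges over \<open>[1, \<infinity>]\<close>.
\<close>

definition Lp :: "ennreal \<Rightarrow> 'a measure \<Rightarrow> ('a \<Rightarrow> real) set" where
  "Lp q m = {u \<in> borel_measurable m.
     if q = \<infinity> then (\<exists>K. AE x in m. \<bar>u x\<bar> \<le> K)
     else integrable m (\<lambda>x. \<bar>u x\<bar> powr enn2real q)}"

definition Lp_norm :: "ennreal \<Rightarrow> 'a measure \<Rightarrow> ('a \<Rightarrow> real) \<Rightarrow> real" where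
  "Lp_norm q m u =
     (if q = \<infinity> then Inf {K. 0 \<le> K \<and> (AE x in m. \<bar>u x\<bar> \<le> K)}
      else (LINT x|m. \<bar>u x\<bar> powr enn2real q) powr (1 / enn2real q))"

definition pairing :: "'a measure \<Rightarrow> ('a \<Rightarrow> real) \<Rightarrow> ('a \<Rightarrow> real) \<Rightarrow> real" where
  "pairing m \<phi> \<psi> = (LINT x|m. \<phi> x * \<psi> x)"

definition bounded_operator_L2 :: "'a measure \<Rightarrow> (('a \<Rightarrow> real) \<Rightarrow> ('a \<Rightarrow> real)) \<Rightarrow> bool" where
  "bounded_operator_L2 m B \<longleftrightarrow>
     (\<forall>u \<in> Lp 2 m. B u \<in> Lp 2 m) \<and>
     (\<forall>u \<in> Lp 2 m. \<forall>v \<in> Lp 2 m. (AE x in m. u x = v x) \<longrightarrow> (AE x in m. B u x = B v x)) \<and>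
     (\<forall>u \<in> Lp 2 m. \<forall>v \<in> Lp 2 m. AE x in m. B (\<lambda>y. u y + v y) x = B u x + B v x) \<and>
     (\<forall>c. \<forall>u \<in> Lp 2 m. AE x in m. B (\<lambda>y. c * u y) x = c * B u x) \<and>
     (\<exists>K. \<forall>u \<in> Lp 2 m. Lp_norm 2 m (B u) \<le> K * Lp_norm 2 m u)"

definition C0_semigroup_L2 :: "'a measure \<Rightarrow> (real \<Rightarrow> ('a \<Rightarrow> real) \<Rightarrow> ('a \<Rightarrow> real)) \<Rightarrow> bool" where
  "C0_semigroup_L2 m T \<longleftrightarrow>
     (\<forall>t\<ge>0. bounded_operator_L2 m (T t)) \<and>
     (\<forall>u \<in> Lp 2 m. AE x in m. T 0 u x = u x) \<and>
     (\<forall>s\<ge>0. \<forall>t\<ge>0. \<forall>u \<in> Lp 2 m. AE x in m. T (s + t) u x = T s (T t u) x) \<and>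
     (\<forall>u \<in> Lp 2 m. ((\<lambda>t. Lp_norm 2 m (\<lambda>x. T t u x - u x)) \<longlongrightarrow> 0) (at_right 0))"

definition positive_semigroup_L2 :: "'a measure \<Rightarrow> (real \<Rightarrow> ('a \<Rightarrow> real) \<Rightarrow> ('a \<Rightarrow> real)) \<Rightarrow> bool" where
  "positive_semigroup_L2 m T \<longleftrightarrow>
     (\<forall>t\<ge>0. \<forall>u \<in> Lp 2 m. (AE x in m. 0 \<le> u x) \<longrightarrow> (AE x in m. 0 \<le> T t u x))"

text \<open>The generator as a graph: \<open>(u, w) \<in> generator_L2 m T\<close> means \<open>u \<in> D(A)\<close> and \<open>A u = w\<close> a.e.\<close>

definition generator_L2 ::
  "'a measure \<Rightarrow> (real \<Rightarrow> ('a \<Rightarrow> real) \<Rightarrow> ('a \<Rightarrow> real)) \<Rightarrow> (('a \<Rightarrow> real) \<times> ('a \<Rightarrow> real)) set" where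
  "generator_L2 m T = {(u, w). u \<in> Lp 2 m \<and> w \<in> Lp 2 m \<and>
     ((\<lambda>t. Lp_norm 2 m (\<lambda>x. (1 / t) * (T t u x - u x) - w x)) \<longlongrightarrow> 0) (at_right 0)}"

text \<open>
  The functional \<open>S(t)' v\<close> on \<open>L\<^sub>2(m)\<close> is \<open>u \<mapsto> \<langle>S(t) u, v\<rangle>\<close>, so the weak* limit of
  \<open>(1 / t) (S(t)' v - v)\<close> is tested against each \<open>u \<in> L\<^sub>2(m)\<close> as follows.
\<close>

definition weak_star_generator_L2 ::
  "'a measure \<Rightarrow> (real \<Rightarrow> ('a \<Rightarrow> real) \<Rightarrow> ('a \<Rightarrow> real)) \<Rightarrow> (('a \<Rightarrow> real) \<times> ('a \<Rightarrow> real)) set" where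
  "weak_star_generator_L2 m S = {(v, w). v \<in> Lp 2 m \<and> w \<in> Lp 2 m \<and>
     (\<forall>u \<in> Lp 2 m.
        ((\<lambda>t. (1 / t) * (pairing m (S t u) v - pairing m u v)) \<longlongrightarrow> pairing m u w) (at_right 0))}"

definition acts_on_Lp_with ::
  "ennreal \<Rightarrow> 'a measure \<Rightarrow> (real \<Rightarrow> ('a \<Rightarrow> real) \<Rightarrow> ('a \<Rightarrow> real)) \<Rightarrow> real \<Rightarrow> real \<Rightarrow> bool" where
  "acts_on_Lp_with q m T K \<omega> \<longleftrightarrow>
     (\<forall>t\<ge>0. \<forall>u \<in> Lp 2 m \<inter> Lp q m.
        T t u \<in> Lp q m \<and> Lp_norm q m (T t u) \<le> K * exp (\<omega> * t) * Lp_norm q m u)"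

definition acts_on_Lp ::
  "ennreal \<Rightarrow> 'a measure \<Rightarrow> (real \<Rightarrow> ('a \<Rightarrow> real) \<Rightarrow> ('a \<Rightarrow> real)) \<Rightarrow> bool" where
  "acts_on_Lp q m T \<longleftrightarrow> (\<exists>K\<ge>1. \<exists>\<omega>. acts_on_Lp_with q m T K \<omega>)"

text \<open>
  A kernel is jointly measurable on \<open>(0, \<infinity>) \<times> \<Omega>\<^sup>2\<close>, so that iterated integrals in space and
  time are meaningful. Integrability is demanded explicitly because the Bochner integral of a
  non-integrable function is \<open>0\<close> by convention. Values \<open>k t x y\<close> for \<open>t \<le> 0\<close> are irrelevant.
\<close>

definition is_kernel ::
  "ennreal \<Rightarrow> 'a measure \<Rightarrow> (real \<Rightarrow> ('a \<Rightarrow> real) \<Rightarrow> ('a \<Rightarrow> real)) \<Rightarrow> (real \<Rightarrow> 'a \<Rightarrow> 'a \<Rightarrow> real) \<Rightarrow> bool" where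
  "is_kernel q m T k \<longleftrightarrow>
     (\<lambda>(t, x, y). k t x y) \<in> borel_measurable (restrict_space borel {0<..} \<Otimes>\<^sub>M (m \<Otimes>\<^sub>M m)) \<and>
     (\<forall>t>0. \<forall>u \<in> Lp 2 m \<inter> Lp q m. AE x in m.
        integrable m (\<lambda>y. k t x y * u y) \<and> T t u x = (LINT y|m. k t x y * u y))"

end

theory Submission
  imports Defs
begin

text \<open>
  Write \<open>\<langle>S(b)T(a)u, v\<rangle> = G(a, b)\<close>. Applied to the time averages
  \<open>u\<^sub>h = h\<^sup>-\<^sup>1\<integral>\<^sub>0\<^sup>h T(a + s)u ds\<close> and \<open>v\<^sub>h = h\<^sup>-\<^sup>1\<integral>\<^sub>0\<^sup>h S(b + s)'v ds\<close>, which lie in the domains of the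
  generators, the form inequality says that \<open>\<partial>\<^sub>aG - \<partial>\<^sub>bG\<close>, averaged over squares of side length
  \<open>h\<close>, is at most \<open>C\<^sub>0M e\<^sup>\<omega>\<^sup>a\<parallel>u\<parallel>\<^sub>1 \<langle>S(b)f, v\<rangle>\<close> up to factors tending to 1. Integrating along
  \<open>a + b = t\<close> and letting \<open>h \<rightarrow> 0\<close> shows that \<open>T(t)\<close> is dominated by the integral operator with
  kernel \<open>k\<^sup>S(t, x, y) + C\<^sub>0M \<integral>\<^sub>0\<^sup>t e\<^sup>\<omega>\<^sup>(\<^sup>t\<^sup>-\<^sup>s\<^sup>)(S(s)f)(x) ds\<close>. The averages \<open>v\<^sub>h\<close> are given by the kernel \<open>k\<^sup>S\<close>,
  so that no representation theorem for functionals is needed.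

  A positive operator dominated by an integral operator defines on measurable rectangles a
  set function that is countably additive by domination; its Radon-Nikodym density is the kernel of
  \<open>T(t)\<close>. By \<open>T(\<sigma> + s) = T(\<sigma>)T(s)\<close> this kernel depends continuously on time in a
  weighted \<open>L\<^sub>1\<close>-space, which yields a version that is jointly measurable in time and space.
\<close>

section \<open>Elementary facts on \<open>L\<^sub>1\<close> and \<open>L\<^sub>2\<close>\<close>

text \<open>The form inequality is available only for nonnegative pairs with u in D(A_T) and L_1 and
  v' in D(A_S^sigma) and L_p'. Time averages meet all these constraints at once; this is why
  \<open>G\<close> itself is never differentiated, only its integrals over squares are. To see that
  the averages of S(b)'v lie in L_p', S(b)'v is written as the integral of v(x) k^S(b, x, y) over x,
  and membership is read off from a converse Hoelder inequality. Sigma-finiteness enters through one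
  weight w with 0 < w \<le> 1 and finite integral: it lies in every L_q, its multiples by indicators
  replace indicators of sets of finite measure, and the v with 0 \<le> v \<le> w are the test
  functions. The constant in the conclusion is C = C0 M, since the L_1 bound for T is spent only
  once. Null sets are the recurrent obstacle: many facts hold for each time, or for each set, off a
  null set depending on it. They are therefore turned into identities between integrals or measures
  and only then read pointwise again.\<close>

lemma Lp_2_iff: "u \<in> Lp 2 m \<longleftrightarrow> u \<in> borel_measurable m \<and> integrable m (\<lambda>x. (u x)\<^sup>2)"
  by (simp add: Lp_def)

lemma Lp_1_iff: "u \<in> Lp 1 m \<longleftrightarrow> integrable m u"
  by (auto simp: Lp_def integrable_abs_iff)

lemma Lp_norm_1: "Lp_norm 1 m u = (LINT x|m. \<bar>u x\<bar>)"
  by (simp add: Lp_norm_def)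

abbreviation norm2 :: "'a measure \<Rightarrow> ('a \<Rightarrow> real) \<Rightarrow> real" where
  "norm2 m u \<equiv> Lp_norm 2 m u"

lemma norm2_eq_sqrt: "norm2 m u = sqrt (LINT x|m. (u x)\<^sup>2)"
proof -
  have "0 \<le> (LINT x|m. (u x)\<^sup>2)" by simp
  then show ?thesis by (simp add: Lp_norm_def powr_half_sqrt)
qed

lemma norm2_nonneg [simp]: "0 \<le> norm2 m u"
  by (simp add: norm2_eq_sqrt)

lemma norm2_sq: "(norm2 m u)\<^sup>2 = (LINT x|m. (u x)\<^sup>2)"
  by (simp add: norm2_eq_sqrt)

lemma L2_measurable: "u \<in> Lp 2 m \<Longrightarrow> u \<in> borel_measurable m"
  by (simp add: Lp_2_iff)

lemma norm2_nn_integral: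
  assumes "u \<in> Lp 2 m"
  shows "(\<integral>\<^sup>+x. ennreal ((u x)\<^sup>2) \<partial>m) = ennreal ((norm2 m u)\<^sup>2)"
  using assms by (simp add: Lp_2_iff norm2_sq nn_integral_eq_integral)

lemma L2I:
  assumes "u \<in> borel_measurable m" "(\<integral>\<^sup>+x. ennreal ((u x)\<^sup>2) \<partial>m) \<le> ennreal (c\<^sup>2)" "0 \<le> c"
  shows "u \<in> Lp 2 m" "norm2 m u \<le> c"
proof -
  have "integrable m (\<lambda>x. (u x)\<^sup>2)"
    using assms by (intro integrableI_nonneg) (auto simp: less_top[symmetric] top_unique)
  then show u: "u \<in> Lp 2 m" using assms by (simp add: Lp_2_iff)
  have "(norm2 m u)\<^sup>2 \<le> c\<^sup>2"
    using norm2_nn_integral[OF u] assms by simp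
  then show "norm2 m u \<le> c" using assms(3) by (rule power2_le_imp_le)
qed

lemma L2_mono:
  assumes v: "v \<in> Lp 2 m" and u: "u \<in> borel_measurable m" and "AE x in m. \<bar>u x\<bar> \<le> \<bar>v x\<bar>"
  shows "u \<in> Lp 2 m" "norm2 m u \<le> norm2 m v"
proof -
  have "(\<integral>\<^sup>+x. ennreal ((u x)\<^sup>2) \<partial>m) \<le> (\<integral>\<^sup>+x. ennreal ((v x)\<^sup>2) \<partial>m)"
    using assms(3) by (intro nn_integral_mono_AE) (auto simp: abs_le_square_iff)
  then have "(\<integral>\<^sup>+x. ennreal ((u x)\<^sup>2) \<partial>m) \<le> ennreal ((norm2 m v)\<^sup>2)"
    using norm2_nn_integral[OF v] by simp
  from L2I[OF u this] show "u \<in> Lp 2 m" "norm2 m u \<le> norm2 m v" by auto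
qed

lemma L2_cong:
  assumes "v \<in> Lp 2 m" "u \<in> borel_measurable m" "AE x in m. u x = v x"
  shows "u \<in> Lp 2 m" 
  proof (rule L2_mono(1)[OF assms(1,2)])
  show "AE x in m. \<bar>u x\<bar> \<le> \<bar>v x\<bar>" using assms(3) by eventually_elim simp
qed

lemma norm2_cong_AE:
  assumes "u \<in> borel_measurable m" "v \<in> borel_measurable m" "AE x in m. u x = v x"
  shows "norm2 m u = norm2 m v"
  unfolding norm2_eq_sqrt using assms by (auto intro!: arg_cong[of _ _ sqrt] integral_cong_AE)

lemma L2_mult_integrable:
  assumes u: "u \<in> Lp 2 m" and v: "v \<in> Lp 2 m"
  shows "integrable m (\<lambda>x. u x * v x)"
proof (rule Bochner_Integration.integrable_bound)
  show "integrable m (\<lambda>x. (u x)\<^sup>2 + (v x)\<^sup>2)" using u v by (simp add: Lp_2_iff)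
  show "(\<lambda>x. u x * v x) \<in> borel_measurable m" using u v by (auto simp: Lp_2_iff)
  have "\<bar>a * b\<bar> \<le> a\<^sup>2 + b\<^sup>2" for a b :: real
  proof -
    have "0 \<le> (\<bar>a\<bar> - \<bar>b\<bar>)\<^sup>2" by simp
    also have "\<dots> = a\<^sup>2 + b\<^sup>2 - 2 * \<bar>a * b\<bar>" by (simp add: power2_diff abs_mult)
    finally show ?thesis using abs_ge_zero[of "a * b"] by linarith
  qed
  then show "AE x in m. norm (u x * v x) \<le> norm ((u x)\<^sup>2 + (v x)\<^sup>2)" by simp
qed

lemma L2_Cauchy_Schwarz:
  assumes u: "u \<in> Lp 2 m" and v: "v \<in> Lp 2 m"
  shows "(LINT x|m. \<bar>u x * v x\<bar>) \<le> norm2 m u * norm2 m v"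
proof -
  have [measurable]: "u \<in> borel_measurable m" "v \<in> borel_measurable m"
    using u v by (auto simp: Lp_2_iff)
  have "(\<integral>\<^sup>+x. ennreal \<bar>u x\<bar> * ennreal \<bar>v x\<bar> \<partial>m) = ennreal (LINT x|m. \<bar>u x * v x\<bar>)"
    using integrable_abs[OF L2_mult_integrable[OF u v]]
    by (subst nn_integral_eq_integral[symmetric]) (auto simp: ennreal_mult abs_mult)
  moreover have "(\<integral>\<^sup>+x. (ennreal \<bar>z x\<bar>)\<^sup>2 \<partial>m) = ennreal ((norm2 m z)\<^sup>2)" if "z \<in> Lp 2 m" for z
    using norm2_nn_integral[OF that] by (simp add: ennreal_power)
  ultimately have "(ennreal (LINT x|m. \<bar>u x * v x\<bar>))\<^sup>2 \<le> ennreal ((norm2 m u)\<^sup>2) * ennreal ((norm2 m v)\<^sup>2)"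
    using Cauchy_Schwarz_nn_integral[of "\<lambda>x. ennreal \<bar>u x\<bar>" m "\<lambda>x. ennreal \<bar>v x\<bar>"] u v by simp
  then have "(LINT x|m. \<bar>u x * v x\<bar>)\<^sup>2 \<le> (norm2 m u * norm2 m v)\<^sup>2"
    by (simp add: ennreal_power ennreal_mult[symmetric] power_mult_distrib)
  then show ?thesis by (rule power2_le_imp_le) simp
qed

lemma pairing_bound:
  assumes "u \<in> Lp 2 m" "v \<in> Lp 2 m"
  shows "\<bar>pairing m u v\<bar> \<le> norm2 m u * norm2 m v"
  unfolding pairing_def using L2_Cauchy_Schwarz[OF assms] integral_abs_bound[of m "\<lambda>x. u x * v x"] by linarith

lemma L2_add:
  assumes u: "u \<in> Lp 2 m" and v: "v \<in> Lp 2 m"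
  shows "(\<lambda>x. u x + v x) \<in> Lp 2 m" "norm2 m (\<lambda>x. u x + v x) \<le> norm2 m u + norm2 m v"
proof -
  have [measurable]: "u \<in> borel_measurable m" "v \<in> borel_measurable m"
    using u v by (auto simp: Lp_2_iff)
  have i: "integrable m (\<lambda>x. (u x)\<^sup>2)" "integrable m (\<lambda>x. (v x)\<^sup>2)" "integrable m (\<lambda>x. u x * v x)"
    using u v L2_mult_integrable[OF u v] by (auto simp: Lp_2_iff)
  then have j: "integrable m (\<lambda>x. (u x + v x)\<^sup>2)"
    by (simp add: power2_sum mult.assoc)
  then show "(\<lambda>x. u x + v x) \<in> Lp 2 m" by (simp add: Lp_2_iff)
  have "(norm2 m (\<lambda>x. u x + v x))\<^sup>2 = (norm2 m u)\<^sup>2 + (norm2 m v)\<^sup>2 + 2 * pairing m u v"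
    unfolding norm2_sq pairing_def using i by (simp add: power2_sum mult.assoc)
  also have "\<dots> \<le> (norm2 m u + norm2 m v)\<^sup>2"
    using pairing_bound[OF u v] by (simp add: power2_sum)
  finally show "norm2 m (\<lambda>x. u x + v x) \<le> norm2 m u + norm2 m v"
    by (rule power2_le_imp_le) simp
qed

lemma L2_cmult:
  assumes "u \<in> Lp 2 m"
  shows "(\<lambda>x. c * u x) \<in> Lp 2 m" "norm2 m (\<lambda>x. c * u x) = \<bar>c\<bar> * norm2 m u"
  using assms by (auto simp: Lp_2_iff norm2_eq_sqrt power_mult_distrib real_sqrt_mult)

lemma L2_diff:
  assumes u: "u \<in> Lp 2 m" and v: "v \<in> Lp 2 m"
  shows "(\<lambda>x. u x - v x) \<in> Lp 2 m" "norm2 m (\<lambda>x. u x - v x) \<le> norm2 m u + norm2 m v"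
  using L2_add[OF u L2_cmult(1)[OF v, of "-1"]] L2_cmult(2)[OF v, of "-1"] by auto

lemma norm2_minus_commute: "norm2 m (\<lambda>x. u x - v x) = norm2 m (\<lambda>x. v x - u x)"
  by (simp add: norm2_eq_sqrt power2_commute)

lemma norm2_le_add_diff:
  assumes u: "u \<in> Lp 2 m" and v: "v \<in> Lp 2 m"
  shows "norm2 m u \<le> norm2 m v + norm2 m (\<lambda>x. u x - v x)"
  using L2_add(2)[OF v L2_diff(1)[OF u v]] by simp

lemma L2_abs:
  assumes "u \<in> Lp 2 m"
  shows "(\<lambda>x. \<bar>u x\<bar>) \<in> Lp 2 m" "norm2 m (\<lambda>x. \<bar>u x\<bar>) = norm2 m u"
  using assms by (auto simp: Lp_2_iff norm2_eq_sqrt)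

lemma norm2_zero [simp]: "norm2 m (\<lambda>x. 0) = 0"
  by (simp add: norm2_eq_sqrt)

lemma L2_zero [simp]: "(\<lambda>x. 0) \<in> Lp 2 m"
  by (simp add: Lp_2_iff)

lemma norm2_eq_0_AE:
  assumes "u \<in> Lp 2 m" "norm2 m u = 0"
  shows "AE x in m. u x = 0"
proof -
  have "(LINT x|m. (u x)\<^sup>2) = 0" using assms(2) norm2_sq[of m u] by simp
  then show ?thesis using assms(1) integral_nonneg_eq_0_iff_AE[of m "\<lambda>x. (u x)\<^sup>2"]
    by (auto simp: Lp_2_iff)
qed

lemma pairing_diff_left:
  assumes "u \<in> Lp 2 m" "u' \<in> Lp 2 m" "v \<in> Lp 2 m"
  shows "pairing m (\<lambda>x. u x - u' x) v = pairing m u v - pairing m u' v"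
  unfolding pairing_def using L2_mult_integrable[of _ m v] assms by (simp add: left_diff_distrib)

lemma pairing_cong_AE:
  assumes "u \<in> borel_measurable m" "u' \<in> borel_measurable m" "v \<in> borel_measurable m"
    and "AE x in m. u x = u' x"
  shows "pairing m u v = pairing m u' v"
  unfolding pairing_def using assms by (intro integral_cong_AE) auto

section \<open>Positive strongly continuous semigroups on \<open>L\<^sub>2\<close>\<close>

definition positive_operator_L2 :: "'a measure \<Rightarrow> (('a \<Rightarrow> real) \<Rightarrow> ('a \<Rightarrow> real)) \<Rightarrow> bool" where
  "positive_operator_L2 m B \<longleftrightarrow> bounded_operator_L2 m B \<and>
     (\<forall>u \<in> Lp 2 m. (AE x in m. 0 \<le> u x) \<longrightarrow> (AE x in m. 0 \<le> B u x))"

lemma positive_operator_L2D: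
  assumes "positive_operator_L2 m B"
  shows "u \<in> Lp 2 m \<Longrightarrow> B u \<in> Lp 2 m"
    and "u \<in> Lp 2 m \<Longrightarrow> v \<in> Lp 2 m \<Longrightarrow> AE x in m. u x = v x \<Longrightarrow> AE x in m. B u x = B v x"
    and "u \<in> Lp 2 m \<Longrightarrow> v \<in> Lp 2 m \<Longrightarrow> AE x in m. B (\<lambda>y. u y + v y) x = B u x + B v x"
    and "u \<in> Lp 2 m \<Longrightarrow> AE x in m. B (\<lambda>y. c * u y) x = c * B u x"
    and "u \<in> Lp 2 m \<Longrightarrow> AE x in m. 0 \<le> u x \<Longrightarrow> AE x in m. 0 \<le> B u x"
  using assms unfolding positive_operator_L2_def bounded_operator_L2_def by blast+

lemma positive_operator_L2_bound:
  assumes "positive_operator_L2 m B"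
  obtains K where "0 \<le> K" "\<And>u. u \<in> Lp 2 m \<Longrightarrow> norm2 m (B u) \<le> K * norm2 m u"
proof -
  obtain K where "\<forall>u\<in>Lp 2 m. norm2 m (B u) \<le> K * norm2 m u"
    using assms unfolding positive_operator_L2_def bounded_operator_L2_def by blast
  then have "norm2 m (B u) \<le> max 0 K * norm2 m u" if "u \<in> Lp 2 m" for u
    using that by (meson max.cobounded2 mult_right_mono norm2_nonneg order_trans)
  then show ?thesis using that[of "max 0 K"] by simp
qed

lemma positive_operator_L2_diff:
  assumes B: "positive_operator_L2 m B" and u: "u \<in> Lp 2 m" and v: "v \<in> Lp 2 m"
  shows "AE x in m. B (\<lambda>y. u y - v y) x = B u x - B v x"
  using positive_operator_L2D(3)[OF B u L2_cmult(1)[OF v, of "-1"]]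
    positive_operator_L2D(4)[OF B v, of "-1"] by auto

lemma positive_operator_L2_mono:
  assumes B: "positive_operator_L2 m B" and u: "u \<in> Lp 2 m" and v: "v \<in> Lp 2 m"
    and "AE x in m. u x \<le> v x"
  shows "AE x in m. B u x \<le> B v x"
proof -
  have "AE x in m. 0 \<le> B (\<lambda>y. v y - u y) x"
    using assms by (intro positive_operator_L2D(5)[OF B] L2_diff) auto
  with positive_operator_L2_diff[OF B v u] show ?thesis by auto
qed

lemma positive_operator_L2_abs:
  assumes B: "positive_operator_L2 m B" and u: "u \<in> Lp 2 m"
  shows "norm2 m (B u) \<le> norm2 m (B (\<lambda>x. \<bar>u x\<bar>))"
proof (rule L2_mono(2))
  note a = L2_abs(1)[OF u]
  show "B (\<lambda>x. \<bar>u x\<bar>) \<in> Lp 2 m" "B u \<in> borel_measurable m"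
    using positive_operator_L2D(1)[OF B] a u L2_measurable by auto
  have "AE x in m. B u x \<le> B (\<lambda>x. \<bar>u x\<bar>) x"
    by (rule positive_operator_L2_mono[OF B u a]) auto
  moreover have "AE x in m. B (\<lambda>x. -1 * u x) x \<le> B (\<lambda>x. \<bar>u x\<bar>) x"
    by (rule positive_operator_L2_mono[OF B L2_cmult(1)[OF u] a]) auto
  ultimately show "AE x in m. \<bar>B u x\<bar> \<le> \<bar>B (\<lambda>x. \<bar>u x\<bar>) x\<bar>"
    using positive_operator_L2D(4)[OF B u, of "-1"] by eventually_elim auto
qed

lemma L2_dominated_convergence:
  assumes u: "u \<in> Lp 2 m" and v: "\<And>n::nat. v n \<in> borel_measurable m"
    and "AE x in m. \<forall>n. 0 \<le> v n x \<and> v n x \<le> u x" and "AE x in m. (\<lambda>n. v n x) \<longlonglongrightarrow> u x"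
  shows "(\<lambda>n. norm2 m (\<lambda>x. v n x - u x)) \<longlonglongrightarrow> 0"
proof -
  have [measurable]: "u \<in> borel_measurable m" "v n \<in> borel_measurable m" for n
    using u v by (auto simp: Lp_2_iff)
  have "(\<lambda>n. LINT x|m. (v n x - u x)\<^sup>2) \<longlonglongrightarrow> (LINT x|m. 0)"
  proof (rule integral_dominated_convergence[where w = "\<lambda>x. (u x)\<^sup>2"])
    show "AE x in m. (\<lambda>n. (v n x - u x)\<^sup>2) \<longlonglongrightarrow> 0"
      using assms(4)
    proof eventually_elim
      case (elim x)
      then have "(\<lambda>n. (v n x - u x)\<^sup>2) \<longlonglongrightarrow> (u x - u x)\<^sup>2" by (intro tendsto_intros)
      then show ?case by simp
    qed
    show "AE x in m. norm ((v n x - u x)\<^sup>2) \<le> (u x)\<^sup>2" for n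
      using assms(3)
    proof eventually_elim
      case (elim x)
      have "\<bar>v n x - u x\<bar> \<le> \<bar>u x\<bar>"
        using spec[OF elim, of n] by linarith
      then show ?case by (simp add: abs_le_square_iff)
    qed
  qed (use u in \<open>auto simp: Lp_2_iff\<close>)
  then have "(\<lambda>n. sqrt (LINT x|m. (v n x - u x)\<^sup>2)) \<longlonglongrightarrow> sqrt 0"
    by (intro tendsto_real_sqrt) simp
  then show ?thesis by (simp add: norm2_eq_sqrt)
qed

text \<open>Norm convergence alone yields pointwise convergence along a subsequence only. Positivity
  makes \<open>B (v n)\<close> increase to a pointwise limit \<open>l\<close> below
  \<open>B u\<close>, and norm convergence then forces \<open>l\<close> to equal \<open>B u\<close>
  almost everywhere.\<close>

lemma positive_operator_L2_monotone_limit: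
  assumes B: "positive_operator_L2 m B" and u: "u \<in> Lp 2 m" and v: "\<And>n::nat. v n \<in> borel_measurable m"
    and inc: "AE x in m. \<forall>n. 0 \<le> v n x \<and> v n x \<le> v (Suc n) x" 
    and lim: "AE x in m. (\<lambda>n. v n x) \<longlonglongrightarrow> u x"
  shows "AE x in m. (\<forall>n. 0 \<le> B (v n) x \<and> B (v n) x \<le> B (v (Suc n)) x \<and> B (v n) x \<le> B u x) \<and>
    (\<lambda>n. B (v n) x) \<longlonglongrightarrow> B u x"
proof -
  have le: "AE x in m. \<forall>n. 0 \<le> v n x \<and> v n x \<le> u x"
    using inc lim
  proof eventually_elim
    case (elim x)
    then have "incseq (\<lambda>n. v n x)" by (auto intro: incseq_SucI)
    from incseq_le[OF this] elim show ?case by auto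
  qed
  have v2: "v n \<in> Lp 2 m" for n
  proof (rule L2_mono(1)[OF u v])
    show "AE x in m. \<bar>v n x\<bar> \<le> \<bar>u x\<bar>"
      using le
    proof eventually_elim
      case (elim x)
      then have "0 \<le> v n x" "v n x \<le> u x" by auto
      then show ?case by simp
    qed
  qed
  have ae1: "AE x in m. v n x \<le> v (Suc n) x" and ae2: "AE x in m. 0 \<le> v n x" for n
    using inc by (auto simp: AE_all_countable)
  have ae3: "AE x in m. v n x \<le> u x" for n
    using le by (auto simp: AE_all_countable)
  have m1: "AE x in m. B (v n) x \<le> B (v (Suc n)) x" for n
    by (rule positive_operator_L2_mono[OF B v2 v2 ae1])
  have m2: "AE x in m. B (v n) x \<le> B u x" for n
    by (rule positive_operator_L2_mono[OF B v2 u ae3])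
  have m0: "AE x in m. 0 \<le> B (v n) x" for n
    by (rule positive_operator_L2D(5)[OF B v2 ae2])
  have Bv: "B (v n) \<in> Lp 2 m" "B u \<in> Lp 2 m" for n
    using positive_operator_L2D(1)[OF B] v2 u by auto
  then have [measurable]: "B (v n) \<in> borel_measurable m" "B u \<in> borel_measurable m" for n
    by (auto simp: Lp_2_iff)
  define l where "l = (\<lambda>x. lim (\<lambda>n. B (v n) x))"
  have [measurable]: "l \<in> borel_measurable m" unfolding l_def by measurable
  have ae: "AE x in m. \<forall>n. 0 \<le> B (v n) x \<and> B (v n) x \<le> B (v (Suc n)) x \<and> B (v n) x \<le> B u x"
    unfolding AE_all_countable using m0 m1 m2 by auto
  have conv: "AE x in m. (\<lambda>n. B (v n) x) \<longlonglongrightarrow> l x \<and> (\<forall>n. B (v n) x \<le> l x) \<and> l x \<le> B u x"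
    using ae
  proof eventually_elim
    case (elim x)
    then have i: "incseq (\<lambda>n. B (v n) x)" by (auto intro: incseq_SucI)
    moreover have "Bseq (\<lambda>n. B (v n) x)"
      using elim by (intro BseqI'[of _ "B u x"]) auto
    ultimately have c: "(\<lambda>n. B (v n) x) \<longlonglongrightarrow> l x"
      unfolding l_def convergent_LIMSEQ_iff[symmetric] by (intro Bseq_mono_convergent) (auto simp: incseq_def)
    then show ?case using incseq_le[OF i c] LIMSEQ_le_const2[OF c] elim by auto
  qed
  obtain K where K: "0 \<le> K" "\<And>u. u \<in> Lp 2 m \<Longrightarrow> norm2 m (B u) \<le> K * norm2 m u"
    using positive_operator_L2_bound[OF B] by blast
  \<comment> \<open>As \<open>l\<close> lies between \<open>B (v n)\<close> and \<open>B u\<close>,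
    its distance from \<open>B u\<close> is at most that of every \<open>B (v n)\<close>.\<close>
  have b: "norm2 m (\<lambda>x. l x - B u x) \<le> K * norm2 m (\<lambda>x. v n x - u x)" for n
  proof -
    have "norm2 m (\<lambda>x. l x - B u x) \<le> norm2 m (\<lambda>x. B (v n) x - B u x)"
    proof (rule L2_mono(2)[OF L2_diff(1)[OF Bv]])
      show "AE x in m. \<bar>l x - B u x\<bar> \<le> \<bar>B (v n) x - B u x\<bar>"
        using conv
      proof eventually_elim
        case (elim x)
        then have "B (v n) x \<le> l x" "l x \<le> B u x" by auto
        then show ?case by simp
      qed
    qed simp
    also have "\<dots> = norm2 m (B (\<lambda>x. v n x - u x))"
      using positive_operator_L2_diff[OF B v2[of n] u] positive_operator_L2D(1)[OF B L2_diff(1)[OF v2[of n] u]]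
      by (intro norm2_cong_AE) (auto simp: Lp_2_iff)
    also have "\<dots> \<le> K * norm2 m (\<lambda>x. v n x - u x)" by (intro K L2_diff v2 u)
    finally show ?thesis .
  qed
  have "(\<lambda>n. K * norm2 m (\<lambda>x. v n x - u x)) \<longlonglongrightarrow> K * 0"
    by (intro tendsto_intros L2_dominated_convergence u v le lim)
  then have "norm2 m (\<lambda>x. l x - B u x) \<le> 0"
    using b by (intro LIMSEQ_le_const) auto
  then have z: "norm2 m (\<lambda>x. l x - B u x) = 0" by (simp add: antisym)
  have l2: "l \<in> Lp 2 m"
  proof (rule L2_mono(1)[OF Bv(2)])
    show "AE x in m. \<bar>l x\<bar> \<le> \<bar>B u x\<bar>"
      using conv ae
    proof eventually_elim
      case (elim x)
      then have "0 \<le> B (v 0) x" "B (v 0) x \<le> l x" "l x \<le> B u x" by auto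
      then show ?case by simp
    qed
  qed simp
  have "AE x in m. l x - B u x = 0"
    by (rule norm2_eq_0_AE[OF L2_diff(1)[OF l2 Bv(2)] z])
  with ae conv show ?thesis by eventually_elim auto
qed

lemma ennreal_le_suminf: "f n \<le> suminf f" for f :: "nat \<Rightarrow> ennreal"
  using sum_le_suminf[of f "{n}"] by simp

locale positive_semigroup = sigma_finite_measure m for m :: "'a measure" +
  fixes T :: "real \<Rightarrow> ('a \<Rightarrow> real) \<Rightarrow> ('a \<Rightarrow> real)"
  assumes C0: "C0_semigroup_L2 m T" and pos: "positive_semigroup_L2 m T"
begin

lemma positive_operator: "0 \<le> t \<Longrightarrow> positive_operator_L2 m (T t)"
  using C0 pos unfolding C0_semigroup_L2_def positive_semigroup_L2_def positive_operator_L2_def by auto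

lemma T_L2: "0 \<le> t \<Longrightarrow> u \<in> Lp 2 m \<Longrightarrow> T t u \<in> Lp 2 m"
  by (rule positive_operator_L2D(1)[OF positive_operator])

lemma T_measurable: "0 \<le> t \<Longrightarrow> u \<in> Lp 2 m \<Longrightarrow> T t u \<in> borel_measurable m"
  by (intro L2_measurable T_L2)

lemma T_zero: "u \<in> Lp 2 m \<Longrightarrow> AE x in m. T 0 u x = u x"
  using C0 unfolding C0_semigroup_L2_def by blast

lemma T_add: "0 \<le> s \<Longrightarrow> 0 \<le> t \<Longrightarrow> u \<in> Lp 2 m \<Longrightarrow> AE x in m. T (s + t) u x = T s (T t u) x"
  using C0 unfolding C0_semigroup_L2_def by blast

lemma T_nonneg: "0 \<le> t \<Longrightarrow> u \<in> Lp 2 m \<Longrightarrow> AE x in m. 0 \<le> u x \<Longrightarrow> AE x in m. 0 \<le> T t u x"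
  by (rule positive_operator_L2D(5)[OF positive_operator])

lemma T_continuous_0: "u \<in> Lp 2 m \<Longrightarrow> ((\<lambda>t. norm2 m (\<lambda>x. T t u x - u x)) \<longlongrightarrow> 0) (at_right 0)"
  using C0 unfolding C0_semigroup_L2_def by blast

text \<open>Positivity replaces the uniform boundedness principle: if \<open>\<parallel>T(t\<^sub>n)u\<^sub>n\<parallel> > 4\<^sup>n\<parallel>u\<^sub>n\<parallel>\<close> with
  \<open>t\<^sub>n \<rightarrow> 0\<close>, \<open>u\<^sub>n \<ge> 0\<close>, then \<open>u = (\<Sum>4\<^sup>-\<^sup>n u\<^sub>n\<^sup>2)\<^sup>1\<^sup>/\<^sup>2\<close> dominates every \<open>2\<^sup>-\<^sup>nu\<^sub>n\<close>.\<close>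

lemma bounded_near_0: "\<exists>\<delta>>0. \<exists>K\<ge>0. \<forall>t\<in>{0..\<delta>}. \<forall>u\<in>Lp 2 m. norm2 m (T t u) \<le> K * norm2 m u"
proof (rule ccontr)
  assume neg: "\<not> ?thesis"
  have "\<exists>t u. 0 \<le> t \<and> t \<le> inverse (Suc n) \<and> u \<in> Lp 2 m \<and> norm2 m (T t u) > 4 ^ n * norm2 m u" for n
  proof -
    have "0 < inverse (real (Suc n))" "(0::real) \<le> 4 ^ n" by auto
    then show ?thesis using neg by (meson atLeastAtMost_iff not_le)
  qed
  then obtain t u where tu: "\<And>n. 0 \<le> t n" "\<And>n. t n \<le> inverse (Suc n)" "\<And>n. u n \<in> Lp 2 m"
    "\<And>n. norm2 m (T (t n) (u n)) > 4 ^ n * norm2 m (u n)"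
    by metis
  define c where "c n = norm2 m (u n)" for n
  \<comment> \<open>A zero norm would make the norm of T(t_n)u_n vanish as well, against the strict
    inequality.\<close>
  have c: "0 < c n" for n
  proof (rule ccontr)
    assume "\<not> 0 < c n"
    then have "norm2 m (u n) = 0" using norm2_nonneg[of m "u n"] unfolding c_def by linarith
    moreover obtain K where "\<And>u. u \<in> Lp 2 m \<Longrightarrow> norm2 m (T (t n) u) \<le> K * norm2 m u"
      using positive_operator_L2_bound[OF positive_operator[OF tu(1)[of n]]] by metis
    ultimately show False using tu(4)[of n] tu(3)[of n] by fastforce
  qed
  define v where "v n x = inverse (c n) * \<bar>u n x\<bar>" for n x
  have v2: "v n \<in> Lp 2 m" and v1: "norm2 m (v n) = 1" for n
    using L2_cmult[OF L2_abs(1)[OF tu(3)[of n]], of "inverse (c n)"] L2_abs(2)[OF tu(3)[of n]] c[of n]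
    unfolding v_def c_def by auto
  have [measurable]: "v n \<in> borel_measurable m" for n by (rule L2_measurable[OF v2])
  have vT: "norm2 m (T (t n) (v n)) > 4 ^ n" for n
  proof -
    have "4 ^ n * c n < norm2 m (T (t n) (u n))" using tu(4)[of n] unfolding c_def .
    also have "\<dots> \<le> norm2 m (T (t n) (\<lambda>x. \<bar>u n x\<bar>))"
      by (rule positive_operator_L2_abs[OF positive_operator[OF tu(1)] tu(3)])
    finally have "4 ^ n < inverse (c n) * norm2 m (T (t n) (\<lambda>x. \<bar>u n x\<bar>))"
      using c[of n] by (simp add: field_simps)
    also have "\<dots> = norm2 m (\<lambda>x. inverse (c n) * T (t n) (\<lambda>x. \<bar>u n x\<bar>) x)"
      using c[of n] by (subst L2_cmult(2)) (auto intro!: T_L2 tu L2_abs)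
    also have "\<dots> = norm2 m (T (t n) (v n))"
    proof (rule norm2_cong_AE)
      show "AE x in m. inverse (c n) * T (t n) (\<lambda>x. \<bar>u n x\<bar>) x = T (t n) (v n) x"
        using positive_operator_L2D(4)[OF positive_operator[OF tu(1)[of n]] L2_abs(1)[OF tu(3)[of n]], of "inverse (c n)"]
        unfolding v_def by auto
      show "(\<lambda>x. inverse (c n) * T (t n) (\<lambda>x. \<bar>u n x\<bar>) x) \<in> borel_measurable m"
        using T_measurable[OF tu(1)[of n] L2_abs(1)[OF tu(3)[of n]]] by simp
      show "T (t n) (v n) \<in> borel_measurable m" by (rule T_measurable[OF tu(1) v2])
    qed
    finally show ?thesis .
  qed
  define g where "g x = (\<Sum>n. ennreal ((1/4) ^ n * (v n x)\<^sup>2))" for x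
  have [measurable]: "g \<in> borel_measurable m" unfolding g_def by measurable
  have "(\<integral>\<^sup>+x. g x \<partial>m) = (\<Sum>n. ennreal ((1/4) ^ n) * ennreal ((norm2 m (v n))\<^sup>2))"
    unfolding g_def by (subst nn_integral_suminf) (auto simp: ennreal_mult nn_integral_cmult norm2_nn_integral[OF v2])
  also have "\<dots> = ennreal (\<Sum>n. (1/4) ^ n)"
    unfolding v1 by (simp add: suminf_ennreal2 summable_geometric)
  finally have gi: "(\<integral>\<^sup>+x. g x \<partial>m) = ennreal (\<Sum>n. (1/4) ^ n)" .
  then have "AE x in m. g x \<noteq> \<infinity>" by (intro nn_integral_PInf_AE) auto
  then have gf: "AE x in m. ennreal (enn2real (g x)) = g x"
    by eventually_elim (simp add: less_top)
  define z where "z x = sqrt (enn2real (g x))" for x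
  have [measurable]: "z \<in> borel_measurable m" unfolding z_def by measurable
  have zz: "(z x)\<^sup>2 = enn2real (g x)" for x unfolding z_def by simp
  have z2: "z \<in> Lp 2 m"
  proof (rule L2I(1))
    have "(\<integral>\<^sup>+x. ennreal ((z x)\<^sup>2) \<partial>m) = (\<integral>\<^sup>+x. g x \<partial>m)"
      unfolding zz using gf by (intro nn_integral_cong_AE) auto
    then show "(\<integral>\<^sup>+x. ennreal ((z x)\<^sup>2) \<partial>m) \<le> ennreal ((sqrt (\<Sum>n. (1/4) ^ n))\<^sup>2)"
      using gi by (simp add: suminf_nonneg summable_geometric)
    show "0 \<le> sqrt (\<Sum>n. (1/4) ^ n :: real)" by (simp add: suminf_nonneg summable_geometric)
  qed simp
  have vz: "AE x in m. (1/2) ^ n * v n x \<le> z x" for n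
    using gf
  proof eventually_elim
    case (elim x)
    have "ennreal ((1/4) ^ n * (v n x)\<^sup>2) \<le> g x"
      unfolding g_def by (rule ennreal_le_suminf)
    then have "(1/4) ^ n * (v n x)\<^sup>2 \<le> (z x)\<^sup>2"
      using elim unfolding zz by (metis enn2real_nonneg ennreal_le_iff)
    moreover have "((1/2) ^ n * v n x)\<^sup>2 = (1/4) ^ n * (v n x)\<^sup>2"
    proof -
      have "((1/2::real) ^ n)\<^sup>2 = ((1/2)\<^sup>2) ^ n" by (metis power_mult mult.commute)
      then show ?thesis by (simp add: power_mult_distrib power2_eq_square)
    qed
    ultimately have "((1/2) ^ n * v n x)\<^sup>2 \<le> (z x)\<^sup>2" by simp
    then show ?case by (rule power2_le_imp_le) (simp add: z_def)
  qed
  have big: "2 ^ n \<le> norm2 m (T (t n) z)" for n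
  proof -
    note op = positive_operator[OF tu(1)[of n]]
    have v0: "AE x in m. 0 \<le> T (t n) (v n) x"
      using c by (intro T_nonneg tu v2) (auto simp: v_def less_imp_le)
    have a: "AE x in m. T (t n) (\<lambda>x. (1/2) ^ n * v n x) x \<le> T (t n) z x"
      by (rule positive_operator_L2_mono[OF op L2_cmult(1)[OF v2] z2 vz])
    have "norm2 m (\<lambda>x. (1/2) ^ n * T (t n) (v n) x) \<le> norm2 m (T (t n) z)"
    proof (rule L2_mono(2)[OF T_L2[OF tu(1) z2]])
      show "(\<lambda>x. (1/2) ^ n * T (t n) (v n) x) \<in> borel_measurable m"
        using T_measurable[OF tu(1) v2] by simp
      show "AE x in m. \<bar>(1/2) ^ n * T (t n) (v n) x\<bar> \<le> \<bar>T (t n) z x\<bar>"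
        using a v0 positive_operator_L2D(4)[OF op v2, of "(1/2)^n" n]
      proof eventually_elim
        case (elim x)
        have "0 \<le> (1/2) ^ n * T (t n) (v n) x" using elim by simp
        then show ?case using elim by simp
      qed
    qed
    moreover have "norm2 m (\<lambda>x. (1/2) ^ n * T (t n) (v n) x) = (1/2) ^ n * norm2 m (T (t n) (v n))"
      by (subst L2_cmult(2)) (auto intro!: T_L2 tu v2)
    moreover have "(2::real) ^ n = (1/2) ^ n * 4 ^ n"
      by (simp flip: power_mult_distrib)
    ultimately show ?thesis using vT[of n]
      by (smt (verit) mult_left_mono zero_le_power half_gt_zero_iff)
  qed
  have "\<forall>\<^sub>F s in at_right 0. norm2 m (\<lambda>x. T s z x - z x) < 1"
    using order_tendstoD(2)[OF T_continuous_0[OF z2], of 1] by simp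
  then obtain b where b: "0 < b" "\<And>s. 0 < s \<Longrightarrow> s < b \<Longrightarrow> norm2 m (\<lambda>x. T s z x - z x) < 1"
    by (auto simp: eventually_at_right_field)
  obtain n1 where n1: "inverse (real (Suc n1)) < b" using reals_Archimedean[OF b(1)] by auto
  obtain n2 where n2: "1 + norm2 m z < 2 ^ n2" using real_arch_pow[of 2] by auto
  define n where "n = max n1 n2"
  have "inverse (real (Suc n)) \<le> inverse (real (Suc n1))" by (simp add: n_def)
  then have tb: "t n < b" using tu(2)[of n] n1 by linarith
  \<comment> \<open>The time \<open>t n\<close> may be 0, where the limit from the right says
    nothing; T(0) = I covers this case.\<close>
  have "norm2 m (\<lambda>x. T (t n) z x - z x) < 1"
  proof (cases "t n = 0")
    case True
    have "norm2 m (\<lambda>x. T (t n) z x - z x) = norm2 m (\<lambda>x. 0)"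
      using T_zero[OF z2] T_measurable[OF tu(1)[of n] z2] unfolding True by (intro norm2_cong_AE) auto
    then show ?thesis by simp
  next
    case False
    then show ?thesis using b(2) tb tu(1)[of n] by simp
  qed
  then have "norm2 m (T (t n) z) < 1 + norm2 m z"
    using norm2_le_add_diff[OF T_L2[OF tu(1)[of n] z2] z2] by linarith
  also have "\<dots> < 2 ^ n2" by (rule n2)
  also have "\<dots> \<le> 2 ^ n" by (simp add: n_def)
  finally show False using big[of n] by simp
qed

text \<open>A time up to (n + 1) \<delta> is split into n + 1 steps of length at most \<delta>, each
  costing one factor \<open>L\<close>. With \<open>L\<close> \<ge> 1 the same power serves all
  shorter times, and \<open>1 \<le> K\<close> permits division by \<open>K\<close> later.\<close>

lemma locally_bounded:
  obtains K where "1 \<le> K" "\<And>t u. 0 \<le> t \<Longrightarrow> t \<le> R \<Longrightarrow> u \<in> Lp 2 m \<Longrightarrow> norm2 m (T t u) \<le> K * norm2 m u"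
proof -
  obtain \<delta> K where d: "0 < \<delta>" and K0: "0 \<le> K"
    and K: "\<And>t u. t \<in> {0..\<delta>} \<Longrightarrow> u \<in> Lp 2 m \<Longrightarrow> norm2 m (T t u) \<le> K * norm2 m u"
    using bounded_near_0 by metis
  define L where "L = max 1 K"
  have L: "1 \<le> L" "\<And>t u. t \<in> {0..\<delta>} \<Longrightarrow> u \<in> Lp 2 m \<Longrightarrow> norm2 m (T t u) \<le> L * norm2 m u"
  proof -
    show "1 \<le> L" by (simp add: L_def)
    fix t u assume "t \<in> {0..\<delta>}" "u \<in> Lp 2 m"
    then show "norm2 m (T t u) \<le> L * norm2 m u"
      using K[of t u] mult_right_mono[of K L "norm2 m u"] by (simp add: L_def)
  qed
  have step: "norm2 m (T t u) \<le> L ^ Suc n * norm2 m u" if "0 \<le> t" "t \<le> Suc n * \<delta>" "u \<in> Lp 2 m" for n t u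
    using that
  proof (induction n arbitrary: t u)
    case 0
    then show ?case using L(2)[of t u] by simp
  next
    case (Suc n)
    define s where "s = min t \<delta>"
    have s: "s \<in> {0..\<delta>}" "0 \<le> t - s" "t - s \<le> Suc n * \<delta>"
      using Suc.prems d unfolding s_def by (auto simp: algebra_simps min_def)
    have "norm2 m (T t u) = norm2 m (T (t - s) (T s u))"
      using T_add[of "t - s" s u] s Suc.prems by (intro norm2_cong_AE T_measurable T_L2) auto
    also have "\<dots> \<le> L ^ Suc n * norm2 m (T s u)"
      using s Suc.prems by (intro Suc.IH T_L2) auto
    also have "\<dots> \<le> L ^ Suc n * (L * norm2 m u)"
      using s Suc.prems L by (intro mult_left_mono L(2)) auto
    finally show ?case by (simp add: mult_ac)
  qed
  obtain n where "R \<le> real n * \<delta>" using reals_Archimedean3[OF d] less_imp_le by blast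
  then have "R \<le> Suc n * \<delta>" using d by (simp add: algebra_simps)
  then show ?thesis using that[of "L ^ Suc n"] step[of _ n] L(1)
    by (meson dual_order.trans one_le_power)
qed

text \<open>For s < t the difference is T(s)(T(t - s)u - u), so the modulus of continuity at 0
  controls it uniformly on [0, R], up to the bound of T there. Partition arguments need this
  uniformity in both times.\<close>

lemma uniformly_continuous:
  assumes u: "u \<in> Lp 2 m" and "0 < \<epsilon>"
  obtains \<delta> where "0 < \<delta>"
    "\<And>s t. 0 \<le> s \<Longrightarrow> s \<le> R \<Longrightarrow> 0 \<le> t \<Longrightarrow> t \<le> R \<Longrightarrow> \<bar>s - t\<bar> < \<delta> \<Longrightarrow> norm2 m (\<lambda>x. T s u x - T t u x) < \<epsilon>"
proof -
  obtain K where K1: "1 \<le> K" and K: "\<And>t u. 0 \<le> t \<Longrightarrow> t \<le> R \<Longrightarrow> u \<in> Lp 2 m \<Longrightarrow> norm2 m (T t u) \<le> K * norm2 m u"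
    using locally_bounded[of R] by blast
  have "\<forall>\<^sub>F s in at_right 0. norm2 m (\<lambda>x. T s u x - u x) < \<epsilon> / K"
    using order_tendstoD(2)[OF T_continuous_0[OF u], of "\<epsilon> / K"] K1 assms by simp
  then obtain b where b: "0 < b" "\<And>s. 0 < s \<Longrightarrow> s < b \<Longrightarrow> norm2 m (\<lambda>x. T s u x - u x) < \<epsilon> / K"
    by (auto simp: eventually_at_right_field)
  have main: "norm2 m (\<lambda>x. T t u x - T s u x) < \<epsilon>" if "0 \<le> s" "s < t" "t \<le> R" "t - s < b" for s t
  proof -
    have s: "0 \<le> s" "s \<le> R" "0 \<le> t - s" "0 \<le> t" using that by auto
    have "norm2 m (\<lambda>x. T t u x - T s u x) = norm2 m (T s (\<lambda>x. T (t - s) u x - u x))"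
    proof (rule norm2_cong_AE)
      show "AE x in m. T t u x - T s u x = T s (\<lambda>x. T (t - s) u x - u x) x"
        using T_add[OF s(1,3) u] positive_operator_L2_diff[OF positive_operator[OF s(1)] T_L2[OF s(3) u] u]
        by eventually_elim simp
    qed (use s u in \<open>auto intro!: T_measurable borel_measurable_diff L2_diff T_L2\<close>)
    also have "\<dots> \<le> K * norm2 m (\<lambda>x. T (t - s) u x - u x)"
      using s u by (intro K L2_diff T_L2) auto
    also have "\<dots> < K * (\<epsilon> / K)"
      using b(2)[of "t - s"] that K1 by (intro mult_strict_left_mono) auto
    also have "\<dots> = \<epsilon>" using K1 by simp
    finally show ?thesis .
  qed
  show ?thesis
  proof (rule that[OF b(1)])
    fix s t assume "0 \<le> s" "s \<le> R" "0 \<le> t" "t \<le> R" "\<bar>s - t\<bar> < b"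
    then show "norm2 m (\<lambda>x. T s u x - T t u x) < \<epsilon>"
      using main[of s t] main[of t s] norm2_minus_commute[of m "T s u" "T t u"] assms(2)
      by (cases s t rule: linorder_cases) auto
  qed
qed

end

section \<open>Jointly measurable versions\<close>

text \<open>Cutting an integrable positive function off at 1 puts it into every L_q, whatever the
  exponent. Outside the space the value is 1, so that positivity holds at all points without a
  membership condition.\<close>

lemma (in sigma_finite_measure) ex_bounded_integrable_weight:
  obtains w :: "'a \<Rightarrow> real" where "w \<in> borel_measurable M" "\<And>x. 0 < w x" "\<And>x. w x \<le> 1" "integrable M w"
proof -
  obtain h where h: "h \<in> borel_measurable M" "integral\<^sup>N M h \<noteq> \<infinity>" "\<And>x. x \<in> space M \<Longrightarrow> 0 < h x \<and> h x < \<infinity>"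
    using Ex_finite_integrable_function by blast
  define w where "w x = (if x \<in> space M then min 1 (enn2real (h x)) else 1)" for x
  have [measurable]: "h \<in> borel_measurable M" "w \<in> borel_measurable M"
    using h(1) unfolding w_def by measurable
  have w0: "0 < w x" "w x \<le> 1" for x
    using h(3)[of x] by (auto simp: w_def enn2real_positive_iff)
  have "integrable M w"
  proof (rule integrableI_nonneg)
    have "(\<integral>\<^sup>+x. ennreal (w x) \<partial>M) \<le> integral\<^sup>N M h"
    proof (rule nn_integral_mono)
      fix x assume "x \<in> space M"
      then have "w x \<le> enn2real (h x)" "h x < \<infinity>" using h(3) by (auto simp: w_def)
      then show "ennreal (w x) \<le> h x"
        by (metis ennreal_enn2real ennreal_leI infinity_ennreal_def)
    qed
    then show "(\<integral>\<^sup>+x. ennreal (w x) \<partial>M) < \<infinity>" using h(2) by (metis infinity_ennreal_def le_less_trans less_top)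
  qed (use w0 in \<open>auto simp: less_imp_le\<close>)
  with w0 show ?thesis by (intro that[of w]) auto
qed

text \<open>The series of the absolute values has finite integral, hence converges almost
  everywhere, and its terms tend to 0. The geometric rate saves the passage to a
  subsequence.\<close>

lemma AE_tendsto_0_of_geometric_L1:
  fixes h :: "nat \<Rightarrow> 'b \<Rightarrow> real"
  assumes "\<And>j. integrable N (h j)" and le: "\<And>j. (LINT z|N. \<bar>h j z\<bar>) \<le> (1/2) ^ j"
  shows "AE z in N. (\<lambda>j. h j z) \<longlonglongrightarrow> 0"
proof -
  have [measurable]: "h j \<in> borel_measurable N" for j using assms(1)[of j] by simp
  have "(\<integral>\<^sup>+z. (\<Sum>j. ennreal \<bar>h j z\<bar>) \<partial>N) = (\<Sum>j. \<integral>\<^sup>+z. ennreal \<bar>h j z\<bar> \<partial>N)"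
    by (rule nn_integral_suminf) measurable
  also have "\<dots> = (\<Sum>j. ennreal (LINT z|N. \<bar>h j z\<bar>))"
    using assms(1) by (simp add: nn_integral_eq_integral)
  also have "\<dots> \<le> (\<Sum>j. ennreal ((1/2) ^ j))"
    using le by (intro suminf_le ennreal_leI) auto
  also have "\<dots> = ennreal (\<Sum>j. (1/2) ^ j)"
    by (rule suminf_ennreal2) (auto simp: summable_geometric)
  finally have "(\<integral>\<^sup>+z. (\<Sum>j. ennreal \<bar>h j z\<bar>) \<partial>N) \<noteq> \<infinity>"
    by (auto simp: top_unique)
  then have "AE z in N. (\<Sum>j. ennreal \<bar>h j z\<bar>) \<noteq> \<infinity>"
    by (intro nn_integral_PInf_AE) measurable
  then show ?thesis
  proof eventually_elim
    case (elim z)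
    then have "summable (\<lambda>j. \<bar>h j z\<bar>)" by (intro summable_suminf_not_top) auto
    from summable_LIMSEQ_zero[OF summable_rabs_cancel[OF this]] show ?case .
  qed
qed

text \<open>At level j, F(t) is replaced by F at the first positive rational, in a fixed
  enumeration, that is closer than 2^-j to it in L_1. This is piecewise constant in t on countably
  many measurable pieces, hence jointly measurable, and for each fixed t > 0 it converges to F(t)
  almost everywhere.\<close>

lemma ex_jointly_measurable_version:
  fixes F :: "real \<Rightarrow> 'b \<Rightarrow> real"
  assumes int: "\<And>t. 0 < t \<Longrightarrow> integrable N (F t)"
    and cont: "\<And>t. 0 < t \<Longrightarrow> ((\<lambda>s. LINT z|N. \<bar>F s z - F t z\<bar>) \<longlongrightarrow> 0) (at t)"
  obtains U where "U \<in> borel_measurable (borel \<Otimes>\<^sub>M N)"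
    "\<And>t. 0 < t \<Longrightarrow> AE z in N. U (t, z) = F t z"
proof -
  define d where "d s t = (LINT z|N. \<bar>F s z - F t z\<bar>)" for s t
  have tri: "d s r \<le> d s t + d t r" if "0 < s" "0 < t" "0 < r" for s t r
  proof -
    have "d s r \<le> (LINT z|N. \<bar>F s z - F t z\<bar> + \<bar>F t z - F r z\<bar>)"
      unfolding d_def using int that by (intro integral_mono) auto
    also have "\<dots> = d s t + d t r"
      unfolding d_def using int that by (intro Bochner_Integration.integral_add) auto
    finally show ?thesis .
  qed
  have sym: "d s t = d t s" for s t unfolding d_def by (simp add: abs_minus_commute)
  have near: "\<exists>\<delta>>0. \<forall>s. \<bar>s - t\<bar> < \<delta> \<longrightarrow> 0 < s \<and> d s t < \<epsilon>" if t: "0 < t" and e: "0 < \<epsilon>" for t \<epsilon>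
  proof -
    have "\<forall>\<^sub>F s in at t. d s t < \<epsilon>"
      using order_tendstoD(2)[OF cont[OF t] e] unfolding d_def .
    then obtain \<delta> where d: "0 < \<delta>" "\<And>s. s \<noteq> t \<Longrightarrow> dist s t < \<delta> \<Longrightarrow> d s t < \<epsilon>"
      by (auto simp: eventually_at)
    have "d t t = 0" unfolding d_def by simp
    have "0 < s \<and> d s t < \<epsilon>" if "\<bar>s - t\<bar> < min \<delta> t" for s
      using d(2)[of s] \<open>d t t = 0\<close> e that by (cases "s = t") (auto simp: dist_real_def)
    then show ?thesis
      using d(1) t by (intro exI[of _ "min \<delta> t"]) auto
  qed
  define Q where "Q = {r::real. r \<in> \<rat> \<and> 0 < r}"
  have cQ: "countable Q" unfolding Q_def using countable_rat by (rule countable_subset[rotated]) auto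
  have "1 \<in> Q" unfolding Q_def by simp
  then have Q0: "Q \<noteq> {}" by blast
  define q where "q = from_nat_into Q"
  have rq: "range q = Q" unfolding q_def using cQ Q0 by (rule range_from_nat_into[rotated])
  then have q0: "0 < q i" for i using Q_def by (metis (mono_tags, lifting) mem_Collect_eq rangeI)
  define E where "E j i = {t. 0 < t \<and> d t (q i) < (1/2) ^ j}" for j i
  have "open (E j i)" for j i
    unfolding open_dist
  proof
    fix t assume "t \<in> E j i"
    then have t: "0 < t" "0 < (1/2) ^ j - d t (q i)" unfolding E_def by auto
    obtain \<delta> where d: "0 < \<delta>" "\<And>s. \<bar>s - t\<bar> < \<delta> \<Longrightarrow> 0 < s \<and> d s t < (1/2) ^ j - d t (q i)"
      using near[OF t] by blast
    have "s \<in> E j i" if "dist s t < \<delta>" for s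
      using d(2)[of s] that tri[of s t "q i"] t q0[of i] unfolding E_def dist_real_def by auto
    with d(1) show "\<exists>e>0. \<forall>y. dist y t < e \<longrightarrow> y \<in> E j i" by blast
  qed
  then have [measurable]: "E j i \<in> sets borel" for j i by simp
  have ex: "\<exists>i. t \<in> E j i" if t: "0 < t" for t j
  proof -
    obtain \<delta> where d: "0 < \<delta>" "\<And>s. \<bar>s - t\<bar> < \<delta> \<Longrightarrow> 0 < s \<and> d s t < (1/2) ^ j"
      using near[OF t, of "(1/2) ^ j"] by auto
    obtain r where r: "r \<in> \<rat>" "t < r" "r < t + \<delta>" using Rats_dense_in_real[of t "t + \<delta>"] d(1) by auto
    then have "r \<in> Q" using t unfolding Q_def by simp
    then obtain i where "r = q i" using rq by (metis rangeE)
    then show ?thesis using d(2)[of r] r t sym unfolding E_def by auto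
  qed
  \<comment> \<open>For t \<le> 0 no index qualifies and \<open>LEAST\<close> denotes some fixed
    index, so \<open>G\<close> stays measurable on the whole line.\<close>
  define G where "G j t z = F (q (LEAST i. t \<in> E j i)) z" for j t z
  have [measurable]: "F (q i) \<in> borel_measurable N" for i using int[OF q0[of i]] by simp
  have G: "(\<lambda>p. G j (fst p) (snd p)) \<in> borel_measurable (borel \<Otimes>\<^sub>M N)" for j
    unfolding G_def by measurable
  \<comment> \<open>\<open>lim\<close> is total and preserves measurability. Where the sequence
    diverges its value does not matter, since for each t > 0 this happens only on a null
    set.\<close>
  define U where "U p = lim (\<lambda>j. G j (fst p) (snd p))" for p
  show ?thesis
  proof (rule that[of U])
    show "U \<in> borel_measurable (borel \<Otimes>\<^sub>M N)"
      unfolding U_def by (rule borel_measurable_lim_metric[OF G])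
    fix t :: real assume t: "0 < t"
    have "AE z in N. (\<lambda>j. G j t z - F t z) \<longlonglongrightarrow> 0"
    proof (rule AE_tendsto_0_of_geometric_L1)
      fix j
      show "integrable N (\<lambda>z. G j t z - F t z)" unfolding G_def using int q0 t by auto
      define i where "i = (LEAST i. t \<in> E j i)"
      have "t \<in> E j i" using ex[OF t] unfolding i_def by (rule LeastI_ex)
      then have "d (q i) t \<le> (1/2) ^ j" using sym[of t] by (simp add: E_def)
      then show "(LINT z|N. \<bar>G j t z - F t z\<bar>) \<le> (1/2) ^ j"
        by (simp add: G_def d_def i_def)
    qed
    then show "AE z in N. U (t, z) = F t z"
    proof eventually_elim
      case (elim z)
      then have "(\<lambda>j. G j t z) \<longlonglongrightarrow> F t z" by (rule LIM_zero_cancel)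
      then show ?case unfolding U_def by (simp add: limI)
    qed
  qed
qed

text \<open>Minkowski's integral inequality with a constant bound: Cauchy-Schwarz in s bounds the
  square of the time integral of |V| by d - c times the time integral of V^2, and Tonelli exchanges
  the order. Finiteness of the result also gives integrability in time for almost every x.\<close>

lemma (in sigma_finite_measure) L2_time_integral:
  assumes V: "V \<in> borel_measurable (borel \<Otimes>\<^sub>M M)" and cd: "c \<le> d" and e: "0 \<le> \<epsilon>"
    and bd: "\<And>s. c < s \<Longrightarrow> s < d \<Longrightarrow> norm2 M (\<lambda>x. V (s, x)) \<le> \<epsilon> \<and> (\<lambda>x. V (s, x)) \<in> Lp 2 M"
  shows "AE x in M. set_integrable lborel {c<..<d} (\<lambda>s. V (s, x))"
    and "(\<lambda>x. LINT s:{c<..<d}|lborel. V (s, x)) \<in> Lp 2 M"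
    and "norm2 M (\<lambda>x. LINT s:{c<..<d}|lborel. V (s, x)) \<le> (d - c) * \<epsilon>"
proof -
  interpret P: pair_sigma_finite lborel M ..
  note V[measurable]
  define b where "b x = (\<integral>\<^sup>+s. indicator {c<..<d} s * ennreal \<bar>V (s, x)\<bar> \<partial>lborel)" for x
  have [measurable]: "b \<in> borel_measurable M" unfolding b_def by measurable
  have ind: "(\<integral>\<^sup>+s. (indicator {c<..<d} s)\<^sup>2 \<partial>lborel) = ennreal (d - c)"
  proof -
    have "(\<integral>\<^sup>+s. (indicator {c<..<d} s)\<^sup>2 \<partial>lborel) = (\<integral>\<^sup>+s. indicator {c<..<d} s \<partial>lborel)"
      by (intro nn_integral_cong) (auto simp: indicator_def)
    then show ?thesis using cd by simp
  qed
  have b2: "(b x)\<^sup>2 \<le> ennreal (d - c) * (\<integral>\<^sup>+s. indicator {c<..<d} s * ennreal ((V (s, x))\<^sup>2) \<partial>lborel)"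
    if "x \<in> space M" for x
  proof -
    have "b x = (\<integral>\<^sup>+s. indicator {c<..<d} s * (indicator {c<..<d} s * ennreal \<bar>V (s, x)\<bar>) \<partial>lborel)"
      unfolding b_def by (intro nn_integral_cong) (auto simp: indicator_def)
    also have "(\<dots>)\<^sup>2 \<le> (\<integral>\<^sup>+s. (indicator {c<..<d} s)\<^sup>2 \<partial>lborel) * (\<integral>\<^sup>+s. (indicator {c<..<d} s * ennreal \<bar>V (s, x)\<bar>)\<^sup>2 \<partial>lborel)"
      using that by (intro Cauchy_Schwarz_nn_integral) measurable
    also have "(\<integral>\<^sup>+s. (indicator {c<..<d} s * ennreal \<bar>V (s, x)\<bar>)\<^sup>2 \<partial>lborel) = (\<integral>\<^sup>+s. indicator {c<..<d} s * ennreal ((V (s, x))\<^sup>2) \<partial>lborel)"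
      by (intro nn_integral_cong) (auto simp: indicator_def ennreal_power)
    finally show ?thesis unfolding ind .
  qed
  have "(\<integral>\<^sup>+x. (b x)\<^sup>2 \<partial>M) \<le> (\<integral>\<^sup>+x. ennreal (d - c) * (\<integral>\<^sup>+s. indicator {c<..<d} s * ennreal ((V (s, x))\<^sup>2) \<partial>lborel) \<partial>M)"
    by (intro nn_integral_mono b2)
  also have "\<dots> = ennreal (d - c) * (\<integral>\<^sup>+x. \<integral>\<^sup>+s. indicator {c<..<d} s * ennreal ((V (s, x))\<^sup>2) \<partial>lborel \<partial>M)"
    by (intro nn_integral_cmult) measurable
  finally have B1: "(\<integral>\<^sup>+x. (b x)\<^sup>2 \<partial>M) \<le>
      ennreal (d - c) * (\<integral>\<^sup>+x. \<integral>\<^sup>+s. indicator {c<..<d} s * ennreal ((V (s, x))\<^sup>2) \<partial>lborel \<partial>M)" .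
  have "(\<integral>\<^sup>+x. \<integral>\<^sup>+s. indicator {c<..<d} s * ennreal ((V (s, x))\<^sup>2) \<partial>lborel \<partial>M) =
      (\<integral>\<^sup>+s. \<integral>\<^sup>+x. indicator {c<..<d} s * ennreal ((V (s, x))\<^sup>2) \<partial>M \<partial>lborel)"
    by (intro P.Fubini') measurable
  also have "\<dots> \<le> (\<integral>\<^sup>+s. indicator {c<..<d} s * ennreal (\<epsilon>\<^sup>2) \<partial>lborel)"
  proof (intro nn_integral_mono)
    fix s :: real
    show "(\<integral>\<^sup>+x. indicator {c<..<d} s * ennreal ((V (s, x))\<^sup>2) \<partial>M) \<le> indicator {c<..<d} s * ennreal (\<epsilon>\<^sup>2)"
    proof (cases "s \<in> {c<..<d}")
      case True
      then have "(\<integral>\<^sup>+x. ennreal ((V (s, x))\<^sup>2) \<partial>M) = ennreal ((norm2 M (\<lambda>x. V (s, x)))\<^sup>2)"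
        using bd by (intro norm2_nn_integral) auto
      also have "\<dots> \<le> ennreal (\<epsilon>\<^sup>2)" using bd[of s] True by (intro ennreal_leI power_mono) auto
      finally show ?thesis using True by simp
    qed simp
  qed
  also have "\<dots> = ennreal (\<epsilon>\<^sup>2) * ennreal (d - c)"
    using cd by (subst mult.commute, subst nn_integral_cmult) auto
  finally have B2: "(\<integral>\<^sup>+x. \<integral>\<^sup>+s. indicator {c<..<d} s * ennreal ((V (s, x))\<^sup>2) \<partial>lborel \<partial>M) \<le>
      ennreal (\<epsilon>\<^sup>2) * ennreal (d - c)" .
  have "(\<integral>\<^sup>+x. (b x)\<^sup>2 \<partial>M) \<le> ennreal (d - c) * (ennreal (\<epsilon>\<^sup>2) * ennreal (d - c))"
    by (rule order_trans[OF B1 mult_left_mono[OF B2]]) simp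
  also have "\<dots> = ennreal (((d - c) * \<epsilon>)\<^sup>2)"
    using cd e by (simp add: ennreal_mult[symmetric] power2_eq_square mult_ac)
  finally have B: "(\<integral>\<^sup>+x. (b x)\<^sup>2 \<partial>M) \<le> ennreal (((d - c) * \<epsilon>)\<^sup>2)" .
  then have "(\<integral>\<^sup>+x. (b x)\<^sup>2 \<partial>M) \<noteq> \<infinity>" by (auto simp: top_unique)
  then have "AE x in M. (b x)\<^sup>2 \<noteq> \<infinity>" by (intro nn_integral_PInf_AE) measurable
  then have bf: "AE x in M. b x < \<infinity>"
    by eventually_elim (auto simp: less_top power2_eq_square ennreal_mult_eq_top_iff)
  have si: "set_integrable lborel {c<..<d} (\<lambda>s. V (s, x))" if "b x < \<infinity>" "x \<in> space M" for x
    unfolding set_integrable_def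
  proof (rule integrableI_bounded)
    show "(\<lambda>s. indicator {c<..<d} s *\<^sub>R V (s, x)) \<in> borel_measurable lborel" using that by measurable
    have "(\<integral>\<^sup>+s. ennreal (norm (indicator {c<..<d} s *\<^sub>R V (s, x))) \<partial>lborel) = b x"
      unfolding b_def by (intro nn_integral_cong) (auto simp: indicator_def)
    then show "(\<integral>\<^sup>+s. ennreal (norm (indicator {c<..<d} s *\<^sub>R V (s, x))) \<partial>lborel) < \<infinity>" using that by simp
  qed
  show "AE x in M. set_integrable lborel {c<..<d} (\<lambda>s. V (s, x))"
    using bf AE_space by eventually_elim (rule si)
  \<comment> \<open>Where the section is not integrable the Bochner integral is 0 by convention, so
    this bound holds at every x.\<close>
  have ib: "ennreal \<bar>LINT s:{c<..<d}|lborel. V (s, x)\<bar> \<le> b x" for x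
  proof -
    have "ennreal (norm (LINT s:{c<..<d}|lborel. V (s, x))) \<le> (\<integral>\<^sup>+s. ennreal (norm (indicator {c<..<d} s *\<^sub>R V (s, x))) \<partial>lborel)"
      unfolding set_lebesgue_integral_def
    proof (cases "integrable lborel (\<lambda>s. indicator {c<..<d} s *\<^sub>R V (s, x))")
      case True
      then show "ennreal (norm (LINT s|lborel. indicator {c<..<d} s *\<^sub>R V (s, x)))
          \<le> (\<integral>\<^sup>+s. ennreal (norm (indicator {c<..<d} s *\<^sub>R V (s, x))) \<partial>lborel)"
        by (rule integral_norm_bound_ennreal)
    qed (simp add: not_integrable_integral_eq)
    also have "\<dots> = b x" unfolding b_def by (intro nn_integral_cong) (auto simp: indicator_def)
    finally show ?thesis by simp
  qed
  have m: "(\<lambda>x. LINT s:{c<..<d}|lborel. V (s, x)) \<in> borel_measurable M"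
    unfolding set_lebesgue_integral_def by measurable
  have "(\<integral>\<^sup>+x. ennreal ((LINT s:{c<..<d}|lborel. V (s, x))\<^sup>2) \<partial>M) \<le> (\<integral>\<^sup>+x. (b x)\<^sup>2 \<partial>M)"
  proof (intro nn_integral_mono)
    fix x
    have "ennreal ((LINT s:{c<..<d}|lborel. V (s, x))\<^sup>2) = (ennreal \<bar>LINT s:{c<..<d}|lborel. V (s, x)\<bar>)\<^sup>2"
      by (simp add: ennreal_power)
    also have "\<dots> \<le> (b x)\<^sup>2" by (intro power_mono ib) auto
    finally show "ennreal ((LINT s:{c<..<d}|lborel. V (s, x))\<^sup>2) \<le> (b x)\<^sup>2" .
  qed
  also note B
  finally show "(\<lambda>x. LINT s:{c<..<d}|lborel. V (s, x)) \<in> Lp 2 M"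
    "norm2 M (\<lambda>x. LINT s:{c<..<d}|lborel. V (s, x)) \<le> (d - c) * \<epsilon>"
    using L2I[OF m] cd e by auto
qed

lemma eq_0_if_le_mult_eps:
  fixes a c :: real
  assumes "0 \<le> a" "\<And>\<epsilon>. 0 < \<epsilon> \<Longrightarrow> a \<le> c * \<epsilon>"
  shows "a = 0"
proof (rule ccontr)
  assume "a \<noteq> 0"
  then have a: "0 < a" using assms(1) by simp
  define e where "e = a / (2 * (\<bar>c\<bar> + 1))"
  have e: "0 < e" unfolding e_def using a by simp
  have "c * e \<le> (\<bar>c\<bar> + 1) * e" using e by (intro mult_right_mono) auto
  also have "\<dots> = a / 2" unfolding e_def by (simp add: field_simps)
  finally show False using assms(2)[OF e] a by simp
qed

lemma set_integral_Ioo_split: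
  fixes f :: "real \<Rightarrow> real"
  assumes "set_integrable lborel {a<..<c} f" "a \<le> b" "b \<le> c"
  shows "(LINT s:{a<..<c}|lborel. f s) = (LINT s:{a<..<b}|lborel. f s) + (LINT s:{b<..<c}|lborel. f s)"
proof -
  have i: "set_integrable lborel {a<..<b} f" "set_integrable lborel {b<..<c} f"
    using assms by (auto intro: set_integrable_subset)
  have "(LINT s:{a<..<c}|lborel. f s) = (LINT s:{a<..<b} \<union> {b<..<c}|lborel. f s)"
    unfolding set_lebesgue_integral_def
  proof (rule integral_cong_AE)
    show "(\<lambda>s. indicator {a<..<c} s *\<^sub>R f s) \<in> borel_measurable lborel"
      using assms(1) unfolding set_integrable_def by simp
    have "set_integrable lborel ({a<..<b} \<union> {b<..<c}) f" using i by (intro set_integrable_Un) auto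
    then show "(\<lambda>s. indicator ({a<..<b} \<union> {b<..<c}) s *\<^sub>R f s) \<in> borel_measurable lborel"
      unfolding set_integrable_def by simp
    show "AE s in lborel. indicator {a<..<c} s *\<^sub>R f s = indicator ({a<..<b} \<union> {b<..<c}) s *\<^sub>R f s"
      using AE_lborel_singleton[of b] by eventually_elim (use assms in \<open>auto simp: indicator_def\<close>)
  qed
  also have "\<dots> = (LINT s:{a<..<b}|lborel. f s) + (LINT s:{b<..<c}|lborel. f s)"
    using i by (intro set_integral_Un) auto
  finally show ?thesis .
qed

section \<open>Jointly measurable versions of orbits and their time integrals\<close>

context positive_semigroup
begin

text \<open>Each \<open>T t u\<close> is determined only up to a null set, so a time integral at a
  fixed point x needs a representative chosen measurably in (t, x). Only t > 0 is constrained, which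
  is why orbit integrals run over open intervals.\<close>

definition orbit_version :: "('a \<Rightarrow> real) \<Rightarrow> (real \<times> 'a \<Rightarrow> real) \<Rightarrow> bool" where
  "orbit_version u U \<longleftrightarrow> U \<in> borel_measurable (borel \<Otimes>\<^sub>M m) \<and>
     (\<forall>t>0. AE x in m. U (t, x) = T t u x)"

text \<open>The weight turns \<open>m\<close> into a finite measure \<open>N\<close>, and
  Cauchy-Schwarz bounds the L_1 norm over \<open>N\<close> by \<open>norm2 m w\<close> times the L_2
  norm over \<open>m\<close>. Strong continuity thus gives the L_1 continuity that a jointly
  measurable version requires; as \<open>w\<close> is positive, \<open>N\<close> and
  \<open>m\<close> have the same null sets.\<close>

lemma ex_orbit_version:
  assumes u: "u \<in> Lp 2 m"
  shows "\<exists>U. orbit_version u U"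
proof -
  obtain w :: "'a \<Rightarrow> real" where w: "w \<in> borel_measurable m" "\<And>x. 0 < w x" "\<And>x. w x \<le> 1" "integrable m w"
    using ex_bounded_integrable_weight by blast
  have w2: "w \<in> Lp 2 m"
    unfolding Lp_2_iff
  proof
    have "(w x)\<^sup>2 \<le> w x" for x
      using mult_left_mono[OF w(3)[of x] less_imp_le[OF w(2)[of x]]] by (simp add: power2_eq_square)
    then show "integrable m (\<lambda>x. (w x)\<^sup>2)"
      using w by (intro Bochner_Integration.integrable_bound[OF w(4)]) (auto simp: less_imp_le)
  qed (rule w)
  define N where "N = density m (\<lambda>x. ennreal (w x))"
  have sN: "sets N = sets m" unfolding N_def by simp
  have meas: "T t u \<in> borel_measurable m" if "0 < t" for t using that u by (intro T_measurable) auto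
  have intw: "integrable m (\<lambda>x. w x * T t u x)" if "0 < t" for t
    using that u by (intro L2_mult_integrable w2 T_L2) auto
  obtain U where U: "U \<in> borel_measurable (borel \<Otimes>\<^sub>M N)" "\<And>t. 0 < t \<Longrightarrow> AE x in N. U (t, x) = T t u x"
  proof (rule ex_jointly_measurable_version[of N "\<lambda>t. T t u"])
    fix t :: real assume t: "0 < t"
    show "integrable N (T t u)"
      unfolding N_def using intw[OF t] meas[OF t] w(1,2) by (subst integrable_density) (auto simp: less_imp_le)
    show "((\<lambda>s. LINT x|N. \<bar>T s u x - T t u x\<bar>) \<longlongrightarrow> 0) (at t)"
    proof (rule tendstoI)
      fix e :: real assume e: "0 < e"
      define e' where "e' = e / (norm2 m w + 1)"
      have pos: "0 < norm2 m w + 1" using norm2_nonneg[of m w] by linarith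
      then have e': "0 < e'" unfolding e'_def using e by simp
      obtain \<delta> where d: "0 < \<delta>" "\<And>s r. 0 \<le> s \<Longrightarrow> s \<le> t + 1 \<Longrightarrow> 0 \<le> r \<Longrightarrow> r \<le> t + 1 \<Longrightarrow> \<bar>s - r\<bar> < \<delta> \<Longrightarrow>
          norm2 m (\<lambda>x. T s u x - T r u x) < e'"
        by (rule uniformly_continuous[OF u e', of "t + 1"]) blast
      have "(LINT x|N. \<bar>T s u x - T t u x\<bar>) < e" if s: "\<bar>s - t\<bar> < min \<delta> (min 1 t)" for s
      proof -
        have s0: "0 < s" using s by (auto simp: abs_if split: if_splits)
        have "(LINT x|N. \<bar>T s u x - T t u x\<bar>) = (LINT x|m. w x * \<bar>T s u x - T t u x\<bar>)"
          unfolding N_def using meas[OF t] meas[OF s0] w(1,2) by (subst integral_density) (auto simp: less_imp_le)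
        also have "\<dots> = (LINT x|m. \<bar>w x * (T s u x - T t u x)\<bar>)"
          using w(2) by (simp add: abs_mult less_imp_le)
        also have "\<dots> \<le> norm2 m w * norm2 m (\<lambda>x. T s u x - T t u x)"
          using s0 t u by (intro L2_Cauchy_Schwarz w2 L2_diff T_L2) auto
        also have "\<dots> \<le> norm2 m w * e'"
          using d(2)[of s t] s s0 t by (intro mult_left_mono less_imp_le[OF d(2)]) auto
        also have "\<dots> < (norm2 m w + 1) * e'" using e' by simp
        also have "\<dots> = e" unfolding e'_def using pos by simp
        finally show ?thesis .
      qed
      moreover have "\<forall>\<^sub>F s in at t. \<bar>s - t\<bar> < min \<delta> (min 1 t)"
        using d(1) t by (auto simp: eventually_at dist_real_def intro!: exI[of _ "min \<delta> (min 1 t)"])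
      ultimately show "\<forall>\<^sub>F s in at t. dist (LINT x|N. \<bar>T s u x - T t u x\<bar>) 0 < e"
        by (auto elim!: eventually_mono simp: dist_real_def)
    qed
  qed auto
  have sp: "sets (borel \<Otimes>\<^sub>M N) = sets (borel \<Otimes>\<^sub>M m)" by (rule sets_pair_measure_cong[OF refl sN])
  have "AE x in m. U (t, x) = T t u x" if "0 < t" for t
    using U(2)[OF that] w(1,2) unfolding N_def by (subst (asm) AE_density) auto
  then show ?thesis
    unfolding orbit_version_def using U(1) measurable_cong_sets[OF sp refl] by blast
qed

lemma orbit_section:
  assumes U: "orbit_version u U" and u: "u \<in> Lp 2 m" and t: "0 < t"
  shows "(\<lambda>x. U (t, x)) \<in> Lp 2 m" "AE x in m. U (t, x) = T t u x"
proof -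
  show ae: "AE x in m. U (t, x) = T t u x" using U t unfolding orbit_version_def by blast
  have [measurable]: "U \<in> borel_measurable (borel \<Otimes>\<^sub>M m)" using U unfolding orbit_version_def by blast
  show "(\<lambda>x. U (t, x)) \<in> Lp 2 m"
    using L2_cong[OF T_L2[of t u] _ ae] t u by auto
qed

definition orbit_integral :: "(real \<times> 'a \<Rightarrow> real) \<Rightarrow> real \<Rightarrow> real \<Rightarrow> 'a \<Rightarrow> real" where
  "orbit_integral U c d x = (LINT s:{c<..<d}|lborel. U (s, x))"

lemma orbit_integrable:
  assumes U: "orbit_version u U" and u: "u \<in> Lp 2 m" and cd: "0 \<le> c" "c \<le> d"
  shows "AE x in m. set_integrable lborel {c<..<d} (\<lambda>s. U (s, x))" "orbit_integral U c d \<in> Lp 2 m"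
proof -
  obtain K where K: "1 \<le> K" "\<And>t u. 0 \<le> t \<Longrightarrow> t \<le> d \<Longrightarrow> u \<in> Lp 2 m \<Longrightarrow> norm2 m (T t u) \<le> K * norm2 m u"
    using locally_bounded[of d] by blast
  have Um: "U \<in> borel_measurable (borel \<Otimes>\<^sub>M m)" using U unfolding orbit_version_def by blast
  have "norm2 m (\<lambda>x. U (s, x)) \<le> K * norm2 m u \<and> (\<lambda>x. U (s, x)) \<in> Lp 2 m" if "c < s" "s < d" for s
  proof -
    have s: "0 < s" "0 \<le> s" "s \<le> d" using that cd by auto
    have "norm2 m (\<lambda>x. U (s, x)) = norm2 m (T s u)"
      by (intro norm2_cong_AE L2_measurable[OF orbit_section(1)[OF U u s(1)]] T_measurable[OF s(2) u]
          orbit_section(2)[OF U u s(1)])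
    then show ?thesis using K(2)[OF s(2,3) u] orbit_section(1)[OF U u s(1)] by simp
  qed
  note L2_time_integral[OF Um cd(2) _ this]
  moreover have "0 \<le> K * norm2 m u" using K(1) by simp
  ultimately show "AE x in m. set_integrable lborel {c<..<d} (\<lambda>s. U (s, x))" "orbit_integral U c d \<in> Lp 2 m"
    unfolding orbit_integral_def[abs_def] by auto
qed

text \<open>The time integral inequality for the orbit minus the constant \<open>z\<close>; it makes
  Riemann-sum estimates possible.\<close>

lemma orbit_integral_near:
  assumes U: "orbit_version u U" and u: "u \<in> Lp 2 m" and z: "z \<in> Lp 2 m"
    and cd: "0 \<le> c" "c \<le> d" and e: "0 \<le> \<epsilon>"
    and near: "\<And>s. c < s \<Longrightarrow> s < d \<Longrightarrow> norm2 m (\<lambda>x. T s u x - z x) \<le> \<epsilon>"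
  shows "norm2 m (\<lambda>x. orbit_integral U c d x - (d - c) * z x) \<le> (d - c) * \<epsilon>"
proof -
  have Um[measurable]: "U \<in> borel_measurable (borel \<Otimes>\<^sub>M m)" using U unfolding orbit_version_def by blast
  have [measurable]: "z \<in> borel_measurable m" by (rule L2_measurable[OF z])
  define V where "V p = U p - z (snd p)" for p
  have Vm: "V \<in> borel_measurable (borel \<Otimes>\<^sub>M m)" unfolding V_def by measurable
  have bd: "norm2 m (\<lambda>x. V (s, x)) \<le> \<epsilon> \<and> (\<lambda>x. V (s, x)) \<in> Lp 2 m" if "c < s" "s < d" for s
  proof -
    have s: "0 < s" "0 \<le> s" using that cd by auto
    have "norm2 m (\<lambda>x. V (s, x)) = norm2 m (\<lambda>x. T s u x - z x)"
      using orbit_section(2)[OF U u s(1)] T_measurable[OF s(2) u] unfolding V_def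
      by (intro norm2_cong_AE) auto
    then show ?thesis using near[OF that] L2_diff(1)[OF orbit_section(1)[OF U u s(1)] z] by (simp add: V_def)
  qed
  have "norm2 m (\<lambda>x. orbit_integral U c d x - (d - c) * z x) = norm2 m (\<lambda>x. LINT s:{c<..<d}|lborel. V (s, x))"
  proof (rule norm2_cong_AE)
    show "(\<lambda>x. orbit_integral U c d x - (d - c) * z x) \<in> borel_measurable m"
      using L2_measurable[OF orbit_integrable(2)[OF U u cd]] by measurable
    show "(\<lambda>x. LINT s:{c<..<d}|lborel. V (s, x)) \<in> borel_measurable m"
      by (intro L2_measurable L2_time_integral(2)[OF Vm cd(2) e bd])
    show "AE x in m. orbit_integral U c d x - (d - c) * z x = (LINT s:{c<..<d}|lborel. V (s, x))"
      using orbit_integrable(1)[OF U u cd]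
    proof eventually_elim
      case (elim x)
      have c: "set_integrable lborel {c<..<d} (\<lambda>s. z x)"
        unfolding set_integrable_def using cd by simp
      have "(LINT s:{c<..<d}|lborel. z x) = (d - c) * z x"
        using cd by (simp add: set_lebesgue_integral_def)
      then show ?case
        unfolding V_def orbit_integral_def using set_integral_diff(2)[OF elim c] by simp
    qed
  qed
  also have "\<dots> \<le> (d - c) * \<epsilon>" by (rule L2_time_integral(3)[OF Vm cd(2) e bd])
  finally show ?thesis .
qed

lemma orbit_integral_split:
  assumes U: "orbit_version u U" and u: "u \<in> Lp 2 m" and "0 \<le> a" "a \<le> b" "b \<le> c"
  shows "AE x in m. orbit_integral U a c x = orbit_integral U a b x + orbit_integral U b c x"
proof -
  have "AE x in m. set_integrable lborel {a<..<c} (\<lambda>s. U (s, x))"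
    using assms by (intro orbit_integrable(1)[OF U u]) auto
  then show ?thesis
    by eventually_elim (use assms in \<open>simp add: orbit_integral_def set_integral_Ioo_split\<close>)
qed

text \<open>\<open>T \<tau>\<close> is an abstract operator, so Fubini does not apply. Instead, on a
  short interval [d, d'] both sides differ from (d' - d) T(\<tau> + d)u by a multiple of (d' - d)
  \<epsilon>; summed over a fine partition of [0, R], the total defect is at most R (K + 1)
  \<epsilon>.\<close>

lemma T_orbit_integral:
  assumes U: "orbit_version u U" and u: "u \<in> Lp 2 m" and \<tau>: "0 \<le> \<tau>" and R: "0 \<le> R"
  shows "AE x in m. T \<tau> (orbit_integral U 0 R) x = orbit_integral U \<tau> (R + \<tau>) x"
proof -
  define E where "E d x = T \<tau> (orbit_integral U 0 d) x - orbit_integral U \<tau> (d + \<tau>) x" for d x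
  note op = positive_operator[OF \<tau>]
  have I0: "orbit_integral U c d \<in> Lp 2 m" if "0 \<le> c" "c \<le> d" for c d
    using orbit_integrable(2)[OF U u that] .
  have E2: "E d \<in> Lp 2 m" if "0 \<le> d" for d
    unfolding E_def using that \<tau> by (intro L2_diff T_L2 I0) auto
  obtain K where K: "1 \<le> K" "\<And>t u. 0 \<le> t \<Longrightarrow> t \<le> \<tau> \<Longrightarrow> u \<in> Lp 2 m \<Longrightarrow> norm2 m (T t u) \<le> K * norm2 m u"
    using locally_bounded[of \<tau>] by blast
  have "norm2 m (E R) \<le> (R * (K + 1)) * \<epsilon>" if e: "0 < \<epsilon>" for \<epsilon>
  proof -
    obtain \<delta> where \<delta>: "0 < \<delta>" "\<And>s t. 0 \<le> s \<Longrightarrow> s \<le> R + \<tau> \<Longrightarrow> 0 \<le> t \<Longrightarrow> t \<le> R + \<tau> \<Longrightarrow> \<bar>s - t\<bar> < \<delta> \<Longrightarrow>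
        norm2 m (\<lambda>x. T s u x - T t u x) < \<epsilon>"
      by (rule uniformly_continuous[OF u e, of "R + \<tau>"]) blast
    have step: "norm2 m (E d') \<le> norm2 m (E d) + (d' - d) * ((K + 1) * \<epsilon>)"
      if d: "0 \<le> d" "d \<le> d'" "d' \<le> R" "d' - d < \<delta>" for d d'
    proof -
      define z where "z = T d u"
      have z: "z \<in> Lp 2 m" unfolding z_def using d u by (intro T_L2) auto
      have Tz: "T \<tau> z \<in> Lp 2 m" using \<tau> z by (rule T_L2)
      \<comment> \<open>Deviations of the two sides from their common approximation on [d, d']. The
        defect grows by \<open>P - Q\<close> over this interval.\<close>
      define P where "P x = T \<tau> (orbit_integral U d d') x - (d' - d) * T \<tau> z x" for x
      define Q where "Q x = orbit_integral U (d + \<tau>) (d' + \<tau>) x - (d' - d) * T \<tau> z x" for x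
      have PQ: "P \<in> Lp 2 m" "Q \<in> Lp 2 m"
        unfolding P_def Q_def using d \<tau> by (auto intro!: L2_diff(1) L2_cmult(1) Tz T_L2 I0)
      have P: "norm2 m P \<le> K * ((d' - d) * \<epsilon>)"
      proof -
        have "norm2 m P = norm2 m (T \<tau> (\<lambda>x. orbit_integral U d d' x - (d' - d) * z x))"
        proof (rule norm2_cong_AE)
          show "P \<in> borel_measurable m" by (rule L2_measurable[OF PQ(1)])
          show "T \<tau> (\<lambda>x. orbit_integral U d d' x - (d' - d) * z x) \<in> borel_measurable m"
            using d by (intro T_measurable \<tau> L2_diff L2_cmult I0 z) auto
          show "AE x in m. P x = T \<tau> (\<lambda>x. orbit_integral U d d' x - (d' - d) * z x) x"
            using positive_operator_L2_diff[OF op I0[OF d(1,2)] L2_cmult(1)[OF z, of "d' - d"]]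
              positive_operator_L2D(4)[OF op z, of "d' - d"]
            unfolding P_def by eventually_elim simp
        qed
        also have "\<dots> \<le> K * norm2 m (\<lambda>x. orbit_integral U d d' x - (d' - d) * z x)"
          using d \<tau> by (intro K L2_diff L2_cmult I0 z) auto
        also have "\<dots> \<le> K * ((d' - d) * \<epsilon>)"
        proof (intro mult_left_mono orbit_integral_near[OF U u z d(1,2)])
          fix s assume "d < s" "s < d'"
          then show "norm2 m (\<lambda>x. T s u x - z x) \<le> \<epsilon>"
            unfolding z_def using d \<tau> by (intro less_imp_le[OF \<delta>(2)]) auto
        qed (use K e in auto)
        finally show ?thesis .
      qed
      have Q: "norm2 m Q \<le> (d' - d) * \<epsilon>"
      proof -
        have "norm2 m Q = norm2 m (\<lambda>x. orbit_integral U (d + \<tau>) (d' + \<tau>) x - ((d' + \<tau>) - (d + \<tau>)) * T (\<tau> + d) u x)"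
        proof (rule norm2_cong_AE)
          show "Q \<in> borel_measurable m" by (rule L2_measurable[OF PQ(2)])
          show "(\<lambda>x. orbit_integral U (d + \<tau>) (d' + \<tau>) x - ((d' + \<tau>) - (d + \<tau>)) * T (\<tau> + d) u x) \<in> borel_measurable m"
            using d \<tau> u by (intro L2_measurable L2_diff L2_cmult I0 T_L2) auto
          show "AE x in m. Q x = orbit_integral U (d + \<tau>) (d' + \<tau>) x - ((d' + \<tau>) - (d + \<tau>)) * T (\<tau> + d) u x"
            using T_add[OF \<tau> d(1) u] unfolding Q_def z_def by eventually_elim simp
        qed
        also have "\<dots> \<le> ((d' + \<tau>) - (d + \<tau>)) * \<epsilon>"
        proof (intro orbit_integral_near[OF U u])
          show "T (\<tau> + d) u \<in> Lp 2 m" using d \<tau> u by (intro T_L2) auto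
          fix s assume "d + \<tau> < s" "s < d' + \<tau>"
          then show "norm2 m (\<lambda>x. T s u x - T (\<tau> + d) u x) \<le> \<epsilon>"
            using d \<tau> by (intro less_imp_le[OF \<delta>(2)]) auto
        qed (use d \<tau> e in auto)
        finally show ?thesis by simp
      qed
      have split: "AE x in m. E d' x = E d x + (P x - Q x)"
      proof -
        have "AE x in m. T \<tau> (orbit_integral U 0 d') x = T \<tau> (\<lambda>x. orbit_integral U 0 d x + orbit_integral U d d' x) x"
          by (rule positive_operator_L2D(2)[OF op])
            (use d in \<open>auto intro!: I0 L2_add orbit_integral_split[OF U u]\<close>)
        moreover have "AE x in m. T \<tau> (\<lambda>x. orbit_integral U 0 d x + orbit_integral U d d' x) x
            = T \<tau> (orbit_integral U 0 d) x + T \<tau> (orbit_integral U d d') x"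
          using d by (intro positive_operator_L2D(3)[OF op] I0) auto
        moreover have "AE x in m. orbit_integral U \<tau> (d' + \<tau>) x = orbit_integral U \<tau> (d + \<tau>) x + orbit_integral U (d + \<tau>) (d' + \<tau>) x"
          using d \<tau> by (intro orbit_integral_split[OF U u]) auto
        ultimately show ?thesis
          unfolding E_def P_def Q_def by eventually_elim simp
      qed
      have dd': "0 \<le> d'" using d by simp
      have "norm2 m (E d') = norm2 m (\<lambda>x. E d x + (P x - Q x))"
        using split by (intro norm2_cong_AE L2_measurable L2_add L2_diff E2 PQ d dd')
      also have "\<dots> \<le> norm2 m (E d) + norm2 m (\<lambda>x. P x - Q x)"
        by (intro L2_add L2_diff E2 PQ d)
      also have "norm2 m (\<lambda>x. P x - Q x) \<le> norm2 m P + norm2 m Q" by (intro L2_diff PQ)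
      finally have "norm2 m (E d') \<le> norm2 m (E d) + (norm2 m P + norm2 m Q)" by simp
      with P Q show ?thesis by (simp add: algebra_simps)
    qed
    \<comment> \<open>The mesh is \<open>R\<close> divided by a number of steps exceeding
      \<open>R / \<delta>\<close>; taking a successor keeps the divisor positive.\<close>
    obtain n0 where "R / \<delta> < real n0" using reals_Archimedean2 by blast
    then obtain n where n: "R / \<delta> < real (Suc n)" by (intro that[of n0]) simp
    define r where "r = R / Suc n"
    have r: "0 \<le> r" "r < \<delta>" "Suc n * r = R"
      using R n \<delta>(1) unfolding r_def by (auto simp: field_simps)
    have "norm2 m (E (k * r)) \<le> k * r * ((K + 1) * \<epsilon>)" if "k \<le> Suc n" for k :: nat
      using that
    proof (induction k)
      case 0
      have "AE x in m. E 0 x = 0"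
      proof -
        have z: "orbit_integral U c c = (\<lambda>x. 0)" for c
          by (auto simp: orbit_integral_def set_lebesgue_integral_def)
        have "AE x in m. T \<tau> (\<lambda>x. 0 * 0) x = 0 * T \<tau> (\<lambda>x. 0) x"
          by (rule positive_operator_L2D(4)[OF op]) simp
        then show ?thesis unfolding E_def by (simp add: z)
      qed
      then have "norm2 m (E 0) = norm2 m (\<lambda>x. 0)"
        by (intro norm2_cong_AE L2_measurable E2) auto
      then show ?case by simp
    next
      case (Suc k)
      have "real (Suc k) * r \<le> Suc n * r" using Suc.prems r by (intro mult_right_mono) auto
      then have "norm2 m (E (Suc k * r)) \<le> norm2 m (E (k * r)) + (Suc k * r - k * r) * ((K + 1) * \<epsilon>)"
        using r by (intro step) (auto simp: algebra_simps)
      also have "\<dots> \<le> Suc k * r * ((K + 1) * \<epsilon>)" using Suc by (simp add: algebra_simps)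
      finally show ?case .
    qed
    from this[of "Suc n"] show ?thesis unfolding r(3) by (simp add: mult.assoc)
  qed
  with norm2_nonneg have "norm2 m (E R) = 0" by (rule eq_0_if_le_mult_eps)
  from norm2_eq_0_AE[OF E2[OF R] this] show ?thesis
    unfolding E_def by eventually_elim simp
qed

end

section \<open>Averages of orbits: domain of the generator, pairings and L_1 bounds\<close>

context positive_semigroup
begin

text \<open>Shifting the window turns the difference quotient into 1 / h times the difference of two
  means of the orbit, over (h, h + \<tau>) and over (0, \<tau>). These tend to T(h)u and to
  u.\<close>

lemma orbit_average_generator:
  assumes U: "orbit_version u U" and u: "u \<in> Lp 2 m" and h: "0 < h"
  shows "(\<lambda>x. (1 / h) * orbit_integral U 0 h x, \<lambda>x. (1 / h) * (T h u x - u x)) \<in> generator_L2 m T"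
proof -
  define I where "I = orbit_integral U"
  have I2: "I c d \<in> Lp 2 m" if "0 \<le> c" "c \<le> d" for c d
    unfolding I_def using orbit_integrable(2)[OF U u that] .
  have h0: "0 \<le> h" using h by simp
  have near: "norm2 m (\<lambda>x. (1 / \<tau>) * I c (c + \<tau>) x - T c u x) \<le> \<epsilon>"
    if c: "0 \<le> c" and t: "0 < \<tau>" and e: "0 \<le> \<epsilon>"
    and n: "\<And>s. c < s \<Longrightarrow> s < c + \<tau> \<Longrightarrow> norm2 m (\<lambda>x. T s u x - T c u x) \<le> \<epsilon>" for c \<tau> \<epsilon>
  proof -
    have Tc: "T c u \<in> Lp 2 m" using c u by (rule T_L2)
    have "norm2 m (\<lambda>x. (1 / \<tau>) * I c (c + \<tau>) x - T c u x) = norm2 m (\<lambda>x. (1 / \<tau>) * (I c (c + \<tau>) x - \<tau> * T c u x))"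
      using t by (simp add: right_diff_distrib)
    also have "\<dots> = (1 / \<tau>) * norm2 m (\<lambda>x. I c (c + \<tau>) x - (c + \<tau> - c) * T c u x)"
      using c t by (subst L2_cmult(2)) (auto intro!: L2_diff(1) L2_cmult(1) I2 Tc)
    also have "\<dots> \<le> (1 / \<tau>) * ((c + \<tau> - c) * \<epsilon>)"
      unfolding I_def using c t by (intro mult_left_mono orbit_integral_near[OF U u Tc _ _ e n]) auto
    also have "\<dots> = \<epsilon>" using t by simp
    finally show ?thesis .
  qed
  have "((\<lambda>t. norm2 m (\<lambda>x. (1 / t) * (T t (\<lambda>x. (1 / h) * I 0 h x) x - (1 / h) * I 0 h x) - (1 / h) * (T h u x - u x))) \<longlongrightarrow> 0) (at_right 0)"
  proof (rule tendstoI)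
    fix e :: real assume e: "0 < e"
    \<comment> \<open>Each of the two means is off by at most \<open>\<epsilon>\<close> and their
      difference is divided by \<open>h\<close>, which leaves e / 2.\<close>
    define \<epsilon> where "\<epsilon> = e * h / 4"
    have eps: "0 < \<epsilon>" unfolding \<epsilon>_def using e h by simp
    obtain \<delta> where \<delta>: "0 < \<delta>" "\<And>s t. 0 \<le> s \<Longrightarrow> s \<le> h + 1 \<Longrightarrow> 0 \<le> t \<Longrightarrow> t \<le> h + 1 \<Longrightarrow> \<bar>s - t\<bar> < \<delta> \<Longrightarrow>
        norm2 m (\<lambda>x. T s u x - T t u x) < \<epsilon>"
      by (rule uniformly_continuous[OF u eps, of "h + 1"]) blast
    have main: "norm2 m (\<lambda>x. (1 / \<tau>) * (T \<tau> (\<lambda>x. (1 / h) * I 0 h x) x - (1 / h) * I 0 h x) - (1 / h) * (T h u x - u x)) < e"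
      (is "norm2 m ?D < e") if t: "0 < \<tau>" "\<tau> < min \<delta> 1" for \<tau>
    proof -
      have t0: "0 \<le> \<tau>" using t by simp
      note op = positive_operator[OF t0]
      define P where "P x = (1 / \<tau>) * I h (h + \<tau>) x - T h u x" for x
      define Q where "Q x = (1 / \<tau>) * I 0 (0 + \<tau>) x - T 0 u x" for x
      have PQ: "P \<in> Lp 2 m" "Q \<in> Lp 2 m"
        unfolding P_def Q_def using h t u by (intro L2_diff(1) L2_cmult(1) I2 T_L2; simp)+
      have Pn: "norm2 m P \<le> \<epsilon>"
        unfolding P_def using h t eps by (intro near less_imp_le[OF \<delta>(2)]) auto
      have Qn: "norm2 m Q \<le> \<epsilon>"
        unfolding Q_def using h t eps by (intro near less_imp_le[OF \<delta>(2)]) auto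
      have D2: "?D \<in> Lp 2 m"
        using h h0 t0 u by (intro L2_diff(1) L2_cmult(1) I2 T_L2) auto
      have le: "\<tau> \<le> h + \<tau>" "h \<le> h + \<tau>" using h t by auto
      have "AE x in m. ?D x = (1 / h) * (P x - Q x)"
        using positive_operator_L2D(4)[OF op I2[OF order_refl h0], of "1 / h"]
          T_orbit_integral[OF U u t0 h0, folded I_def] T_zero[OF u]
          orbit_integral_split[OF U u order_refl t0 le(1), folded I_def]
          orbit_integral_split[OF U u order_refl h0 le(2), folded I_def]
      proof eventually_elim
        case (elim x)
        have "I \<tau> (h + \<tau>) x - I 0 h x = I h (h + \<tau>) x - I 0 \<tau> x" using elim h0 t0 by simp
        moreover have "?D x = (1 / h) * ((1 / \<tau>) * (I \<tau> (h + \<tau>) x - I 0 h x) - (T h u x - u x))"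
          using elim h t by (simp add: field_simps)
        moreover have "P x - Q x = (1 / \<tau>) * (I h (h + \<tau>) x - I 0 \<tau> x) - (T h u x - u x)"
          using elim unfolding P_def Q_def by (simp add: algebra_simps)
        ultimately show ?case by simp
      qed
      then have "norm2 m ?D = norm2 m (\<lambda>x. (1 / h) * (P x - Q x))"
        by (intro norm2_cong_AE L2_measurable[OF D2] L2_measurable L2_cmult L2_diff PQ) auto
      also have "\<dots> = (1 / h) * norm2 m (\<lambda>x. P x - Q x)"
        using h by (subst L2_cmult(2)) (auto intro!: L2_diff(1) PQ)
      also have "\<dots> \<le> (1 / h) * (\<epsilon> + \<epsilon>)"
        using h L2_diff(2)[OF PQ] Pn Qn by (intro mult_left_mono) auto
      also have "\<dots> < e" using h e unfolding \<epsilon>_def by simp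
      finally show ?thesis .
    qed
    have "\<forall>\<^sub>F \<tau> in at_right 0. 0 < \<tau> \<and> \<tau> < min \<delta> (1::real)"
      unfolding eventually_at_right_field using \<delta>(1) by (intro exI[of _ "min \<delta> 1"]) auto
    then show "\<forall>\<^sub>F t in at_right 0. dist (norm2 m (\<lambda>x. (1 / t) * (T t (\<lambda>x. (1 / h) * I 0 h x) x - (1 / h) * I 0 h x) - (1 / h) * (T h u x - u x))) 0 < e"
    proof eventually_elim
      case (elim \<tau>)
      then show ?case using main[of \<tau>] by (simp add: dist_real_def)
    qed
  qed
  then show ?thesis
    unfolding generator_L2_def I_def[symmetric] mem_Collect_eq prod.case using h u
    by (intro conjI L2_cmult(1) L2_diff(1) I2 T_L2) auto
qed

text \<open>Fubini applies because Cauchy-Schwarz and the local bound of T control the L_1 norm of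
  U(s, .) v uniformly for s in (0, h).\<close>

lemma orbit_integral_pairing:
  assumes U: "orbit_version u U" and u: "u \<in> Lp 2 m" and v: "v \<in> Lp 2 m" and h: "0 \<le> h"
  shows "pairing m (orbit_integral U 0 h) v = (LINT s:{0<..<h}|lborel. pairing m (T s u) v)"
proof -
  interpret P: pair_sigma_finite lborel m ..
  have [measurable]: "U \<in> borel_measurable (borel \<Otimes>\<^sub>M m)" using U unfolding orbit_version_def by blast
  have [measurable]: "v \<in> borel_measurable m" by (rule L2_measurable[OF v])
  obtain K where K: "1 \<le> K" "\<And>t u. 0 \<le> t \<Longrightarrow> t \<le> h \<Longrightarrow> u \<in> Lp 2 m \<Longrightarrow> norm2 m (T t u) \<le> K * norm2 m u"
    using locally_bounded[of h] by blast
  define g where "g p = indicator {0<..<h} (fst p) * (U p * v (snd p))" for p :: "real \<times> 'a"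
  have [measurable]: "g \<in> borel_measurable (borel \<Otimes>\<^sub>M m)" unfolding g_def by measurable
  have gm: "g \<in> borel_measurable (lborel \<Otimes>\<^sub>M m)" by measurable
  have sec: "integrable m (\<lambda>x. g (s, x))" for s
  proof (cases "s \<in> {0<..<h}")
    case True
    then show ?thesis unfolding g_def using L2_mult_integrable[OF orbit_section(1)[OF U u] v, of s] by simp
  qed (simp add: g_def)
  have gi: "integrable (lborel \<Otimes>\<^sub>M m) g"
  proof (rule P.Fubini_integrable[OF gm])
    show "AE s in lborel. integrable m (\<lambda>x. g (s, x))" using sec by simp
    show "integrable lborel (\<lambda>s. LINT x|m. norm (g (s, x)))"
    proof (rule Bochner_Integration.integrable_bound)
      show "integrable lborel (\<lambda>s. indicator {0<..<h} s * (K * norm2 m u * norm2 m v))" using h by simp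
      show "(\<lambda>s. LINT x|m. norm (g (s, x))) \<in> borel_measurable lborel" by measurable
      have "(LINT x|m. norm (g (s, x))) \<le> indicator {0<..<h} s * (K * norm2 m u * norm2 m v)" for s
      proof (cases "s \<in> {0<..<h}")
        case True
        then have "(LINT x|m. norm (g (s, x))) = (LINT x|m. \<bar>U (s, x) * v x\<bar>)" unfolding g_def by simp
        also have "\<dots> \<le> norm2 m (\<lambda>x. U (s, x)) * norm2 m v"
          using True by (intro L2_Cauchy_Schwarz orbit_section(1)[OF U u] v) auto
        also have "norm2 m (\<lambda>x. U (s, x)) = norm2 m (T s u)"
          using True u by (intro norm2_cong_AE orbit_section(2)[OF U u] L2_measurable[OF orbit_section(1)[OF U u]] T_measurable) auto
        also have "norm2 m (T s u) * norm2 m v \<le> (K * norm2 m u) * norm2 m v"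
          using True u by (intro mult_right_mono K) auto
        finally show ?thesis using True by simp
      qed (simp add: g_def)
      moreover have "0 \<le> (LINT x|m. norm (g (s, x)))" for s by (intro integral_nonneg_AE) simp
      ultimately show "AE s in lborel. norm (LINT x|m. norm (g (s, x))) \<le> norm (indicator {0<..<h} s * (K * norm2 m u * norm2 m v))"
        by (intro AE_I2) (simp only: real_norm_def abs_of_nonneg, meson abs_ge_self order_trans)
    qed
  qed
  have "pairing m (orbit_integral U 0 h) v = (LINT x|m. LINT s|lborel. g (s, x))"
    unfolding pairing_def orbit_integral_def set_lebesgue_integral_def
  proof (intro Bochner_Integration.integral_cong refl)
    fix x
    have "(LINT s|lborel. indicator {0<..<h} s *\<^sub>R U (s, x)) * v x = (LINT s|lborel. indicator {0<..<h} s *\<^sub>R U (s, x) * v x)"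
      by (rule integral_mult_left_zero[symmetric])
    then show "(LINT s|lborel. indicator {0<..<h} s *\<^sub>R U (s, x)) * v x = (LINT s|lborel. g (s, x))"
      unfolding g_def by (simp add: mult.assoc)
  qed
  also have "\<dots> = (LINT s|lborel. LINT x|m. g (s, x))"
    using P.Fubini_integral[of "\<lambda>s x. g (s, x)"] gi by simp
  also have "\<dots> = (LINT s:{0<..<h}|lborel. pairing m (T s u) v)"
    unfolding set_lebesgue_integral_def
  proof (intro Bochner_Integration.integral_cong refl)
    fix s
    show "(LINT x|m. g (s, x)) = indicator {0<..<h} s *\<^sub>R pairing m (T s u) v"
    proof (cases "s \<in> {0<..<h}")
      case True
      then have "(LINT x|m. g (s, x)) = pairing m (\<lambda>x. U (s, x)) v" unfolding g_def pairing_def by simp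
      also have "\<dots> = pairing m (T s u) v"
        using True u by (intro pairing_cong_AE orbit_section(2)[OF U u] L2_measurable[OF orbit_section(1)[OF U u]] T_measurable) auto
      finally show ?thesis using True by simp
    qed (simp add: g_def)
  qed
  finally show ?thesis .
qed

text \<open>The form inequality demands an argument that is nonnegative and in L_1, and it charges
  the L_1 norm. By Tonelli, an average inherits any bound \<open>c\<close> that holds along the
  orbit.\<close>

lemma orbit_average_L1:
  assumes U: "orbit_version u U" and u: "u \<in> Lp 2 m" and u0: "AE x in m. 0 \<le> u x" and h: "0 < h"
    and L1: "\<And>s. 0 < s \<Longrightarrow> s < h \<Longrightarrow> integrable m (T s u) \<and> (LINT x|m. \<bar>T s u x\<bar>) \<le> c" and c: "0 \<le> c"
  shows "integrable m (\<lambda>x. (1 / h) * orbit_integral U 0 h x)"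
    and "(LINT x|m. \<bar>(1 / h) * orbit_integral U 0 h x\<bar>) \<le> c"
    and "AE x in m. 0 \<le> (1 / h) * orbit_integral U 0 h x"
proof -
  interpret P: pair_sigma_finite lborel m ..
  have [measurable]: "U \<in> borel_measurable (borel \<Otimes>\<^sub>M m)" using U unfolding orbit_version_def by blast
  have [measurable]: "orbit_integral U 0 h \<in> borel_measurable m"
    using h by (intro L2_measurable orbit_integrable(2)[OF U u]) auto
  \<comment> \<open>Nonnegativity holds at each time off a null set depending on that time; joint
    measurability allows the quantifiers to be exchanged.\<close>
  have "AE s in lborel. AE x in m. 0 < s \<longrightarrow> 0 \<le> U (s, x)"
  proof (rule AE_I2)
    fix s :: real
    show "AE x in m. 0 < s \<longrightarrow> 0 \<le> U (s, x)"
    proof (cases "0 < s")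
      case True
      then show ?thesis using orbit_section(2)[OF U u True] T_nonneg[of s u] u u0 by auto
    qed simp
  qed
  then have U0: "AE x in m. AE s in lborel. 0 < s \<longrightarrow> 0 \<le> U (s, x)"
    by (subst P.AE_commute[symmetric]) measurable
  then show nn: "AE x in m. 0 \<le> (1 / h) * orbit_integral U 0 h x"
  proof eventually_elim
    case (elim x)
    have "0 \<le> orbit_integral U 0 h x"
      unfolding orbit_integral_def set_lebesgue_integral_def
      by (rule integral_nonneg_AE) (use elim in eventually_elim, auto simp: indicator_def)
    then show ?case using h by simp
  qed
  have "(\<integral>\<^sup>+x. ennreal \<bar>orbit_integral U 0 h x\<bar> \<partial>m) \<le> (\<integral>\<^sup>+x. \<integral>\<^sup>+s. indicator {0<..<h} s * ennreal \<bar>U (s, x)\<bar> \<partial>lborel \<partial>m)"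
  proof (rule nn_integral_mono_AE)
    have "AE x in m. set_integrable lborel {0<..<h} (\<lambda>s. U (s, x))"
      using h by (intro orbit_integrable(1)[OF U u]) auto
    then show "AE x in m. ennreal \<bar>orbit_integral U 0 h x\<bar> \<le> (\<integral>\<^sup>+s. indicator {0<..<h} s * ennreal \<bar>U (s, x)\<bar> \<partial>lborel)"
    proof eventually_elim
      case (elim x)
      have "ennreal (norm (orbit_integral U 0 h x)) \<le> (\<integral>\<^sup>+s. ennreal (norm (indicator {0<..<h} s *\<^sub>R U (s, x))) \<partial>lborel)"
        unfolding orbit_integral_def set_lebesgue_integral_def
        by (rule integral_norm_bound_ennreal) (use elim in \<open>simp add: set_integrable_def\<close>)
      also have "\<dots> = (\<integral>\<^sup>+s. indicator {0<..<h} s * ennreal \<bar>U (s, x)\<bar> \<partial>lborel)"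
        by (intro nn_integral_cong) (auto simp: indicator_def)
      finally show ?case by simp
    qed
  qed
  also have "\<dots> = (\<integral>\<^sup>+s. \<integral>\<^sup>+x. indicator {0<..<h} s * ennreal \<bar>U (s, x)\<bar> \<partial>m \<partial>lborel)"
    by (intro P.Fubini') measurable
  also have "\<dots> \<le> (\<integral>\<^sup>+s. indicator {0<..<h} s * ennreal c \<partial>lborel)"
  proof (intro nn_integral_mono)
    fix s :: real
    show "(\<integral>\<^sup>+x. indicator {0<..<h} s * ennreal \<bar>U (s, x)\<bar> \<partial>m) \<le> indicator {0<..<h} s * ennreal c"
    proof (cases "s \<in> {0<..<h}")
      case True
      then have s: "0 < s" "s < h" by auto
      have "(\<integral>\<^sup>+x. ennreal \<bar>U (s, x)\<bar> \<partial>m) = (\<integral>\<^sup>+x. ennreal \<bar>T s u x\<bar> \<partial>m)"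
        using orbit_section(2)[OF U u s(1)] by (intro nn_integral_cong_AE) auto
      also have "\<dots> = ennreal (LINT x|m. \<bar>T s u x\<bar>)"
        using L1[OF s] by (intro nn_integral_eq_integral) auto
      also have "\<dots> \<le> ennreal c" using L1[OF s] by (intro ennreal_leI) auto
      finally show ?thesis using True by simp
    qed simp
  qed
  also have "\<dots> = ennreal (h * c)"
    using h c by (subst mult.commute, subst nn_integral_cmult) (auto simp: ennreal_mult mult.commute)
  finally have b: "(\<integral>\<^sup>+x. ennreal \<bar>orbit_integral U 0 h x\<bar> \<partial>m) \<le> ennreal (h * c)" .
  then have i: "integrable m (orbit_integral U 0 h)"
    by (intro integrableI_bounded) (auto simp: less_top[symmetric] top_unique)
  then show "integrable m (\<lambda>x. (1 / h) * orbit_integral U 0 h x)" by simp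
  have "(LINT x|m. \<bar>orbit_integral U 0 h x\<bar>) \<le> h * c"
    using b i h c by (subst (asm) nn_integral_eq_integral) auto
  then show "(LINT x|m. \<bar>(1 / h) * orbit_integral U 0 h x\<bar>) \<le> c"
    using h by (simp add: abs_mult field_simps)
qed

end

section \<open>Integral kernels from additive set functions\<close>

context sigma_finite_measure
begin

text \<open>Caratheodory extension starts from a semiring. The difference of two rectangles splits
  into the disjoint rectangles (A - A') x B and (A \<inter> A') x (B - B').\<close>

lemma semiring_of_rectangles:
  "semiring_of_sets (space M \<times> space M) {A \<times> B |A B. A \<in> sets M \<and> B \<in> sets M}"
proof -
  have cover: "\<exists>C\<subseteq>{A \<times> B |A B. A \<in> sets M \<and> B \<in> sets M}. finite C \<and> disjoint C \<and> A \<times> B - A' \<times> B' = \<Union>C"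
    if "A \<in> sets M" "B \<in> sets M" "A' \<in> sets M" "B' \<in> sets M" for A B A' B'
  proof (intro exI[of _ "{(A - A') \<times> B, (A \<inter> A') \<times> (B - B')}"] conjI)
    have "A - A' \<in> sets M" "A \<inter> A' \<in> sets M" "B - B' \<in> sets M" using that by auto
    then show "{(A - A') \<times> B, (A \<inter> A') \<times> (B - B')} \<subseteq> {A \<times> B |A B. A \<in> sets M \<and> B \<in> sets M}"
      using that by blast
    show "disjoint {(A - A') \<times> B, (A \<inter> A') \<times> (B - B')}"
      unfolding disjoint_def by auto
    show "A \<times> B - A' \<times> B' = \<Union>{(A - A') \<times> B, (A \<inter> A') \<times> (B - B')}" by auto
  qed simp
  have int: "\<exists>C D. A \<times> B \<inter> A' \<times> B' = C \<times> D \<and> C \<in> sets M \<and> D \<in> sets M"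
    if "A \<in> sets M" "B \<in> sets M" "A' \<in> sets M" "B' \<in> sets M" for A B A' B'
    using that by (intro exI[of _ "A \<inter> A'"] exI[of _ "B \<inter> B'"]) auto
  have "{} \<in> {A \<times> B |A B. A \<in> sets M \<and> B \<in> sets M}"
    using sets.empty_sets by blast
  then show ?thesis
  proof (intro semiring_of_sets.intro subset_class.intro semiring_of_sets_axioms.intro)
    show "{A \<times> B |A B. A \<in> sets M \<and> B \<in> sets M} \<subseteq> Pow (space M \<times> space M)"
      using sets.sets_into_space by blast
    fix a b assume "a \<in> {A \<times> B |A B. A \<in> sets M \<and> B \<in> sets M}" "b \<in> {A \<times> B |A B. A \<in> sets M \<and> B \<in> sets M}"
    then obtain A B A' B' where ab: "a = A \<times> B" "b = A' \<times> B'"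
      "A \<in> sets M" "B \<in> sets M" "A' \<in> sets M" "B' \<in> sets M" by blast
    show "a \<inter> b \<in> {A \<times> B |A B. A \<in> sets M \<and> B \<in> sets M}"
      unfolding ab(1,2) using int[OF ab(3-6)] by simp
    show "\<exists>C\<subseteq>{A \<times> B |A B. A \<in> sets M \<and> B \<in> sets M}. finite C \<and> disjoint C \<and> a - b = \<Union>C"
      unfolding ab(1,2) by (rule cover[OF ab(3-6)])
  qed
qed

lemma emeasure_density_Times:
  fixes f :: "'a \<times> 'a \<Rightarrow> ennreal"
  assumes [measurable]: "f \<in> borel_measurable (M \<Otimes>\<^sub>M M)" "A \<in> sets M" "B \<in> sets M"
  shows "emeasure (density (M \<Otimes>\<^sub>M M) f) (A \<times> B) = (\<integral>\<^sup>+x. (\<integral>\<^sup>+y. f (x, y) * indicator B y \<partial>M) * indicator A x \<partial>M)"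
proof -
  have "emeasure (density (M \<Otimes>\<^sub>M M) f) (A \<times> B) = (\<integral>\<^sup>+x. \<integral>\<^sup>+y. f (x, y) * indicator (A \<times> B) (x, y) \<partial>M \<partial>M)"
    by (subst emeasure_density) (auto simp: nn_integral_fst[symmetric])
  also have "\<dots> = (\<integral>\<^sup>+x. (\<integral>\<^sup>+y. f (x, y) * indicator B y \<partial>M) * indicator A x \<partial>M)"
    by (intro nn_integral_cong) (auto simp: indicator_def)
  finally show ?thesis .
qed

text \<open>Rectangles are stable under intersection and generate the product sigma-algebra. Finite
  total mass lets the whole square act as the exhausting sequence and makes the density unique
  almost everywhere.\<close>

lemma density_eq_on_rectangles:
  fixes f g :: "'a \<times> 'a \<Rightarrow> ennreal"
  assumes [measurable]: "f \<in> borel_measurable (M \<Otimes>\<^sub>M M)" "g \<in> borel_measurable (M \<Otimes>\<^sub>M M)"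
    and fin: "(\<integral>\<^sup>+p. f p \<partial>(M \<Otimes>\<^sub>M M)) \<noteq> \<infinity>"
    and eq: "\<And>A B. A \<in> sets M \<Longrightarrow> B \<in> sets M \<Longrightarrow>
      emeasure (density (M \<Otimes>\<^sub>M M) f) (A \<times> B) = emeasure (density (M \<Otimes>\<^sub>M M) g) (A \<times> B)"
  shows "AE p in M \<Otimes>\<^sub>M M. f p = g p"
proof -
  have "density (M \<Otimes>\<^sub>M M) f = density (M \<Otimes>\<^sub>M M) g"
  proof (rule measure_eqI_generator_eq[OF Int_stable_pair_measure_generator[of M M], where A = "\<lambda>_. space M \<times> space M"])
    show "{a \<times> b |a b. a \<in> sets M \<and> b \<in> sets M} \<subseteq> Pow (space M \<times> space M)"
      using sets.sets_into_space by blast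
    show "sets (density (M \<Otimes>\<^sub>M M) f) = sigma_sets (space M \<times> space M) {a \<times> b |a b. a \<in> sets M \<and> b \<in> sets M}"
      "sets (density (M \<Otimes>\<^sub>M M) g) = sigma_sets (space M \<times> space M) {a \<times> b |a b. a \<in> sets M \<and> b \<in> sets M}"
      by (auto simp: sets_pair_measure)
    show "range (\<lambda>_. space M \<times> space M) \<subseteq> {a \<times> b |a b. a \<in> sets M \<and> b \<in> sets M}" by blast
    fix i :: nat
    have "emeasure (density (M \<Otimes>\<^sub>M M) f) (space M \<times> space M) = (\<integral>\<^sup>+p. f p \<partial>(M \<Otimes>\<^sub>M M))"
      by (subst emeasure_density) (auto simp: space_pair_measure intro!: nn_integral_cong)
    then show "emeasure (density (M \<Otimes>\<^sub>M M) f) (space M \<times> space M) \<noteq> \<infinity>" using fin by simp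
  qed (use eq in auto)
  then show ?thesis using finite_density_unique[OF assms(1,2) _ _ fin] by simp
qed

text \<open>For a.e. \<open>x\<close> and all \<open>n\<close>, additivity applies to the finitely many \<open>B\<^sub>i\<close>, \<open>i < n\<close>, with \<open>x \<in> A\<^sub>i\<close>;
  domination by a kernel makes the remainder vanish as \<open>n \<rightarrow> \<infinity>\<close>.\<close>

lemma additive_dominated_rectangle_sums:
  fixes r :: "'a set \<Rightarrow> 'a \<Rightarrow> ennreal" and K :: "'a \<times> 'a \<Rightarrow> ennreal"
  assumes K[measurable]: "K \<in> borel_measurable (M \<Otimes>\<^sub>M M)" and Kfin: "(\<integral>\<^sup>+p. K p \<partial>(M \<Otimes>\<^sub>M M)) \<noteq> \<infinity>"
    and add: "\<And>B C. B \<in> sets M \<Longrightarrow> C \<in> sets M \<Longrightarrow> B \<inter> C = {} \<Longrightarrow> AE x in M. r (B \<union> C) x = r B x + r C x"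
    and dom: "\<And>B. B \<in> sets M \<Longrightarrow> AE x in M. r B x \<le> (\<integral>\<^sup>+y. K (x, y) * indicator B y \<partial>M)"
    and A[measurable]: "\<And>n::nat. A n \<in> sets M" and B[measurable]: "\<And>n::nat. B n \<in> sets M"
    and S: "S \<in> sets M" and S'[measurable]: "S' \<in> sets M"
    and disj: "disjoint_family (\<lambda>n. A n \<times> B n)" and un: "(\<Union>n. A n \<times> B n) = S \<times> S'"
  shows "AE x in M. r S' x * indicator S x = (\<Sum>n. r (B n) x * indicator (A n) x)"
proof -
  have r0: "AE x in M. r {} x = 0" using dom[of "{}"] by simp
  have fin: "AE x in M. (\<integral>\<^sup>+y. K (x, y) \<partial>M) \<noteq> \<infinity>"
    using Kfin nn_integral_fst[OF K] by (intro nn_integral_PInf_AE) auto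
  have UB: "(\<Union>i\<in>J. B i) \<in> sets M" if "finite J" for J using that by auto
  have sum_add: "AE x in M. r (\<Union>i\<in>J. B i) x = (\<Sum>i\<in>J. r (B i) x)"
    if "finite J" "disjoint_family_on B J" for J
    using that
  proof (induction J)
    case empty
    then show ?case using r0 by simp
  next
    case (insert j J)
    have "B j \<inter> (\<Union>i\<in>J. B i) = {}" using insert.prems insert.hyps(2) by (fastforce simp: disjoint_family_on_def)
    from add[OF B[of j] UB[OF insert.hyps(1)] this]
      insert.IH[OF disjoint_family_on_mono[OF subset_insertI insert.prems]]
    show ?case by eventually_elim (use insert.hyps in simp)
  qed
  have dec: "AE x in M. disjoint_family_on B J \<longrightarrow> (\<Union>i\<in>J. B i) \<subseteq> S' \<longrightarrow>
      r S' x = r (S' - (\<Union>i\<in>J. B i)) x + (\<Sum>i\<in>J. r (B i) x)" if J: "finite J" for J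
  proof (cases "disjoint_family_on B J \<and> (\<Union>i\<in>J. B i) \<subseteq> S'")
    case True
    have "AE x in M. r ((S' - (\<Union>i\<in>J. B i)) \<union> (\<Union>i\<in>J. B i)) x = r (S' - (\<Union>i\<in>J. B i)) x + r (\<Union>i\<in>J. B i) x"
      using UB[OF J] by (intro add) auto
    moreover have "(S' - (\<Union>i\<in>J. B i)) \<union> (\<Union>i\<in>J. B i) = S'" using True by auto
    ultimately show ?thesis using sum_add[OF J] True by auto
  qed auto
  \<comment> \<open>The index set used below depends on the point x, so one exceptional null set has
    to serve all finite index sets; there are only countably many of them.\<close>
  have "countable (Collect (finite :: nat set \<Rightarrow> bool))" by (rule countable_Collect_finite)
  then have dec': "AE x in M. \<forall>J\<in>Collect finite. disjoint_family_on B J \<longrightarrow> (\<Union>i\<in>J. B i) \<subseteq> S' \<longrightarrow>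
      r S' x = r (S' - (\<Union>i\<in>J. B i)) x + (\<Sum>i\<in>J. r (B i) x)"
    by (subst AE_ball_countable) (use dec in auto)
  have dom': "AE x in M. \<forall>J\<in>Collect finite. r (S' - (\<Union>i\<in>J. B i)) x \<le> (\<integral>\<^sup>+y. K (x, y) * indicator (S' - (\<Union>i\<in>J. B i)) y \<partial>M)"
    by (subst AE_ball_countable) (use UB in \<open>auto intro!: dom countable_Collect_finite\<close>)
  \<comment> \<open>For points outside \<open>S\<close>: such an x can lie in \<open>A n\<close>
    only if \<open>B n\<close> is empty.\<close>
  have e0: "AE x in M. \<forall>n. B n = {} \<longrightarrow> r (B n) x = 0"
    unfolding AE_all_countable using r0 by auto
  show ?thesis
    using dec' dom' fin e0 AE_space
  proof eventually_elim
    case (elim x)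
    show ?case
    proof (cases "x \<in> S")
      case False
      have "r (B n) x * indicator (A n) x = 0" for n
      proof (cases "x \<in> A n \<and> B n \<noteq> {}")
        case True
        then obtain y where "(x, y) \<in> A n \<times> B n" by auto
        then have "(x, y) \<in> S \<times> S'" using un by blast
        then show ?thesis using False by simp
      qed (use elim(4) in \<open>auto simp: indicator_def\<close>)
      then have "(\<lambda>n. r (B n) x * indicator (A n) x) = (\<lambda>_. 0)" by blast
      then show ?thesis using False by simp
    next
      case True
      define J where "J n = {i. i < n \<and> x \<in> A i}" for n
      define D where "D n = S' - (\<Union>i\<in>J n. B i)" for n
      have J: "J n \<in> Collect finite" for n unfolding J_def by auto
      have "disjoint_family_on B (J n)" for n
        using disj unfolding disjoint_family_on_def J_def by (auto 0 3 simp: set_eq_iff)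
      moreover have "(\<Union>i\<in>J n. B i) \<subseteq> S'" for n
      proof
        fix y assume "y \<in> (\<Union>i\<in>J n. B i)"
        then obtain i where "(x, y) \<in> A i \<times> B i" unfolding J_def by auto
        then have "(x, y) \<in> S \<times> S'" using un by blast
        then show "y \<in> S'" by simp
      qed
      ultimately have "r S' x = r (D n) x + (\<Sum>i\<in>J n. r (B i) x)" for n
        using elim(1) J unfolding D_def by blast
      moreover have "(\<Sum>i\<in>J n. r (B i) x) = (\<Sum>i<n. r (B i) x * indicator (A i) x)" for n
        unfolding J_def by (intro sum.mono_neutral_cong_left) (auto simp: indicator_def)
      ultimately have eq: "r S' x = r (D n) x + (\<Sum>i<n. r (B i) x * indicator (A i) x)" for n by simp
      have [measurable]: "D n \<in> sets M" for n unfolding D_def using UB J[of n] by auto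
      have "(\<lambda>n. \<integral>\<^sup>+y. K (x, y) * indicator (D n) y \<partial>M) \<longlonglongrightarrow> (\<integral>\<^sup>+y. 0 \<partial>M)"
      proof (rule nn_integral_dominated_convergence[where w = "\<lambda>y. K (x, y)"])
        show "(\<integral>\<^sup>+y. K (x, y) \<partial>M) < \<infinity>" using elim(3) by (simp add: less_top)
        show "AE y in M. (\<lambda>n. K (x, y) * indicator (D n) y) \<longlonglongrightarrow> 0"
        proof (rule AE_I2)
          fix y
          have "\<exists>n0. \<forall>n\<ge>n0. y \<notin> D n"
          proof (cases "y \<in> S'")
            case True
            then have "(x, y) \<in> (\<Union>n. A n \<times> B n)" using \<open>x \<in> S\<close> un by blast
            then obtain i where "x \<in> A i" "y \<in> B i" by auto
            then show ?thesis unfolding D_def J_def by (intro exI[of _ "Suc i"]) auto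
          qed (auto simp: D_def)
          then have "\<forall>\<^sub>F n in sequentially. y \<notin> D n"
            by (simp add: eventually_sequentially)
          then have "\<forall>\<^sub>F n in sequentially. K (x, y) * indicator (D n) y = 0"
            by eventually_elim simp
          then show "(\<lambda>n. K (x, y) * indicator (D n) y) \<longlonglongrightarrow> 0" by (rule tendsto_eventually)
        qed
      qed (use elim(5) in \<open>auto simp: indicator_def\<close>)
      then have "(\<lambda>n. \<integral>\<^sup>+y. K (x, y) * indicator (D n) y \<partial>M) \<longlonglongrightarrow> 0" by simp
      moreover have "r (D n) x \<le> (\<integral>\<^sup>+y. K (x, y) * indicator (D n) y \<partial>M)" for n
        using elim(2) J unfolding D_def by blast
      ultimately have "(\<lambda>n. r (D n) x) \<longlonglongrightarrow> 0"
        by (intro tendsto_sandwich[where f = "\<lambda>_. 0" and g = "\<lambda>n. r (D n) x"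
            and h = "\<lambda>n. \<integral>\<^sup>+y. K (x, y) * indicator (D n) y \<partial>M"]) auto
      moreover have "(\<lambda>n. \<Sum>i<n. r (B i) x * indicator (A i) x) \<longlonglongrightarrow> (\<Sum>n. r (B n) x * indicator (A n) x)"
        by (intro summable_LIMSEQ) auto
      ultimately have "(\<lambda>n. r (D n) x + (\<Sum>i<n. r (B i) x * indicator (A i) x)) \<longlonglongrightarrow> 0 + (\<Sum>n. r (B n) x * indicator (A n) x)"
        by (rule tendsto_add)
      then have "(\<lambda>n::nat. r S' x) \<longlonglongrightarrow> (\<Sum>n. r (B n) x * indicator (A n) x)" using eq by simp
      then have "r S' x = (\<Sum>n. r (B n) x * indicator (A n) x)"
        using LIMSEQ_unique tendsto_const by blast
      then show ?thesis using True by simp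
    qed
  qed
qed

text \<open>The mass of a rectangle is well defined because a nonempty rectangle determines its
  sides, while an empty one gets mass 0 by domination. Countable additivity is the preceding
  pointwise identity integrated over x.\<close>

lemma density_of_additive:
  fixes r :: "'a set \<Rightarrow> 'a \<Rightarrow> ennreal" and K :: "'a \<times> 'a \<Rightarrow> ennreal"
  assumes K[measurable]: "K \<in> borel_measurable (M \<Otimes>\<^sub>M M)" and Kfin: "(\<integral>\<^sup>+p. K p \<partial>(M \<Otimes>\<^sub>M M)) \<noteq> \<infinity>"
    and r: "\<And>B. B \<in> sets M \<Longrightarrow> r B \<in> borel_measurable M"
    and add: "\<And>B C. B \<in> sets M \<Longrightarrow> C \<in> sets M \<Longrightarrow> B \<inter> C = {} \<Longrightarrow> AE x in M. r (B \<union> C) x = r B x + r C x"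
    and dom: "\<And>B. B \<in> sets M \<Longrightarrow> AE x in M. r B x \<le> (\<integral>\<^sup>+y. K (x, y) * indicator B y \<partial>M)"
  obtains N where "sets N = sets (M \<Otimes>\<^sub>M M)"
    "\<And>A B. A \<in> sets M \<Longrightarrow> B \<in> sets M \<Longrightarrow> emeasure N (A \<times> B) = (\<integral>\<^sup>+x. r B x * indicator A x \<partial>M)"
proof -
  define \<mu> where "\<mu> A B = (\<integral>\<^sup>+x. r B x * indicator A x \<partial>M)" for A B
  define N where "N = extend_measure (space M \<times> space M) {(A, B). A \<in> sets M \<and> B \<in> sets M} (\<lambda>(A, B). A \<times> B) (\<lambda>(A, B). \<mu> A B)"
  have img: "(\<lambda>(A, B). A \<times> B) ` {(A, B). A \<in> sets M \<and> B \<in> sets M} = {A \<times> B |A B. A \<in> sets M \<and> B \<in> sets M}"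
    by auto
  have sN: "sets N = sets (M \<Otimes>\<^sub>M M)"
    unfolding N_def sets_pair_measure using sets.sets_into_space
    by (subst sets_extend_measure; unfold img) blast+
  have z: "\<mu> A B = 0" if "A \<times> B = {}" "A \<in> sets M" "B \<in> sets M" for A B
  proof (cases "A = {}")
    case False
    then have "B = {}" using that by auto
    then have "AE x in M. r B x = 0" using dom[of "{}"] by simp
    then have "AE x in M. r B x * indicator A x = 0" by eventually_elim simp
    then show ?thesis unfolding \<mu>_def using r[OF that(3)] that(2) by (subst nn_integral_0_iff_AE) auto
  qed (simp add: \<mu>_def)
  have "emeasure N (A \<times> B) = \<mu> A B" if AB: "A \<in> sets M" "B \<in> sets M" for A B
  proof (rule extend_measure_caratheodory_pair[OF N_def])
    show "A \<in> sets M \<and> B \<in> sets M" using AB by simp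
    show "semiring_of_sets (space M \<times> space M) {a \<times> b |a b. a \<in> sets M \<and> b \<in> sets M}"
      by (rule semiring_of_rectangles)
    show "\<mu> i j = \<mu> k l" if "i \<in> sets M \<and> j \<in> sets M" "k \<in> sets M \<and> l \<in> sets M" "i \<times> j = k \<times> l" for i j k l
    proof (cases "i \<times> j = {}")
      case True
      then show ?thesis using z[of i j] z[of k l] that by auto
    next
      case False
      then show ?thesis using that(3) by (auto simp: times_eq_iff)
    qed
  next
    fix A B :: "nat \<Rightarrow> 'a set" and j k
    assume AB: "\<And>n. A n \<in> sets M \<and> B n \<in> sets M" and jk: "j \<in> sets M \<and> k \<in> sets M"
      and disj: "disjoint_family (\<lambda>n. A n \<times> B n)" and un: "(\<Union>i. A i \<times> B i) = j \<times> k"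
    have [measurable]: "r (B n) \<in> borel_measurable M" "A n \<in> sets M" for n using AB r by auto
    have "\<mu> j k = (\<integral>\<^sup>+x. (\<Sum>n. r (B n) x * indicator (A n) x) \<partial>M)"
      unfolding \<mu>_def using AB jk
      by (intro nn_integral_cong_AE additive_dominated_rectangle_sums[OF K Kfin add dom _ _ _ _ disj un]) auto
    also have "\<dots> = (\<Sum>n. \<mu> (A n) (B n))"
      unfolding \<mu>_def by (rule nn_integral_suminf) measurable
    finally show "(\<Sum>n. \<mu> (A n) (B n)) = \<mu> j k" by simp
  qed (use z in auto)
  then show ?thesis using that[OF sN] unfolding \<mu>_def by blast
qed

text \<open>The bound \<open>K\<close> passes from rectangles to densities by complementation:
  \<open>\<kappa> - r\<close> is also additive and dominated, and the two resulting measures add up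
  to the measure with density \<open>K\<close> on rectangles, hence on all measurable sets. Both are
  therefore absolutely continuous, and the identity \<open>K = k + k'\<close> of the densities gives
  \<open>k \<le> K\<close>.\<close>

lemma kernel_of_additive:
  fixes r :: "'a set \<Rightarrow> 'a \<Rightarrow> ennreal" and K :: "'a \<times> 'a \<Rightarrow> ennreal"
  assumes K[measurable]: "K \<in> borel_measurable (M \<Otimes>\<^sub>M M)" and Kfin: "(\<integral>\<^sup>+p. K p \<partial>(M \<Otimes>\<^sub>M M)) \<noteq> \<infinity>"
    and r: "\<And>B. B \<in> sets M \<Longrightarrow> r B \<in> borel_measurable M"
    and add: "\<And>B C. B \<in> sets M \<Longrightarrow> C \<in> sets M \<Longrightarrow> B \<inter> C = {} \<Longrightarrow> AE x in M. r (B \<union> C) x = r B x + r C x"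
    and dom: "\<And>B. B \<in> sets M \<Longrightarrow> AE x in M. r B x \<le> (\<integral>\<^sup>+y. K (x, y) * indicator B y \<partial>M)"
  obtains k where "k \<in> borel_measurable (M \<Otimes>\<^sub>M M)" "AE p in M \<Otimes>\<^sub>M M. k p \<le> K p"
    "\<And>B. B \<in> sets M \<Longrightarrow> AE x in M. r B x = (\<integral>\<^sup>+y. k (x, y) * indicator B y \<partial>M)"
proof -
  interpret P: pair_sigma_finite M M ..
  define \<kappa> where "\<kappa> B x = (\<integral>\<^sup>+y. K (x, y) * indicator B y \<partial>M)" for B x
  define r' where "r' B x = \<kappa> B x - r B x" for B x
  have \<kappa>m: "\<kappa> B \<in> borel_measurable M" if [measurable]: "B \<in> sets M" for B
    unfolding \<kappa>_def by measurable
  have \<kappa>fin: "AE x in M. \<kappa> B x \<noteq> \<infinity>" for B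
  proof -
    have "AE x in M. (\<integral>\<^sup>+y. K (x, y) \<partial>M) \<noteq> \<infinity>"
      using Kfin nn_integral_fst[OF K] by (intro nn_integral_PInf_AE) auto
    then show ?thesis
    proof eventually_elim
      case (elim x)
      have "\<kappa> B x \<le> (\<integral>\<^sup>+y. K (x, y) \<partial>M)" unfolding \<kappa>_def by (intro nn_integral_mono) (auto simp: indicator_def)
      then show ?case using elim by (auto simp: top_unique)
    qed
  qed
  have \<kappa>add: "\<kappa> (B \<union> C) x = \<kappa> B x + \<kappa> C x"
    if [measurable]: "B \<in> sets M" "C \<in> sets M" and d: "B \<inter> C = {}" and x: "x \<in> space M" for B C x
  proof -
    have "\<kappa> (B \<union> C) x = (\<integral>\<^sup>+y. K (x, y) * indicator B y + K (x, y) * indicator C y \<partial>M)"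
      unfolding \<kappa>_def using d by (intro nn_integral_cong) (auto simp: indicator_def)
    also have "\<dots> = \<kappa> B x + \<kappa> C x"
      unfolding \<kappa>_def using x by (intro nn_integral_add) measurable
    finally show ?thesis .
  qed
  have dom\<kappa>: "AE x in M. r B x \<le> \<kappa> B x" if "B \<in> sets M" for B
    using dom[OF that] unfolding \<kappa>_def .
  have r'm: "r' B \<in> borel_measurable M" if "B \<in> sets M" for B
    unfolding r'_def using r[OF that] \<kappa>m[OF that] by measurable
  have r'add: "AE x in M. r' (B \<union> C) x = r' B x + r' C x"
    if BC: "B \<in> sets M" "C \<in> sets M" "B \<inter> C = {}" for B C
    using add[OF BC] dom\<kappa>[OF BC(1)] dom\<kappa>[OF BC(2)] \<kappa>fin[of B] \<kappa>fin[of C] AE_space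
  proof eventually_elim
    case (elim x)
    have "r' B x + r B x = \<kappa> B x" "r' C x + r C x = \<kappa> C x"
      unfolding r'_def using elim by (auto intro: diff_add_cancel_ennreal)
    then have "\<kappa> (B \<union> C) x = (r' B x + r' C x) + (r B x + r C x)"
      using \<kappa>add[OF BC elim(6)] by (metis add.assoc add.left_commute)
    moreover have "r B x + r C x \<noteq> \<infinity>" using elim by (auto simp: top_unique)
    ultimately show ?case unfolding r'_def[of "B \<union> C"] elim(1)
      by (simp add: ennreal_add_diff_cancel_right)
  qed
  have r'dom: "AE x in M. r' B x \<le> (\<integral>\<^sup>+y. K (x, y) * indicator B y \<partial>M)" if "B \<in> sets M" for B
    unfolding r'_def \<kappa>_def[symmetric] by (intro AE_I2) (simp add: diff_le_self_ennreal)
  obtain N where N: "sets N = sets (M \<Otimes>\<^sub>M M)"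
    "\<And>A B. A \<in> sets M \<Longrightarrow> B \<in> sets M \<Longrightarrow> emeasure N (A \<times> B) = (\<integral>\<^sup>+x. r B x * indicator A x \<partial>M)"
    using density_of_additive[OF K Kfin r add dom] by blast
  obtain N' where N': "sets N' = sets (M \<Otimes>\<^sub>M M)"
    "\<And>A B. A \<in> sets M \<Longrightarrow> B \<in> sets M \<Longrightarrow> emeasure N' (A \<times> B) = (\<integral>\<^sup>+x. r' B x * indicator A x \<partial>M)"
    using density_of_additive[OF K Kfin r'm r'add r'dom] by blast
  have K\<kappa>: "(\<integral>\<^sup>+x. \<kappa> B x * indicator A x \<partial>M) = emeasure (density (M \<Otimes>\<^sub>M M) K) (A \<times> B)"
    if "A \<in> sets M" "B \<in> sets M" for A B
    unfolding \<kappa>_def by (rule emeasure_density_Times[OF K that, symmetric])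
  have sum: "emeasure N (A \<times> B) + emeasure N' (A \<times> B) = emeasure (density (M \<Otimes>\<^sub>M M) K) (A \<times> B)"
    if AB: "A \<in> sets M" "B \<in> sets M" for A B
  proof -
    have "emeasure N (A \<times> B) + emeasure N' (A \<times> B) = (\<integral>\<^sup>+x. r B x * indicator A x + r' B x * indicator A x \<partial>M)"
      unfolding N(2)[OF AB] N'(2)[OF AB] using r[OF AB(2)] r'm[OF AB(2)] AB(1)
      by (intro nn_integral_add[symmetric]) auto
    also have "\<dots> = (\<integral>\<^sup>+x. \<kappa> B x * indicator A x \<partial>M)"
      using dom\<kappa>[OF AB(2)]
      by (intro nn_integral_cong_AE, eventually_elim)
        (auto simp: r'_def indicator_def add.commute diff_add_cancel_ennreal)
    finally show ?thesis using K\<kappa>[OF AB] by simp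
  qed
  \<comment> \<open>The sum of the two measures is built as a measure of its own, so that it can be
    compared with the density \<open>K\<close> on the generating rectangles.\<close>
  define L where "L = measure_of (space M \<times> space M) (sets (M \<Otimes>\<^sub>M M)) (\<lambda>X. emeasure N X + emeasure N' X)"
  have sp: "space (M \<Otimes>\<^sub>M M) = space M \<times> space M" by (rule space_pair_measure)
  have sL: "sets L = sets (M \<Otimes>\<^sub>M M)"
    unfolding L_def sp[symmetric] by simp
  have eL: "emeasure L X = emeasure N X + emeasure N' X" if "X \<in> sets (M \<Otimes>\<^sub>M M)" for X
    unfolding L_def
  proof (rule emeasure_measure_of_sigma)
    show "sigma_algebra (space M \<times> space M) (sets (M \<Otimes>\<^sub>M M))"
      unfolding sp[symmetric] by (rule sets.sigma_algebra_axioms)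
    show "positive (sets (M \<Otimes>\<^sub>M M)) (\<lambda>X. emeasure N X + emeasure N' X)" by (simp add: positive_def)
    show "countably_additive (sets (M \<Otimes>\<^sub>M M)) (\<lambda>X. emeasure N X + emeasure N' X)"
    proof (rule countably_additiveI)
      fix A :: "nat \<Rightarrow> ('a \<times> 'a) set"
      assume A: "range A \<subseteq> sets (M \<Otimes>\<^sub>M M)" "disjoint_family A"
      have "(\<Sum>i. emeasure N (A i) + emeasure N' (A i)) = (\<Sum>i. emeasure N (A i)) + (\<Sum>i. emeasure N' (A i))"
        by (rule suminf_add[symmetric]) auto
      then show "(\<Sum>i. emeasure N (A i) + emeasure N' (A i)) = emeasure N (\<Union>i. A i) + emeasure N' (\<Union>i. A i)"
        using A N(1) N'(1) suminf_emeasure[of A N] suminf_emeasure[of A N'] by simp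
    qed
    show "X \<in> sets (M \<Otimes>\<^sub>M M)" by (rule that)
  qed
  have dK: "emeasure (density (M \<Otimes>\<^sub>M M) K) (space M \<times> space M) = (\<integral>\<^sup>+p. K p \<partial>(M \<Otimes>\<^sub>M M))"
    by (subst emeasure_density) (auto simp: space_pair_measure intro!: nn_integral_cong)
  have "density (M \<Otimes>\<^sub>M M) K = L"
  proof (rule measure_eqI_generator_eq[OF Int_stable_pair_measure_generator[of M M], where A = "\<lambda>_. space M \<times> space M"])
    show "{a \<times> b |a b. a \<in> sets M \<and> b \<in> sets M} \<subseteq> Pow (space M \<times> space M)"
      using sets.sets_into_space by blast
    show "sets (density (M \<Otimes>\<^sub>M M) K) = sigma_sets (space M \<times> space M) {a \<times> b |a b. a \<in> sets M \<and> b \<in> sets M}"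
      "sets L = sigma_sets (space M \<times> space M) {a \<times> b |a b. a \<in> sets M \<and> b \<in> sets M}"
      unfolding sL by (auto simp: sets_pair_measure)
    show "range (\<lambda>_. space M \<times> space M) \<subseteq> {a \<times> b |a b. a \<in> sets M \<and> b \<in> sets M}" by blast
    show "emeasure (density (M \<Otimes>\<^sub>M M) K) X = emeasure L X" if "X \<in> {a \<times> b |a b. a \<in> sets M \<and> b \<in> sets M}" for X
      using that by (auto simp: eL sum)
    show "emeasure (density (M \<Otimes>\<^sub>M M) K) (space M \<times> space M) \<noteq> \<infinity>" for i :: nat
      using Kfin dK by simp
  qed simp
  then have tot: "emeasure (density (M \<Otimes>\<^sub>M M) K) X = emeasure N X + emeasure N' X" if "X \<in> sets (M \<Otimes>\<^sub>M M)" for X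
    using eL[OF that] by simp
  have null: "X \<in> null_sets N \<and> X \<in> null_sets N'" if X: "X \<in> null_sets (M \<Otimes>\<^sub>M M)" for X
  proof -
    have "absolutely_continuous (M \<Otimes>\<^sub>M M) (density (M \<Otimes>\<^sub>M M) K)"
      by (rule absolutely_continuousI_density[OF K])
    then have "X \<in> null_sets (density (M \<Otimes>\<^sub>M M) K)" using X unfolding absolutely_continuous_def by blast
    then have "emeasure N X + emeasure N' X = 0" using tot[of X] null_setsD2[OF X] by (metis null_setsD1)
    then show ?thesis using null_setsD2[OF X] N(1) N'(1) by (auto intro!: null_setsI)
  qed
  obtain k where k[measurable]: "k \<in> borel_measurable (M \<Otimes>\<^sub>M M)" and kN: "density (M \<Otimes>\<^sub>M M) k = N"
    using P.P.Radon_Nikodym[of N] N(1) null unfolding absolutely_continuous_def by blast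
  obtain k' where k'[measurable]: "k' \<in> borel_measurable (M \<Otimes>\<^sub>M M)" and k'N: "density (M \<Otimes>\<^sub>M M) k' = N'"
    using P.P.Radon_Nikodym[of N'] N'(1) null unfolding absolutely_continuous_def by blast
  have "AE p in M \<Otimes>\<^sub>M M. K p = k p + k' p"
  proof (rule density_eq_on_rectangles[OF K _ Kfin])
    fix A B assume AB: "A \<in> sets M" "B \<in> sets M"
    then have X: "A \<times> B \<in> sets (M \<Otimes>\<^sub>M M)" by simp
    have "emeasure (density (M \<Otimes>\<^sub>M M) (\<lambda>p. k p + k' p)) (A \<times> B) = emeasure N (A \<times> B) + emeasure N' (A \<times> B)"
      unfolding kN[symmetric] k'N[symmetric] using X
      by (subst (1 2 3) emeasure_density) (auto simp: distrib_right nn_integral_add)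
    then show "emeasure (density (M \<Otimes>\<^sub>M M) K) (A \<times> B) = emeasure (density (M \<Otimes>\<^sub>M M) (\<lambda>p. k p + k' p)) (A \<times> B)"
      using sum[OF AB] by simp
  qed measurable
  then have "AE p in M \<Otimes>\<^sub>M M. k p \<le> K p" by eventually_elim simp
  moreover have "AE x in M. r B x = (\<integral>\<^sup>+y. k (x, y) * indicator B y \<partial>M)" if B[measurable]: "B \<in> sets M" for B
  proof -
    define q where "q x = (\<integral>\<^sup>+y. k (x, y) * indicator B y \<partial>M)" for x
    have [measurable]: "q \<in> borel_measurable M" unfolding q_def by measurable
    have "density M (r B) = density M q"
    proof (rule measure_eqI)
      fix A assume "A \<in> sets (density M (r B))"
      then have A[measurable]: "A \<in> sets M" by simp
      have "emeasure (density M (r B)) A = emeasure N (A \<times> B)"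
        using r[OF B] by (simp add: emeasure_density N(2))
      also have "\<dots> = (\<integral>\<^sup>+x. q x * indicator A x \<partial>M)"
        unfolding kN[symmetric] q_def by (rule emeasure_density_Times[OF k A B])
      finally show "emeasure (density M (r B)) A = emeasure (density M q) A" by (simp add: emeasure_density)
    qed simp
    then show ?thesis using density_unique_iff[OF r[OF B], of q] unfolding q_def[abs_def] by simp
  qed
  ultimately show ?thesis using that k by blast
qed

end

section \<open>Positive operators tested on weighted indicators\<close>

locale weighted_measure = sigma_finite_measure m for m :: "'a measure" +
  fixes w :: "'a \<Rightarrow> real"
  assumes w_measurable[measurable]: "w \<in> borel_measurable m"
    and w_pos: "0 < w x" and w_le_1: "w x \<le> 1" and w_integrable: "integrable m w"
begin

lemma w_nonneg [simp]: "0 \<le> w x" using w_pos[of x] by simp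

lemma w_sq_le: "(w x)\<^sup>2 \<le> w x"
  using mult_left_mono[OF w_le_1[of x] w_nonneg] by (simp add: power2_eq_square)

lemma w_L2: "w \<in> Lp 2 m"
  unfolding Lp_2_iff using w_sq_le
  by (auto intro!: Bochner_Integration.integrable_bound[OF w_integrable])

lemma w_ind_L2: "A \<in> sets m \<Longrightarrow> (\<lambda>y. w y * indicator A y) \<in> Lp 2 m"
  by (rule L2_mono(1)[OF w_L2]) (auto simp: indicator_def)

lemma positive_operator_w_ind_Un:
  assumes B: "positive_operator_L2 m B" and A: "A \<in> sets m" "C \<in> sets m" "A \<inter> C = {}"
  shows "AE x in m. B (\<lambda>y. w y * indicator (A \<union> C) y) x =
    B (\<lambda>y. w y * indicator A y) x + B (\<lambda>y. w y * indicator C y) x"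
proof -
  have "(\<lambda>y. w y * indicator (A \<union> C) y) = (\<lambda>y. w y * indicator A y + w y * indicator C y)"
    using A(3) by (auto simp: indicator_add[symmetric] distrib_left)
  then show ?thesis
    using positive_operator_L2D(3)[OF B w_ind_L2[OF A(1)] w_ind_L2[OF A(2)]] by simp
qed

text \<open>Each nonnegative u in L_2 has the form w \<phi> with \<phi> \<ge> 0, so induction on
  \<phi> through indicators, multiples, sums and increasing limits suffices. The limit step rests on
  the monotone continuity of positive operators.\<close>

lemma kernel_extends_from_weight:
  assumes B: "positive_operator_L2 m B" and k[measurable]: "k \<in> borel_measurable (m \<Otimes>\<^sub>M m)"
    and rep: "\<And>A. A \<in> sets m \<Longrightarrow> AE x in m. ennreal (B (\<lambda>y. w y * indicator A y) x) =
      (\<integral>\<^sup>+y. k (x, y) * ennreal (w y * indicator A y) \<partial>m)"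
    and u: "u \<in> Lp 2 m" and u0: "\<And>x. 0 \<le> u x"
  shows "AE x in m. ennreal (B u x) = (\<integral>\<^sup>+y. k (x, y) * ennreal (u y) \<partial>m)"
proof -
  have [measurable]: "u \<in> borel_measurable m" by (rule L2_measurable[OF u])
  define \<phi> where "\<phi> x = u x / w x" for x
  have \<phi>: "\<phi> \<in> borel_measurable m" "\<And>x. 0 \<le> \<phi> x" unfolding \<phi>_def using u0 by auto
  have w\<phi>: "(\<lambda>x. w x * \<phi> x) = u" unfolding \<phi>_def using w_pos by (auto simp: less_imp_neq[symmetric])
  \<comment> \<open>The induction ranges over all nonnegative measurable \<phi>, so membership of w
    \<phi> in L_2 is carried along as a premise.\<close>
  have "(\<lambda>x. w x * \<phi> x) \<in> Lp 2 m \<longrightarrow> (AE x in m. ennreal (B (\<lambda>x. w x * \<phi> x) x) = (\<integral>\<^sup>+y. k (x, y) * ennreal (w y * \<phi> y) \<partial>m))"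
    using \<phi>
  proof (induction \<phi> rule: borel_measurable_induct_real)
    case (set A)
    then show ?case using rep by blast
  next
    case (mult \<phi> c)
    note [measurable] = mult(2)
    show ?case
    proof (intro impI)
      assume a: "(\<lambda>x. w x * (c * \<phi> x)) \<in> Lp 2 m"
      \<comment> \<open>For c = 0 the premise says nothing about \<open>\<phi>\<close>, so the
        induction hypothesis is out of reach; both sides vanish directly.\<close>
      show "AE x in m. ennreal (B (\<lambda>x. w x * (c * \<phi> x)) x) = (\<integral>\<^sup>+y. k (x, y) * ennreal (w y * (c * \<phi> y)) \<partial>m)"
      proof (cases "c = 0")
        case True
        have "AE x in m. B (\<lambda>x. 0 * 0) x = 0 * B (\<lambda>x. 0) x"
          by (rule positive_operator_L2D(4)[OF B L2_zero])
        then show ?thesis unfolding True by eventually_elim simp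
      next
        case False
        then have c: "0 < c" using mult(1) by simp
        have "(\<lambda>x. (1 / c) * (w x * (c * \<phi> x))) \<in> Lp 2 m" by (rule L2_cmult(1)[OF a])
        then have p: "(\<lambda>x. w x * \<phi> x) \<in> Lp 2 m" using c by simp
        have "AE x in m. B (\<lambda>x. c * (w x * \<phi> x)) x = c * B (\<lambda>x. w x * \<phi> x) x"
          by (rule positive_operator_L2D(4)[OF B p])
        with mult(4) p have "AE x in m. B (\<lambda>x. c * (w x * \<phi> x)) x = c * B (\<lambda>x. w x * \<phi> x) x \<and>
            ennreal (B (\<lambda>x. w x * \<phi> x) x) = (\<integral>\<^sup>+y. k (x, y) * ennreal (w y * \<phi> y) \<partial>m)"
          by auto
        then show ?thesis
          using AE_space
        proof eventually_elim
          case (elim x)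
          have "(\<integral>\<^sup>+y. k (x, y) * ennreal (w y * (c * \<phi> y)) \<partial>m) = (\<integral>\<^sup>+y. ennreal c * (k (x, y) * ennreal (w y * \<phi> y)) \<partial>m)"
            using c mult(3) by (intro nn_integral_cong) (simp add: ennreal_mult mult_ac)
          also have "\<dots> = ennreal c * ennreal (B (\<lambda>x. w x * \<phi> x) x)"
            using elim by (subst nn_integral_cmult) auto
          also have "\<dots> = ennreal (c * B (\<lambda>x. w x * \<phi> x) x)"
            using c by (simp add: ennreal_mult')
          finally show ?case using elim by (simp add: mult.left_commute)
        qed
      qed
    qed
  next
    case (add \<phi> \<psi>)
    note [measurable] = add.hyps(1,3)
    show ?case
    proof (intro impI)
      assume a: "(\<lambda>x. w x * (\<psi> x + \<phi> x)) \<in> Lp 2 m"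
      have p: "(\<lambda>x. w x * \<phi> x) \<in> Lp 2 m" "(\<lambda>x. w x * \<psi> x) \<in> Lp 2 m"
        using add.hyps(2,4) by (auto intro!: L2_mono(1)[OF a] AE_I2 mult_left_mono simp: abs_mult)
      have "AE x in m. B (\<lambda>x. w x * \<psi> x + w x * \<phi> x) x = B (\<lambda>x. w x * \<psi> x) x + B (\<lambda>x. w x * \<phi> x) x"
        by (rule positive_operator_L2D(3)[OF B p(2,1)])
      moreover have "AE x in m. ennreal (B (\<lambda>x. w x * \<phi> x) x) = (\<integral>\<^sup>+y. k (x, y) * ennreal (w y * \<phi> y) \<partial>m)"
        "AE x in m. ennreal (B (\<lambda>x. w x * \<psi> x) x) = (\<integral>\<^sup>+y. k (x, y) * ennreal (w y * \<psi> y) \<partial>m)"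
        using add.IH p by blast+
      moreover have "AE x in m. 0 \<le> B (\<lambda>x. w x * \<phi> x) x" "AE x in m. 0 \<le> B (\<lambda>x. w x * \<psi> x) x"
        using add.hyps(2,4) by (auto intro!: positive_operator_L2D(5)[OF B] p)
      ultimately show "AE x in m. ennreal (B (\<lambda>x. w x * (\<psi> x + \<phi> x)) x) = (\<integral>\<^sup>+y. k (x, y) * ennreal (w y * (\<psi> y + \<phi> y)) \<partial>m)"
        using AE_space
      proof eventually_elim
        case (elim x)
        have "(\<integral>\<^sup>+y. k (x, y) * ennreal (w y * (\<psi> y + \<phi> y)) \<partial>m) =
            (\<integral>\<^sup>+y. k (x, y) * ennreal (w y * \<psi> y) + k (x, y) * ennreal (w y * \<phi> y) \<partial>m)"
          using add.hyps(2,4) by (intro nn_integral_cong) (simp add: distrib_left)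
        also have "\<dots> = (\<integral>\<^sup>+y. k (x, y) * ennreal (w y * \<psi> y) \<partial>m) + (\<integral>\<^sup>+y. k (x, y) * ennreal (w y * \<phi> y) \<partial>m)"
          using elim(6) by (intro nn_integral_add) auto
        finally show ?case using elim by (simp add: distrib_left)
      qed
    qed
  next
    case (seq V)
    note [measurable] = seq(1)
    show ?case
    proof (intro impI)
      assume a: "(\<lambda>x. w x * \<phi> x) \<in> Lp 2 m"
      have inc: "V n x \<le> V (Suc n) x" for n x
        using seq.hyps(3) by (auto simp: incseq_def le_fun_def)
      have lim: "(\<lambda>n. w x * V n x) \<longlonglongrightarrow> w x * \<phi> x" if "x \<in> space m" for x
        by (intro tendsto_mult_left seq.hyps(4) that)
      have le: "V n x \<le> \<phi> x" if "x \<in> space m" for n x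
        using incseq_le[OF _ seq.hyps(4)[OF that], of n] inc by (auto intro: incseq_SucI)
      have p: "(\<lambda>x. w x * V n x) \<in> Lp 2 m" for n
      proof (rule L2_mono(1)[OF a])
        show "AE x in m. \<bar>w x * V n x\<bar> \<le> \<bar>w x * \<phi> x\<bar>"
          using seq(2) \<phi>(2) le by (intro AE_I2) (auto simp: abs_mult intro!: mult_left_mono)
      qed simp
      have "AE x in m. (\<forall>n. 0 \<le> B (\<lambda>x. w x * V n x) x \<and> B (\<lambda>x. w x * V n x) x \<le> B (\<lambda>x. w x * V (Suc n) x) x \<and>
          B (\<lambda>x. w x * V n x) x \<le> B (\<lambda>x. w x * \<phi> x) x) \<and> (\<lambda>n. B (\<lambda>x. w x * V n x) x) \<longlonglongrightarrow> B (\<lambda>x. w x * \<phi> x) x"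
        using seq(2) inc lim
        by (intro positive_operator_L2_monotone_limit[OF B a]) (auto intro!: mult_left_mono)
      moreover have "AE x in m. \<forall>n. ennreal (B (\<lambda>x. w x * V n x) x) = (\<integral>\<^sup>+y. k (x, y) * ennreal (w y * V n y) \<partial>m)"
        unfolding AE_all_countable using seq.IH p by blast
      ultimately show "AE x in m. ennreal (B (\<lambda>x. w x * \<phi> x) x) = (\<integral>\<^sup>+y. k (x, y) * ennreal (w y * \<phi> y) \<partial>m)"
        using AE_space
      proof eventually_elim
        case (elim x)
        have "(\<integral>\<^sup>+y. k (x, y) * ennreal (w y * \<phi> y) \<partial>m) = (\<integral>\<^sup>+y. (SUP n. k (x, y) * ennreal (w y * V n y)) \<partial>m)"
        proof (rule nn_integral_cong)
          fix y assume y: "y \<in> space m"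
          have "incseq (\<lambda>n. ennreal (w y * V n y))"
            using inc by (intro incseq_SucI ennreal_leI mult_left_mono) auto
          then have "(\<lambda>n. ennreal (w y * V n y)) \<longlonglongrightarrow> (SUP n. ennreal (w y * V n y))" by (rule LIMSEQ_SUP)
          moreover have "(\<lambda>n. ennreal (w y * V n y)) \<longlonglongrightarrow> ennreal (w y * \<phi> y)"
            using lim[OF y] by (rule tendsto_ennrealI)
          ultimately have "(SUP n. ennreal (w y * V n y)) = ennreal (w y * \<phi> y)" by (rule LIMSEQ_unique)
          then show "k (x, y) * ennreal (w y * \<phi> y) = (SUP n. k (x, y) * ennreal (w y * V n y))"
            by (simp add: SUP_mult_left_ennreal[symmetric])
        qed
        also have "\<dots> = (SUP n. \<integral>\<^sup>+y. k (x, y) * ennreal (w y * V n y) \<partial>m)"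
        proof (rule nn_integral_monotone_convergence_SUP)
          show "incseq (\<lambda>n y. k (x, y) * ennreal (w y * V n y))"
            using inc by (intro incseq_SucI le_funI mult_left_mono ennreal_leI) auto
        qed (use elim(3) in measurable)
        also have "\<dots> = (SUP n. ennreal (B (\<lambda>x. w x * V n x) x))" using elim(2) by simp
        finally have e: "(\<integral>\<^sup>+y. k (x, y) * ennreal (w y * \<phi> y) \<partial>m) = (SUP n. ennreal (B (\<lambda>x. w x * V n x) x))" .
        have l1: "(\<lambda>n. ennreal (B (\<lambda>x. w x * V n x) x)) \<longlonglongrightarrow> (SUP n. ennreal (B (\<lambda>x. w x * V n x) x))"
          using elim(1) by (intro LIMSEQ_SUP incseq_SucI ennreal_leI) auto
        have l2: "(\<lambda>n. ennreal (B (\<lambda>x. w x * V n x) x)) \<longlonglongrightarrow> ennreal (B (\<lambda>x. w x * \<phi> x) x)"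
          using elim(1) by (intro tendsto_ennrealI) auto
        show ?case unfolding e by (rule LIMSEQ_unique[OF l2 l1])
      qed
    qed
  qed
  then show ?thesis
    using u unfolding w\<phi> by (simp add: w\<phi>[THEN fun_cong])
qed

text \<open>Positivity of B makes the integral over a set A nonnegative only off a null set
  depending on A, and there may be uncountably many sets. So B, scaled by \<open>\<alpha>\<close>,
  is given a nonnegative kernel \<open>k\<close>, and uniqueness of densities yields
  \<open>K1 = k + K2\<close> with the positive part \<open>K1\<close> and the negative part
  \<open>K2\<close> of the given kernel. Where the kernel is negative, \<open>K1\<close> is 0 and
  \<open>K2\<close> is positive, a contradiction.\<close>

lemma kernel_nonneg:
  assumes B: "positive_operator_L2 m B" and \<kappa>[measurable]: "\<kappa> \<in> borel_measurable (m \<Otimes>\<^sub>M m)"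
    and rep: "\<And>A. A \<in> sets m \<Longrightarrow> AE x in m. integrable m (\<lambda>y. \<kappa> (x, y) * (w y * indicator A y)) \<and>
      B (\<lambda>y. w y * indicator A y) x = (LINT y|m. \<kappa> (x, y) * (w y * indicator A y))"
  shows "AE p in m \<Otimes>\<^sub>M m. 0 \<le> (\<kappa> p :: real)"
proof -
  interpret P: pair_sigma_finite m m ..
  define g where "g x = (\<integral>\<^sup>+y. ennreal (\<bar>\<kappa> (x, y)\<bar> * w y) \<partial>m)" for x
  have gm[measurable]: "g \<in> borel_measurable m" unfolding g_def by measurable
  have gf: "AE x in m. g x < \<infinity>"
    using rep[OF sets.top] AE_space
  proof eventually_elim
    case (elim x)
    have "g x = (\<integral>\<^sup>+y. ennreal (norm (\<kappa> (x, y) * (w y * indicator (space m) y))) \<partial>m)"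
      unfolding g_def by (intro nn_integral_cong) (simp add: abs_mult)
    then show ?case using elim by (simp add: integrable_iff_bounded)
  qed
  \<comment> \<open>This scaling makes \<open>K\<close> integrable: its integral over y is
    \<open>\<alpha> x * g x\<close>, which is at most \<open>w x\<close>.\<close>
  define \<alpha> where "\<alpha> x = w x / (1 + enn2real (g x))" for x
  have [measurable]: "\<alpha> \<in> borel_measurable m" unfolding \<alpha>_def by measurable
  have \<alpha>: "0 < \<alpha> x" for x unfolding \<alpha>_def using w_pos[of x] by (simp add: add_pos_nonneg)
  define K where "K p = ennreal (\<alpha> (fst p) * (\<bar>\<kappa> p\<bar> * w (snd p)))" for p
  \<comment> \<open>\<open>ennreal\<close> sends negative numbers to 0, so \<open>K1\<close> and
    \<open>K2\<close> are the weighted positive and negative parts.\<close>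
  define K1 where "K1 p = ennreal (\<alpha> (fst p) * (\<kappa> p * w (snd p)))" for p
  define K2 where "K2 p = ennreal (\<alpha> (fst p) * (- \<kappa> p * w (snd p)))" for p
  have [measurable]: "K \<in> borel_measurable (m \<Otimes>\<^sub>M m)" "K1 \<in> borel_measurable (m \<Otimes>\<^sub>M m)" "K2 \<in> borel_measurable (m \<Otimes>\<^sub>M m)"
    unfolding K_def K1_def K2_def by measurable
  have "(\<integral>\<^sup>+p. K p \<partial>(m \<Otimes>\<^sub>M m)) = (\<integral>\<^sup>+x. \<integral>\<^sup>+y. K (x, y) \<partial>m \<partial>m)" by (rule nn_integral_fst[symmetric]) measurable
  also have "\<dots> = (\<integral>\<^sup>+x. ennreal (\<alpha> x) * g x \<partial>m)"
    unfolding K_def g_def using \<alpha> by (intro nn_integral_cong) (simp add: ennreal_mult less_imp_le nn_integral_cmult)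
  also have "\<dots> \<le> (\<integral>\<^sup>+x. ennreal (w x) \<partial>m)"
    using gf
  proof (intro nn_integral_mono_AE, eventually_elim)
    case (elim x)
    then have "ennreal (\<alpha> x) * g x = ennreal (\<alpha> x * enn2real (g x))"
      using \<alpha>[of x] by (simp add: ennreal_mult less_imp_le)
    also have "\<dots> \<le> ennreal (w x)"
      unfolding \<alpha>_def using w_nonneg[of x] by (intro ennreal_leI) (simp add: field_simps add_pos_nonneg)
    finally show ?case .
  qed
  also have "\<dots> < \<infinity>" using w_integrable by (simp add: nn_integral_eq_integral)
  finally have Kfin: "(\<integral>\<^sup>+p. K p \<partial>(m \<Otimes>\<^sub>M m)) \<noteq> \<infinity>" by simp
  define b where "b A = B (\<lambda>y. w y * indicator A y)" for A
  have bm[measurable]: "b A \<in> borel_measurable m" if "A \<in> sets m" for A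
    unfolding b_def by (intro L2_measurable positive_operator_L2D(1)[OF B] w_ind_L2 that)
  have b0: "AE x in m. 0 \<le> b A x" if "A \<in> sets m" for A
    unfolding b_def by (intro positive_operator_L2D(5)[OF B] w_ind_L2 that) simp
  define r where "r A x = ennreal (\<alpha> x * b A x)" for A x
  have rm: "r A \<in> borel_measurable m" if "A \<in> sets m" for A unfolding r_def using bm[OF that] by measurable
  have radd: "AE x in m. r (A \<union> C) x = r A x + r C x" if AC: "A \<in> sets m" "C \<in> sets m" "A \<inter> C = {}" for A C
  proof -
    have "AE x in m. b (A \<union> C) x = b A x + b C x"
      unfolding b_def by (rule positive_operator_w_ind_Un[OF B AC])
    with b0[OF AC(1)] b0[OF AC(2)] show ?thesis
      by eventually_elim (use \<alpha> in \<open>simp add: r_def distrib_left less_imp_le\<close>)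
  qed
  have split: "AE x in m. r A x + (\<integral>\<^sup>+y. K2 (x, y) * indicator A y \<partial>m) = (\<integral>\<^sup>+y. K1 (x, y) * indicator A y \<partial>m)"
    if A[measurable]: "A \<in> sets m" for A
    using rep[OF A] b0[OF A] AE_space
  proof eventually_elim
    case (elim x)
    define h where "h y = \<alpha> x * (\<kappa> (x, y) * (w y * indicator A y))" for y
    have hi: "integrable m h" unfolding h_def using elim(1) by simp
    have bh: "\<alpha> x * b A x = (LINT y|m. h y)" unfolding h_def b_def using elim(1) by simp
    have e1: "(\<integral>\<^sup>+y. K1 (x, y) * indicator A y \<partial>m) = (\<integral>\<^sup>+y. ennreal (h y) \<partial>m)"
      unfolding K1_def h_def by (intro nn_integral_cong) (auto simp: indicator_def)
    have e2: "(\<integral>\<^sup>+y. K2 (x, y) * indicator A y \<partial>m) = (\<integral>\<^sup>+y. ennreal (- h y) \<partial>m)"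
      unfolding K2_def h_def by (intro nn_integral_cong) (auto simp: indicator_def)
    define p where "p = enn2real (\<integral>\<^sup>+y. ennreal (h y) \<partial>m)"
    define q where "q = enn2real (\<integral>\<^sup>+y. ennreal (- h y) \<partial>m)"
    have "(\<integral>\<^sup>+y. ennreal (h y) \<partial>m) < \<infinity>" "(\<integral>\<^sup>+y. ennreal (- h y) \<partial>m) < \<infinity>"
      using real_integrable_def[of m h] hi by (auto simp: less_top)
    then have pq: "(\<integral>\<^sup>+y. ennreal (h y) \<partial>m) = ennreal p" "(\<integral>\<^sup>+y. ennreal (- h y) \<partial>m) = ennreal q" "0 \<le> p" "0 \<le> q"
      unfolding p_def q_def by auto
    have "(LINT y|m. h y) = p - q"
      unfolding p_def q_def by (rule real_lebesgue_integral_def[OF hi])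
    then have "\<alpha> x * b A x + q = p" using bh by simp
    moreover have "0 \<le> \<alpha> x * b A x" using \<alpha>[of x] elim(2) by simp
    ultimately show ?case unfolding e1 e2 pq(1,2) r_def using pq by (simp add: ennreal_plus[symmetric])
  qed
  have rdom: "AE x in m. r A x \<le> (\<integral>\<^sup>+y. K (x, y) * indicator A y \<partial>m)" if A[measurable]: "A \<in> sets m" for A
    using split[OF A]
  proof eventually_elim
    case (elim x)
    have "r A x \<le> (\<integral>\<^sup>+y. K1 (x, y) * indicator A y \<partial>m)" using elim by (metis add.commute add.right_neutral add_left_mono zero_le)
    also have "\<dots> \<le> (\<integral>\<^sup>+y. K (x, y) * indicator A y \<partial>m)"
      unfolding K1_def K_def using \<alpha>[of x]
      by (intro nn_integral_mono mult_right_mono ennreal_leI mult_left_mono) auto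
    finally show ?case .
  qed
  obtain k where k[measurable]: "k \<in> borel_measurable (m \<Otimes>\<^sub>M m)" "AE p in m \<Otimes>\<^sub>M m. k p \<le> K p"
    "\<And>A. A \<in> sets m \<Longrightarrow> AE x in m. r A x = (\<integral>\<^sup>+y. k (x, y) * indicator A y \<partial>m)"
    by (rule kernel_of_additive[OF _ Kfin rm radd rdom]) (auto intro: that)
  have "AE p in m \<Otimes>\<^sub>M m. K1 p = k p + K2 p"
  proof (rule density_eq_on_rectangles)
    have "(\<integral>\<^sup>+p. K1 p \<partial>(m \<Otimes>\<^sub>M m)) \<le> (\<integral>\<^sup>+p. K p \<partial>(m \<Otimes>\<^sub>M m))"
      unfolding K1_def K_def using \<alpha> by (intro nn_integral_mono ennreal_leI mult_left_mono mult_right_mono) (auto simp: less_imp_le)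
    then show "(\<integral>\<^sup>+p. K1 p \<partial>(m \<Otimes>\<^sub>M m)) \<noteq> \<infinity>" using Kfin by (auto simp: top_unique)
    fix A C assume [measurable]: "A \<in> sets m" "C \<in> sets m"
    show "emeasure (density (m \<Otimes>\<^sub>M m) K1) (A \<times> C) = emeasure (density (m \<Otimes>\<^sub>M m) (\<lambda>p. k p + K2 p)) (A \<times> C)"
    proof (subst (1 2) emeasure_density_Times)
      have "AE x in m. (\<integral>\<^sup>+y. K1 (x, y) * indicator C y \<partial>m) = (\<integral>\<^sup>+y. (k (x, y) + K2 (x, y)) * indicator C y \<partial>m)"
        using split[OF \<open>C \<in> sets m\<close>] k(3)[OF \<open>C \<in> sets m\<close>] AE_space
      proof eventually_elim
        case (elim x)
        have "(\<integral>\<^sup>+y. (k (x, y) + K2 (x, y)) * indicator C y \<partial>m) = (\<integral>\<^sup>+y. k (x, y) * indicator C y \<partial>m) + (\<integral>\<^sup>+y. K2 (x, y) * indicator C y \<partial>m)"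
          unfolding distrib_right using elim(3) by (intro nn_integral_add) auto
        then show ?case using elim by simp
      qed
      then show "(\<integral>\<^sup>+x. (\<integral>\<^sup>+y. K1 (x, y) * indicator C y \<partial>m) * indicator A x \<partial>m) =
          (\<integral>\<^sup>+x. (\<integral>\<^sup>+y. (k (x, y) + K2 (x, y)) * indicator C y \<partial>m) * indicator A x \<partial>m)"
        by (intro nn_integral_cong_AE) auto
    qed auto
  qed auto
  then show ?thesis
  proof eventually_elim
    case (elim p)
    show ?case
    proof (rule ccontr)
      assume "\<not> 0 \<le> \<kappa> p"
      then have n: "\<kappa> p < 0" by simp
      then have "0 < \<alpha> (fst p) * (- \<kappa> p * w (snd p))"
        by (intro mult_pos_pos \<alpha> w_pos) simp
      then have "0 < K2 p" unfolding K2_def by (simp add: ennreal_less_zero_iff)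
      moreover have "\<alpha> (fst p) * (\<kappa> p * w (snd p)) \<le> 0"
        using n \<alpha>[of "fst p"] by (intro mult_nonneg_nonpos mult_nonpos_nonneg) (auto simp: less_imp_le)
      then have "K1 p = 0" unfolding K1_def by (rule ennreal_neg)
      ultimately show False using elim by auto
    qed
  qed
qed

end

section \<open>A comparison argument for functions of two real variables\<close>

text \<open>The window integral is a difference of two values of a primitive. The primitive starts
  at a - 1, so that \<open>a\<close> is an interior point of its domain.\<close>

lemma window_integral_has_derivative:
  fixes j :: "real \<Rightarrow> real"
  assumes j: "continuous_on UNIV j" and h: "0 \<le> h"
  shows "((\<lambda>a. integral {0..h} (\<lambda>x. j (a + x))) has_real_derivative (j (a + h) - j a)) (at a)"
proof -
  have jc: "continuous_on A j" for A using j by (rule continuous_on_subset) auto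
  have ji: "j integrable_on {c..d}" for c d by (rule integrable_continuous_real[OF jc])
  define F where "F u = integral {a - 1..u} j" for u
  have F: "(F has_real_derivative j u) (at u)" if u: "a - 1 < u" for u
  proof -
    have "(F has_vector_derivative j u) (at u within {a - 1..u + 1})"
      unfolding F_def using u by (intro integral_has_vector_derivative jc) auto
    moreover have "at u within {a - 1..u + 1} = at u"
      using u by (intro at_within_interior) auto
    ultimately show ?thesis by (simp add: has_real_derivative_iff_has_vector_derivative)
  qed
  have eq: "integral {0..h} (\<lambda>x. j (u + x)) = F (u + h) - F u" if "a - 1 < u" for u
  proof -
    have "integral {0..h} (j \<circ> (\<lambda>x. x + u)) = integral {0 + u..h + u} j"
      by (rule integral_shift[OF jc])
    moreover have "integral {a - 1..u} j + integral {u..u + h} j = integral {a - 1..u + h} j"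
      using that h by (intro Henstock_Kurzweil_Integration.integral_combine ji) auto
    ultimately show ?thesis unfolding F_def by (simp add: o_def add.commute)
  qed
  have "((\<lambda>u. F (u + h) - F u) has_real_derivative (j (a + h) - j a)) (at a)"
  proof -
    have "((\<lambda>u. F (u + h)) has_real_derivative j (a + h)) (at a)"
      using F[of "a + h"] h by (intro DERIV_shift[THEN iffD1]) auto
    then show ?thesis using F[of a] by (intro DERIV_diff) auto
  qed
  then show ?thesis
    by (rule has_field_derivative_transform_within_open[of _ _ _ "{a - 1<..}"]) (auto simp: eq)
qed

text \<open>\<open>G\<close> is merely continuous, but its integral \<open>Q\<close> over a square
  of side h is differentiable, and \<open>step\<close> says that along a + b = t the derivative of
  \<open>Q\<close> plus h C(h) times a window integral of \<Gamma> is nonnegative. Only increments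
  of \<Gamma> occur, so continuity of \<Gamma> suffices. Dividing by h^2 and letting h tend to 0
  gives the claim.\<close>

lemma window_comparison:
  fixes G :: "real \<times> real \<Rightarrow> real" and \<Gamma> C :: "real \<Rightarrow> real"
  assumes G: "continuous_on UNIV G" and \<Gamma>: "continuous_on UNIV \<Gamma>" "mono \<Gamma>" "\<And>x. 0 \<le> \<Gamma> x"
    and t: "0 < t" and C: "(C \<longlongrightarrow> c) (at_right 0)" "\<And>h. 0 \<le> C h"
    and step: "\<And>h s. 0 < h \<Longrightarrow> h < 1 \<Longrightarrow> 0 < s \<Longrightarrow> s < t \<Longrightarrow>
      integral {0..h} (\<lambda>y. G (t - s + h, s + y)) - integral {0..h} (\<lambda>y. G (t - s, s + y)) \<le>
      integral {0..h} (\<lambda>x. G (t - s + x, s + h)) - integral {0..h} (\<lambda>x. G (t - s + x, s)) +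
      h * C h * (\<Gamma> (s + h) - \<Gamma> s)"
  shows "G (t, 0) \<le> G (0, t) + c * \<Gamma> t"
proof -
  have Gc: "continuous_on A (\<lambda>x. G (f x, g x))" if "continuous_on A f" "continuous_on A g" for A :: "'z::topological_space set" and f g
    by (rule continuous_on_compose2[OF G]) (use that in \<open>auto intro!: continuous_intros\<close>)
  define J where "J h b q = integral {0..h} (\<lambda>y. G (q, b + y))" for h b q
  define L where "L h a r = integral {0..h} (\<lambda>x. G (a + x, r))" for h a r
  define Q where "Q h a b = integral {0..h} (\<lambda>x. J h b (a + x))" for h a b
  have Jc: "continuous_on UNIV (\<lambda>p. J h (fst p) (snd p))" for h
  proof -
    have "continuous_on UNIV (\<lambda>p. integral (cbox 0 h) (\<lambda>y. G (snd p, fst p + y)))"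
      by (rule integral_continuous_on_param) (auto simp: case_prod_beta' intro!: Gc continuous_intros)
    then show ?thesis unfolding J_def by (simp add: cbox_interval)
  qed
  have Lc: "continuous_on UNIV (\<lambda>p. L h (fst p) (snd p))" for h
  proof -
    have "continuous_on UNIV (\<lambda>p. integral (cbox 0 h) (\<lambda>x. G (fst p + x, snd p)))"
      by (rule integral_continuous_on_param) (auto simp: case_prod_beta' intro!: Gc continuous_intros)
    then show ?thesis unfolding L_def by (simp add: cbox_interval)
  qed
  have Jc': "continuous_on A (\<lambda>x. J h (f x) (g x))" if "continuous_on A f" "continuous_on A g" for A :: "'z::topological_space set" and f g h
    using continuous_on_compose2[OF Jc, of A "\<lambda>x. (f x, g x)"] that by (auto intro!: continuous_intros)
  have Lc': "continuous_on A (\<lambda>x. L h (f x) (g x))" if "continuous_on A f" "continuous_on A g" for A :: "'z::topological_space set" and f g h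
    using continuous_on_compose2[OF Lc, of A "\<lambda>x. (f x, g x)"] that by (auto intro!: continuous_intros)
  \<comment> \<open>Exchanging the order of integration displays \<open>Q\<close> as a window
    integral in its second variable, hence as differentiable there.\<close>
  have swap: "Q h a b = integral {0..h} (\<lambda>y. L h a (b + y))" for h a b
  proof -
    have "integral (cbox 0 h) (\<lambda>x. integral (cbox 0 h) (\<lambda>y. G (a + x, b + y))) =
        integral (cbox 0 h) (\<lambda>y. integral (cbox 0 h) (\<lambda>x. G (a + x, b + y)))"
      by (rule integral_swap_continuous) (auto simp: case_prod_beta' intro!: Gc continuous_intros)
    then show ?thesis unfolding Q_def J_def L_def by (simp add: cbox_interval)
  qed
  \<comment> \<open>The chain rule along s \<mapsto> (t - s, s) needs total differentiability, which
    follows from the two partial derivatives and joint continuity of the one in b.\<close>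
  have dQ: "((\<lambda>s. Q h (t - s) s) has_real_derivative
      (- (J h s (t - s + h) - J h s (t - s)) + (L h (t - s) (s + h) - L h (t - s) s))) (at s)" if h: "0 \<le> h" for h s
  proof -
    define fy where "fy a b = blinfun_scaleR_left (L h a (b + h) - L h a b)" for a b
    have "((\<lambda>(a, b). Q h a b) has_derivative (\<lambda>(ta, tb). (J h s (t - s + h) - J h s (t - s)) * ta + blinfun_apply (fy (t - s) s) tb))
        (at (t - s, s) within UNIV \<times> UNIV)"
    proof (rule has_derivative_partialsI)
      show "((\<lambda>a. Q h a s) has_derivative (\<lambda>ta. (J h s (t - s + h) - J h s (t - s)) * ta)) (at (t - s) within UNIV)"
        using window_integral_has_derivative[OF Jc'[OF continuous_on_const continuous_on_id] h, of h s "t - s"]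
        unfolding Q_def by (simp add: has_field_derivative_def)
      show "((\<lambda>b. Q h a b) has_derivative blinfun_apply (fy a b)) (at b within UNIV)" for a b
        using window_integral_has_derivative[OF Lc'[OF continuous_on_const continuous_on_id] h, of h a b]
        unfolding swap fy_def by (auto simp: has_field_derivative_def mult.commute elim!: has_derivative_eq_rhs)
      have "continuous_on UNIV (\<lambda>p. fy (fst p) (snd p))"
        unfolding fy_def by (intro continuous_intros Lc' bounded_linear.continuous_on[OF bounded_linear_blinfun_scaleR_left])
      then show "continuous (at (t - s, s) within UNIV \<times> UNIV) (\<lambda>(a, b). fy a b)"
        by (simp add: continuous_on_eq_continuous_at case_prod_beta')
    qed auto
    then have "((\<lambda>(a, b). Q h a b) has_derivative (\<lambda>(ta, tb). (J h s (t - s + h) - J h s (t - s)) * ta + blinfun_apply (fy (t - s) s) tb))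
        (at (t - s, s))" by simp
    moreover have "((\<lambda>s. (t - s, s)) has_derivative (\<lambda>x. (- x, x))) (at s)"
      by (auto intro!: derivative_eq_intros)
    ultimately have "((\<lambda>x. case (t - x, x) of (a, b) \<Rightarrow> Q h a b) has_derivative
        (\<lambda>x. case (- x, x) of (ta, tb) \<Rightarrow> (J h s (t - s + h) - J h s (t - s)) * ta + blinfun_apply (fy (t - s) s) tb)) (at s)"
      using has_derivative_compose by blast
    then show ?thesis unfolding has_field_derivative_def fy_def
      by (auto elim!: has_derivative_eq_rhs simp: algebra_simps fun_eq_iff)
  qed
  have main: "Q h t 0 \<le> Q h 0 t + h\<^sup>2 * C h * \<Gamma> (t + h)" if h: "0 < h" "h < 1" for h
  proof -
    \<comment> \<open>Its derivative is the increment \<Gamma>(s + h) - \<Gamma>(s) that occurs in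
      \<open>step\<close>; this makes \<open>D\<close> nondecreasing.\<close>
    define W where "W s = integral {0..h} (\<lambda>x. \<Gamma> (s + x))" for s
    have dW: "(W has_real_derivative (\<Gamma> (s + h) - \<Gamma> s)) (at s)" for s
      unfolding W_def using h by (intro window_integral_has_derivative \<Gamma>) auto
    define D where "D s = Q h (t - s) s + h * C h * W s" for s
    have dD: "(D has_real_derivative (- (J h s (t - s + h) - J h s (t - s)) + (L h (t - s) (s + h) - L h (t - s) s)
        + h * C h * (\<Gamma> (s + h) - \<Gamma> s))) (at s)" for s
      unfolding D_def using h by (intro DERIV_add dQ DERIV_cmult dW) auto
    have "D 0 \<le> D t"
    proof (rule DERIV_nonneg_imp_increasing_open[of 0 t D])
      show "0 \<le> t" using t by simp
      show "\<exists>y. (D has_real_derivative y) (at s) \<and> 0 \<le> y" if "0 < s" "s < t" for s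
        using dD[of s] step[OF h that] unfolding J_def L_def by (intro exI conjI) auto
      show "continuous_on {0..t} D"
        using dD by (intro continuous_at_imp_continuous_on ballI DERIV_isCont) blast
    qed
    \<comment> \<open>Monotonicity of \<Gamma> bounds \<open>W t\<close>, and the nonnegative
      \<open>W 0\<close> is dropped.\<close>
    moreover have "W t - W 0 \<le> h * \<Gamma> (t + h)"
    proof -
      have ti: "(\<lambda>x. \<Gamma> (s + x)) integrable_on {0..h}" for s
        by (intro integrable_continuous_real continuous_on_compose2[OF \<Gamma>(1)] continuous_intros) auto
      have "W t \<le> integral {0..h} (\<lambda>x. \<Gamma> (t + h))"
        unfolding W_def using \<Gamma>(2) by (intro integral_le ti) (auto simp: mono_def)
      moreover have "0 \<le> W 0" unfolding W_def using \<Gamma>(3) by (intro Henstock_Kurzweil_Integration.integral_nonneg ti) auto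
      ultimately show ?thesis using h by simp
    qed
    then have "h * C h * (W t - W 0) \<le> h * C h * (h * \<Gamma> (t + h))"
      using h C(2) by (intro mult_left_mono) auto
    ultimately show ?thesis unfolding D_def by (simp add: power2_eq_square algebra_simps)
  qed
  \<comment> \<open>The mean of a continuous function over a small square is close to its value at
    the corner.\<close>
  have near: "\<exists>\<delta>>0. \<forall>h. 0 < h \<longrightarrow> h < \<delta> \<longrightarrow> \<bar>Q h a b - h\<^sup>2 * G (a, b)\<bar> \<le> h\<^sup>2 * \<epsilon>" if e: "0 < \<epsilon>" for a b \<epsilon>
  proof -
    have "\<exists>d>0. \<forall>p. dist p (a, b) < d \<longrightarrow> dist (G p) (G (a, b)) < \<epsilon>"
      using G e unfolding continuous_on_iff by auto
    then obtain d where d: "0 < d" "\<And>p. dist p (a, b) < d \<Longrightarrow> dist (G p) (G (a, b)) < \<epsilon>" by blast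
    have "\<bar>Q h a b - h\<^sup>2 * G (a, b)\<bar> \<le> h\<^sup>2 * \<epsilon>" if h: "0 < h" "h < d / 2" for h
    proof -
      have b: "\<bar>G (a + x, b + y) - G (a, b)\<bar> \<le> \<epsilon>" if "x \<in> {0..h}" "y \<in> {0..h}" for x y
      proof -
        have "dist (a + x, b + y) (a, b) \<le> \<bar>x\<bar> + \<bar>y\<bar>"
          unfolding dist_Pair_Pair dist_real_def using sqrt_sum_squares_le_sum_abs[of x y] by simp
        then show ?thesis using d(2)[of "(a + x, b + y)"] that h by (auto simp: dist_real_def)
      qed
      have i1: "(\<lambda>y. G (q, b + y)) integrable_on {0..h}" for q
        by (intro integrable_continuous_real Gc continuous_intros)
      have i2: "(\<lambda>x. J h b (a + x)) integrable_on {0..h}"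
        by (intro integrable_continuous_real Jc' continuous_intros)
      have "J h b (a + x) \<le> integral {0..h} (\<lambda>y. G (a, b) + \<epsilon>)" "integral {0..h} (\<lambda>y. G (a, b) - \<epsilon>) \<le> J h b (a + x)" if "x \<in> {0..h}" for x
        unfolding J_def using b[OF that] by (intro integral_le i1; force simp: abs_le_iff)+
      then have J: "J h b (a + x) \<le> h * (G (a, b) + \<epsilon>)" "h * (G (a, b) - \<epsilon>) \<le> J h b (a + x)" if "x \<in> {0..h}" for x
        using that h by auto
      have "Q h a b \<le> integral {0..h} (\<lambda>x. h * (G (a, b) + \<epsilon>))" "integral {0..h} (\<lambda>x. h * (G (a, b) - \<epsilon>)) \<le> Q h a b"
        unfolding Q_def using J by (intro integral_le i2 integrable_const_ivl; blast)+
      then show ?thesis using h by (simp add: abs_le_iff power2_eq_square algebra_simps)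
    qed
    then show ?thesis using d(1) by (intro exI[of _ "d / 2"]) auto
  qed
  have "G (t, 0) \<le> G (0, t) + c * \<Gamma> t + e" if e: "0 < e" for e
  proof -
    define \<epsilon> where "\<epsilon> = e / 2"
    have eps: "0 < \<epsilon>" using e unfolding \<epsilon>_def by simp
    obtain d1 where d1: "0 < d1" "\<And>h. 0 < h \<Longrightarrow> h < d1 \<Longrightarrow> \<bar>Q h t 0 - h\<^sup>2 * G (t, 0)\<bar> \<le> h\<^sup>2 * \<epsilon>"
      using near[OF eps] by blast
    obtain d2 where d2: "0 < d2" "\<And>h. 0 < h \<Longrightarrow> h < d2 \<Longrightarrow> \<bar>Q h 0 t - h\<^sup>2 * G (0, t)\<bar> \<le> h\<^sup>2 * \<epsilon>"
      using near[OF eps] by blast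
    have "G (t, 0) - \<epsilon> \<le> G (0, t) + \<epsilon> + C h * \<Gamma> (t + h)" if h: "0 < h" "h < Min {1, d1, d2}" for h
    proof -
      have "h\<^sup>2 * G (t, 0) - h\<^sup>2 * \<epsilon> \<le> Q h t 0" using d1(2)[of h] h by (auto simp: abs_le_iff)
      also have "\<dots> \<le> Q h 0 t + h\<^sup>2 * C h * \<Gamma> (t + h)" using main h by simp
      also have "Q h 0 t \<le> h\<^sup>2 * G (0, t) + h\<^sup>2 * \<epsilon>" using d2(2)[of h] h by (auto simp: abs_le_iff)
      finally have "h\<^sup>2 * (G (t, 0) - \<epsilon>) \<le> h\<^sup>2 * (G (0, t) + \<epsilon> + C h * \<Gamma> (t + h))" by (simp add: algebra_simps)
      then show ?thesis using h by simp
    qed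
    then have ev: "\<forall>\<^sub>F h in at_right 0. G (t, 0) - \<epsilon> \<le> G (0, t) + \<epsilon> + C h * \<Gamma> (t + h)"
      unfolding eventually_at_right_field using d1(1) d2(1) by (intro exI[of _ "Min {1, d1, d2}"]) auto
    have "((\<lambda>h. \<Gamma> (t + h)) \<longlongrightarrow> \<Gamma> (t + 0)) (at_right 0)"
    proof (rule continuous_on_tendsto_compose[OF \<Gamma>(1)])
      show "((\<lambda>h. t + h) \<longlongrightarrow> t + 0) (at_right 0)" by (intro tendsto_intros)
    qed auto
    then have "((\<lambda>h. G (0, t) + \<epsilon> + C h * \<Gamma> (t + h)) \<longlongrightarrow> G (0, t) + \<epsilon> + c * \<Gamma> t) (at_right 0)"
      by (intro tendsto_intros C) simp
    then have "G (t, 0) - \<epsilon> \<le> G (0, t) + \<epsilon> + c * \<Gamma> t"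
      by (rule tendsto_lowerbound[OF _ ev]) simp
    then show ?thesis unfolding \<epsilon>_def by simp
  qed
  then show ?thesis by (rule field_le_epsilon)
qed

text \<open>A bridge between the Lebesgue integrals over open intervals that come from orbit
  averages and the gauge integrals over closed intervals used for calculus.\<close>

lemma LBINT_window:
  fixes j :: "real \<Rightarrow> real"
  assumes j: "continuous_on UNIV j" and h: "0 \<le> h"
  shows "(LINT s:{a<..<a + h}|lborel. j s) = integral {0..h} (\<lambda>x. j (a + x))"
    and "set_integrable lborel {a<..<a + h} j"
proof -
  have jc: "continuous_on A j" for A using j by (rule continuous_on_subset) auto
  have "set_integrable lborel {a..a + h} j"
    using borel_integrable_atLeastAtMost'[OF jc] .
  then show si: "set_integrable lborel {a<..<a + h} j" by (rule set_integrable_subset) auto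
  have "(LINT s:{a<..<a + h}|lborel. j s) = integral {a<..<a + h} j"
    using set_borel_integral_eq_integral(2)[OF si] .
  also have "\<dots> = integral {a..a + h} j" using integral_open_interval[of a "a + h" j] by (simp add: box_real cbox_interval)
  also have "\<dots> = integral {0..h} (j \<circ> (\<lambda>x. x + a))" using integral_shift[OF jc, of 0 h a] by (simp add: add.commute)
  finally show "(LINT s:{a<..<a + h}|lborel. j s) = integral {0..h} (\<lambda>x. j (a + x))" by (simp add: o_def add.commute)
qed

section \<open>Converse Hoelder inequalities\<close>

context weighted_measure
begin

text \<open>Testing with the extremal function V^(Q - 1) / a^(1 / P), where a is the integral of
  V^Q, gives a^(1 / Q) \<le> c. The truncation of W at n w makes a finite, so that the division is
  legitimate; the bound does not depend on n, and monotone convergence removes the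
  truncation.\<close>

lemma converse_Hoelder:
  fixes W :: "'a \<Rightarrow> real"
  assumes W[measurable]: "W \<in> borel_measurable m" and W0: "\<And>x. 0 \<le> W x"
    and PQ: "1 < P" "1 < Q" "1 / P + 1 / Q = 1" and c: "0 \<le> c"
    and bd: "\<And>\<phi>. \<phi> \<in> borel_measurable m \<Longrightarrow> (\<And>x. 0 \<le> \<phi> x) \<Longrightarrow> (\<integral>\<^sup>+x. ennreal (\<phi> x powr P) \<partial>m) \<le> 1 \<Longrightarrow>
      (\<integral>\<^sup>+x. ennreal (W x) * ennreal (\<phi> x) \<partial>m) \<le> ennreal c"
  shows "integrable m (\<lambda>x. W x powr Q)"
proof -
  define V where "V n x = min (W x) (real n * w x)" for n :: nat and x
  have [measurable]: "V n \<in> borel_measurable m" for n unfolding V_def by measurable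
  have V0: "0 \<le> V n x" "V n x \<le> W x" for n x unfolding V_def using W0[of x] by auto
  have QP: "(Q - 1) * P = Q" using PQ by (simp add: field_simps)
  have b: "(\<integral>\<^sup>+x. ennreal (V n x powr Q) \<partial>m) \<le> ennreal (c powr Q)" for n
  proof -
    have vw: "V n x powr Q \<le> real n powr Q * w x" for x
    proof -
      have "V n x powr Q \<le> (real n * w x) powr Q" using V0 PQ by (intro powr_mono2) (auto simp: V_def)
      also have "\<dots> = real n powr Q * w x powr Q" by (simp add: powr_mult)
      also have "w x powr Q \<le> w x powr 1" using w_pos[of x] w_le_1[of x] PQ by (intro powr_mono') auto
      finally show ?thesis using w_pos[of x] by (simp add: mult_left_mono)
    qed
    have int: "integrable m (\<lambda>x. V n x powr Q)"
      by (rule Bochner_Integration.integrable_bound[of m "\<lambda>x. real n powr Q * w x"])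
        (use w_integrable vw in auto)
    define a where "a = (LINT x|m. V n x powr Q)"
    have a0: "0 \<le> a" unfolding a_def by (intro integral_nonneg_AE) simp
    have na: "(\<integral>\<^sup>+x. ennreal (V n x powr Q) \<partial>m) = ennreal a"
      unfolding a_def by (rule nn_integral_eq_integral[OF int]) simp
    show ?thesis
    proof (cases "a = 0")
      case True
      then show ?thesis using na by simp
    next
      case False
      then have a: "0 < a" using a0 by simp
      define \<phi> where "\<phi> x = V n x powr (Q - 1) / a powr (1 / P)" for x
      have "(\<integral>\<^sup>+x. ennreal (\<phi> x powr P) \<partial>m) = (\<integral>\<^sup>+x. ennreal (1 / a) * ennreal (V n x powr Q) \<partial>m)"
        using a PQ V0 unfolding \<phi>_def
        by (intro nn_integral_cong) (simp add: ennreal_mult[symmetric] powr_divide powr_powr QP)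
      also have "\<dots> = ennreal (1 / a) * ennreal a" by (simp add: nn_integral_cmult na)
      also have "\<dots> = 1" using a by (simp add: ennreal_mult[symmetric])
      finally have "(\<integral>\<^sup>+x. ennreal (W x) * ennreal (\<phi> x) \<partial>m) \<le> ennreal c"
        by (intro bd) (auto simp: \<phi>_def)
      moreover have "(\<integral>\<^sup>+x. ennreal (1 / a powr (1 / P)) * ennreal (V n x powr Q) \<partial>m) \<le> (\<integral>\<^sup>+x. ennreal (W x) * ennreal (\<phi> x) \<partial>m)"
      proof (intro nn_integral_mono)
        fix x
        have "V n x powr Q = V n x * V n x powr (Q - 1)"
          using V0(1)[of n x] PQ by (cases "V n x = 0") (auto simp: powr_diff)
        also have "\<dots> \<le> W x * V n x powr (Q - 1)" using V0 by (intro mult_right_mono) auto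
        finally have "1 / a powr (1 / P) * V n x powr Q \<le> W x * \<phi> x"
          using a unfolding \<phi>_def by (simp add: field_simps)
        then show "ennreal (1 / a powr (1 / P)) * ennreal (V n x powr Q) \<le> ennreal (W x) * ennreal (\<phi> x)"
          using a W0[of x] by (simp add: ennreal_mult[symmetric] \<phi>_def)
      qed
      moreover have "(\<integral>\<^sup>+x. ennreal (1 / a powr (1 / P)) * ennreal (V n x powr Q) \<partial>m) = ennreal (1 / a powr (1 / P) * a)"
      proof (subst nn_integral_cmult)
        show "ennreal (1 / a powr (1 / P)) * (\<integral>\<^sup>+x. ennreal (V n x powr Q) \<partial>m) = ennreal (1 / a powr (1 / P) * a)"
          unfolding na using a by (intro ennreal_mult[symmetric]) auto
      qed simp
      ultimately have "ennreal (1 / a powr (1 / P) * a) \<le> ennreal c" by simp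
      then have "1 / a powr (1 / P) * a \<le> c" using c by simp
      moreover have "1 / a powr (1 / P) * a = a powr (1 / Q)"
      proof -
        have e: "1 / Q = 1 - 1 / P" using PQ(3) by linarith
        show ?thesis unfolding e using a by (simp add: powr_diff)
      qed
      ultimately have "a powr (1 / Q) \<le> c" by simp
      then have "(a powr (1 / Q)) powr Q \<le> c powr Q" using PQ by (intro powr_mono2) auto
      then have "a \<le> c powr Q" using a PQ by (simp add: powr_powr)
      then show ?thesis using na by (simp add: ennreal_leI)
    qed
  qed
  have inc: "incseq (\<lambda>n x. ennreal (V n x powr Q))"
  proof (intro incseq_SucI le_funI ennreal_leI powr_mono2)
    fix n x
    have "real n * w x \<le> real (Suc n) * w x" by (intro mult_right_mono) auto
    then show "V n x \<le> V (Suc n) x" unfolding V_def by (rule min.mono[OF order_refl])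
  qed (use V0 PQ in auto)
  have "(\<lambda>n. ennreal (V n x powr Q)) \<longlonglongrightarrow> ennreal (W x powr Q)" for x
  proof (rule tendsto_eventually)
    obtain n0 where n0: "W x \<le> real n0 * w x" using reals_Archimedean3[OF w_pos[of x]] by (meson less_imp_le)
    have "V n x = W x" if "n \<ge> n0" for n
    proof -
      have "real n0 * w x \<le> real n * w x" using that by (intro mult_right_mono) auto
      then show ?thesis using n0 unfolding V_def by simp
    qed
    then show "\<forall>\<^sub>F n in sequentially. ennreal (V n x powr Q) = ennreal (W x powr Q)"
      unfolding eventually_sequentially by metis
  qed
  then have "(\<lambda>n. \<integral>\<^sup>+x. ennreal (V n x powr Q) \<partial>m) \<longlonglongrightarrow> (\<integral>\<^sup>+x. ennreal (W x powr Q) \<partial>m)"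
    by (intro nn_integral_LIMSEQ[OF inc]) auto
  then have "(\<integral>\<^sup>+x. ennreal (W x powr Q) \<partial>m) \<le> ennreal (c powr Q)"
    using b by (intro LIMSEQ_le_const2) auto
  then show ?thesis by (intro integrableI_nonneg) (auto simp: le_less_trans)
qed

text \<open>If the set where W > c were not null, the normalised restriction of \<open>w\<close> to
  it would be an admissible test function whose integral against W exceeds c. The weight keeps it
  integrable even when the set has infinite measure.\<close>

lemma converse_Hoelder_L1:
  fixes W :: "'a \<Rightarrow> real"
  assumes W[measurable]: "W \<in> borel_measurable m" and W0: "\<And>x. 0 \<le> W x" and c: "0 \<le> c"
    and bd: "\<And>\<phi>. \<phi> \<in> borel_measurable m \<Longrightarrow> (\<And>x. 0 \<le> \<phi> x) \<Longrightarrow> (\<integral>\<^sup>+x. ennreal (\<phi> x) \<partial>m) \<le> 1 \<Longrightarrow>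
      (\<integral>\<^sup>+x. ennreal (W x) * ennreal (\<phi> x) \<partial>m) \<le> ennreal c"
  shows "AE x in m. W x \<le> c"
proof -
  define E where "E = {x \<in> space m. c < W x}"
  have [measurable]: "E \<in> sets m" unfolding E_def by measurable
  have int: "integrable m (\<lambda>x. w x * indicator E x)"
    by (rule Bochner_Integration.integrable_bound[OF w_integrable]) (auto simp: indicator_def)
  define a where "a = (LINT x|m. w x * indicator E x)"
  have a0: "0 \<le> a" unfolding a_def by (intro integral_nonneg_AE) simp
  have "a = 0"
  proof (rule ccontr)
    assume "a \<noteq> 0"
    then have a: "0 < a" using a0 by simp
    have na: "(\<integral>\<^sup>+x. ennreal (w x * indicator E x) \<partial>m) = ennreal a"
      unfolding a_def by (rule nn_integral_eq_integral[OF int]) simp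
    define \<phi> where "\<phi> x = w x * indicator E x / a" for x
    have \<phi>0: "0 \<le> \<phi> x" for x unfolding \<phi>_def using a by simp
    have "(\<integral>\<^sup>+x. ennreal (\<phi> x) \<partial>m) = (\<integral>\<^sup>+x. ennreal (1 / a) * ennreal (w x * indicator E x) \<partial>m)"
      using a unfolding \<phi>_def by (intro nn_integral_cong) (simp add: ennreal_mult[symmetric])
    also have "\<dots> = ennreal (1 / a) * ennreal a" by (simp add: nn_integral_cmult na)
    also have "\<dots> = 1" using a by (simp add: ennreal_mult[symmetric])
    finally have n1: "(\<integral>\<^sup>+x. ennreal (\<phi> x) \<partial>m) = 1" .
    then have b: "(\<integral>\<^sup>+x. ennreal (W x) * ennreal (\<phi> x) \<partial>m) \<le> ennreal c"
      using \<phi>0 by (intro bd) (auto simp: \<phi>_def)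
    have \<phi>i: "integrable m \<phi>" unfolding \<phi>_def using int by simp
    have Wi: "integrable m (\<lambda>x. W x * \<phi> x)"
      using b W0 \<phi>0 \<phi>i by (intro integrableI_nonneg) (auto simp: ennreal_mult le_less_trans)
    have "(LINT x|m. (W x - c) * \<phi> x) = (LINT x|m. W x * \<phi> x) - c * (LINT x|m. \<phi> x)"
      using Wi \<phi>i by (simp add: left_diff_distrib)
    moreover have "(LINT x|m. \<phi> x) = 1"
      using n1 \<phi>i \<phi>0 by (simp add: nn_integral_eq_integral)
    moreover have "(LINT x|m. W x * \<phi> x) \<le> c"
      using b Wi W0 \<phi>0 c by (simp add: ennreal_mult[symmetric] nn_integral_eq_integral)
    ultimately have le: "(LINT x|m. (W x - c) * \<phi> x) \<le> 0" by simp
    have nn: "0 \<le> (W x - c) * \<phi> x" if "x \<in> space m" for x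
      using \<phi>0[of x] that by (cases "x \<in> E") (simp add: E_def, simp add: \<phi>_def)
    have "(LINT x|m. (W x - c) * \<phi> x) = 0"
      using le nn by (intro antisym integral_nonneg_AE) auto
    moreover have "integrable m (\<lambda>x. (W x - c) * \<phi> x)" using Wi \<phi>i by (simp add: left_diff_distrib)
    ultimately have "AE x in m. (W x - c) * \<phi> x = 0"
      using nn by (subst (asm) integral_nonneg_eq_0_iff_AE) auto
    then have "AE x in m. \<phi> x = 0" 
    proof eventually_elim
      case (elim x)
      then show ?case by (cases "x \<in> E") (auto simp: E_def \<phi>_def)
    qed
    then have "(LINT x|m. \<phi> x) = (LINT x|m. 0)" by (intro integral_cong_AE) (auto simp: \<phi>_def)
    then show False using \<open>(LINT x|m. \<phi> x) = 1\<close> by simp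
  qed
  then have "AE x in m. w x * indicator E x = 0"
    unfolding a_def using int by (subst (asm) integral_nonneg_eq_0_iff_AE) auto
  then show ?thesis using AE_space
  proof eventually_elim
    case (elim x)
    then show ?case using w_pos[of x] by (auto simp: E_def indicator_def split: if_splits)
  qed
qed

end

section \<open>Kernel semigroups acting on \<open>L\<^sub>p\<close>\<close>

locale lp_kernel_semigroup = positive_semigroup m S + weighted_measure m w
  for m :: "'a measure" and S :: "real \<Rightarrow> ('a \<Rightarrow> real) \<Rightarrow> ('a \<Rightarrow> real)" and w :: "'a \<Rightarrow> real" +
  fixes p p' :: ennreal and kS :: "real \<Rightarrow> 'a \<Rightarrow> 'a \<Rightarrow> real"
  assumes p_ge_1: "1 \<le> p" and p_finite: "p < \<infinity>" and conjugate: "1 / p + 1 / p' = 1"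
    and acts_S: "acts_on_Lp p m S" and kernel_S: "is_kernel p m S kS"
begin

text \<open>A nonnegative extended version of the kernel, so that Tonelli applies without
  integrability checks. It is 0 for t \<le> 0 and where \<open>kS\<close> is negative; for t > 0 the
  latter set is null by \<open>kS_nonneg\<close>.\<close>

definition k :: "real \<times> 'a \<times> 'a \<Rightarrow> ennreal" where
  "k q = (if 0 < fst q then ennreal (kS (fst q) (fst (snd q)) (snd (snd q))) else 0)"

abbreviation p_real :: real where "p_real \<equiv> enn2real p"

lemma p_real_ge_1: "1 \<le> p_real"
  using p_ge_1 p_finite by (metis enn2real_1 enn2real_mono infinity_ennreal_def)

lemma p_ne_top: "p \<noteq> \<infinity>"
  using p_finite by simp

lemma Lp_iff: "u \<in> Lp p m \<longleftrightarrow> u \<in> borel_measurable m \<and> integrable m (\<lambda>x. \<bar>u x\<bar> powr p_real)"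
  unfolding Lp_def using p_ne_top by simp

lemma kS_measurable_joint:
  "(\<lambda>q. if 0 < fst q then kS (fst q) (fst (snd q)) (snd (snd q)) else 0) \<in> borel_measurable (borel \<Otimes>\<^sub>M (m \<Otimes>\<^sub>M m))"
proof -
  \<comment> \<open>Nonpositive times are redirected to 1, which carries measurability from the
    restricted time space to the whole line.\<close>
  define \<tau> where "\<tau> t = (if 0 < t then t else 1)" for t :: real
  have "\<tau> \<in> borel \<rightarrow>\<^sub>M restrict_space borel {0<..}"
  proof (rule measurable_restrict_space2)
    show "\<tau> \<in> borel_measurable borel" unfolding \<tau>_def by measurable
  qed (auto simp: \<tau>_def)
  then have "(\<lambda>q. (\<tau> (fst q), snd q)) \<in> (borel \<Otimes>\<^sub>M (m \<Otimes>\<^sub>M m)) \<rightarrow>\<^sub>M (restrict_space borel {0<..} \<Otimes>\<^sub>M (m \<Otimes>\<^sub>M m))"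
    by measurable
  moreover have "(\<lambda>(t, x, y). kS t x y) \<in> borel_measurable (restrict_space borel {0<..} \<Otimes>\<^sub>M (m \<Otimes>\<^sub>M m))"
    using kernel_S unfolding is_kernel_def by blast
  ultimately have "(\<lambda>q. (\<lambda>(t, x, y). kS t x y) (\<tau> (fst q), snd q)) \<in> borel_measurable (borel \<Otimes>\<^sub>M (m \<Otimes>\<^sub>M m))"
    by (rule measurable_compose)
  then have [measurable]: "(\<lambda>q. kS (\<tau> (fst q)) (fst (snd q)) (snd (snd q))) \<in> borel_measurable (borel \<Otimes>\<^sub>M (m \<Otimes>\<^sub>M m))"
    by (simp add: case_prod_beta')
  have "(\<lambda>q. if 0 < fst q then kS (fst q) (fst (snd q)) (snd (snd q)) else 0) =
      (\<lambda>q. if 0 < fst q then kS (\<tau> (fst q)) (fst (snd q)) (snd (snd q)) else 0)"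
    by (auto simp: \<tau>_def fun_eq_iff)
  then show ?thesis by simp
qed

lemma k_measurable[measurable]: "k \<in> borel_measurable (borel \<Otimes>\<^sub>M (m \<Otimes>\<^sub>M m))"
proof -
  have "k = (\<lambda>q. ennreal (if 0 < fst q then kS (fst q) (fst (snd q)) (snd (snd q)) else 0))"
    by (auto simp: k_def fun_eq_iff)
  then show ?thesis using measurable_compose[OF kS_measurable_joint measurable_ennreal] by simp
qed

lemma kS_measurable:
  assumes "0 < t"
  shows "(\<lambda>q. kS t (fst q) (snd q)) \<in> borel_measurable (m \<Otimes>\<^sub>M m)"
proof -
  have "(\<lambda>q. (t, q)) \<in> (m \<Otimes>\<^sub>M m) \<rightarrow>\<^sub>M (borel \<Otimes>\<^sub>M (m \<Otimes>\<^sub>M m))" by simp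
  from measurable_compose[OF this kS_measurable_joint] show ?thesis using assms by simp
qed

lemma w_ind_Lp: "A \<in> sets m \<Longrightarrow> (\<lambda>y. w y * indicator A y) \<in> Lp p m"
proof -
  assume [measurable]: "A \<in> sets m"
  have "\<bar>w y * indicator A y\<bar> powr p_real \<le> w y" for y
  proof (cases "y \<in> A")
    case True
    have "w y powr p_real \<le> w y powr 1"
      using w_pos[of y] w_le_1[of y] p_real_ge_1 by (intro powr_mono') auto
    then show ?thesis using True w_pos[of y] by simp
  qed (use p_real_ge_1 in simp)
  then show ?thesis
    unfolding Lp_iff by (auto intro!: Bochner_Integration.integrable_bound[OF w_integrable])
qed

lemma kernel_rep_w:
  assumes "0 < t" "A \<in> sets m"
  shows "AE x in m. integrable m (\<lambda>y. kS t x y * (w y * indicator A y)) \<and>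
      S t (\<lambda>y. w y * indicator A y) x = (LINT y|m. kS t x y * (w y * indicator A y))"
proof -
  have "(\<lambda>y. w y * indicator A y) \<in> Lp 2 m \<inter> Lp p m"
    using w_ind_L2[OF assms(2)] w_ind_Lp[OF assms(2)] by (rule IntI)
  moreover have "\<forall>t>0. \<forall>u\<in>Lp 2 m \<inter> Lp p m. AE x in m. integrable m (\<lambda>y. kS t x y * u y) \<and> S t u x = (LINT y|m. kS t x y * u y)"
    using kernel_S unfolding is_kernel_def by (rule conjunct2)
  ultimately show ?thesis using assms(1) by fast
qed

lemma kS_nonneg: "0 < t \<Longrightarrow> AE q in m \<Otimes>\<^sub>M m. 0 \<le> kS t (fst q) (snd q)"
proof (rule kernel_nonneg)
  assume t: "0 < t"
  then show "positive_operator_L2 m (S t)" by (intro positive_operator) simp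
  show "(\<lambda>q. kS t (fst q) (snd q)) \<in> borel_measurable (m \<Otimes>\<^sub>M m)" by (rule kS_measurable[OF t])
  fix A assume "A \<in> sets m"
  from kernel_rep_w[OF t this]
  show "AE x in m. integrable m (\<lambda>y. kS t (fst (x, y)) (snd (x, y)) * (w y * indicator A y)) \<and>
      S t (\<lambda>y. w y * indicator A y) x = (LINT y|m. kS t (fst (x, y)) (snd (x, y)) * (w y * indicator A y))" by simp
qed

text \<open>The hypothesis represents S(t) on the intersection of L_2 and L_p. The weighted
  indicators lie there, and from them the formula extends to every nonnegative function in
  L_2.\<close>

lemma k_rep:
  assumes t: "0 < t" and u: "u \<in> Lp 2 m" and u0: "AE x in m. 0 \<le> u x"
  shows "AE x in m. ennreal (S t u x) = (\<integral>\<^sup>+y. k (t, x, y) * ennreal (u y) \<partial>m)"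
proof -
  interpret P: pair_sigma_finite m m ..
  have [measurable]: "u \<in> borel_measurable m" by (rule L2_measurable[OF u])
  have [measurable]: "(\<lambda>q. kS t (fst q) (snd q)) \<in> borel_measurable (m \<Otimes>\<^sub>M m)" using kS_measurable[OF t] .
  define v where "v x = max 0 (u x)" for x
  have v: "v \<in> Lp 2 m" unfolding v_def by (rule L2_mono(1)[OF u]) auto
  have uv: "AE x in m. u x = v x" using u0 by eventually_elim (simp add: v_def)
  have op: "positive_operator_L2 m (S t)" using t by (intro positive_operator) simp
  have nn: "AE x in m. AE y in m. 0 \<le> kS t x y"
    using P.AE_pair[OF kS_nonneg[OF t]] by simp
  have "AE x in m. ennreal (S t v x) = (\<integral>\<^sup>+y. (\<lambda>q. k (t, q)) (x, y) * ennreal (v y) \<partial>m)"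
  proof (rule kernel_extends_from_weight[OF op _ _ v])
    show "(\<lambda>q. k (t, q)) \<in> borel_measurable (m \<Otimes>\<^sub>M m)" by measurable
    show "0 \<le> v x" for x unfolding v_def by simp
    fix A assume A[measurable]: "A \<in> sets m"
    show "AE x in m. ennreal (S t (\<lambda>y. w y * indicator A y) x) = (\<integral>\<^sup>+y. k (t, x, y) * ennreal (w y * indicator A y) \<partial>m)"
      using kernel_rep_w[OF t A] nn AE_space
    proof eventually_elim
      case (elim x)
      have "ennreal (S t (\<lambda>y. w y * indicator A y) x) = (\<integral>\<^sup>+y. ennreal (kS t x y * (w y * indicator A y)) \<partial>m)"
      proof (subst nn_integral_eq_integral)
        show "AE y in m. 0 \<le> kS t x y * (w y * indicator A y)"
          using elim(2) by eventually_elim simp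
      qed (use elim(1) in auto)
      also have "\<dots> = (\<integral>\<^sup>+y. k (t, x, y) * ennreal (w y * indicator A y) \<partial>m)"
      proof (rule nn_integral_cong_AE)
        show "AE y in m. ennreal (kS t x y * (w y * indicator A y)) = k (t, x, y) * ennreal (w y * indicator A y)"
          using elim(2) by eventually_elim (use t in \<open>simp add: k_def ennreal_mult\<close>)
      qed
      finally show ?case .
    qed
  qed
  moreover have "AE x in m. S t u x = S t v x" by (rule positive_operator_L2D(2)[OF op u v uv])
  moreover have "(\<integral>\<^sup>+y. k (t, x, y) * ennreal (u y) \<partial>m) = (\<integral>\<^sup>+y. k (t, x, y) * ennreal (v y) \<partial>m)" for x
    unfolding v_def by (intro nn_integral_cong) (auto simp: max_def ennreal_neg)
  ultimately show ?thesis by auto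
qed

text \<open>The pairing of S(s)\<phi> with v, written through the kernel. It makes sense for every
  nonnegative measurable \<phi>, in particular for the function f of the theorem, which lies in L_p
  but need not lie in L_2; no extension of S to L_p is constructed.\<close>

definition pair_form :: "('a \<Rightarrow> real) \<Rightarrow> real \<Rightarrow> ('a \<Rightarrow> real) \<Rightarrow> ennreal" where
  "pair_form v s \<phi> = (\<integral>\<^sup>+x. ennreal (v x) * (\<integral>\<^sup>+y. k (s, x, y) * ennreal (\<phi> y) \<partial>m) \<partial>m)"

lemma pair_form_L2:
  assumes s: "0 < s" and u: "u \<in> Lp 2 m" "AE x in m. 0 \<le> u x" and v: "v \<in> Lp 2 m" "\<And>x. 0 \<le> v x"
  shows "pair_form v s u = ennreal (pairing m (S s u) v)" and "0 \<le> pairing m (S s u) v"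
proof -
  have nn: "AE x in m. 0 \<le> S s u x" using s u by (intro T_nonneg) auto
  have i: "integrable m (\<lambda>x. S s u x * v x)" using s u v by (intro L2_mult_integrable T_L2) auto
  have n: "AE x in m. 0 \<le> S s u x * v x" using nn by eventually_elim (simp add: v)
  show "0 \<le> pairing m (S s u) v" unfolding pairing_def using n by (rule integral_nonneg_AE)
  have "pair_form v s u = (\<integral>\<^sup>+x. ennreal (S s u x * v x) \<partial>m)"
    unfolding pair_form_def
  proof (rule nn_integral_cong_AE)
    show "AE x in m. ennreal (v x) * (\<integral>\<^sup>+y. k (s, x, y) * ennreal (u y) \<partial>m) = ennreal (S s u x * v x)"
      using k_rep[OF s u] nn
    proof eventually_elim
      case (elim x)
      show ?case unfolding elim(1)[symmetric] using elim(2) v(2)[of x] by (simp add: ennreal_mult mult.commute)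
    qed
  qed
  also have "\<dots> = ennreal (pairing m (S s u) v)"
    unfolding pairing_def by (rule nn_integral_eq_integral[OF i n])
  finally show "pair_form v s u = ennreal (pairing m (S s u) v)" .
qed

lemma truncation_L2_Lp:
  assumes \<phi>: "\<phi> \<in> borel_measurable m" "\<And>x. 0 \<le> \<phi> x"
  shows "(\<lambda>x. min (\<phi> x) (real n * w x)) \<in> Lp 2 m" 
    and "\<phi> \<in> Lp p m \<Longrightarrow> (\<lambda>x. min (\<phi> x) (real n * w x)) \<in> Lp p m"
proof -
  note [measurable] = \<phi>(1)
  show "(\<lambda>x. min (\<phi> x) (real n * w x)) \<in> Lp 2 m"
    by (rule L2_mono(1)[OF L2_cmult(1)[OF w_L2, of "real n"]]) (use \<phi>(2) in \<open>auto simp: abs_mult\<close>)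
  assume "\<phi> \<in> Lp p m"
  then have "integrable m (\<lambda>x. \<bar>\<phi> x\<bar> powr p_real)" by (simp add: Lp_iff)
  then have "integrable m (\<lambda>x. \<bar>min (\<phi> x) (real n * w x)\<bar> powr p_real)"
    by (rule Bochner_Integration.integrable_bound)
      (use \<phi>(2) p_real_ge_1 in \<open>auto intro!: powr_mono2\<close>)
  then show "(\<lambda>x. min (\<phi> x) (real n * w x)) \<in> Lp p m" by (simp add: Lp_iff)
qed

lemma truncation_SUP:
  assumes "0 \<le> (z::real)"
  shows "(SUP n::nat. ennreal (min z (real n * w x))) = ennreal z"
proof (rule antisym)
  show "(SUP n. ennreal (min z (real n * w x))) \<le> ennreal z"
    by (intro SUP_least ennreal_leI) simp
  obtain n where "z \<le> real n * w x" using reals_Archimedean3[OF w_pos[of x]] by (meson less_imp_le)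
  then have "ennreal z = ennreal (min z (real n * w x))" by simp
  also have "\<dots> \<le> (SUP n. ennreal (min z (real n * w x)))" by (rule SUP_upper) simp
  finally show "ennreal z \<le> (SUP n. ennreal (min z (real n * w x)))" .
qed

lemma truncation_incseq: "incseq (\<lambda>n. ennreal (min z (real n * w x)))"
proof (intro incseq_SucI ennreal_leI min.mono order_refl)
  fix n show "real n * w x \<le> real (Suc n) * w x" by (intro mult_right_mono) auto
qed

text \<open>The minima of \<phi> and n w lie in L_2, and in L_p if \<phi> does, and increase to
  \<phi>. Estimates for S on the intersection of both spaces thus pass to \<phi> by monotone
  convergence.\<close>

lemma pair_form_truncation:
  assumes [measurable]: "\<phi> \<in> borel_measurable m" "v \<in> borel_measurable m" and \<phi>: "\<And>x. 0 \<le> \<phi> x"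
  shows "pair_form v s \<phi> = (SUP n::nat. pair_form v s (\<lambda>x. min (\<phi> x) (real n * w x)))"
proof -
  have i: "incseq (\<lambda>n y. k (s, x, y) * ennreal (min (\<phi> y) (real n * w y)))" for x
    by (auto simp: incseq_def le_fun_def intro!: mult_left_mono incseqD[OF truncation_incseq])
  have e: "(\<integral>\<^sup>+y. k (s, x, y) * ennreal (\<phi> y) \<partial>m) = (SUP n. \<integral>\<^sup>+y. k (s, x, y) * ennreal (min (\<phi> y) (real n * w y)) \<partial>m)"
    if "x \<in> space m" for x
  proof -
    have "(\<integral>\<^sup>+y. k (s, x, y) * ennreal (\<phi> y) \<partial>m) = (\<integral>\<^sup>+y. (SUP n. k (s, x, y) * ennreal (min (\<phi> y) (real n * w y))) \<partial>m)"
      by (intro nn_integral_cong) (simp add: SUP_mult_left_ennreal[symmetric] truncation_SUP[OF \<phi>])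
    also have "\<dots> = (SUP n. \<integral>\<^sup>+y. k (s, x, y) * ennreal (min (\<phi> y) (real n * w y)) \<partial>m)"
      using that by (intro nn_integral_monotone_convergence_SUP i) measurable
    finally show ?thesis .
  qed
  have "pair_form v s \<phi> = (\<integral>\<^sup>+x. (SUP n. ennreal (v x) * (\<integral>\<^sup>+y. k (s, x, y) * ennreal (min (\<phi> y) (real n * w y)) \<partial>m)) \<partial>m)"
    unfolding pair_form_def by (intro nn_integral_cong) (simp add: e SUP_mult_left_ennreal)
  also have "\<dots> = (SUP n. pair_form v s (\<lambda>x. min (\<phi> x) (real n * w x)))"
    unfolding pair_form_def
  proof (rule nn_integral_monotone_convergence_SUP)
    show "incseq (\<lambda>n x. ennreal (v x) * (\<integral>\<^sup>+y. k (s, x, y) * ennreal (min (\<phi> y) (real n * w y)) \<partial>m))"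
      by (auto simp: incseq_def le_fun_def intro!: mult_left_mono nn_integral_mono incseqD[OF truncation_incseq])
  qed measurable
  finally show ?thesis .
qed

text \<open>For truncated \<phi> the L_p bound of S applies, and y \<le> 1 + y^p together with v
  \<le> w \<le> 1 takes the place of Hoelder's inequality. The constant is uniform in v, s \<le> R
  and \<phi>.\<close>

lemma pair_form_Lp_bound:
  obtains c where "\<And>(s::real) v \<phi> R. 0 < s \<Longrightarrow> s \<le> R \<Longrightarrow> v \<in> borel_measurable m \<Longrightarrow> (\<And>x. 0 \<le> v x \<and> v x \<le> w x) \<Longrightarrow>
    \<phi> \<in> Lp p m \<Longrightarrow> (\<And>x. 0 \<le> \<phi> x) \<Longrightarrow> (\<integral>\<^sup>+x. ennreal (\<phi> x powr p_real) \<partial>m) \<le> ennreal b \<Longrightarrow> pair_form v s \<phi> \<le> ennreal (c R)"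
proof -
  obtain K \<omega> where K: "1 \<le> K" "acts_on_Lp_with p m S K \<omega>" using acts_S unfolding acts_on_Lp_def by blast
  \<comment> \<open>The integral of \<open>w\<close> comes from the summand 1 in y \<le> 1 + y^p;
    the rest bounds the integral of |S(s)\<psi>|^p. Since \<open>ennreal b\<close> is 0 for negative
    \<open>b\<close>, the relevant number is \<open>max 0 b\<close>.\<close>
  define c where "c R = (LINT x|m. w x) + (K * exp (\<bar>\<omega>\<bar> * R) * (max 0 b) powr (1 / p_real)) powr p_real" for R
  have p0: "1 \<le> p_real" "0 < p_real" using p_real_ge_1 by auto
  show ?thesis
  proof (rule that[of c])
    fix s R :: real and v \<phi> assume s: "0 < s" "s \<le> R" and v[measurable]: "v \<in> borel_measurable m" and vw: "\<And>x. 0 \<le> v x \<and> v x \<le> w x"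
      and \<phi>: "\<phi> \<in> Lp p m" "\<And>x. 0 \<le> \<phi> x" and b: "(\<integral>\<^sup>+x. ennreal (\<phi> x powr p_real) \<partial>m) \<le> ennreal b"
    have [measurable]: "\<phi> \<in> borel_measurable m" using \<phi>(1) by (simp add: Lp_iff)
    have "pair_form v s (\<lambda>x. min (\<phi> x) (real n * w x)) \<le> ennreal (c R)" for n
    proof -
      define \<psi> where "\<psi> x = min (\<phi> x) (real n * w x)" for x
      have \<psi>: "\<psi> \<in> Lp 2 m" "\<psi> \<in> Lp p m" "\<And>x. 0 \<le> \<psi> x"
        using truncation_L2_Lp[of \<phi> n] \<phi> unfolding \<psi>_def by auto
      have v2: "v \<in> Lp 2 m" by (rule L2_mono(1)[OF w_L2]) (use vw in auto)
      have Sp: "S s \<psi> \<in> Lp p m" "Lp_norm p m (S s \<psi>) \<le> K * exp (\<omega> * s) * Lp_norm p m \<psi>"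
        using K(2) \<psi> s unfolding acts_on_Lp_with_def by auto
      have i\<psi>: "integrable m (\<lambda>x. \<psi> x powr p_real)" using \<psi>(2,3) by (simp add: Lp_iff)
      have iS: "integrable m (\<lambda>x. \<bar>S s \<psi> x\<bar> powr p_real)" using Sp(1) by (simp add: Lp_iff)
      have "(\<integral>\<^sup>+x. ennreal (\<psi> x powr p_real) \<partial>m) \<le> (\<integral>\<^sup>+x. ennreal (\<phi> x powr p_real) \<partial>m)"
        using p0 \<psi>(3) by (intro nn_integral_mono ennreal_leI powr_mono2) (auto simp: \<psi>_def)
      then have "ennreal (LINT x|m. \<psi> x powr p_real) \<le> ennreal b"
        using b i\<psi> by (simp add: nn_integral_eq_integral)
      then have "(LINT x|m. \<psi> x powr p_real) \<le> max 0 b"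
        by (cases "0 \<le> b") (auto simp: ennreal_neg ennreal_eq_0_iff le_zero_eq)
      then have "Lp_norm p m \<psi> \<le> max 0 b powr (1 / p_real)"
        unfolding Lp_norm_def using p_ne_top p0 \<psi>(3) by (auto intro!: powr_mono2 integral_nonneg_AE)
      moreover have "exp (\<omega> * s) \<le> exp (\<bar>\<omega>\<bar> * R)"
      proof -
        have "\<omega> * s \<le> \<bar>\<omega>\<bar> * s" using s by (intro mult_right_mono) auto
        also have "\<dots> \<le> \<bar>\<omega>\<bar> * R" using s by (intro mult_left_mono) auto
        finally show ?thesis by simp
      qed
      ultimately have "K * exp (\<omega> * s) * Lp_norm p m \<psi> \<le> K * exp (\<bar>\<omega>\<bar> * R) * max 0 b powr (1 / p_real)"
        using K(1) by (intro mult_mono) (auto simp: Lp_norm_def p_ne_top[simplified])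
      then have "(LINT x|m. \<bar>S s \<psi> x\<bar> powr p_real) powr (1 / p_real) \<le> K * exp (\<bar>\<omega>\<bar> * R) * max 0 b powr (1 / p_real)"
        using Sp(2) p_ne_top by (simp add: Lp_norm_def)
      then have "((LINT x|m. \<bar>S s \<psi> x\<bar> powr p_real) powr (1 / p_real)) powr p_real \<le>
          (K * exp (\<bar>\<omega>\<bar> * R) * max 0 b powr (1 / p_real)) powr p_real"
        using p0 by (intro powr_mono2) auto
      moreover have "0 \<le> (LINT x|m. \<bar>S s \<psi> x\<bar> powr p_real)" by (intro integral_nonneg_AE) simp
      ultimately have Sb: "(LINT x|m. \<bar>S s \<psi> x\<bar> powr p_real) \<le> (K * exp (\<bar>\<omega>\<bar> * R) * max 0 b powr (1 / p_real)) powr p_real"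
        using p0 by (simp add: powr_powr)
      have "pairing m (S s \<psi>) v \<le> (LINT x|m. w x + \<bar>S s \<psi> x\<bar> powr p_real)"
        unfolding pairing_def
      proof (rule integral_mono)
        show "integrable m (\<lambda>x. S s \<psi> x * v x)" using s \<psi> v2 by (intro L2_mult_integrable T_L2) auto
        show "integrable m (\<lambda>x. w x + \<bar>S s \<psi> x\<bar> powr p_real)" using w_integrable iS by simp
        fix x
        have y: "y \<le> 1 + y powr p_real" if "0 \<le> y" for y :: real
        proof (cases "y \<le> 1")
          case False
          then have "y powr 1 \<le> y powr p_real" using p0 by (intro powr_mono) auto
          then show ?thesis using False by simp
        qed (use powr_ge_zero[of y p_real] in linarith)
        have "S s \<psi> x * v x \<le> \<bar>S s \<psi> x\<bar> * w x" using vw[of x] by (intro mult_mono) auto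
        also have "\<dots> \<le> (1 + \<bar>S s \<psi> x\<bar> powr p_real) * w x" by (intro mult_right_mono y) auto
        also have "\<dots> \<le> w x + \<bar>S s \<psi> x\<bar> powr p_real"
          using mult_left_le[OF w_le_1[of x], of "\<bar>S s \<psi> x\<bar> powr p_real"] by (simp add: algebra_simps)
        finally show "S s \<psi> x * v x \<le> w x + \<bar>S s \<psi> x\<bar> powr p_real" .
      qed
      also have "\<dots> \<le> c R" unfolding c_def using w_integrable iS Sb by simp
      finally have "pairing m (S s \<psi>) v \<le> c R" .
      then show ?thesis
        using pair_form_L2(1)[OF s(1) \<psi>(1) _ v2] \<psi>(3) vw unfolding \<psi>_def[symmetric] by (simp add: ennreal_leI)
    qed
    then show "pair_form v s \<phi> \<le> ennreal (c R)"
      unfolding pair_form_truncation[OF \<open>\<phi> \<in> borel_measurable m\<close> v \<phi>(2)] by (rule SUP_least)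
  qed
qed

end

text \<open>Testing with \<open>w\<close> shows that the density is finite almost everywhere, and
  the converse Hoelder inequality with P = Q = 2 puts it into L_2. The representation, given on
  nonnegative functions only, extends to L_2 by splitting into positive and negative parts.\<close>

lemma (in weighted_measure) dual_function_L2:
  fixes \<Theta> :: "'a \<Rightarrow> ennreal" and \<Lambda> :: "('a \<Rightarrow> real) \<Rightarrow> real"
  assumes \<Theta>[measurable]: "\<Theta> \<in> borel_measurable m"
    and rep: "\<And>u. u \<in> Lp 2 m \<Longrightarrow> (\<And>x. 0 \<le> u x) \<Longrightarrow> (\<integral>\<^sup>+x. \<Theta> x * ennreal (u x) \<partial>m) = ennreal (\<Lambda> u)"
    and nn: "\<And>u. u \<in> Lp 2 m \<Longrightarrow> (\<And>x. 0 \<le> u x) \<Longrightarrow> 0 \<le> \<Lambda> u"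
    and diff: "\<And>u u'. u \<in> Lp 2 m \<Longrightarrow> u' \<in> Lp 2 m \<Longrightarrow> \<Lambda> (\<lambda>x. u x - u' x) = \<Lambda> u - \<Lambda> u'"
    and bd: "\<And>u. u \<in> Lp 2 m \<Longrightarrow> \<Lambda> u \<le> c * norm2 m u" and c: "0 \<le> c"
  shows "AE x in m. \<Theta> x < \<infinity>" and "(\<lambda>x. enn2real (\<Theta> x)) \<in> Lp 2 m"
    and "\<And>u. u \<in> Lp 2 m \<Longrightarrow> pairing m u (\<lambda>x. enn2real (\<Theta> x)) = \<Lambda> u"
proof -
  have "(\<integral>\<^sup>+x. \<Theta> x * ennreal (w x) \<partial>m) \<noteq> \<infinity>"
    using rep[OF w_L2] by simp
  then have "AE x in m. \<Theta> x * ennreal (w x) \<noteq> \<infinity>" by (intro nn_integral_PInf_AE) auto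
  then show fin: "AE x in m. \<Theta> x < \<infinity>"
    by eventually_elim (use w_pos in \<open>auto simp: ennreal_mult_eq_top_iff less_top ennreal_eq_0_iff not_le\<close>)
  define W where "W x = enn2real (\<Theta> x)" for x
  have [measurable]: "W \<in> borel_measurable m" unfolding W_def by measurable
  have W0: "0 \<le> W x" for x unfolding W_def by simp
  have eq: "(\<integral>\<^sup>+x. ennreal (W x) * ennreal (u x) \<partial>m) = (\<integral>\<^sup>+x. \<Theta> x * ennreal (u x) \<partial>m)" for u
    using fin by (intro nn_integral_cong_AE, eventually_elim) (auto simp: W_def)
  have "integrable m (\<lambda>x. W x powr 2)"
  proof (rule converse_Hoelder[of W 2 2 c])
    fix \<phi> :: "'a \<Rightarrow> real" assume \<phi>: "\<phi> \<in> borel_measurable m" "\<And>x. 0 \<le> \<phi> x" "(\<integral>\<^sup>+x. ennreal (\<phi> x powr 2) \<partial>m) \<le> 1"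
    then have "\<phi> \<in> Lp 2 m" "norm2 m \<phi> \<le> 1" using L2I[of \<phi> m 1] by auto
    then have "\<Lambda> \<phi> \<le> c" using bd[of \<phi>] c mult_left_mono[of "norm2 m \<phi>" 1 c] by simp
    then show "(\<integral>\<^sup>+x. ennreal (W x) * ennreal (\<phi> x) \<partial>m) \<le> ennreal c"
      unfolding eq using rep[OF \<open>\<phi> \<in> Lp 2 m\<close> \<phi>(2)] by (simp add: ennreal_leI)
  qed (use W0 c in auto)
  then show W2: "(\<lambda>x. enn2real (\<Theta> x)) \<in> Lp 2 m"
    unfolding Lp_2_iff W_def[symmetric] using W0 by simp
  fix u assume u: "u \<in> Lp 2 m"
  have [measurable]: "u \<in> borel_measurable m" by (rule L2_measurable[OF u])
  define u1 where "u1 x = max 0 (u x)" for x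
  define u2 where "u2 x = max 0 (- u x)" for x
  have u12: "u1 \<in> Lp 2 m" "u2 \<in> Lp 2 m" "0 \<le> u1 x" "0 \<le> u2 x" for x
    unfolding u1_def u2_def by (auto intro!: L2_mono(1)[OF u])
  have i: "pairing m z W = \<Lambda> z" if z: "z \<in> Lp 2 m" "\<And>x. 0 \<le> z x" for z
  proof -
    have "ennreal (pairing m z W) = (\<integral>\<^sup>+x. ennreal (z x * W x) \<partial>m)"
      unfolding pairing_def using L2_mult_integrable[OF z(1) W2] z(2) W0
      by (intro nn_integral_eq_integral[symmetric]) (auto simp: W_def)
    also have "\<dots> = (\<integral>\<^sup>+x. ennreal (W x) * ennreal (z x) \<partial>m)"
      using z(2) W0 by (intro nn_integral_cong) (simp add: ennreal_mult mult.commute)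
    also have "\<dots> = ennreal (\<Lambda> z)" unfolding eq by (rule rep[OF z])
    finally show ?thesis
      using nn[OF z] z(2) W0 by (subst (asm) ennreal_inj) (auto simp: pairing_def intro!: integral_nonneg_AE)
  qed
  have "u = (\<lambda>x. u1 x - u2 x)" unfolding u1_def u2_def by auto
  then have "pairing m u W = pairing m u1 W - pairing m u2 W" "\<Lambda> u = \<Lambda> u1 - \<Lambda> u2"
    using pairing_diff_left[OF u12(1,2) W2] diff[OF u12(1,2)] unfolding W_def by auto
  then show "pairing m u (\<lambda>x. enn2real (\<Theta> x)) = \<Lambda> u"
    using i[OF u12(1) u12(3)] i[OF u12(2) u12(4)] unfolding W_def[abs_def] by simp
qed

section \<open>Adjoint orbits given by the kernel\<close>

context lp_kernel_semigroup
begin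

text \<open>Such v lie in every L_q, and those of the form w times an indicator already suffice to
  compare two functions almost everywhere.\<close>

definition test_function :: "('a \<Rightarrow> real) \<Rightarrow> bool" where
  "test_function v \<longleftrightarrow> v \<in> borel_measurable m \<and> (\<forall>x. 0 \<le> v x \<and> v x \<le> w x)"

lemma test_function_L2: "test_function v \<Longrightarrow> v \<in> Lp 2 m"
  by (rule L2_mono(1)[OF w_L2]) (auto simp: test_function_def)

text \<open>This is S(s)'v as a concrete function with values in [0, \<infinity>].\<close>

definition adj :: "('a \<Rightarrow> real) \<Rightarrow> real \<Rightarrow> 'a \<Rightarrow> ennreal" where
  "adj v s y = (\<integral>\<^sup>+x. ennreal (v x) * k (s, x, y) \<partial>m)"

text \<open>The time integral of the adjoint orbit, not yet divided by h. It is of interest for b >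
  0, as the kernel carries no information at nonpositive times.\<close>

definition avg_adj :: "('a \<Rightarrow> real) \<Rightarrow> real \<Rightarrow> real \<Rightarrow> 'a \<Rightarrow> ennreal" where
  "avg_adj v b h y = (\<integral>\<^sup>+s. indicator {b<..<b + h} s * adj v s y \<partial>lborel)"

lemma adj_measurable_compose:
  assumes [measurable]: "v \<in> borel_measurable m" "f \<in> N \<rightarrow>\<^sub>M borel" "g \<in> N \<rightarrow>\<^sub>M m"
  shows "(\<lambda>q. adj v (f q) (g q)) \<in> borel_measurable N"
  unfolding adj_def by measurable

lemma adj_measurable: "v \<in> borel_measurable m \<Longrightarrow> adj v s \<in> borel_measurable m"
  using adj_measurable_compose[of v "\<lambda>_. s" m "\<lambda>y. y"] by simp

lemma avg_adj_measurable: "v \<in> borel_measurable m \<Longrightarrow> avg_adj v b h \<in> borel_measurable m"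
proof -
  assume "v \<in> borel_measurable m"
  note [measurable (raw)] = adj_measurable_compose[OF this]
  show ?thesis unfolding avg_adj_def by measurable
qed

lemma pair_form_adj:
  assumes [measurable]: "v \<in> borel_measurable m" "\<phi> \<in> borel_measurable m"
  shows "(\<integral>\<^sup>+y. adj v s y * ennreal (\<phi> y) \<partial>m) = pair_form v s \<phi>"
proof -
  interpret P: pair_sigma_finite m m ..
  have "(\<integral>\<^sup>+y. adj v s y * ennreal (\<phi> y) \<partial>m) = (\<integral>\<^sup>+y. \<integral>\<^sup>+x. ennreal (v x) * (k (s, x, y) * ennreal (\<phi> y)) \<partial>m \<partial>m)"
    unfolding adj_def by (intro nn_integral_cong) (simp add: nn_integral_multc[symmetric] mult.assoc)
  also have "\<dots> = (\<integral>\<^sup>+x. \<integral>\<^sup>+y. ennreal (v x) * (k (s, x, y) * ennreal (\<phi> y)) \<partial>m \<partial>m)"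
    by (intro P.Fubini') measurable
  also have "\<dots> = pair_form v s \<phi>"
    unfolding pair_form_def by (intro nn_integral_cong nn_integral_cmult) measurable
  finally show ?thesis .
qed

lemma pair_form_measurable:
  assumes [measurable]: "v \<in> borel_measurable m" "\<phi> \<in> borel_measurable m"
  shows "(\<lambda>s. pair_form v s \<phi>) \<in> borel_measurable borel"
  unfolding pair_form_def by measurable

lemma pair_form_avg_adj:
  assumes v: "v \<in> borel_measurable m" and \<phi>[measurable]: "\<phi> \<in> borel_measurable m"
  shows "(\<integral>\<^sup>+y. avg_adj v b h y * ennreal (\<phi> y) \<partial>m) = (\<integral>\<^sup>+s. indicator {b<..<b + h} s * pair_form v s \<phi> \<partial>lborel)"
proof -
  interpret P: pair_sigma_finite lborel m ..
  note [measurable (raw)] = adj_measurable_compose[OF v]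
  have "(\<integral>\<^sup>+y. avg_adj v b h y * ennreal (\<phi> y) \<partial>m) =
      (\<integral>\<^sup>+y. \<integral>\<^sup>+s. indicator {b<..<b + h} s * (adj v s y * ennreal (\<phi> y)) \<partial>lborel \<partial>m)"
    unfolding avg_adj_def by (intro nn_integral_cong) (simp add: nn_integral_multc[symmetric] mult.assoc)
  also have "\<dots> = (\<integral>\<^sup>+s. \<integral>\<^sup>+y. indicator {b<..<b + h} s * (adj v s y * ennreal (\<phi> y)) \<partial>m \<partial>lborel)"
    by (intro P.Fubini') measurable
  also have "\<dots> = (\<integral>\<^sup>+s. indicator {b<..<b + h} s * pair_form v s \<phi> \<partial>lborel)"
    by (intro nn_integral_cong) (simp add: nn_integral_cmult pair_form_adj[OF v \<phi>])
  finally show ?thesis .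
qed

lemma pairing_orbit_diff:
  assumes s: "0 \<le> s" and u: "u \<in> Lp 2 m" "u' \<in> Lp 2 m" and v: "v \<in> Lp 2 m"
  shows "pairing m (S s (\<lambda>x. u x - u' x)) v = pairing m (S s u) v - pairing m (S s u') v"
proof -
  have "pairing m (S s (\<lambda>x. u x - u' x)) v = pairing m (\<lambda>x. S s u x - S s u' x) v"
    using s u v by (intro pairing_cong_AE positive_operator_L2_diff[OF positive_operator] L2_measurable T_L2 L2_diff)
  then show ?thesis using s u v by (simp add: pairing_diff_left T_L2)
qed

text \<open>Freezing negative times at 0 by \<open>max 0 s\<close> gives a continuous function on
  the whole line, to which the window calculus applies.\<close>

lemma pairing_orbit_continuous:
  assumes u: "u \<in> Lp 2 m" and v: "v \<in> Lp 2 m"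
  shows "continuous_on UNIV (\<lambda>s. pairing m (S (max 0 s) u) v)"
  unfolding continuous_on_iff
proof (intro ballI allI impI)
  fix s e :: real assume e: "0 < e"
  define e' where "e' = e / (norm2 m v + 1)"
  have pos: "0 < norm2 m v + 1" using norm2_nonneg[of m v] by linarith
  then have e': "0 < e'" unfolding e'_def using e by simp
  obtain \<delta> where \<delta>: "0 < \<delta>" "\<And>r t. 0 \<le> r \<Longrightarrow> r \<le> \<bar>s\<bar> + 1 \<Longrightarrow> 0 \<le> t \<Longrightarrow> t \<le> \<bar>s\<bar> + 1 \<Longrightarrow> \<bar>r - t\<bar> < \<delta> \<Longrightarrow>
      norm2 m (\<lambda>x. S r u x - S t u x) < e'"
    by (rule uniformly_continuous[OF u e', of "\<bar>s\<bar> + 1"]) blast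
  have "dist (pairing m (S (max 0 r) u) v) (pairing m (S (max 0 s) u) v) < e" if r: "dist r s < min \<delta> 1" for r
  proof -
    have "\<bar>pairing m (\<lambda>x. S (max 0 r) u x - S (max 0 s) u x) v\<bar> \<le> norm2 m (\<lambda>x. S (max 0 r) u x - S (max 0 s) u x) * norm2 m v"
      using u v by (intro pairing_bound L2_diff T_L2) auto
    also have "\<dots> \<le> e' * norm2 m v"
      using r by (intro mult_right_mono less_imp_le[OF \<delta>(2)]) (auto simp: dist_real_def max_def abs_if split: if_splits)
    also have "\<dots> < e' * (norm2 m v + 1)" using e' by simp
    also have "\<dots> = e" unfolding e'_def using pos by simp
    finally show ?thesis using u v by (simp add: pairing_diff_left T_L2 dist_real_def)
  qed
  then show "\<exists>d>0. \<forall>r\<in>UNIV. dist r s < d \<longrightarrow> dist (pairing m (S (max 0 r) u) v) (pairing m (S (max 0 s) u) v) < e"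
    using \<delta>(1) by (intro exI[of _ "min \<delta> 1"]) auto
qed

lemma pairing_orbit_integrable:
  assumes u: "u \<in> Lp 2 m" and v: "v \<in> Lp 2 m" and b: "0 \<le> b" "0 \<le> h"
  shows "set_integrable lborel {b<..<b + h} (\<lambda>s. pairing m (S s u) v)"
proof -
  have "set_integrable lborel {b<..<b + h} (\<lambda>s. pairing m (S (max 0 s) u) v)"
    by (rule LBINT_window(2)[OF pairing_orbit_continuous[OF u v] b(2)])
  then show ?thesis
    using b by (subst (asm) set_integrable_cong[OF refl refl]) auto
qed

lemma adj_L2:
  assumes v: "test_function v" and s: "0 < s"
  shows "(\<lambda>y. enn2real (adj v s y)) \<in> Lp 2 m"
    and "u \<in> Lp 2 m \<Longrightarrow> pairing m u (\<lambda>y. enn2real (adj v s y)) = pairing m (S s u) v"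
proof -
  have vm: "v \<in> borel_measurable m" and v0: "\<And>x. 0 \<le> v x" using v by (auto simp: test_function_def)
  note v2 = test_function_L2[OF v]
  obtain K where K: "1 \<le> K" "\<And>t u. 0 \<le> t \<Longrightarrow> t \<le> s \<Longrightarrow> u \<in> Lp 2 m \<Longrightarrow> norm2 m (S t u) \<le> K * norm2 m u"
    using locally_bounded[of s] by blast
  have c: "pairing m (S s u) v \<le> (K * norm2 m v) * norm2 m u" if u: "u \<in> Lp 2 m" for u
  proof -
    have "pairing m (S s u) v \<le> norm2 m (S s u) * norm2 m v"
      using pairing_bound[OF T_L2[of s u] v2] s u by simp
    also have "\<dots> \<le> (K * norm2 m u) * norm2 m v"
      using s u by (intro mult_right_mono K) auto
    finally show ?thesis by (simp add: mult_ac)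
  qed
  have r: "(\<integral>\<^sup>+x. adj v s x * ennreal (u x) \<partial>m) = ennreal (pairing m (S s u) v)" "0 \<le> pairing m (S s u) v"
    if u: "u \<in> Lp 2 m" "\<And>x. 0 \<le> u x" for u
    using pair_form_L2[OF s u(1) _ v2 v0] u(2) pair_form_adj[OF vm L2_measurable[OF u(1)]] by auto
  have K0: "0 \<le> K * norm2 m v" using K(1) by simp
  note D = dual_function_L2[OF adj_measurable[OF vm] r pairing_orbit_diff[OF less_imp_le[OF s] _ _ v2] c K0]
  show "(\<lambda>y. enn2real (adj v s y)) \<in> Lp 2 m" by (rule D(2))
  show "u \<in> Lp 2 m \<Longrightarrow> pairing m u (\<lambda>y. enn2real (adj v s y)) = pairing m (S s u) v" by (rule D(3))
qed

text \<open>Integrating the pairing of S(s)u with v over (b, b + h) gives a functional of u that is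
  bounded on L_2 and nonnegative on nonnegative functions. \<open>avg_adj\<close> represents it by
  Tonelli, so \<open>dual_function_L2\<close> applies.\<close>

lemma avg_adj_L2:
  assumes v: "test_function v" and b: "0 < b" "0 \<le> h"
  shows "AE y in m. avg_adj v b h y < \<infinity>" and "(\<lambda>y. enn2real (avg_adj v b h y)) \<in> Lp 2 m"
    and "u \<in> Lp 2 m \<Longrightarrow> pairing m u (\<lambda>y. enn2real (avg_adj v b h y)) = (LINT s:{b<..<b + h}|lborel. pairing m (S s u) v)"
proof -
  have vm: "v \<in> borel_measurable m" and v0: "\<And>x. 0 \<le> v x" using v by (auto simp: test_function_def)
  note v2 = test_function_L2[OF v]
  have b0: "0 \<le> b" using b by simp
  note si = pairing_orbit_integrable[OF _ v2 b0 b(2)]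
  obtain K where K: "1 \<le> K" "\<And>t u. 0 \<le> t \<Longrightarrow> t \<le> b + h \<Longrightarrow> u \<in> Lp 2 m \<Longrightarrow> norm2 m (S t u) \<le> K * norm2 m u"
    using locally_bounded[of "b + h"] by blast
  have c: "(LINT s:{b<..<b + h}|lborel. pairing m (S s u) v) \<le> (h * K * norm2 m v) * norm2 m u" if u: "u \<in> Lp 2 m" for u
  proof -
    have "(LINT s:{b<..<b + h}|lborel. pairing m (S s u) v) \<le> (LINT s:{b<..<b + h}|lborel. K * norm2 m u * norm2 m v)"
    proof (rule set_integral_mono[OF si[OF u]])
      show "set_integrable lborel {b<..<b + h} (\<lambda>s. K * norm2 m u * norm2 m v)"
        unfolding set_integrable_def using b by simp
      fix s assume s: "s \<in> {b<..<b + h}"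
      then have "pairing m (S s u) v \<le> norm2 m (S s u) * norm2 m v"
        using pairing_bound[OF T_L2[of s u] v2] b u by simp
      also have "\<dots> \<le> (K * norm2 m u) * norm2 m v"
        using s b u by (intro mult_right_mono K) auto
      finally show "pairing m (S s u) v \<le> K * norm2 m u * norm2 m v" .
    qed
    also have "\<dots> = (h * K * norm2 m v) * norm2 m u"
      using b by (simp add: set_lebesgue_integral_def)
    finally show ?thesis .
  qed
  have r: "(\<integral>\<^sup>+x. avg_adj v b h x * ennreal (u x) \<partial>m) = ennreal (LINT s:{b<..<b + h}|lborel. pairing m (S s u) v)" (is ?A)
    "0 \<le> (LINT s:{b<..<b + h}|lborel. pairing m (S s u) v)" (is ?B)
    if u: "u \<in> Lp 2 m" "\<And>x. 0 \<le> u x" for u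
  proof -
    have f: "pair_form v s u = ennreal (pairing m (S s u) v)" "0 \<le> pairing m (S s u) v" if "b < s" for s
      using pair_form_L2[OF _ u(1) _ v2 v0, of s] u(2) that b by auto
    show ?B unfolding set_lebesgue_integral_def
      using f by (intro integral_nonneg_AE AE_I2) (auto simp: indicator_def)
    have "(\<integral>\<^sup>+x. avg_adj v b h x * ennreal (u x) \<partial>m) = (\<integral>\<^sup>+s. ennreal (indicator {b<..<b + h} s *\<^sub>R pairing m (S s u) v) \<partial>lborel)"
      unfolding pair_form_avg_adj[OF vm L2_measurable[OF u(1)]]
      using f by (intro nn_integral_cong) (auto simp: indicator_def)
    also have "\<dots> = ennreal (LINT s:{b<..<b + h}|lborel. pairing m (S s u) v)"
      unfolding set_lebesgue_integral_def using si[OF u(1)] f unfolding set_integrable_def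
      by (intro nn_integral_eq_integral) (auto simp: indicator_def)
    finally show ?A .
  qed
  have d: "(LINT s:{b<..<b + h}|lborel. pairing m (S s (\<lambda>x. u x - u' x)) v) =
      (LINT s:{b<..<b + h}|lborel. pairing m (S s u) v) - (LINT s:{b<..<b + h}|lborel. pairing m (S s u') v)"
    if "u \<in> Lp 2 m" "u' \<in> Lp 2 m" for u u'
  proof -
    have "(LINT s:{b<..<b + h}|lborel. pairing m (S s (\<lambda>x. u x - u' x)) v) =
        (LINT s:{b<..<b + h}|lborel. pairing m (S s u) v - pairing m (S s u') v)"
      using b that by (intro set_lebesgue_integral_cong) (auto simp: pairing_orbit_diff v2)
    then show ?thesis using set_integral_diff(2)[OF si si] that by simp
  qed
  have K0: "0 \<le> h * K * norm2 m v" using K(1) b by simp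
  note D = dual_function_L2[OF avg_adj_measurable[OF vm] r d c K0]
  show "AE y in m. avg_adj v b h y < \<infinity>" by (rule D(1))
  show "(\<lambda>y. enn2real (avg_adj v b h y)) \<in> Lp 2 m" by (rule D(2))
  show "u \<in> Lp 2 m \<Longrightarrow> pairing m u (\<lambda>y. enn2real (avg_adj v b h y)) = (LINT s:{b<..<b + h}|lborel. pairing m (S s u) v)"
    by (rule D(3))
qed

end

section \<open>Admissibility of the averaged adjoint orbits\<close>

context lp_kernel_semigroup
begin

text \<open>Passage from extended to real exponents, separating the endpoint p = 1, where membership
  in L_p' means essential boundedness.\<close>

lemma p'_cases:
  obtains "p_real = 1" "p' = \<infinity>" | "1 < p_real" "p' \<noteq> \<infinity>" "1 < enn2real p'" "1 / p_real + 1 / enn2real p' = 1"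
proof -
  have p: "p = ennreal p_real" "1 \<le> p_real" using p_ne_top p_real_ge_1 by (auto simp: less_top)
  have ip: "1 / p = ennreal (1 / p_real)"
    using p by (metis divide_ennreal ennreal_1 less_le_trans zero_less_one zero_le_one)
  show ?thesis
  proof (cases "p' = \<infinity>")
    case True
    then have "ennreal (1 / p_real) = ennreal 1" using conjugate ip by simp
    then have "p_real = 1" using p(2) by (subst (asm) ennreal_inj) auto
    then show ?thesis using True that(1) by blast
  next
    case False
    define r where "r = enn2real p'"
    have r: "p' = ennreal r" "0 \<le> r" unfolding r_def using False by (auto simp: less_top)
    \<comment> \<open>Division by 0 gives \<infinity> in the extended reals, so p' = 0 would violate
      the conjugacy relation.\<close>
    have "r \<noteq> 0"
    proof
      assume "r = 0"
      then have "1 / p' = \<infinity>" using r(1) by (simp add: ennreal_divide_zero)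
      then show False using conjugate by simp
    qed
    then have r0: "0 < r" using r(2) by simp
    then have "1 / p' = ennreal (1 / r)" unfolding r(1) by (metis divide_ennreal ennreal_1 zero_le_one)
    then have "ennreal (1 / p_real + 1 / r) = ennreal 1"
      using conjugate ip p(2) r0 by (simp add: ennreal_plus[symmetric] del: ennreal_plus)
    then have eq: "1 / p_real + 1 / r = 1" using p(2) r0 by (subst (asm) ennreal_inj) auto
    have "0 < 1 / r" "0 < 1 / p_real" using r0 p(2) by auto
    then have "1 / p_real < 1" "1 / r < 1" using eq by linarith+
    then have "1 < p_real" "1 < r" using p(2) r0 by (auto simp: field_simps)
    then show ?thesis using that(2) False eq unfolding r_def by blast
  qed
qed

text \<open>As S acts on L_p, the pairing with \<phi> from the unit ball of L_p is bounded uniformly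
  for s in (b, b + h). Integration over s and the converse Hoelder inequality, or its endpoint
  version for p = 1, give membership in L_p'.\<close>

lemma avg_adj_Lp':
  assumes v: "test_function v" and b: "0 < b" "0 \<le> h"
  shows "(\<lambda>y. c * enn2real (avg_adj v b h y)) \<in> Lp p' m"
proof -
  have vm[measurable]: "v \<in> borel_measurable m" and vw: "\<And>x. 0 \<le> v x \<and> v x \<le> w x" using v by (auto simp: test_function_def)
  note [measurable] = avg_adj_measurable[OF vm, of b h]
  define W where "W y = enn2real (avg_adj v b h y)" for y
  have [measurable]: "W \<in> borel_measurable m" unfolding W_def by measurable
  have W0: "0 \<le> W x" for x unfolding W_def by simp
  obtain C where C: "\<And>(s::real) v \<phi> R. 0 < s \<Longrightarrow> s \<le> R \<Longrightarrow> v \<in> borel_measurable m \<Longrightarrow> (\<And>x. 0 \<le> v x \<and> v x \<le> w x) \<Longrightarrow>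
    \<phi> \<in> Lp p m \<Longrightarrow> (\<And>x. 0 \<le> \<phi> x) \<Longrightarrow> (\<integral>\<^sup>+x. ennreal (\<phi> x powr p_real) \<partial>m) \<le> ennreal 1 \<Longrightarrow> pair_form v s \<phi> \<le> ennreal (C R)"
    by (rule pair_form_Lp_bound[of 1]) blast
  define c' where "c' = h * max 0 (C (b + h))"
  have c'0: "0 \<le> c'" unfolding c'_def using b by simp
  have bd: "(\<integral>\<^sup>+x. ennreal (W x) * ennreal (\<phi> x) \<partial>m) \<le> ennreal c'"
    if \<phi>: "\<phi> \<in> borel_measurable m" "\<And>x. 0 \<le> \<phi> x" "(\<integral>\<^sup>+x. ennreal (\<phi> x powr p_real) \<partial>m) \<le> 1" for \<phi> :: "'a \<Rightarrow> real"
  proof -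
    have \<phi>p: "\<phi> \<in> Lp p m"
      unfolding Lp_iff using \<phi> by (auto intro!: integrableI_nonneg simp: le_less_trans)
    have "(\<integral>\<^sup>+x. ennreal (W x) * ennreal (\<phi> x) \<partial>m) \<le> (\<integral>\<^sup>+x. avg_adj v b h x * ennreal (\<phi> x) \<partial>m)"
      unfolding W_def by (intro nn_integral_mono mult_right_mono) (auto simp: ennreal_enn2real_if)
    also have "\<dots> = (\<integral>\<^sup>+s. indicator {b<..<b + h} s * pair_form v s \<phi> \<partial>lborel)"
      by (rule pair_form_avg_adj[OF vm \<phi>(1)])
    also have "\<dots> \<le> (\<integral>\<^sup>+s. ennreal (max 0 (C (b + h))) * indicator {b<..<b + h} s \<partial>lborel)"
    proof (rule nn_integral_mono)
      fix s :: real
      show "indicator {b<..<b + h} s * pair_form v s \<phi> \<le> ennreal (max 0 (C (b + h))) * indicator {b<..<b + h} s"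
      proof (cases "s \<in> {b<..<b + h}")
        case True
        then have "pair_form v s \<phi> \<le> ennreal (C (b + h))"
          using b \<phi> by (intro C vm vw \<phi>p) auto
        also have "\<dots> \<le> ennreal (max 0 (C (b + h)))" by (intro ennreal_leI) simp
        finally show ?thesis using True by simp
      qed simp
    qed
    also have "\<dots> = ennreal (max 0 (C (b + h))) * ennreal h"
      using b by (subst nn_integral_cmult) auto
    also have "\<dots> = ennreal c'" unfolding c'_def using b by (simp add: ennreal_mult[symmetric] mult.commute)
    finally show ?thesis .
  qed
  show ?thesis
  proof (rule p'_cases)
    assume p1: "p_real = 1" "p' = \<infinity>"
    have "AE x in m. W x \<le> c'"
      by (rule converse_Hoelder_L1[OF _ W0 c'0 bd]) (auto simp: p1 powr_one)
    then have "AE x in m. \<bar>c * W x\<bar> \<le> \<bar>c\<bar> * c'"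
      by eventually_elim (use W0 in \<open>auto simp: abs_mult intro!: mult_left_mono\<close>)
    then show ?thesis unfolding Lp_def W_def[symmetric] using p1(2) by auto
  next
    assume p2: "1 < p_real" "p' \<noteq> \<infinity>" "1 < enn2real p'" "1 / p_real + 1 / enn2real p' = 1"
    have "integrable m (\<lambda>x. W x powr enn2real p')"
      by (rule converse_Hoelder[OF _ W0 p2(1,3,4) c'0 bd]) auto
    then have "integrable m (\<lambda>x. \<bar>c\<bar> powr enn2real p' * W x powr enn2real p')" by simp
    then have "integrable m (\<lambda>x. \<bar>c * W x\<bar> powr enn2real p')"
      using W0 by (simp add: abs_mult powr_mult)
    then show ?thesis unfolding Lp_def W_def[symmetric] using p2(2) by auto
  qed
qed

lemma avg_adj_pairing:
  assumes v: "test_function v" and b: "0 < b" "0 \<le> h" and f[measurable]: "f \<in> borel_measurable m" and f0: "\<And>x. 0 \<le> f x"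
  shows "pairing m f (\<lambda>y. enn2real (avg_adj v b h y)) = enn2real (\<integral>\<^sup>+s. indicator {b<..<b + h} s * pair_form v s f \<partial>lborel)"
proof -
  have vm: "v \<in> borel_measurable m" using v by (auto simp: test_function_def)
  note [measurable] = avg_adj_measurable[OF vm, of b h]
  have "pairing m f (\<lambda>y. enn2real (avg_adj v b h y)) = enn2real (\<integral>\<^sup>+x. ennreal (f x * enn2real (avg_adj v b h x)) \<partial>m)"
    unfolding pairing_def using f0 by (intro integral_eq_nn_integral) auto
  also have "(\<integral>\<^sup>+x. ennreal (f x * enn2real (avg_adj v b h x)) \<partial>m) = (\<integral>\<^sup>+x. avg_adj v b h x * ennreal (f x) \<partial>m)"
  proof (rule nn_integral_cong_AE)
    show "AE x in m. ennreal (f x * enn2real (avg_adj v b h x)) = avg_adj v b h x * ennreal (f x)"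
      using avg_adj_L2(1)[OF v b] by eventually_elim (use f0 in \<open>simp add: ennreal_mult mult.commute\<close>)
  qed
  finally show ?thesis using pair_form_avg_adj[OF vm f] by simp
qed

text \<open>Tested against u, the semigroup law turns the quotient into 1 / h times a difference
  quotient at b of the function \<open>P\<close>, the window integral of the pairing of S(s)u with
  v. Its derivative is the difference of this pairing at b + h and at b, which the two adjoint
  orbits represent.\<close>

lemma avg_adj_generator:
  assumes v: "test_function v" and b: "0 < b" "0 < h"
  shows "(\<lambda>y. (1 / h) * enn2real (avg_adj v b h y),
      \<lambda>y. (1 / h) * (enn2real (adj v (b + h) y) - enn2real (adj v b y))) \<in> weak_star_generator_L2 m S"
proof -
  note v2 = test_function_L2[OF v]
  have bh: "0 < b + h" "0 \<le> h" "0 \<le> b" using b by auto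
  note W2 = avg_adj_L2(2)[OF v b(1) bh(2)]
  have Z2: "(\<lambda>y. enn2real (adj v (b + h) y) - enn2real (adj v b y)) \<in> Lp 2 m"
    by (intro L2_diff(1) adj_L2(1) v b bh)
  have "((\<lambda>t. (1 / t) * (pairing m (S t u) (\<lambda>y. (1 / h) * enn2real (avg_adj v b h y)) - pairing m u (\<lambda>y. (1 / h) * enn2real (avg_adj v b h y))))
      \<longlongrightarrow> pairing m u (\<lambda>y. (1 / h) * (enn2real (adj v (b + h) y) - enn2real (adj v b y)))) (at_right 0)"
    if u: "u \<in> Lp 2 m" for u
  proof -
    define g where "g s = pairing m (S (max 0 s) u) v" for s
    have gc: "continuous_on UNIV g" unfolding g_def by (rule pairing_orbit_continuous[OF u v2])
    define P where "P a = integral {0..h} (\<lambda>x. g (a + x))" for a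
    have Pd: "(P has_real_derivative (g (b + h) - g b)) (at b)"
      unfolding P_def by (rule window_integral_has_derivative[OF gc bh(2)])
    have shift: "pairing m (S r (S t u)) v = g (r + t)" if "0 \<le> r" "0 \<le> t" for r t
    proof -
      have "pairing m (S (r + t) u) v = pairing m (S r (S t u)) v"
        using that u v2 by (intro pairing_cong_AE T_add L2_measurable[OF T_L2] L2_measurable[OF v2] T_L2) auto
      then show ?thesis unfolding g_def using that by simp
    qed
    have c: "pairing m z (\<lambda>y. (1 / h) * Y y) = (1 / h) * pairing m z Y" for z Y
      unfolding pairing_def by (simp add: mult.left_commute)
    have W: "pairing m (S t u) (\<lambda>y. (1 / h) * enn2real (avg_adj v b h y)) = (1 / h) * P (b + t)" if t: "0 \<le> t" for t
    proof -
      have "pairing m (S t u) (\<lambda>y. enn2real (avg_adj v b h y)) = (LINT s:{b<..<b + h}|lborel. pairing m (S s (S t u)) v)"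
        using t u by (intro avg_adj_L2(3)[OF v b(1) bh(2)] T_L2)
      also have "\<dots> = (LINT s:{b<..<b + h}|lborel. g (s + t))"
        using b t by (intro set_lebesgue_integral_cong) (auto simp: shift)
      also have "\<dots> = integral {0..h} (\<lambda>x. g (b + x + t))"
        by (rule LBINT_window(1)[OF _ bh(2)]) (intro continuous_on_compose2[OF gc] continuous_intros, auto)
      finally show ?thesis unfolding c P_def by (simp add: ac_simps)
    qed
    have W0: "pairing m u (\<lambda>y. (1 / h) * enn2real (avg_adj v b h y)) = (1 / h) * P b"
    proof -
      have "pairing m u (\<lambda>y. (1 / h) * enn2real (avg_adj v b h y)) = pairing m (S 0 u) (\<lambda>y. (1 / h) * enn2real (avg_adj v b h y))"
        using T_zero[OF u] u by (intro pairing_cong_AE L2_measurable L2_cmult(1) W2 T_L2) auto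
      then show ?thesis using W[of 0] by simp
    qed
    have Z: "pairing m u (\<lambda>y. (1 / h) * (enn2real (adj v (b + h) y) - enn2real (adj v b y))) = (1 / h) * (g (b + h) - g b)"
    proof -
      have "pairing m u (\<lambda>y. enn2real (adj v (b + h) y) - enn2real (adj v b y)) =
          pairing m u (\<lambda>y. enn2real (adj v (b + h) y)) - pairing m u (\<lambda>y. enn2real (adj v b y))"
        unfolding pairing_def using u adj_L2(1)[OF v b(1)] adj_L2(1)[OF v bh(1)]
        by (simp add: right_diff_distrib L2_mult_integrable)
      also have "\<dots> = g (b + h) - g b"
        unfolding g_def using adj_L2(2)[OF v b(1) u] adj_L2(2)[OF v bh(1) u] bh by simp
      finally show ?thesis unfolding c by simp
    qed
    have "((\<lambda>t. (P (b + t) - P b) / t) \<longlongrightarrow> g (b + h) - g b) (at 0)"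
      using Pd by (simp add: DERIV_def)
    then have "((\<lambda>t. (P (b + t) - P b) / t) \<longlongrightarrow> g (b + h) - g b) (at_right 0)"
      by (rule tendsto_mono[rotated]) (simp add: at_le)
    then have "((\<lambda>t. (1 / h) * ((P (b + t) - P b) / t)) \<longlongrightarrow> (1 / h) * (g (b + h) - g b)) (at_right 0)"
      by (intro tendsto_intros)
    moreover have "\<forall>\<^sub>F t in at_right 0. (1 / h) * ((P (b + t) - P b) / t) =
        (1 / t) * (pairing m (S t u) (\<lambda>y. (1 / h) * enn2real (avg_adj v b h y)) - pairing m u (\<lambda>y. (1 / h) * enn2real (avg_adj v b h y)))"
      unfolding eventually_at_right_field
    proof (intro exI[of _ 1] conjI allI impI)
      fix t :: real assume t: "0 < t" "t < 1"
      show "(1 / h) * ((P (b + t) - P b) / t) =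
        (1 / t) * (pairing m (S t u) (\<lambda>y. (1 / h) * enn2real (avg_adj v b h y)) - pairing m u (\<lambda>y. (1 / h) * enn2real (avg_adj v b h y)))"
        unfolding W[OF less_imp_le[OF t(1)]] W0 using b t by (simp add: field_simps)
    qed simp
    ultimately show ?thesis unfolding Z by (rule Lim_transform_eventually)
  qed
  then show ?thesis
    unfolding weak_star_generator_L2_def using L2_cmult(1)[OF W2, of "1 / h"] L2_cmult(1)[OF Z2, of "1 / h"] by blast
qed

end

section \<open>Domination of \<open>T\<close>\<close>

text \<open>The function \<open>f\<close> is nonnegative at every point here; the theorem's almost
  everywhere assumption is reduced to this by changing f on a null set.\<close>

locale semigroup_comparison = lp_kernel_semigroup m S w p p' kS + T: positive_semigroup m T
  for m :: "'a measure" and S w p p' kS and T :: "real \<Rightarrow> ('a \<Rightarrow> real) \<Rightarrow> ('a \<Rightarrow> real)" +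
  fixes M \<omega> C0 :: real and f :: "'a \<Rightarrow> real"
  assumes M_ge_1: "1 \<le> M" and acts_T: "acts_on_Lp_with 1 m T M \<omega>"
    and f_Lp: "f \<in> Lp p m" and f_nonneg: "0 \<le> f x" and C0_nonneg: "0 \<le> C0"
    and form_inequality: "\<And>u Au v' Av'.
      (u, Au) \<in> generator_L2 m T \<Longrightarrow> u \<in> Lp 1 m \<Longrightarrow> (AE x in m. 0 \<le> u x) \<Longrightarrow>
      (v', Av') \<in> weak_star_generator_L2 m S \<Longrightarrow> v' \<in> Lp p' m \<Longrightarrow> (AE x in m. 0 \<le> v' x) \<Longrightarrow>
      pairing m Au v' \<le> pairing m u Av' + C0 * Lp_norm 1 m u * pairing m f v'"
begin

lemma f_measurable[measurable]: "f \<in> borel_measurable m"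
  using f_Lp by (simp add: Lp_iff)

lemma T_L1:
  assumes "0 \<le> t" "u \<in> Lp 2 m" "integrable m u"
  shows "integrable m (T t u)" "(LINT x|m. \<bar>T t u x\<bar>) \<le> M * exp (\<omega> * t) * (LINT x|m. \<bar>u x\<bar>)"
proof -
  have "u \<in> Lp 2 m \<inter> Lp 1 m" using assms by (simp add: Lp_1_iff)
  then have "T t u \<in> Lp 1 m \<and> Lp_norm 1 m (T t u) \<le> M * exp (\<omega> * t) * Lp_norm 1 m u"
    using acts_T assms(1) unfolding acts_on_Lp_with_def by blast
  then show "integrable m (T t u)" "(LINT x|m. \<bar>T t u x\<bar>) \<le> M * exp (\<omega> * t) * (LINT x|m. \<bar>u x\<bar>)"
    by (auto simp: Lp_1_iff Lp_norm_1)
qed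

lemma pair_form_f_bound:
  obtains B where "0 \<le> B" "\<And>s v. 0 < s \<Longrightarrow> s \<le> R \<Longrightarrow> test_function v \<Longrightarrow> pair_form v s f \<le> ennreal B"
proof -
  have i: "integrable m (\<lambda>x. f x powr p_real)" using f_Lp f_nonneg by (simp add: Lp_iff)
  obtain C where C: "\<And>(s::real) v \<phi> R. 0 < s \<Longrightarrow> s \<le> R \<Longrightarrow> v \<in> borel_measurable m \<Longrightarrow> (\<And>x. 0 \<le> v x \<and> v x \<le> w x) \<Longrightarrow>
    \<phi> \<in> Lp p m \<Longrightarrow> (\<And>x. 0 \<le> \<phi> x) \<Longrightarrow> (\<integral>\<^sup>+x. ennreal (\<phi> x powr p_real) \<partial>m) \<le> ennreal (LINT x|m. f x powr p_real) \<Longrightarrow>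
    pair_form v s \<phi> \<le> ennreal (C R)"
    by (rule pair_form_Lp_bound[of "LINT x|m. f x powr p_real"]) blast
  show ?thesis
  proof (rule that[of "max 0 (C R)"])
    fix s :: real and v assume s: "0 < s" "s \<le> R" and v: "test_function v"
    have "pair_form v s f \<le> ennreal (C R)"
      using v f_Lp f_nonneg i by (intro C s) (auto simp: test_function_def nn_integral_eq_integral)
    also have "\<dots> \<le> ennreal (max 0 (C R))" by (intro ennreal_leI) simp
    finally show "pair_form v s f \<le> ennreal (max 0 (C R))" .
  qed simp
qed

text \<open>\<open>max 0\<close> extends the function to negative times, since the comparison
  argument works with continuous functions on the whole plane.\<close>

definition G :: "('a \<Rightarrow> real) \<Rightarrow> ('a \<Rightarrow> real) \<Rightarrow> real \<times> real \<Rightarrow> real" where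
  "G u v q = pairing m (S (max 0 (snd q)) (T (max 0 (fst q)) u)) v"

text \<open>A change in the first time is absorbed by the bound of S on bounded intervals, applied
  to the difference of two values of the orbit of u under T. What remains is a single orbit of S
  with fixed initial value.\<close>

lemma G_continuous:
  assumes u: "u \<in> Lp 2 m" and v: "v \<in> Lp 2 m"
  shows "continuous_on UNIV (G u v)"
  unfolding continuous_on_iff
proof (intro ballI allI impI)
  fix q0 :: "real \<times> real" and e :: real assume e: "0 < e"
  obtain a b where q0: "q0 = (a, b)" by (cases q0)
  define R where "R = \<bar>a\<bar> + \<bar>b\<bar> + 1"
  obtain K where K: "1 \<le> K" "\<And>t u. 0 \<le> t \<Longrightarrow> t \<le> R \<Longrightarrow> u \<in> Lp 2 m \<Longrightarrow> norm2 m (S t u) \<le> K * norm2 m u"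
    using locally_bounded[of R] by blast
  \<comment> \<open>Adding 1 keeps the divisor positive when v has norm 0.\<close>
  define e' where "e' = e / 2 / (K * (norm2 m v + 1))"
  have pos: "0 < K * (norm2 m v + 1)" using norm2_nonneg[of m v] K(1) by (intro mult_pos_pos) linarith+
  then have e': "0 < e'" unfolding e'_def using e by simp
  obtain \<delta> where \<delta>: "0 < \<delta>" "\<And>r t. 0 \<le> r \<Longrightarrow> r \<le> R \<Longrightarrow> 0 \<le> t \<Longrightarrow> t \<le> R \<Longrightarrow> \<bar>r - t\<bar> < \<delta> \<Longrightarrow>
      norm2 m (\<lambda>x. T r u x - T t u x) < e'"
    by (rule T.uniformly_continuous[OF u e', of R]) blast
  define z where "z = T (max 0 a) u"
  have z: "z \<in> Lp 2 m" unfolding z_def using u by (intro T.T_L2) auto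
  obtain \<delta>2 where \<delta>2: "0 < \<delta>2" "\<And>r. dist r b < \<delta>2 \<Longrightarrow> dist (pairing m (S (max 0 r) z) v) (pairing m (S (max 0 b) z) v) < e / 2"
    using pairing_orbit_continuous[OF z v] e unfolding continuous_on_iff by (metis UNIV_I half_gt_zero)
  have "dist (G u v q) (G u v q0) < e" if d: "dist q q0 < min (min \<delta> \<delta>2) 1" for q
  proof -
    obtain c r where q: "q = (c, r)" by (cases q)
    have "dist c a \<le> dist q q0" "dist r b \<le> dist q q0"
      unfolding q q0 using dist_fst_le[of "(c, r)" "(a, b)"] dist_snd_le[of "(c, r)" "(a, b)"] by auto
    then have cr: "\<bar>c - a\<bar> < \<delta>" "\<bar>c - a\<bar> < 1" "dist r b < \<delta>2" "\<bar>r - b\<bar> < 1" using d by (auto simp: dist_real_def)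
    have r: "0 \<le> max 0 r" "max 0 r \<le> R" "0 \<le> max 0 c" "max 0 c \<le> R" "0 \<le> max 0 a" "max 0 a \<le> R"
      using cr unfolding R_def by auto
    have Tc: "T (max 0 c) u \<in> Lp 2 m" using u by (intro T.T_L2) auto
    have "G u v q - pairing m (S (max 0 r) z) v = pairing m (S (max 0 r) (\<lambda>x. T (max 0 c) u x - z x)) v"
      unfolding G_def q using pairing_orbit_diff[OF r(1) Tc z v] by simp
    also have "\<bar>\<dots>\<bar> \<le> norm2 m (S (max 0 r) (\<lambda>x. T (max 0 c) u x - z x)) * norm2 m v"
      by (intro pairing_bound v T_L2 L2_diff(1) Tc z r)
    also have "\<dots> \<le> (K * norm2 m (\<lambda>x. T (max 0 c) u x - z x)) * norm2 m v"
      by (intro mult_right_mono K L2_diff(1) Tc z r norm2_nonneg)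
    also have "\<dots> \<le> (K * e') * norm2 m v"
    proof (intro mult_right_mono mult_left_mono norm2_nonneg)
      have "\<bar>max 0 c - max 0 a\<bar> < \<delta>" using cr(1) by (auto simp: max_def abs_if split: if_splits)
      then show "norm2 m (\<lambda>x. T (max 0 c) u x - z x) \<le> e'"
        unfolding z_def using r by (intro less_imp_le[OF \<delta>(2)]) auto
    qed (use K in auto)
    also have "\<dots> \<le> (K * e') * (norm2 m v + 1)" using K(1) e' by (intro mult_left_mono) auto
    also have "\<dots> = e / 2" unfolding e'_def using pos K(1) by (simp add: field_simps)
    finally have "\<bar>G u v q - pairing m (S (max 0 r) z) v\<bar> \<le> e / 2" .
    moreover have "dist (pairing m (S (max 0 r) z) v) (G u v q0) < e / 2"
      using \<delta>2(2)[OF cr(3)] unfolding G_def q0 z_def by simp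
    ultimately show ?thesis unfolding dist_real_def by linarith
  qed
  then show "\<exists>d>0. \<forall>q\<in>UNIV. dist q q0 < d \<longrightarrow> dist (G u v q) (G u v q0) < e"
    using \<delta>(1) \<delta>2(1) by (intro exI[of _ "min (min \<delta> \<delta>2) 1"]) auto
qed

lemma G_eq: "0 \<le> q \<Longrightarrow> 0 \<le> r \<Longrightarrow> G u v (q, r) = pairing m (S r (T q u)) v"
  by (simp add: G_def)

text \<open>Both generators send averages to differences of endpoint values, so the two pairings in
  the form inequality become integrals of \<open>G\<close> over the four sides of the square with
  corner (a, b). Multiplying by h^2 clears the normalisations and leaves one factor h in the
  perturbation term.\<close>

lemma window_step:
  assumes u: "u \<in> Lp 2 m" "integrable m u" "AE x in m. 0 \<le> u x" and v: "test_function v"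
    and h: "0 < h" and a: "0 \<le> a" and b: "0 < b"
  shows "integral {0..h} (\<lambda>y. G u v (a + h, b + y)) - integral {0..h} (\<lambda>y. G u v (a, b + y)) \<le>
      integral {0..h} (\<lambda>x. G u v (a + x, b + h)) - integral {0..h} (\<lambda>x. G u v (a + x, b)) +
      h * (C0 * (M * exp (\<omega> * a) * exp (\<bar>\<omega>\<bar> * h) * (LINT x|m. \<bar>u x\<bar>)) *
        enn2real (\<integral>\<^sup>+s. indicator {b<..<b + h} s * pair_form v s f \<partial>lborel))"
proof -
  note v2 = test_function_L2[OF v]
  have h0: "0 \<le> h" "0 \<le> b" "0 < b + h" using h b by auto
  have Gc: "continuous_on UNIV (\<lambda>x. G u v (g x, g' x))" if "continuous_on UNIV g" "continuous_on UNIV g'" for g g' :: "real \<Rightarrow> real"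
    by (rule continuous_on_compose2[OF G_continuous[OF u(1) v2]]) (use that in \<open>auto intro!: continuous_intros\<close>)
  define u0 where "u0 = T a u"
  have u0: "u0 \<in> Lp 2 m" "AE x in m. 0 \<le> u0 x"
    unfolding u0_def by (rule T.T_L2[OF a u(1)], rule T.T_nonneg[OF a u(1,3)])
  have Tu0: "AE x in m. T q u0 x = T (a + q) u x" if "0 \<le> q" for q
    using T.T_add[OF that a u(1)] unfolding u0_def by eventually_elim (simp add: add.commute)
  have ST: "pairing m (S r (T q u0)) v = G u v (a + q, r)" if "0 \<le> q" "0 \<le> r" for q r
  proof -
    have "AE x in m. S r (T q u0) x = S r (T (a + q) u) x"
      using that a u u0 by (intro positive_operator_L2D(2)[OF positive_operator] T.T_L2 Tu0) auto
    then have "pairing m (S r (T q u0)) v = pairing m (S r (T (a + q) u)) v"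
      using that a u u0 v2 by (intro pairing_cong_AE L2_measurable[OF T_L2] L2_measurable[OF v2] T.T_L2) auto
    then show ?thesis using that a by (simp add: G_eq)
  qed
  have S0: "pairing m (S r u0) v = G u v (a, r)" if "0 \<le> r" for r
    unfolding u0_def using that a by (simp add: G_eq)
  obtain U where U: "T.orbit_version u0 U" using T.ex_orbit_version[OF u0(1)] by blast
  define I where "I = T.orbit_integral U 0 h"
  have I2: "I \<in> Lp 2 m" unfolding I_def by (rule T.orbit_integrable(2)[OF U u0(1) order_refl h0(1)])
  define W where "W y = enn2real (avg_adj v b h y)" for y
  define Z where "Z y = enn2real (adj v (b + h) y) - enn2real (adj v b y)" for y
  have W2: "W \<in> Lp 2 m" unfolding W_def by (rule avg_adj_L2(2)[OF v b h0(1)])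
  have Z2: "Z \<in> Lp 2 m" unfolding Z_def by (intro L2_diff(1) adj_L2(1) v b h0)
  \<comment> \<open>The factor exp(|\<omega>| h) covers all s in (0, h) for either sign of \<omega>,
    and it tends to 1 with h.\<close>
  define c where "c = M * exp (\<omega> * a) * exp (\<bar>\<omega>\<bar> * h) * (LINT x|m. \<bar>u x\<bar>)"
  have c0: "0 \<le> c" unfolding c_def using M_ge_1 by (intro mult_nonneg_nonneg integral_nonneg_AE) auto
  \<comment> \<open>The L_1 bound is applied to T(a + s)u as a whole; bounding T(a) and T(s)
    separately would produce M^2.\<close>
  have L1: "integrable m (T s u0) \<and> (LINT x|m. \<bar>T s u0 x\<bar>) \<le> c" if s: "0 < s" "s < h" for s
  proof -
    have as: "0 \<le> a + s" using s a by simp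
    note m1 = T.T_measurable[OF less_imp_le[OF s(1)] u0(1)] and m2 = T.T_measurable[OF as u(1)]
    have "integrable m (T s u0)"
      using T_L1(1)[OF as u(1,2)] by (rule integrable_cong_AE_imp) (use m1 Tu0[of s] s in auto)
    moreover have "(LINT x|m. \<bar>T s u0 x\<bar>) = (LINT x|m. \<bar>T (a + s) u x\<bar>)"
      using m1 m2 Tu0[of s] s by (intro integral_cong_AE) auto
    moreover have "\<dots> \<le> M * exp (\<omega> * (a + s)) * (LINT x|m. \<bar>u x\<bar>)" by (rule T_L1(2)[OF as u(1,2)])
    moreover have "\<dots> \<le> c"
    proof -
      have "\<omega> * s \<le> \<bar>\<omega>\<bar> * s" using s by (intro mult_right_mono) auto
      also have "\<dots> \<le> \<bar>\<omega>\<bar> * h" using s by (intro mult_left_mono) auto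
      finally have "exp (\<omega> * (a + s)) \<le> exp (\<omega> * a) * exp (\<bar>\<omega>\<bar> * h)"
        by (simp add: exp_add[symmetric] distrib_left)
      then have "M * exp (\<omega> * (a + s)) \<le> M * (exp (\<omega> * a) * exp (\<bar>\<omega>\<bar> * h))"
        using M_ge_1 by (intro mult_left_mono) auto
      then have "M * exp (\<omega> * (a + s)) * (LINT x|m. \<bar>u x\<bar>) \<le> M * (exp (\<omega> * a) * exp (\<bar>\<omega>\<bar> * h)) * (LINT x|m. \<bar>u x\<bar>)"
        by (rule mult_right_mono) (auto intro: integral_nonneg_AE)
      then show ?thesis unfolding c_def by (simp only: mult.assoc)
    qed
    ultimately show ?thesis by linarith
  qed
  note avg = T.orbit_average_L1[OF U u0 h L1 c0]
  have "pairing m (\<lambda>x. (1 / h) * (T h u0 x - u0 x)) (\<lambda>y. (1 / h) * W y) \<le>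
      pairing m (\<lambda>x. (1 / h) * I x) (\<lambda>y. (1 / h) * Z y) + C0 * Lp_norm 1 m (\<lambda>x. (1 / h) * I x) * pairing m f (\<lambda>y. (1 / h) * W y)"
  proof (rule form_inequality)
    show "(\<lambda>x. (1 / h) * I x, \<lambda>x. (1 / h) * (T h u0 x - u0 x)) \<in> generator_L2 m T"
      unfolding I_def by (rule T.orbit_average_generator[OF U u0(1) h])
    show "(\<lambda>x. (1 / h) * I x) \<in> Lp 1 m" "AE x in m. 0 \<le> (1 / h) * I x"
      unfolding I_def Lp_1_iff using avg by auto
    show "(\<lambda>y. (1 / h) * W y, \<lambda>y. (1 / h) * Z y) \<in> weak_star_generator_L2 m S"
      unfolding W_def Z_def by (rule avg_adj_generator[OF v b h])
    show "(\<lambda>y. (1 / h) * W y) \<in> Lp p' m"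
      unfolding W_def by (rule avg_adj_Lp'[OF v b h0(1)])
    show "AE x in m. 0 \<le> 1 / h * W x" unfolding W_def using h by simp
  qed
  moreover have pc: "pairing m (\<lambda>x. (1 / h) * X x) (\<lambda>y. (1 / h) * Y y) = (1 / h\<^sup>2) * pairing m X Y" for X Y
  proof -
    have "pairing m (\<lambda>x. (1 / h) * X x) (\<lambda>y. (1 / h) * Y y) = (LINT x|m. (1 / h\<^sup>2) * (X x * Y x))"
      unfolding pairing_def by (intro Bochner_Integration.integral_cong refl) (simp add: power2_eq_square)
    then show ?thesis unfolding pairing_def by simp
  qed
  moreover have "pairing m f (\<lambda>y. (1 / h) * W y) = (1 / h) * pairing m f W"
    unfolding pairing_def by (simp add: mult.left_commute)
  ultimately have ineq: "(1 / h\<^sup>2) * pairing m (\<lambda>x. T h u0 x - u0 x) W \<le>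
      (1 / h\<^sup>2) * pairing m I Z + C0 * Lp_norm 1 m (\<lambda>x. (1 / h) * I x) * ((1 / h) * pairing m f W)" by simp
  have fW: "pairing m f W = enn2real (\<integral>\<^sup>+s. indicator {b<..<b + h} s * pair_form v s f \<partial>lborel)"
    unfolding W_def by (rule avg_adj_pairing[OF v b h0(1) f_measurable f_nonneg])
  have "C0 * Lp_norm 1 m (\<lambda>x. (1 / h) * I x) * ((1 / h) * pairing m f W) \<le> C0 * c * ((1 / h) * pairing m f W)"
    using avg(2) C0_nonneg h unfolding Lp_norm_1 I_def fW by (intro mult_right_mono mult_left_mono) auto
  with ineq have "(1 / h\<^sup>2) * pairing m (\<lambda>x. T h u0 x - u0 x) W \<le> (1 / h\<^sup>2) * pairing m I Z + C0 * c * ((1 / h) * pairing m f W)"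
    by linarith
  then have "h\<^sup>2 * ((1 / h\<^sup>2) * pairing m (\<lambda>x. T h u0 x - u0 x) W) \<le> h\<^sup>2 * ((1 / h\<^sup>2) * pairing m I Z + C0 * c * ((1 / h) * pairing m f W))"
    by (intro mult_left_mono) auto
  then have main: "pairing m (\<lambda>x. T h u0 x - u0 x) W \<le> pairing m I Z + h * (C0 * c * pairing m f W)"
    using h by (simp add: distrib_left power2_eq_square mult_ac)
  have "pairing m (\<lambda>x. T h u0 x - u0 x) W = pairing m (T h u0) W - pairing m u0 W"
    using h by (intro pairing_diff_left T.T_L2 u0 W2) auto
  also have "pairing m (T h u0) W = (LINT s:{b<..<b + h}|lborel. pairing m (S s (T h u0)) v)"
    unfolding W_def using h by (intro avg_adj_L2(3)[OF v b h0(1)] T.T_L2 u0) auto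
  also have "\<dots> = (LINT s:{b<..<b + h}|lborel. G u v (a + h, s))"
    using h b by (intro set_lebesgue_integral_cong) (auto simp: ST)
  also have "\<dots> = integral {0..h} (\<lambda>y. G u v (a + h, b + y))"
    by (intro LBINT_window(1) Gc h0 continuous_intros)
  also have "pairing m u0 W = (LINT s:{b<..<b + h}|lborel. pairing m (S s u0) v)"
    unfolding W_def by (intro avg_adj_L2(3)[OF v b h0(1)] u0)
  also have "\<dots> = (LINT s:{b<..<b + h}|lborel. G u v (a, s))"
    using b by (intro set_lebesgue_integral_cong) (auto simp: S0)
  also have "\<dots> = integral {0..h} (\<lambda>y. G u v (a, b + y))"
    by (intro LBINT_window(1) Gc h0 continuous_intros)
  finally have e1: "pairing m (\<lambda>x. T h u0 x - u0 x) W =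
    integral {0..h} (\<lambda>y. G u v (a + h, b + y)) - integral {0..h} (\<lambda>y. G u v (a, b + y))" .
  \<comment> \<open>The generator applied to the averaged adjoint orbit yields the two sides of the
    square on which the second time is constant.\<close>
  have pz: "pairing m (T q u0) Z = G u v (a + q, b + h) - G u v (a + q, b)" if q: "0 \<le> q" for q
  proof -
    have Tq: "T q u0 \<in> Lp 2 m" using q u0 by (intro T.T_L2)
    have "pairing m (T q u0) Z = pairing m (T q u0) (\<lambda>y. enn2real (adj v (b + h) y)) - pairing m (T q u0) (\<lambda>y. enn2real (adj v b y))"
      unfolding Z_def pairing_def using Tq adj_L2(1)[OF v b] adj_L2(1)[OF v h0(3)]
      by (simp add: right_diff_distrib L2_mult_integrable)
    then show ?thesis using adj_L2(2)[OF v b Tq] adj_L2(2)[OF v h0(3) Tq] ST q h0 by simp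
  qed
  have "pairing m I Z = (LINT q:{0<..<h}|lborel. pairing m (T q u0) Z)"
    unfolding I_def by (rule T.orbit_integral_pairing[OF U u0(1) Z2 h0(1)])
  also have "\<dots> = (LINT q:{0<..<h}|lborel. G u v (a + q, b + h) - G u v (a + q, b))"
    by (intro set_lebesgue_integral_cong) (auto simp: pz)
  also have "\<dots> = integral {0..h} (\<lambda>x. G u v (a + x, b + h) - G u v (a + x, b))"
  proof -
    have "continuous_on UNIV (\<lambda>q. G u v (a + q, b + h) - G u v (a + q, b))"
      by (intro continuous_on_diff Gc continuous_intros)
    from LBINT_window(1)[OF this h0(1), of 0] show ?thesis by simp
  qed
  also have "\<dots> = integral {0..h} (\<lambda>x. G u v (a + x, b + h)) - integral {0..h} (\<lambda>x. G u v (a + x, b))"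
    by (intro Henstock_Kurzweil_Integration.integral_diff integrable_continuous_real continuous_on_subset[OF Gc] continuous_intros) auto
  finally show ?thesis using main unfolding e1 fW c_def by linarith
qed

end

text \<open>Test on the set where \<open>\<beta>\<close> < \<open>\<alpha>\<close>. Finiteness
  permits subtraction of the integrals, and the difference is the integral of a function that is
  positive there because \<open>w\<close> is, so the set is null.\<close>

lemma (in weighted_measure) AE_le_of_weighted_integrals:
  fixes \<alpha> \<beta> :: "'a \<Rightarrow> ennreal"
  assumes [measurable]: "\<alpha> \<in> borel_measurable m" "\<beta> \<in> borel_measurable m"
    and fin: "(\<integral>\<^sup>+x. ennreal (w x) * \<beta> x \<partial>m) \<noteq> \<infinity>"
    and le: "\<And>A. A \<in> sets m \<Longrightarrow> (\<integral>\<^sup>+x. ennreal (w x * indicator A x) * \<alpha> x \<partial>m) \<le> (\<integral>\<^sup>+x. ennreal (w x * indicator A x) * \<beta> x \<partial>m)"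
  shows "AE x in m. \<alpha> x \<le> \<beta> x"
proof -
  define A where "A = {x \<in> space m. \<beta> x < \<alpha> x}"
  have A[measurable]: "A \<in> sets m" unfolding A_def by measurable
  have finA: "(\<integral>\<^sup>+x. ennreal (w x * indicator A x) * \<beta> x \<partial>m) \<noteq> \<infinity>"
  proof -
    have "(\<integral>\<^sup>+x. ennreal (w x * indicator A x) * \<beta> x \<partial>m) \<le> (\<integral>\<^sup>+x. ennreal (w x) * \<beta> x \<partial>m)"
      by (intro nn_integral_mono mult_right_mono ennreal_leI) (auto simp: indicator_def)
    then show ?thesis using fin by (auto simp: top_unique)
  qed
  have "(\<integral>\<^sup>+x. ennreal (w x * indicator A x) * \<alpha> x - ennreal (w x * indicator A x) * \<beta> x \<partial>m) =
      (\<integral>\<^sup>+x. ennreal (w x * indicator A x) * \<alpha> x \<partial>m) - (\<integral>\<^sup>+x. ennreal (w x * indicator A x) * \<beta> x \<partial>m)"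
    using finA by (intro nn_integral_diff) (auto simp: A_def indicator_def intro!: mult_left_mono AE_I2)
  also have "\<dots> = 0" using le[OF A] finA by (intro diff_eq_0_ennreal) (auto simp: less_top)
  finally have z: "AE x in m. ennreal (w x * indicator A x) * \<alpha> x - ennreal (w x * indicator A x) * \<beta> x = 0"
    by (subst (asm) nn_integral_0_iff_AE) auto
  have "AE x in m. ennreal (w x * indicator A x) * \<beta> x \<noteq> \<infinity>"
    using finA by (intro nn_integral_PInf_AE) auto
  with z show ?thesis using AE_space
  proof eventually_elim
    case (elim x)
    show ?case
    proof (rule ccontr)
      assume n: "\<not> \<alpha> x \<le> \<beta> x"
      then have xA: "x \<in> A" using elim(3) unfolding A_def by simp
      have le: "ennreal (w x) * \<alpha> x \<le> ennreal (w x) * \<beta> x"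
        using elim(1,2) xA by (auto simp: diff_eq_0_iff_ennreal)
      have "\<beta> x < \<infinity>" using n by (auto simp: less_top[symmetric] top_unique)
      moreover have "ennreal (w x) * \<beta> x < ennreal (w x) * \<alpha> x"
        using n w_pos[of x] by (intro ennreal_mult_strict_left_mono) (auto simp: not_le)
      ultimately show False using le by simp
    qed
  qed
qed

context semigroup_comparison
begin

text \<open>The double integral of the conclusion, with values in [0, \<infinity>] and nonnegative
  kernel. Its finiteness almost everywhere comes out of \<open>test_domination\<close>.\<close>

definition perturbation :: "real \<Rightarrow> 'a \<Rightarrow> ennreal" where
  "perturbation t x = (\<integral>\<^sup>+s. indicator {0<..<t} s * (ennreal (exp (\<omega> * (t - s))) *
     (\<integral>\<^sup>+z. k (s, x, z) * ennreal (f z) \<partial>m)) \<partial>lborel)"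

lemma perturbation_measurable[measurable]: "perturbation t \<in> borel_measurable m"
  unfolding perturbation_def by measurable

lemma perturbation_pairing:
  assumes [measurable]: "v \<in> borel_measurable m"
  shows "(\<integral>\<^sup>+x. ennreal (v x) * perturbation t x \<partial>m) =
    (\<integral>\<^sup>+s. indicator {0<..<t} s * (ennreal (exp (\<omega> * (t - s))) * pair_form v s f) \<partial>lborel)"
proof -
  interpret P: pair_sigma_finite lborel m ..
  define \<gamma> where "\<gamma> q = (\<integral>\<^sup>+z. k (fst q, snd q, z) * ennreal (f z) \<partial>m)" for q
  have \<gamma>[measurable]: "\<gamma> \<in> borel_measurable (borel \<Otimes>\<^sub>M m)" unfolding \<gamma>_def by measurable
  have "(\<integral>\<^sup>+x. ennreal (v x) * perturbation t x \<partial>m) =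
      (\<integral>\<^sup>+x. \<integral>\<^sup>+s. ennreal (v x) * (indicator {0<..<t} s * (ennreal (exp (\<omega> * (t - s))) * \<gamma> (s, x))) \<partial>lborel \<partial>m)"
    unfolding perturbation_def
  proof (rule nn_integral_cong)
    fix x assume x: "x \<in> space m"
    have e: "\<gamma> (s, x) = (\<integral>\<^sup>+z. k (s, x, z) * ennreal (f z) \<partial>m)" for s unfolding \<gamma>_def by simp
    show "ennreal (v x) * (\<integral>\<^sup>+s. indicator {0<..<t} s * (ennreal (exp (\<omega> * (t - s))) * (\<integral>\<^sup>+z. k (s, x, z) * ennreal (f z) \<partial>m)) \<partial>lborel) =
        (\<integral>\<^sup>+s. ennreal (v x) * (indicator {0<..<t} s * (ennreal (exp (\<omega> * (t - s))) * \<gamma> (s, x))) \<partial>lborel)"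
      unfolding e[symmetric] using x by (intro nn_integral_cmult[symmetric]) measurable
  qed
  also have "\<dots> = (\<integral>\<^sup>+s. \<integral>\<^sup>+x. ennreal (v x) * (indicator {0<..<t} s * (ennreal (exp (\<omega> * (t - s))) * \<gamma> (s, x))) \<partial>m \<partial>lborel)"
    by (intro P.Fubini') measurable
  also have "\<dots> = (\<integral>\<^sup>+s. indicator {0<..<t} s * (ennreal (exp (\<omega> * (t - s))) * pair_form v s f) \<partial>lborel)"
  proof (intro nn_integral_cong)
    fix s
    have "(\<integral>\<^sup>+x. ennreal (v x) * (indicator {0<..<t} s * (ennreal (exp (\<omega> * (t - s))) * \<gamma> (s, x))) \<partial>m) =
        (\<integral>\<^sup>+x. indicator {0<..<t} s * ennreal (exp (\<omega> * (t - s))) * (ennreal (v x) * \<gamma> (s, x)) \<partial>m)"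
      by (intro nn_integral_cong) (simp add: mult_ac)
    also have "\<dots> = indicator {0<..<t} s * ennreal (exp (\<omega> * (t - s))) * pair_form v s f"
      by (subst nn_integral_cmult) (auto simp: pair_form_def \<gamma>_def)
    finally show "(\<integral>\<^sup>+x. ennreal (v x) * (indicator {0<..<t} s * (ennreal (exp (\<omega> * (t - s))) * \<gamma> (s, x))) \<partial>m) =
        indicator {0<..<t} s * (ennreal (exp (\<omega> * (t - s))) * pair_form v s f)" by (simp add: mult.assoc)
  qed
  finally show ?thesis .
qed

text \<open>Let \<Gamma> be the primitive of e^(\<omega>(t - s)) times the pairing of S(s)f with v.
  Then \<open>window_step\<close> at the corner (t - s, s) supplies the hypothesis of
  \<open>window_comparison\<close>. The integrand is only known to be measurable and bounded, which
  makes \<Gamma> Lipschitz and hence continuous.\<close>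

lemma test_domination:
  assumes u: "u \<in> Lp 2 m" "integrable m u" "AE x in m. 0 \<le> u x" and v: "test_function v" and t: "0 < t"
  shows "(\<integral>\<^sup>+x. ennreal (v x) * perturbation t x \<partial>m) < \<infinity>"
    and "pairing m (T t u) v \<le> pairing m (S t u) v +
      C0 * M * (LINT x|m. \<bar>u x\<bar>) * enn2real (\<integral>\<^sup>+x. ennreal (v x) * perturbation t x \<partial>m)"
proof -
  note v2 = test_function_L2[OF v]
  have vm[measurable]: "v \<in> borel_measurable m" using v by (simp add: test_function_def)
  \<comment> \<open>Windows reach up to s + h with s < t and h < 1.\<close>
  define R where "R = t + 1"
  obtain B where B: "0 \<le> B" "\<And>s v. 0 < s \<Longrightarrow> s \<le> R \<Longrightarrow> test_function v \<Longrightarrow> pair_form v s f \<le> ennreal B"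
    by (rule pair_form_f_bound[of R]) blast
  have [measurable]: "(\<lambda>s. pair_form v s f) \<in> borel_measurable borel"
    by (rule pair_form_measurable) auto
  define \<gamma> where "\<gamma> s = exp (\<omega> * (t - s)) * enn2real (pair_form v s f)" for s
  have \<gamma>m[measurable]: "\<gamma> \<in> borel_measurable borel" unfolding \<gamma>_def by measurable
  have \<gamma>0: "0 \<le> \<gamma> s" for s unfolding \<gamma>_def by simp
  define B' where "B' = exp (\<bar>\<omega>\<bar> * R) * B"
  have B'0: "0 \<le> B'" unfolding B'_def using B by simp
  have pf: "pair_form v s f = ennreal (enn2real (pair_form v s f))" "enn2real (pair_form v s f) \<le> B" if "0 < s" "s \<le> R" for s
  proof -
    have "pair_form v s f \<le> ennreal B" using that v by (intro B)
    then show "pair_form v s f = ennreal (enn2real (pair_form v s f))" "enn2real (pair_form v s f) \<le> B"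
      using B(1) by (auto simp: enn2real_leI le_less_trans[OF _ ennreal_less_top] intro!: ennreal_enn2real[symmetric])
  qed
  have \<gamma>B: "\<gamma> s \<le> B'" if s: "0 < s" "s \<le> R" for s
  proof -
    have "\<omega> * (t - s) \<le> \<bar>\<omega>\<bar> * \<bar>t - s\<bar>" by (metis abs_ge_self abs_mult)
    also have "\<dots> \<le> \<bar>\<omega>\<bar> * R" using s t unfolding R_def by (intro mult_left_mono) auto
    finally show ?thesis unfolding \<gamma>_def B'_def using pf(2)[OF s] by (intro mult_mono) auto
  qed
  have \<gamma>i: "set_integrable lborel {a<..<b} \<gamma>" if "0 \<le> a" "b \<le> R" for a b
    unfolding set_integrable_def
  proof (rule Bochner_Integration.integrable_bound)
    show "integrable lborel (\<lambda>s. indicator {a<..<b} s * B')" by (cases "a \<le> b") auto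
    show "AE s in lborel. norm (indicator {a<..<b} s *\<^sub>R \<gamma> s) \<le> norm (indicator {a<..<b} s * B')"
      using that \<gamma>0 \<gamma>B B'0 by (intro AE_I2) (auto simp: indicator_def)
  qed measurable
  \<comment> \<open>The cut at \<open>R\<close> is where the bound for \<open>\<gamma>\<close> ends.
    The function is constant on both sides of [0, R], so it is monotone and Lipschitz on the whole
    line.\<close>
  define \<Gamma> where "\<Gamma> x = (LINT s:{0<..<min x R}|lborel. \<gamma> s)" for x
  have diff: "\<Gamma> y - \<Gamma> x = (LINT s:{max 0 (min x R)<..<max 0 (min y R)}|lborel. \<gamma> s)" if "x \<le> y" for x y
  proof -
    have e: "\<Gamma> z = (LINT s:{0<..<max 0 (min z R)}|lborel. \<gamma> s)" for z
      unfolding \<Gamma>_def by (cases "0 \<le> min z R") (auto simp: max_def)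
    have "(LINT s:{0<..<max 0 (min y R)}|lborel. \<gamma> s) = (LINT s:{0<..<max 0 (min x R)}|lborel. \<gamma> s) +
        (LINT s:{max 0 (min x R)<..<max 0 (min y R)}|lborel. \<gamma> s)"
      using that t by (intro set_integral_Ioo_split \<gamma>i) (auto simp: R_def)
    then show ?thesis unfolding e by simp
  qed
  have bnd: "0 \<le> (LINT s:{a<..<b}|lborel. \<gamma> s)" "(LINT s:{a<..<b}|lborel. \<gamma> s) \<le> B' * (b - a)" if "0 \<le> a" "a \<le> b" "b \<le> R" for a b
  proof -
    show "0 \<le> (LINT s:{a<..<b}|lborel. \<gamma> s)"
      unfolding set_lebesgue_integral_def using \<gamma>0 by (intro integral_nonneg_AE AE_I2) simp
    have "(LINT s:{a<..<b}|lborel. \<gamma> s) \<le> (LINT s:{a<..<b}|lborel. B')"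
      using that \<gamma>B by (intro set_integral_mono \<gamma>i) (auto simp: set_integrable_def)
    also have "\<dots> = B' * (b - a)" using that by (simp add: set_lebesgue_integral_def mult.commute)
    finally show "(LINT s:{a<..<b}|lborel. \<gamma> s) \<le> B' * (b - a)" .
  qed
  have R0: "0 \<le> R" unfolding R_def using t by simp
  have inc: "0 \<le> \<Gamma> y - \<Gamma> x" "\<Gamma> y - \<Gamma> x \<le> B' * (y - x)" if "x \<le> y" for x y
  proof -
    have o: "0 \<le> max 0 (min x R)" "max 0 (min x R) \<le> max 0 (min y R)" "max 0 (min y R) \<le> R"
      using that R0 by auto
    show "0 \<le> \<Gamma> y - \<Gamma> x" unfolding diff[OF that] by (rule bnd(1)[OF o])
    have "\<Gamma> y - \<Gamma> x \<le> B' * (max 0 (min y R) - max 0 (min x R))" unfolding diff[OF that] by (rule bnd(2)[OF o])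
    also have "\<dots> \<le> B' * (y - x)" using B'0 that by (intro mult_left_mono) auto
    finally show "\<Gamma> y - \<Gamma> x \<le> B' * (y - x)" .
  qed
  have \<Gamma>c: "continuous_on UNIV \<Gamma>"
    unfolding continuous_on_iff
  proof (intro ballI allI impI)
    fix x e :: real assume e: "0 < e"
    have L: "\<bar>\<Gamma> y - \<Gamma> x\<bar> \<le> B' * \<bar>y - x\<bar>" for y
      using inc[of x y] inc[of y x] by (cases "x \<le> y") auto
    have "dist (\<Gamma> y) (\<Gamma> x) < e" if "dist y x < e / (B' + 1)" for y
    proof -
      have "\<bar>\<Gamma> y - \<Gamma> x\<bar> \<le> (B' + 1) * \<bar>y - x\<bar>" using L[of y] by (simp add: distrib_right)
      also have "\<dots> < (B' + 1) * (e / (B' + 1))" using that B'0 by (intro mult_strict_left_mono) (auto simp: dist_real_def)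
      finally show ?thesis using B'0 by (simp add: dist_real_def)
    qed
    then show "\<exists>d>0. \<forall>y\<in>UNIV. dist y x < d \<longrightarrow> dist (\<Gamma> y) (\<Gamma> x) < e"
      using e B'0 by (intro exI[of _ "e / (B' + 1)"]) auto
  qed
  have \<Gamma>m: "mono \<Gamma>" using inc(1) by (auto simp: mono_def)
  have \<Gamma>0: "0 \<le> \<Gamma> x" for x
    unfolding \<Gamma>_def set_lebesgue_integral_def using \<gamma>0 by (intro integral_nonneg_AE AE_I2) simp
  define L where "L = (LINT x|m. \<bar>u x\<bar>)"
  have L0: "0 \<le> L" unfolding L_def by (intro integral_nonneg_AE) simp
  \<comment> \<open>One factor exp(|\<omega>| h) comes from \<open>window_step\<close>, the other
    from replacing e^(\<omega>(t - s)) by e^(\<omega>(t - r)) for r in (s, s + h). Both tend to 1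
    with h.\<close>
  define C where "C h = C0 * M * L * exp (2 * \<bar>\<omega>\<bar> * h)" for h
  have C: "(C \<longlongrightarrow> C0 * M * L * exp (2 * \<bar>\<omega>\<bar> * 0)) (at_right 0)"
    unfolding C_def by (intro tendsto_intros)
  have C0': "0 \<le> C h" for h unfolding C_def using C0_nonneg M_ge_1 L0 by simp
  have "G u v (t, 0) \<le> G u v (0, t) + C0 * M * L * exp (2 * \<bar>\<omega>\<bar> * 0) * \<Gamma> t"
  proof (rule window_comparison[OF G_continuous[OF u(1) v2] \<Gamma>c \<Gamma>m \<Gamma>0 t C C0'])
    fix h s :: real assume h: "0 < h" "h < 1" and s: "0 < s" "s < t"
    define J where "J = enn2real (\<integral>\<^sup>+r. indicator {s<..<s + h} r * pair_form v r f \<partial>lborel)"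
    have sh: "s + h \<le> R" using h s by (simp add: R_def)
    have si: "set_integrable lborel {s<..<s + h} (\<lambda>r. enn2real (pair_form v r f))"
      unfolding set_integrable_def
    proof (rule Bochner_Integration.integrable_bound)
      show "integrable lborel (\<lambda>r. indicator {s<..<s + h} r * B)" using h by simp
      show "AE r in lborel. norm (indicator {s<..<s + h} r *\<^sub>R enn2real (pair_form v r f)) \<le> norm (indicator {s<..<s + h} r * B)"
        using pf(2) s sh B(1) by (intro AE_I2) (auto simp: indicator_def)
    qed measurable
    have J: "J = (LINT r:{s<..<s + h}|lborel. enn2real (pair_form v r f))"
    proof -
      have "(LINT r:{s<..<s + h}|lborel. enn2real (pair_form v r f)) =
          enn2real (\<integral>\<^sup>+r. ennreal (indicator {s<..<s + h} r *\<^sub>R enn2real (pair_form v r f)) \<partial>lborel)"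
        unfolding set_lebesgue_integral_def by (rule integral_eq_nn_integral) auto
      also have "(\<integral>\<^sup>+r. ennreal (indicator {s<..<s + h} r *\<^sub>R enn2real (pair_form v r f)) \<partial>lborel) =
          (\<integral>\<^sup>+r. indicator {s<..<s + h} r * pair_form v r f \<partial>lborel)"
        using s sh pf(1) by (intro nn_integral_cong) (auto simp: indicator_def)
      finally show ?thesis unfolding J_def by simp
    qed
    have "exp (\<omega> * (t - s)) * J = (LINT r:{s<..<s + h}|lborel. exp (\<omega> * (t - s)) * enn2real (pair_form v r f))"
      unfolding J by simp
    also have "\<dots> \<le> (LINT r:{s<..<s + h}|lborel. exp (\<bar>\<omega>\<bar> * h) * \<gamma> r)"
    proof (rule set_integral_mono)
      show "set_integrable lborel {s<..<s + h} (\<lambda>r. exp (\<omega> * (t - s)) * enn2real (pair_form v r f))"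
        "set_integrable lborel {s<..<s + h} (\<lambda>r. exp (\<bar>\<omega>\<bar> * h) * \<gamma> r)"
        using si \<gamma>i[of s "s + h"] s sh by auto
      fix r assume r: "r \<in> {s<..<s + h}"
      have "\<omega> * (r - s) \<le> \<bar>\<omega>\<bar> * (r - s)" using r by (intro mult_right_mono) auto
      also have "\<dots> \<le> \<bar>\<omega>\<bar> * h" using r by (intro mult_left_mono) auto
      finally have "exp (\<omega> * (t - s)) \<le> exp (\<bar>\<omega>\<bar> * h) * exp (\<omega> * (t - r))"
        by (simp add: exp_add[symmetric] algebra_simps)
      then show "exp (\<omega> * (t - s)) * enn2real (pair_form v r f) \<le> exp (\<bar>\<omega>\<bar> * h) * \<gamma> r"
        unfolding \<gamma>_def mult.assoc[symmetric] by (rule mult_right_mono) simp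
    qed
    also have "\<dots> = exp (\<bar>\<omega>\<bar> * h) * (\<Gamma> (s + h) - \<Gamma> s)"
      using diff[of s "s + h"] h s sh by simp
    finally have EJ: "exp (\<omega> * (t - s)) * J \<le> exp (\<bar>\<omega>\<bar> * h) * (\<Gamma> (s + h) - \<Gamma> s)" .
    have "C0 * (M * exp (\<omega> * (t - s)) * exp (\<bar>\<omega>\<bar> * h) * L) * J = C0 * M * L * exp (\<bar>\<omega>\<bar> * h) * (exp (\<omega> * (t - s)) * J)"
      by (simp add: mult_ac)
    also have "\<dots> \<le> C0 * M * L * exp (\<bar>\<omega>\<bar> * h) * (exp (\<bar>\<omega>\<bar> * h) * (\<Gamma> (s + h) - \<Gamma> s))"
      using C0_nonneg M_ge_1 L0 by (intro mult_left_mono EJ) auto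
    also have "\<dots> = C0 * M * L * (exp (\<bar>\<omega>\<bar> * h) * exp (\<bar>\<omega>\<bar> * h)) * (\<Gamma> (s + h) - \<Gamma> s)" by (simp only: mult_ac)
    also have "exp (\<bar>\<omega>\<bar> * h) * exp (\<bar>\<omega>\<bar> * h) = exp (2 * \<bar>\<omega>\<bar> * h)" by (simp add: exp_add[symmetric])
    finally have "C0 * (M * exp (\<omega> * (t - s)) * exp (\<bar>\<omega>\<bar> * h) * L) * J \<le> C h * (\<Gamma> (s + h) - \<Gamma> s)"
      unfolding C_def .
    then have "h * (C0 * (M * exp (\<omega> * (t - s)) * exp (\<bar>\<omega>\<bar> * h) * L) * J) \<le> h * (C h * (\<Gamma> (s + h) - \<Gamma> s))"
      using h by (intro mult_left_mono) auto
    then show "integral {0..h} (\<lambda>y. G u v (t - s + h, s + y)) - integral {0..h} (\<lambda>y. G u v (t - s, s + y))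
       \<le> integral {0..h} (\<lambda>x. G u v (t - s + x, s + h)) - integral {0..h} (\<lambda>x. G u v (t - s + x, s)) + h * C h * (\<Gamma> (s + h) - \<Gamma> s)"
      using window_step[OF u v h(1), of "t - s" s] s unfolding L_def[symmetric] J_def[symmetric] by (simp add: mult.assoc)
  qed
  moreover have "G u v (t, 0) = pairing m (T t u) v"
  proof -
    have "pairing m (S 0 (T t u)) v = pairing m (T t u) v"
      using t u v2 by (intro pairing_cong_AE T_zero L2_measurable[OF T_L2] L2_measurable[OF v2] T.T_measurable T.T_L2) auto
    then show ?thesis using t by (simp add: G_eq)
  qed
  moreover have "G u v (0, t) = pairing m (S t u) v"
  proof -
    have "AE x in m. S t (T 0 u) x = S t u x"
      using t u by (intro positive_operator_L2D(2)[OF positive_operator] T.T_L2 T.T_zero) auto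
    then have "pairing m (S t (T 0 u)) v = pairing m (S t u) v"
      using t u v2 by (intro pairing_cong_AE L2_measurable[OF T_L2] L2_measurable[OF v2] T.T_L2) auto
    then show ?thesis using t by (simp add: G_eq)
  qed
  moreover have pt: "(\<integral>\<^sup>+x. ennreal (v x) * perturbation t x \<partial>m) = ennreal (\<Gamma> t)"
  proof -
    have tR: "min t R = t" by (simp add: R_def)
    have "(\<integral>\<^sup>+x. ennreal (v x) * perturbation t x \<partial>m) = (\<integral>\<^sup>+s. ennreal (indicator {0<..<t} s *\<^sub>R \<gamma> s) \<partial>lborel)"
      unfolding perturbation_pairing[OF vm]
    proof (intro nn_integral_cong)
      fix s show "indicator {0<..<t} s * (ennreal (exp (\<omega> * (t - s))) * pair_form v s f) = ennreal (indicator {0<..<t} s *\<^sub>R \<gamma> s)"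
        using pf(1)[of s] by (cases "s \<in> {0<..<t}") (auto simp: \<gamma>_def R_def ennreal_mult)
    qed
    also have "\<dots> = ennreal (\<Gamma> t)"
      unfolding \<Gamma>_def tR set_lebesgue_integral_def using \<gamma>i[of 0 t] \<gamma>0 unfolding set_integrable_def R_def
      by (intro nn_integral_eq_integral) auto
    finally show ?thesis .
  qed
  ultimately show "pairing m (T t u) v \<le> pairing m (S t u) v +
      C0 * M * (LINT x|m. \<bar>u x\<bar>) * enn2real (\<integral>\<^sup>+x. ennreal (v x) * perturbation t x \<partial>m)"
    unfolding pt L_def using \<Gamma>0 by simp
  show "(\<integral>\<^sup>+x. ennreal (v x) * perturbation t x \<partial>m) < \<infinity>" unfolding pt by simp
qed

text \<open>Test functions equal to w on arbitrary sets localise the tested inequality. Since u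
  \<ge> 0, its L_1 norm is the integral of u, so the perturbation term is an integral operator whose
  kernel is constant in y.\<close>

lemma domination:
  assumes u: "u \<in> Lp 2 m" "integrable m u" "\<And>x. 0 \<le> u x" and t: "0 < t"
  shows "AE x in m. ennreal (T t u x) \<le> (\<integral>\<^sup>+y. (k (t, x, y) + ennreal (C0 * M) * perturbation t x) * ennreal (u y) \<partial>m)"
proof -
  have [measurable]: "u \<in> borel_measurable m" by (rule L2_measurable[OF u(1)])
  have t0: "0 \<le> t" using t by simp
  have u0: "AE x in m. 0 \<le> u x" using u(3) by simp
  define c where "c = C0 * M * (LINT x|m. \<bar>u x\<bar>)"
  have c0: "0 \<le> c" unfolding c_def using C0_nonneg M_ge_1 by (auto intro!: mult_nonneg_nonneg integral_nonneg_AE)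
  have Tm[measurable]: "T t u \<in> borel_measurable m" by (rule T.T_measurable[OF t0 u(1)])
  have Sm[measurable]: "S t u \<in> borel_measurable m" by (rule T_measurable[OF t0 u(1)])
  have tn: "AE x in m. 0 \<le> T t u x" "AE x in m. 0 \<le> S t u x" using T.T_nonneg[OF t0 u(1) u0] T_nonneg[OF t0 u(1) u0] by auto
  have nnp: "(\<integral>\<^sup>+x. ennreal (v x) * ennreal (z x) \<partial>m) = ennreal (pairing m z v)"
    if "z \<in> Lp 2 m" "AE x in m. 0 \<le> z x" "test_function v" for z v
  proof -
    have v0: "\<And>x. 0 \<le> v x" using that(3) by (simp add: test_function_def)
    have "(\<integral>\<^sup>+x. ennreal (v x) * ennreal (z x) \<partial>m) = (\<integral>\<^sup>+x. ennreal (z x * v x) \<partial>m)"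
      by (intro nn_integral_cong) (metis ennreal_mult'' mult.commute v0)
    also have "\<dots> = ennreal (pairing m z v)"
      unfolding pairing_def
    proof (rule nn_integral_eq_integral)
      show "integrable m (\<lambda>x. z x * v x)" by (rule L2_mult_integrable[OF that(1) test_function_L2[OF that(3)]])
      show "AE x in m. 0 \<le> z x * v x" using that(2) by eventually_elim (simp add: v0)
    qed
    finally show ?thesis .
  qed
  have main: "(\<integral>\<^sup>+x. ennreal (v x) * ennreal (T t u x) \<partial>m) \<le> (\<integral>\<^sup>+x. ennreal (v x) * (ennreal (S t u x) + ennreal c * perturbation t x) \<partial>m)"
    and fin: "(\<integral>\<^sup>+x. ennreal (v x) * (ennreal (S t u x) + ennreal c * perturbation t x) \<partial>m) < \<infinity>"
    if v: "test_function v" for v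
  proof -
    have [measurable]: "v \<in> borel_measurable m" using v by (simp add: test_function_def)
    note td = test_domination[OF u(1,2) u0 v t]
    have S0: "0 \<le> pairing m (S t u) v"
      using pair_form_L2(2)[OF t u(1) u0 test_function_L2[OF v]] v by (simp add: test_function_def)
    have "(\<integral>\<^sup>+x. ennreal (v x) * (ennreal (S t u x) + ennreal c * perturbation t x) \<partial>m) =
        (\<integral>\<^sup>+x. ennreal (v x) * ennreal (S t u x) \<partial>m) + (\<integral>\<^sup>+x. ennreal c * (ennreal (v x) * perturbation t x) \<partial>m)"
      by (subst nn_integral_add[symmetric]) (auto simp: distrib_left mult_ac)
    also have "\<dots> = ennreal (pairing m (S t u) v) + ennreal c * (\<integral>\<^sup>+x. ennreal (v x) * perturbation t x \<partial>m)"
      using nnp[OF T_L2[OF t0 u(1)] tn(2) v] by (simp add: nn_integral_cmult)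
    finally have e: "(\<integral>\<^sup>+x. ennreal (v x) * (ennreal (S t u x) + ennreal c * perturbation t x) \<partial>m) =
        ennreal (pairing m (S t u) v) + ennreal c * (\<integral>\<^sup>+x. ennreal (v x) * perturbation t x \<partial>m)" .
    show "(\<integral>\<^sup>+x. ennreal (v x) * (ennreal (S t u x) + ennreal c * perturbation t x) \<partial>m) < \<infinity>"
      unfolding e using td(1) by (auto simp: ennreal_mult_less_top)
    have "(\<integral>\<^sup>+x. ennreal (v x) * ennreal (T t u x) \<partial>m) = ennreal (pairing m (T t u) v)"
      by (rule nnp[OF T.T_L2[OF t0 u(1)] tn(1) v])
    also have "\<dots> \<le> ennreal (pairing m (S t u) v + c * enn2real (\<integral>\<^sup>+x. ennreal (v x) * perturbation t x \<partial>m))"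
      using td(2) unfolding c_def by (rule ennreal_leI)
    also have "\<dots> = ennreal (pairing m (S t u) v) + ennreal c * (\<integral>\<^sup>+x. ennreal (v x) * perturbation t x \<partial>m)"
      using S0 c0 td(1) by (simp add: ennreal_mult)
    finally show "(\<integral>\<^sup>+x. ennreal (v x) * ennreal (T t u x) \<partial>m) \<le> (\<integral>\<^sup>+x. ennreal (v x) * (ennreal (S t u x) + ennreal c * perturbation t x) \<partial>m)"
      unfolding e .
  qed
  have tf: "test_function (\<lambda>x. w x * indicator A x)" if "A \<in> sets m" for A
    using that by (auto simp: test_function_def indicator_def)
  have "AE x in m. ennreal (T t u x) \<le> ennreal (S t u x) + ennreal c * perturbation t x"
  proof (rule AE_le_of_weighted_integrals)
    have "test_function w" by (simp add: test_function_def)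
    from fin[OF this] show "(\<integral>\<^sup>+x. ennreal (w x) * (ennreal (S t u x) + ennreal c * perturbation t x) \<partial>m) \<noteq> \<infinity>" by simp
  qed (use main[OF tf] in auto)
  then show ?thesis
    using k_rep[OF t u(1) u0] AE_space
  proof eventually_elim
    case (elim x)
    have "ennreal c = ennreal (C0 * M) * (\<integral>\<^sup>+y. ennreal (u y) \<partial>m)"
      unfolding c_def using u C0_nonneg M_ge_1
      by (simp add: nn_integral_eq_integral ennreal_mult integral_nonneg_AE)
    then have "ennreal c * perturbation t x = (ennreal (C0 * M) * perturbation t x) * (\<integral>\<^sup>+y. ennreal (u y) \<partial>m)"
      by (simp add: mult_ac)
    also have "\<dots> = (\<integral>\<^sup>+y. (ennreal (C0 * M) * perturbation t x) * ennreal (u y) \<partial>m)"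
      by (rule nn_integral_cmult[symmetric]) simp
    finally have "ennreal c * perturbation t x = (\<integral>\<^sup>+y. (ennreal (C0 * M) * perturbation t x) * ennreal (u y) \<partial>m)" .
    moreover have "(\<integral>\<^sup>+y. (k (t, x, y) + ennreal (C0 * M) * perturbation t x) * ennreal (u y) \<partial>m) =
        (\<integral>\<^sup>+y. k (t, x, y) * ennreal (u y) \<partial>m) + (\<integral>\<^sup>+y. (ennreal (C0 * M) * perturbation t x) * ennreal (u y) \<partial>m)"
      unfolding distrib_right using elim(3) by (intro nn_integral_add) auto
    ultimately show ?case using elim(1,2) by simp
  qed
qed

end

section \<open>The kernel of \<open>T(t)\<close>\<close>

context semigroup_comparison
begin

lemma test_function_w: "test_function w"
  by (simp add: test_function_def)

lemma perturbation_weight_finite: "0 < t \<Longrightarrow> (\<integral>\<^sup>+x. ennreal (w x) * perturbation t x \<partial>m) < \<infinity>"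
  using test_domination(1)[OF w_L2 w_integrable _ test_function_w] by simp

definition bound_kernel :: "real \<Rightarrow> 'a \<times> 'a \<Rightarrow> ennreal" where
  "bound_kernel t q = k (t, q) + ennreal (C0 * M) * perturbation t (fst q)"

lemma bound_kernel_measurable[measurable]: "bound_kernel t \<in> borel_measurable (m \<Otimes>\<^sub>M m)"
  unfolding bound_kernel_def by measurable

text \<open>The set function sending A to w T(t)(w 1_A) is additive and dominated, and the factor
  w(x) w(y) makes the dominating kernel integrable. Dividing the resulting density by this factor
  gives a kernel on weighted indicators, hence on all nonnegative functions in L_2.\<close>

lemma ex_T_kernel:
  assumes t: "0 < t"
  shows "\<exists>\<kappa>::'a \<times> 'a \<Rightarrow> real. \<kappa> \<in> borel_measurable (m \<Otimes>\<^sub>M m) \<and> (\<forall>q. 0 \<le> \<kappa> q) \<and>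
    (AE q in m \<Otimes>\<^sub>M m. ennreal (\<kappa> q) \<le> bound_kernel t q) \<and>
    (\<forall>u\<in>Lp 2 m. (\<forall>x. 0 \<le> u x) \<longrightarrow> (AE x in m. ennreal (T t u x) = (\<integral>\<^sup>+y. ennreal (\<kappa> (x, y)) * ennreal (u y) \<partial>m)))"
proof -
  interpret P: pair_sigma_finite m m ..
  have t0: "0 \<le> t" using t by simp
  note op = T.positive_operator[OF t0]
  define K where "K q = ennreal (w (fst q)) * bound_kernel t q * ennreal (w (snd q))" for q
  have Km[measurable]: "K \<in> borel_measurable (m \<Otimes>\<^sub>M m)" unfolding K_def by measurable
  have wi: "(\<integral>\<^sup>+x. ennreal (w x) \<partial>m) < \<infinity>" using w_integrable by (simp add: nn_integral_eq_integral)
  have "(\<integral>\<^sup>+q. K q \<partial>(m \<Otimes>\<^sub>M m)) = (\<integral>\<^sup>+x. \<integral>\<^sup>+y. K (x, y) \<partial>m \<partial>m)" by (rule nn_integral_fst[symmetric]) measurable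
  also have "\<dots> = (\<integral>\<^sup>+x. ennreal (w x) * (\<integral>\<^sup>+y. k (t, x, y) * ennreal (w y) \<partial>m) +
      ennreal (w x) * perturbation t x * (ennreal (C0 * M) * (\<integral>\<^sup>+y. ennreal (w y) \<partial>m)) \<partial>m)"
  proof (intro nn_integral_cong)
    fix x assume x[measurable]: "x \<in> space m"
    have "(\<integral>\<^sup>+y. K (x, y) \<partial>m) = (\<integral>\<^sup>+y. ennreal (w x) * (k (t, x, y) * ennreal (w y)) +
        ennreal (w x) * perturbation t x * ennreal (C0 * M) * ennreal (w y) \<partial>m)"
      unfolding K_def bound_kernel_def by (intro nn_integral_cong) (simp add: algebra_simps)
    also have "\<dots> = (\<integral>\<^sup>+y. ennreal (w x) * (k (t, x, y) * ennreal (w y)) \<partial>m) +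
        (\<integral>\<^sup>+y. ennreal (w x) * perturbation t x * ennreal (C0 * M) * ennreal (w y) \<partial>m)"
      by (intro nn_integral_add) measurable
    also have "\<dots> = ennreal (w x) * (\<integral>\<^sup>+y. k (t, x, y) * ennreal (w y) \<partial>m) +
      ennreal (w x) * perturbation t x * (ennreal (C0 * M) * (\<integral>\<^sup>+y. ennreal (w y) \<partial>m))"
      by (subst (1 2) nn_integral_cmult) (auto simp: mult.assoc)
    finally show "(\<integral>\<^sup>+y. K (x, y) \<partial>m) = \<dots>" .
  qed
  \<comment> \<open>Both terms are finite: the first is the pairing of S(t)w with w, the second was
    controlled with the test function w.\<close>
  also have "\<dots> = pair_form w t w + (\<integral>\<^sup>+x. ennreal (w x) * perturbation t x \<partial>m) * (ennreal (C0 * M) * (\<integral>\<^sup>+y. ennreal (w y) \<partial>m))"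
    unfolding pair_form_def by (subst nn_integral_add) (auto simp: nn_integral_multc)
  also have "\<dots> < \<infinity>"
    using pair_form_L2(1)[OF t w_L2 _ w_L2] perturbation_weight_finite[OF t] wi
    by (auto simp: ennreal_mult_less_top)
  finally have Kfin: "(\<integral>\<^sup>+q. K q \<partial>(m \<Otimes>\<^sub>M m)) \<noteq> \<infinity>" by simp
  define b where "b A = T t (\<lambda>y. w y * indicator A y)" for A
  have bm: "b A \<in> borel_measurable m" if "A \<in> sets m" for A
    unfolding b_def by (intro T.T_measurable t0 w_ind_L2 that)
  have b0: "AE x in m. 0 \<le> b A x" if "A \<in> sets m" for A
    unfolding b_def by (intro T.T_nonneg t0 w_ind_L2 that) simp
  define r where "r A x = ennreal (w x * b A x)" for A x
  have rm: "r A \<in> borel_measurable m" if "A \<in> sets m" for A unfolding r_def using bm[OF that] by measurable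
  have radd: "AE x in m. r (A \<union> C) x = r A x + r C x" if AC: "A \<in> sets m" "C \<in> sets m" "A \<inter> C = {}" for A C
  proof -
    have "AE x in m. b (A \<union> C) x = b A x + b C x"
      unfolding b_def by (rule positive_operator_w_ind_Un[OF op AC])
    with b0[OF AC(1)] b0[OF AC(2)] show ?thesis
      by eventually_elim (simp add: r_def distrib_left)
  qed
  have rdom: "AE x in m. r A x \<le> (\<integral>\<^sup>+y. K (x, y) * indicator A y \<partial>m)" if A[measurable]: "A \<in> sets m" for A
  proof -
    have "integrable m (\<lambda>y. w y * indicator A y)"
      by (rule Bochner_Integration.integrable_bound[OF w_integrable]) (auto simp: indicator_def)
    then have "AE x in m. ennreal (b A x) \<le> (\<integral>\<^sup>+y. bound_kernel t (x, y) * ennreal (w y * indicator A y) \<partial>m)"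
      using domination[OF w_ind_L2[OF A] _ _ t] unfolding b_def bound_kernel_def by simp
    then show ?thesis using b0[OF A] AE_space
    proof eventually_elim
      case (elim x)
      note [measurable] = elim(3)
      have "r A x = ennreal (w x) * ennreal (b A x)" unfolding r_def by (simp add: ennreal_mult elim(2))
      also have "\<dots> \<le> ennreal (w x) * (\<integral>\<^sup>+y. bound_kernel t (x, y) * ennreal (w y * indicator A y) \<partial>m)"
        using elim(1) by (intro mult_left_mono) auto
      also have "\<dots> = (\<integral>\<^sup>+y. ennreal (w x) * (bound_kernel t (x, y) * ennreal (w y * indicator A y)) \<partial>m)"
        by (rule nn_integral_cmult[symmetric]) measurable
      also have "\<dots> = (\<integral>\<^sup>+y. K (x, y) * indicator A y \<partial>m)"
        unfolding K_def by (intro nn_integral_cong) (auto simp: indicator_def mult_ac)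
      finally show ?case .
    qed
  qed
  obtain k' where k'[measurable]: "k' \<in> borel_measurable (m \<Otimes>\<^sub>M m)" and k'K: "AE q in m \<Otimes>\<^sub>M m. k' q \<le> K q"
    and k'r: "\<And>A. A \<in> sets m \<Longrightarrow> AE x in m. r A x = (\<integral>\<^sup>+y. k' (x, y) * indicator A y \<partial>m)"
    by (rule kernel_of_additive[OF Km Kfin rm radd rdom]) (auto intro: that)
  have Kae: "AE q in m \<Otimes>\<^sub>M m. K q \<noteq> \<infinity>" using Kfin by (intro nn_integral_PInf_AE) auto
  \<comment> \<open>\<open>enn2real\<close> loses nothing almost everywhere, as \<open>k'\<close>
    lies below \<open>K\<close>, which has finite integral.\<close>
  define \<kappa> where "\<kappa> q = enn2real (k' q) / (w (fst q) * w (snd q))" for q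
  have [measurable]: "\<kappa> \<in> borel_measurable (m \<Otimes>\<^sub>M m)" unfolding \<kappa>_def by measurable
  have \<kappa>0: "0 \<le> \<kappa> q" for q unfolding \<kappa>_def by simp
  have wk: "AE q in m \<Otimes>\<^sub>M m. k' q = ennreal (w (fst q)) * (ennreal (\<kappa> q) * ennreal (w (snd q)))"
    using Kae k'K
  proof eventually_elim
    case (elim q)
    then have f: "k' q < \<infinity>" by (auto simp: less_top[symmetric] top_unique)
    have "w (fst q) * (\<kappa> q * w (snd q)) = enn2real (k' q)"
      unfolding \<kappa>_def using w_pos[of "fst q"] w_pos[of "snd q"] by simp
    then have "ennreal (w (fst q)) * (ennreal (\<kappa> q) * ennreal (w (snd q))) = ennreal (enn2real (k' q))"
      using \<kappa>0[of q] by (simp add: ennreal_mult[symmetric])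
    then show ?case using f by simp
  qed
  have le: "AE q in m \<Otimes>\<^sub>M m. ennreal (\<kappa> q) \<le> bound_kernel t q"
    using wk k'K
  proof eventually_elim
    case (elim q)
    have "ennreal (w (fst q) * w (snd q)) * ennreal (\<kappa> q) \<le> ennreal (w (fst q) * w (snd q)) * bound_kernel t q"
      using elim unfolding K_def by (simp add: ennreal_mult mult_ac)
    moreover have "w (fst q) \<noteq> 0" "w (snd q) \<noteq> 0" using w_pos by (metis less_irrefl)+
    ultimately show ?case
      using ennreal_mult_le_mult_iff[of "ennreal (w (fst q) * w (snd q))"] by auto
  qed
  have rep: "AE x in m. ennreal (T t u x) = (\<integral>\<^sup>+y. ennreal (\<kappa> (x, y)) * ennreal (u y) \<partial>m)"
    if u: "u \<in> Lp 2 m" "\<And>x. 0 \<le> u x" for u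
  proof (rule kernel_extends_from_weight[OF op _ _ u, of "\<lambda>q. ennreal (\<kappa> q)"])
    fix A assume A[measurable]: "A \<in> sets m"
    have "AE x in m. AE y in m. k' (x, y) = ennreal (w x) * (ennreal (\<kappa> (x, y)) * ennreal (w y))"
      using P.AE_pair[OF wk] by simp
    then show "AE x in m. ennreal (T t (\<lambda>y. w y * indicator A y) x) = (\<integral>\<^sup>+y. ennreal (\<kappa> (x, y)) * ennreal (w y * indicator A y) \<partial>m)"
      using k'r[OF A] b0[OF A] AE_space
    proof eventually_elim
      case (elim x)
      note [measurable] = elim(4)
      have "ennreal (w x) * ennreal (b A x) = r A x" unfolding r_def by (simp add: ennreal_mult elim(3))
      also have "\<dots> = (\<integral>\<^sup>+y. ennreal (w x) * (ennreal (\<kappa> (x, y)) * ennreal (w y * indicator A y)) \<partial>m)"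
        unfolding elim(2)
      proof (rule nn_integral_cong_AE)
        show "AE y in m. k' (x, y) * indicator A y = ennreal (w x) * (ennreal (\<kappa> (x, y)) * ennreal (w y * indicator A y))"
          using elim(1) by eventually_elim (auto simp: indicator_def)
      qed
      also have "\<dots> = ennreal (w x) * (\<integral>\<^sup>+y. ennreal (\<kappa> (x, y)) * ennreal (w y * indicator A y) \<partial>m)"
        by (rule nn_integral_cmult) measurable
      finally show ?case
        unfolding b_def using w_pos[of x] by (simp add: ennreal_mult_cancel_left)
    qed
  qed measurable
  show ?thesis using \<kappa>0 le rep by (intro exI[of _ \<kappa>]) auto
qed

text \<open>The choice is made separately for each t, so it carries no measurability in
  time.\<close>

definition kT0 :: "real \<Rightarrow> 'a \<times> 'a \<Rightarrow> real" where
  "kT0 t = (SOME \<kappa>. \<kappa> \<in> borel_measurable (m \<Otimes>\<^sub>M m) \<and> (\<forall>q. 0 \<le> \<kappa> q) \<and>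
    (AE q in m \<Otimes>\<^sub>M m. ennreal (\<kappa> q) \<le> bound_kernel t q) \<and>
    (\<forall>u\<in>Lp 2 m. (\<forall>x. 0 \<le> u x) \<longrightarrow> (AE x in m. ennreal (T t u x) = (\<integral>\<^sup>+y. ennreal (\<kappa> (x, y)) * ennreal (u y) \<partial>m))))"

lemma kT0:
  assumes "0 < t"
  shows kT0_measurable: "kT0 t \<in> borel_measurable (m \<Otimes>\<^sub>M m)" and kT0_nonneg: "0 \<le> kT0 t q"
    and kT0_le: "AE q in m \<Otimes>\<^sub>M m. ennreal (kT0 t q) \<le> bound_kernel t q"
    and kT0_rep: "\<And>u. u \<in> Lp 2 m \<Longrightarrow> (\<And>x. 0 \<le> u x) \<Longrightarrow> AE x in m. ennreal (T t u x) = (\<integral>\<^sup>+y. ennreal (kT0 t (x, y)) * ennreal (u y) \<partial>m)"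
  using someI_ex[OF ex_T_kernel[OF assms], folded kT0_def] by blast+

text \<open>Chapman-Kolmogorov: both sides represent T(s + t) on weighted indicators, so they have
  equal masses on rectangles after multiplication by w(x) w(y), which also makes these masses
  finite.\<close>

lemma kT0_semigroup:
  assumes s: "0 < s" and t: "0 < t"
  shows "AE q in m \<Otimes>\<^sub>M m. ennreal (kT0 (s + t) q) = (\<integral>\<^sup>+z. ennreal (kT0 s (fst q, z)) * ennreal (kT0 t (z, snd q)) \<partial>m)"
proof -
  interpret P: pair_sigma_finite m m ..
  have st: "0 < s + t" using s t by simp
  note [measurable] = kT0_measurable[OF s] kT0_measurable[OF t] kT0_measurable[OF st]
  define c where "c q = (\<integral>\<^sup>+z. ennreal (kT0 s (fst q, z)) * ennreal (kT0 t (z, snd q)) \<partial>m)" for q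
  have [measurable]: "c \<in> borel_measurable (m \<Otimes>\<^sub>M m)" unfolding c_def by measurable
  define W where "W q = ennreal (w (fst q) * w (snd q))" for q
  have [measurable]: "W \<in> borel_measurable (m \<Otimes>\<^sub>M m)" unfolding W_def by measurable
  have rect: "emeasure (density (m \<Otimes>\<^sub>M m) (\<lambda>q. W q * h q)) (A \<times> B) =
      (\<integral>\<^sup>+x. ennreal (w x * indicator A x) * (\<integral>\<^sup>+y. h (x, y) * ennreal (w y * indicator B y) \<partial>m) \<partial>m)"
    if [measurable]: "h \<in> borel_measurable (m \<Otimes>\<^sub>M m)" "A \<in> sets m" "B \<in> sets m" for h A B
  proof -
    have "emeasure (density (m \<Otimes>\<^sub>M m) (\<lambda>q. W q * h q)) (A \<times> B) =
        (\<integral>\<^sup>+x. (\<integral>\<^sup>+y. W (x, y) * h (x, y) * indicator B y \<partial>m) * indicator A x \<partial>m)"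
      by (rule emeasure_density_Times) measurable
    also have "\<dots> = (\<integral>\<^sup>+x. ennreal (w x * indicator A x) * (\<integral>\<^sup>+y. h (x, y) * ennreal (w y * indicator B y) \<partial>m) \<partial>m)"
    proof (intro nn_integral_cong)
      fix x assume [measurable]: "x \<in> space m"
      have "(\<integral>\<^sup>+y. W (x, y) * h (x, y) * indicator B y \<partial>m) = (\<integral>\<^sup>+y. ennreal (w x) * (h (x, y) * ennreal (w y * indicator B y)) \<partial>m)"
        unfolding W_def by (intro nn_integral_cong) (auto simp: indicator_def ennreal_mult mult_ac)
      also have "\<dots> = ennreal (w x) * (\<integral>\<^sup>+y. h (x, y) * ennreal (w y * indicator B y) \<partial>m)"
        by (rule nn_integral_cmult) measurable
      finally show "(\<integral>\<^sup>+y. W (x, y) * h (x, y) * indicator B y \<partial>m) * indicator A x =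
          ennreal (w x * indicator A x) * (\<integral>\<^sup>+y. h (x, y) * ennreal (w y * indicator B y) \<partial>m)"
        by (auto simp: indicator_def)
    qed
    finally show ?thesis .
  qed
  have comp: "AE x in m. (\<integral>\<^sup>+y. ennreal (kT0 (s + t) (x, y)) * ennreal (w y * indicator B y) \<partial>m) =
      (\<integral>\<^sup>+y. c (x, y) * ennreal (w y * indicator B y) \<partial>m)" if B[measurable]: "B \<in> sets m" for B
  proof -
    define g where "g y = w y * indicator B y" for y
    have g: "g \<in> Lp 2 m" "\<And>y. 0 \<le> g y" unfolding g_def using w_ind_L2[OF B] by auto
    have [measurable]: "g \<in> borel_measurable m" by (rule L2_measurable[OF g(1)])
    have Tg: "T t g \<in> Lp 2 m" using t g by (intro T.T_L2) auto
    have Tg0: "AE x in m. 0 \<le> T t g x" using t g by (intro T.T_nonneg) auto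
    \<comment> \<open>T(t)g is nonnegative only almost everywhere, whereas \<open>kT0_rep\<close>
      asks for nonnegativity at every point.\<close>
    define g' where "g' x = max 0 (T t g x)" for x
    have g': "g' \<in> Lp 2 m" unfolding g'_def by (rule L2_mono(1)[OF Tg]) (use L2_measurable[OF Tg] in auto)
    have eq: "AE x in m. T t g x = g' x" using Tg0 by eventually_elim (simp add: g'_def)
    have "AE x in m. T s (T t g) x = T s g' x"
      using s by (intro positive_operator_L2D(2)[OF T.positive_operator] Tg g' eq) auto
    moreover have "AE x in m. T (s + t) g x = T s (T t g) x" using s t g by (intro T.T_add) auto
    moreover have "AE x in m. ennreal (T s g' x) = (\<integral>\<^sup>+z. ennreal (kT0 s (x, z)) * ennreal (g' z) \<partial>m)"
      by (rule kT0_rep[OF s g']) (simp add: g'_def)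
    moreover have gz: "AE z in m. ennreal (g' z) = (\<integral>\<^sup>+y. ennreal (kT0 t (z, y)) * ennreal (g y) \<partial>m)"
      using kT0_rep[OF t g] eq by eventually_elim simp
    moreover have "AE x in m. ennreal (T (s + t) g x) = (\<integral>\<^sup>+y. ennreal (kT0 (s + t) (x, y)) * ennreal (g y) \<partial>m)"
      by (rule kT0_rep[OF st g])
    ultimately have "AE x in m. (\<integral>\<^sup>+y. ennreal (kT0 (s + t) (x, y)) * ennreal (g y) \<partial>m) = (\<integral>\<^sup>+z. ennreal (kT0 s (x, z)) * ennreal (g' z) \<partial>m)"
      by auto
    moreover have "(\<integral>\<^sup>+z. ennreal (kT0 s (x, z)) * ennreal (g' z) \<partial>m) = (\<integral>\<^sup>+y. c (x, y) * ennreal (g y) \<partial>m)"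
      if [measurable]: "x \<in> space m" for x
    proof -
      have "(\<integral>\<^sup>+z. ennreal (kT0 s (x, z)) * ennreal (g' z) \<partial>m) = (\<integral>\<^sup>+z. ennreal (kT0 s (x, z)) * (\<integral>\<^sup>+y. ennreal (kT0 t (z, y)) * ennreal (g y) \<partial>m) \<partial>m)"
        using gz by (intro nn_integral_cong_AE) auto
      also have "\<dots> = (\<integral>\<^sup>+z. \<integral>\<^sup>+y. ennreal (kT0 s (x, z)) * (ennreal (kT0 t (z, y)) * ennreal (g y)) \<partial>m \<partial>m)"
        by (intro nn_integral_cong nn_integral_cmult[symmetric]) measurable
      also have "\<dots> = (\<integral>\<^sup>+y. \<integral>\<^sup>+z. ennreal (kT0 s (x, z)) * (ennreal (kT0 t (z, y)) * ennreal (g y)) \<partial>m \<partial>m)"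
        by (rule P.Fubini') measurable
      also have "\<dots> = (\<integral>\<^sup>+y. c (x, y) * ennreal (g y) \<partial>m)"
      proof (intro nn_integral_cong)
        fix y assume [measurable]: "y \<in> space m"
        have "(\<integral>\<^sup>+z. ennreal (kT0 s (x, z)) * (ennreal (kT0 t (z, y)) * ennreal (g y)) \<partial>m) =
            (\<integral>\<^sup>+z. ennreal (kT0 s (x, z)) * ennreal (kT0 t (z, y)) * ennreal (g y) \<partial>m)" by (simp add: mult.assoc)
        also have "\<dots> = c (x, y) * ennreal (g y)" unfolding c_def fst_conv snd_conv by (rule nn_integral_multc) measurable
        finally show "(\<integral>\<^sup>+z. ennreal (kT0 s (x, z)) * (ennreal (kT0 t (z, y)) * ennreal (g y)) \<partial>m) = c (x, y) * ennreal (g y)" .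
      qed
      finally show ?thesis .
    qed
    ultimately show ?thesis unfolding g_def[symmetric] using AE_space by (auto elim: AE_mp)
  qed
  have "AE q in m \<Otimes>\<^sub>M m. W q * ennreal (kT0 (s + t) q) = W q * c q"
  proof (rule density_eq_on_rectangles)
    have "(\<integral>\<^sup>+q. W q * ennreal (kT0 (s + t) q) \<partial>(m \<Otimes>\<^sub>M m)) = emeasure (density (m \<Otimes>\<^sub>M m) (\<lambda>q. W q * ennreal (kT0 (s + t) q))) (space m \<times> space m)"
      by (subst emeasure_density) (auto simp: space_pair_measure intro!: nn_integral_cong)
    also have "\<dots> = (\<integral>\<^sup>+x. ennreal (w x * indicator (space m) x) * (\<integral>\<^sup>+y. ennreal (kT0 (s + t) (x, y)) * ennreal (w y * indicator (space m) y) \<partial>m) \<partial>m)"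
      by (rule rect) auto
    also have "\<dots> = (\<integral>\<^sup>+x. ennreal (w x) * ennreal (T (s + t) w x) \<partial>m)"
    proof (rule nn_integral_cong_AE)
      have "(\<integral>\<^sup>+y. ennreal (kT0 (s + t) (x, y)) * ennreal (w y * indicator (space m) y) \<partial>m) = (\<integral>\<^sup>+y. ennreal (kT0 (s + t) (x, y)) * ennreal (w y) \<partial>m)" for x
        by (intro nn_integral_cong) simp
      then show "AE x in m. ennreal (w x * indicator (space m) x) * (\<integral>\<^sup>+y. ennreal (kT0 (s + t) (x, y)) * ennreal (w y * indicator (space m) y) \<partial>m) = ennreal (w x) * ennreal (T (s + t) w x)"
        using kT0_rep[OF st w_L2] AE_space by auto
    qed
    also have "\<dots> \<le> (\<integral>\<^sup>+x. ennreal \<bar>T (s + t) w x * w x\<bar> \<partial>m)"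
      by (intro nn_integral_mono) (auto simp: abs_mult ennreal_mult mult.commute intro!: mult_left_mono ennreal_leI)
    also have "\<dots> < \<infinity>"
    proof -
      have "integrable m (\<lambda>x. T (s + t) w x * w x)" using st by (intro L2_mult_integrable T.T_L2 w_L2) auto
      then show ?thesis by (simp add: integrable_iff_bounded)
    qed
    finally show "(\<integral>\<^sup>+q. W q * ennreal (kT0 (s + t) q) \<partial>(m \<Otimes>\<^sub>M m)) \<noteq> \<infinity>" by simp
    fix A B assume [measurable]: "A \<in> sets m" "B \<in> sets m"
    show "emeasure (density (m \<Otimes>\<^sub>M m) (\<lambda>q. W q * ennreal (kT0 (s + t) q))) (A \<times> B) = emeasure (density (m \<Otimes>\<^sub>M m) (\<lambda>q. W q * c q)) (A \<times> B)"
      using comp[OF \<open>B \<in> sets m\<close>] by (subst (1 2) rect) (auto intro!: nn_integral_cong_AE)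
  qed measurable
  then show ?thesis
  proof eventually_elim
    case (elim q)
    have "0 < w (fst q) * w (snd q)" by (simp add: w_pos)
    then have "W q \<noteq> 0" "W q \<noteq> \<infinity>" unfolding W_def by auto
    then show ?case using elim unfolding c_def by (simp add: ennreal_mult_cancel_left)
  qed
qed

end

section \<open>Continuity of the kernel in time\<close>

context semigroup_comparison
begin

text \<open>A finite measure with the null sets of m^2. Kernels are compared in its L_1-space, where
  the norm of \<open>kT0 t\<close> is the pairing of T(t)w with w.\<close>

definition weighted_square :: "('a \<times> 'a) measure" where
  "weighted_square = density (m \<Otimes>\<^sub>M m) (\<lambda>q. ennreal (w (fst q) * w (snd q)))"

lemma weighted_square_sets[measurable_cong, simp]: "sets weighted_square = sets (m \<Otimes>\<^sub>M m)" unfolding weighted_square_def by simp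

lemma weighted_square_nn_integral:
  assumes [measurable]: "h \<in> borel_measurable (m \<Otimes>\<^sub>M m)"
  shows "(\<integral>\<^sup>+q. h q \<partial>weighted_square) = (\<integral>\<^sup>+x. ennreal (w x) * (\<integral>\<^sup>+y. h (x, y) * ennreal (w y) \<partial>m) \<partial>m)"
proof -
  have "(\<integral>\<^sup>+q. h q \<partial>weighted_square) = (\<integral>\<^sup>+q. ennreal (w (fst q) * w (snd q)) * h q \<partial>(m \<Otimes>\<^sub>M m))"
    unfolding weighted_square_def by (rule nn_integral_density) measurable
  also have "\<dots> = (\<integral>\<^sup>+x. \<integral>\<^sup>+y. ennreal (w x * w y) * h (x, y) \<partial>m \<partial>m)"
    by (subst nn_integral_fst[symmetric]) auto
  also have "\<dots> = (\<integral>\<^sup>+x. ennreal (w x) * (\<integral>\<^sup>+y. h (x, y) * ennreal (w y) \<partial>m) \<partial>m)"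
  proof (intro nn_integral_cong)
    fix x assume [measurable]: "x \<in> space m"
    have "(\<integral>\<^sup>+y. ennreal (w x * w y) * h (x, y) \<partial>m) = (\<integral>\<^sup>+y. ennreal (w x) * (h (x, y) * ennreal (w y)) \<partial>m)"
      by (intro nn_integral_cong) (simp add: ennreal_mult mult_ac)
    also have "\<dots> = ennreal (w x) * (\<integral>\<^sup>+y. h (x, y) * ennreal (w y) \<partial>m)" by (rule nn_integral_cmult) measurable
    finally show "(\<integral>\<^sup>+y. ennreal (w x * w y) * h (x, y) \<partial>m) = \<dots>" .
  qed
  finally show ?thesis .
qed

lemma weighted_square_AE: "(AE q in weighted_square. P q) \<longleftrightarrow> (AE q in m \<Otimes>\<^sub>M m. P q)"
  unfolding weighted_square_def by (subst AE_density) (auto simp: w_pos mult_pos_pos)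

lemma kT0_integrable:
  assumes t: "0 < t"
  shows "integrable weighted_square (kT0 t)"
proof (rule integrableI_nonneg)
  note [measurable] = kT0_measurable[OF t]
  show "kT0 t \<in> borel_measurable weighted_square" using kT0_measurable[OF t] measurable_cong_sets[OF weighted_square_sets refl] by blast
  show "AE q in weighted_square. 0 \<le> kT0 t q" using kT0_nonneg[OF t] by simp
  have "(\<integral>\<^sup>+q. ennreal (kT0 t q) \<partial>weighted_square) = (\<integral>\<^sup>+x. ennreal (w x) * (\<integral>\<^sup>+y. ennreal (kT0 t (x, y)) * ennreal (w y) \<partial>m) \<partial>m)"
    by (rule weighted_square_nn_integral) measurable
  also have "\<dots> = (\<integral>\<^sup>+x. ennreal (w x) * ennreal (T t w x) \<partial>m)"
    using kT0_rep[OF t w_L2] by (intro nn_integral_cong_AE) auto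
  also have "\<dots> \<le> (\<integral>\<^sup>+x. ennreal \<bar>T t w x * w x\<bar> \<partial>m)"
    by (intro nn_integral_mono) (auto simp: abs_mult ennreal_mult mult.commute intro!: mult_left_mono ennreal_leI)
  also have "\<dots> < \<infinity>"
  proof -
    have "integrable m (\<lambda>x. T t w x * w x)" using t by (intro L2_mult_integrable T.T_L2 w_L2) auto
    then show ?thesis by (simp add: integrable_iff_bounded)
  qed
  finally show "(\<integral>\<^sup>+q. ennreal (kT0 t q) \<partial>weighted_square) < \<infinity>" .
qed

text \<open>Splitting the kernel at time \<open>s\<close> into a part dominated by \<open>n w(z)\<close> and a remainder:
  the semigroup acts on the first part strongly continuously in \<open>L\<^sub>2\<close>, and the remainder is small
  in \<open>L\<^sub>1\<close>, uniformly for bounded times.\<close>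

definition cut :: "real \<Rightarrow> nat \<Rightarrow> 'a \<times> 'a \<Rightarrow> real" where
  "cut s n q = min (kT0 s q) (real n * w (fst q))"

definition rest :: "real \<Rightarrow> nat \<Rightarrow> 'a \<times> 'a \<Rightarrow> real" where
  "rest s n q = kT0 s q - cut s n q"

definition cut_image :: "real \<Rightarrow> nat \<Rightarrow> real \<Rightarrow> 'a \<times> 'a \<Rightarrow> ennreal" where
  "cut_image s n \<sigma> q = (\<integral>\<^sup>+z. ennreal (kT0 \<sigma> (fst q, z)) * ennreal (cut s n (z, snd q)) \<partial>m)"

definition rest_image :: "real \<Rightarrow> nat \<Rightarrow> real \<Rightarrow> 'a \<times> 'a \<Rightarrow> ennreal" where
  "rest_image s n \<sigma> q = (\<integral>\<^sup>+z. ennreal (kT0 \<sigma> (fst q, z)) * ennreal (rest s n (z, snd q)) \<partial>m)"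

context
  fixes s :: real assumes s: "0 < s"
begin

lemma cut_measurable[measurable]: "cut s n \<in> borel_measurable (m \<Otimes>\<^sub>M m)"
  and rest_measurable[measurable]: "rest s n \<in> borel_measurable (m \<Otimes>\<^sub>M m)"
  using kT0_measurable[OF s] unfolding rest_def cut_def by measurable

lemma cut_nonneg: "0 \<le> cut s n q" and cut_le: "cut s n q \<le> real n * w (fst q)" and rest_nonneg: "0 \<le> rest s n q"
  and rest_le: "rest s n q \<le> kT0 s q"
  using kT0_nonneg[OF s, of q] unfolding rest_def cut_def by auto

lemma cut_image_measurable: "0 < \<sigma> \<Longrightarrow> cut_image s n \<sigma> \<in> borel_measurable (m \<Otimes>\<^sub>M m)"
  and rest_image_measurable: "0 < \<sigma> \<Longrightarrow> rest_image s n \<sigma> \<in> borel_measurable (m \<Otimes>\<^sub>M m)"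
proof -
  assume "0 < \<sigma>"
  note [measurable] = kT0_measurable[OF this]
  show "cut_image s n \<sigma> \<in> borel_measurable (m \<Otimes>\<^sub>M m)" "rest_image s n \<sigma> \<in> borel_measurable (m \<Otimes>\<^sub>M m)"
    unfolding cut_image_def rest_image_def by measurable
qed

lemma cut_section:
  assumes y: "y \<in> space m"
  shows "(\<lambda>z. cut s n (z, y)) \<in> Lp 2 m"
    and "0 < \<sigma> \<Longrightarrow> AE x in m. cut_image s n \<sigma> (x, y) = ennreal (T \<sigma> (\<lambda>z. cut s n (z, y)) x)"
proof -
  note [measurable] = y
  show g: "(\<lambda>z. cut s n (z, y)) \<in> Lp 2 m"
    by (rule L2_mono(1)[OF L2_cmult(1)[OF w_L2, of "real n"]]) (use cut_nonneg cut_le in \<open>auto simp: abs_mult\<close>)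
  show "AE x in m. cut_image s n \<sigma> (x, y) = ennreal (T \<sigma> (\<lambda>z. cut s n (z, y)) x)" if "0 < \<sigma>"
    using kT0_rep[OF that g cut_nonneg] unfolding cut_image_def by auto
qed

lemma kT0_split:
  assumes \<sigma>: "0 < \<sigma>"
  shows "AE q in m \<Otimes>\<^sub>M m. ennreal (kT0 (\<sigma> + s) q) = cut_image s n \<sigma> q + rest_image s n \<sigma> q"
  using kT0_semigroup[OF \<sigma> s] AE_space
proof eventually_elim
  case (elim q)
  note [measurable] = kT0_measurable[OF \<sigma>]
  have [measurable]: "fst q \<in> space m" "snd q \<in> space m" using elim(2) by (auto simp: space_pair_measure)
  have "(\<integral>\<^sup>+z. ennreal (kT0 \<sigma> (fst q, z)) * ennreal (kT0 s (z, snd q)) \<partial>m) =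
      (\<integral>\<^sup>+z. ennreal (kT0 \<sigma> (fst q, z)) * ennreal (cut s n (z, snd q)) + ennreal (kT0 \<sigma> (fst q, z)) * ennreal (rest s n (z, snd q)) \<partial>m)"
  proof (intro nn_integral_cong)
    fix z
    have "kT0 s (z, snd q) = cut s n (z, snd q) + rest s n (z, snd q)" by (simp add: rest_def)
    then show "ennreal (kT0 \<sigma> (fst q, z)) * ennreal (kT0 s (z, snd q)) =
        ennreal (kT0 \<sigma> (fst q, z)) * ennreal (cut s n (z, snd q)) + ennreal (kT0 \<sigma> (fst q, z)) * ennreal (rest s n (z, snd q))"
      by (simp add: cut_nonneg rest_nonneg distrib_left)
  qed
  also have "\<dots> = cut_image s n \<sigma> q + rest_image s n \<sigma> q"
    unfolding cut_image_def rest_image_def by (rule nn_integral_add) measurable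
  finally show ?case using elim(1) by simp
qed

text \<open>Integrating out y first gives a function \<psi> of z below T(s)w, hence in L_1 and L_2.
  The integral then becomes the pairing of T(\<sigma>)\<psi> with w, and w \<le> 1 together with the
  L_1 bound of T gives the estimate.\<close>

lemma rest_image_bound:
  assumes \<sigma>: "0 < \<sigma>"
  shows "(\<integral>\<^sup>+q. rest_image s n \<sigma> q \<partial>weighted_square) \<le> ennreal (M * exp (\<omega> * \<sigma>)) * (\<integral>\<^sup>+z. \<integral>\<^sup>+y. ennreal (rest s n (z, y)) * ennreal (w y) \<partial>m \<partial>m)"
proof -
  interpret P: pair_sigma_finite m m ..
  note [measurable] = kT0_measurable[OF \<sigma>] rest_image_measurable[OF \<sigma>] kT0_measurable[OF s]
  define \<phi> where "\<phi> z = (\<integral>\<^sup>+y. ennreal (rest s n (z, y)) * ennreal (w y) \<partial>m)" for z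
  have [measurable]: "\<phi> \<in> borel_measurable m" unfolding \<phi>_def by measurable
  define \<psi> where "\<psi> z = enn2real (\<phi> z)" for z
  have [measurable]: "\<psi> \<in> borel_measurable m" unfolding \<psi>_def by measurable
  have \<psi>0: "0 \<le> \<psi> z" for z unfolding \<psi>_def by simp
  have Tw: "T s w \<in> Lp 2 m" "integrable m (T s w)" using s w_L2 w_integrable by (auto intro!: T.T_L2 T_L1(1))
  have \<phi>le: "AE z in m. \<phi> z \<le> ennreal (T s w z)"
    using kT0_rep[OF s w_L2 w_nonneg]
  proof eventually_elim
    case (elim z)
    show ?case unfolding elim \<phi>_def by (intro nn_integral_mono mult_right_mono ennreal_leI rest_le) auto
  qed
  then have \<phi>\<psi>: "AE z in m. \<phi> z = ennreal (\<psi> z)"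
    by eventually_elim (auto simp: \<psi>_def le_less_trans[OF _ ennreal_less_top])
  have \<psi>le: "AE z in m. \<bar>\<psi> z\<bar> \<le> \<bar>T s w z\<bar>"
    using \<phi>le \<phi>\<psi>
  proof eventually_elim
    case (elim z)
    then have "ennreal (\<psi> z) \<le> ennreal (T s w z)" by simp
    then show ?case using \<psi>0[of z] by (cases "0 \<le> T s w z") (auto simp: ennreal_neg ennreal_eq_0_iff)
  qed
  have \<psi>2: "\<psi> \<in> Lp 2 m" by (rule L2_mono(1)[OF Tw(1) _ \<psi>le]) measurable
  have \<psi>1: "integrable m \<psi>" by (rule Bochner_Integration.integrable_bound[OF Tw(2)]) (use \<psi>le in auto)
  have "(\<integral>\<^sup>+q. rest_image s n \<sigma> q \<partial>weighted_square) = (\<integral>\<^sup>+x. ennreal (w x) * (\<integral>\<^sup>+y. rest_image s n \<sigma> (x, y) * ennreal (w y) \<partial>m) \<partial>m)"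
    by (rule weighted_square_nn_integral) measurable
  also have "\<dots> = (\<integral>\<^sup>+x. ennreal (w x) * (\<integral>\<^sup>+z. ennreal (kT0 \<sigma> (x, z)) * \<phi> z \<partial>m) \<partial>m)"
  proof (rule nn_integral_cong)
    fix x assume [measurable]: "x \<in> space m"
    have "(\<integral>\<^sup>+y. rest_image s n \<sigma> (x, y) * ennreal (w y) \<partial>m) =
        (\<integral>\<^sup>+y. \<integral>\<^sup>+z. ennreal (kT0 \<sigma> (x, z)) * (ennreal (rest s n (z, y)) * ennreal (w y)) \<partial>m \<partial>m)"
    proof (intro nn_integral_cong)
      fix y assume [measurable]: "y \<in> space m"
      have "rest_image s n \<sigma> (x, y) * ennreal (w y) = (\<integral>\<^sup>+z. ennreal (kT0 \<sigma> (x, z)) * ennreal (rest s n (z, y)) * ennreal (w y) \<partial>m)"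
        unfolding rest_image_def fst_conv snd_conv by (rule nn_integral_multc[symmetric]) measurable
      then show "rest_image s n \<sigma> (x, y) * ennreal (w y) = (\<integral>\<^sup>+z. ennreal (kT0 \<sigma> (x, z)) * (ennreal (rest s n (z, y)) * ennreal (w y)) \<partial>m)"
        by (simp add: mult.assoc)
    qed
    also have "\<dots> = (\<integral>\<^sup>+z. \<integral>\<^sup>+y. ennreal (kT0 \<sigma> (x, z)) * (ennreal (rest s n (z, y)) * ennreal (w y)) \<partial>m \<partial>m)"
      by (rule P.Fubini'[symmetric]) measurable
    also have "\<dots> = (\<integral>\<^sup>+z. ennreal (kT0 \<sigma> (x, z)) * \<phi> z \<partial>m)"
      unfolding \<phi>_def by (intro nn_integral_cong nn_integral_cmult) measurable
    finally show "ennreal (w x) * (\<integral>\<^sup>+y. rest_image s n \<sigma> (x, y) * ennreal (w y) \<partial>m) =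
        ennreal (w x) * (\<integral>\<^sup>+z. ennreal (kT0 \<sigma> (x, z)) * \<phi> z \<partial>m)" by simp
  qed
  also have "\<dots> = (\<integral>\<^sup>+x. ennreal (w x) * ennreal (T \<sigma> \<psi> x) \<partial>m)"
  proof (rule nn_integral_cong_AE)
    have "(\<integral>\<^sup>+z. ennreal (kT0 \<sigma> (x, z)) * \<phi> z \<partial>m) = (\<integral>\<^sup>+z. ennreal (kT0 \<sigma> (x, z)) * ennreal (\<psi> z) \<partial>m)" for x
      using \<phi>\<psi> by (intro nn_integral_cong_AE) auto
    then show "AE x in m. ennreal (w x) * (\<integral>\<^sup>+z. ennreal (kT0 \<sigma> (x, z)) * \<phi> z \<partial>m) = ennreal (w x) * ennreal (T \<sigma> \<psi> x)"
      using kT0_rep[OF \<sigma> \<psi>2 \<psi>0] by auto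
  qed
  also have "\<dots> \<le> (\<integral>\<^sup>+x. ennreal \<bar>T \<sigma> \<psi> x\<bar> \<partial>m)"
  proof (intro nn_integral_mono)
    fix x
    have "ennreal (w x) * ennreal (T \<sigma> \<psi> x) \<le> ennreal 1 * ennreal \<bar>T \<sigma> \<psi> x\<bar>"
      using w_le_1[of x] by (intro mult_mono ennreal_leI) auto
    then show "ennreal (w x) * ennreal (T \<sigma> \<psi> x) \<le> ennreal \<bar>T \<sigma> \<psi> x\<bar>" by simp
  qed
  also have "\<dots> = ennreal (LINT x|m. \<bar>T \<sigma> \<psi> x\<bar>)"
    using T_L1(1)[OF less_imp_le[OF \<sigma>] \<psi>2 \<psi>1] by (intro nn_integral_eq_integral) auto
  also have "\<dots> \<le> ennreal (M * exp (\<omega> * \<sigma>) * (LINT x|m. \<bar>\<psi> x\<bar>))"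
    by (intro ennreal_leI T_L1(2) less_imp_le[OF \<sigma>] \<psi>2 \<psi>1)
  also have "\<dots> = ennreal (M * exp (\<omega> * \<sigma>)) * (\<integral>\<^sup>+z. ennreal (\<psi> z) \<partial>m)"
    using M_ge_1 \<psi>1 \<psi>0 by (simp add: ennreal_mult integral_nonneg_AE nn_integral_eq_integral)
  also have "(\<integral>\<^sup>+z. ennreal (\<psi> z) \<partial>m) = (\<integral>\<^sup>+z. \<phi> z \<partial>m)"
    using \<phi>\<psi> by (intro nn_integral_cong_AE) auto
  finally show ?thesis unfolding \<phi>_def .
qed

text \<open>At each point the remainder is 0 once n w(z) reaches the kernel, and the kernel itself
  dominates, its weighted integral being that of T(s)w.\<close>

lemma rest_tendsto_0:
  "(\<lambda>n. \<integral>\<^sup>+z. \<integral>\<^sup>+y. ennreal (rest s n (z, y)) * ennreal (w y) \<partial>m \<partial>m) \<longlonglongrightarrow> 0"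
proof -
  note [measurable] = kT0_measurable[OF s]
  have Tw: "integrable m (T s w)" using s w_L2 w_integrable by (auto intro!: T_L1(1))
  have "(\<lambda>n. \<integral>\<^sup>+q. ennreal (rest s n q) * ennreal (w (snd q)) \<partial>(m \<Otimes>\<^sub>M m)) \<longlonglongrightarrow> (\<integral>\<^sup>+q. 0 \<partial>(m \<Otimes>\<^sub>M m))"
  proof (rule nn_integral_dominated_convergence[where w = "\<lambda>q. ennreal (kT0 s q) * ennreal (w (snd q))"])
    show "AE q in m \<Otimes>\<^sub>M m. ennreal (rest s n q) * ennreal (w (snd q)) \<le> ennreal (kT0 s q) * ennreal (w (snd q))" for n
      by (intro AE_I2 mult_right_mono ennreal_leI rest_le) auto
    have "(\<integral>\<^sup>+q. ennreal (kT0 s q) * ennreal (w (snd q)) \<partial>(m \<Otimes>\<^sub>M m)) = (\<integral>\<^sup>+x. \<integral>\<^sup>+y. ennreal (kT0 s (x, y)) * ennreal (w y) \<partial>m \<partial>m)"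
      by (subst nn_integral_fst[symmetric]) auto
    also have "\<dots> = (\<integral>\<^sup>+x. ennreal (T s w x) \<partial>m)"
      using kT0_rep[OF s w_L2] by (intro nn_integral_cong_AE) auto
    also have "\<dots> \<le> (\<integral>\<^sup>+x. ennreal \<bar>T s w x\<bar> \<partial>m)" by (intro nn_integral_mono ennreal_leI) simp
    also have "\<dots> < \<infinity>" using Tw by (simp add: integrable_iff_bounded)
    finally show "(\<integral>\<^sup>+q. ennreal (kT0 s q) * ennreal (w (snd q)) \<partial>(m \<Otimes>\<^sub>M m)) < \<infinity>" .
    show "AE q in m \<Otimes>\<^sub>M m. (\<lambda>n. ennreal (rest s n q) * ennreal (w (snd q))) \<longlonglongrightarrow> 0"
    proof (intro AE_I2 tendsto_eventually)
      fix q
      obtain n0 where n0: "kT0 s q \<le> real n0 * w (fst q)" using reals_Archimedean3[OF w_pos[of "fst q"]] by (meson less_imp_le)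
      have "rest s n q = 0" if "n \<ge> n0" for n
      proof -
        have "real n0 * w (fst q) \<le> real n * w (fst q)" using that by (intro mult_right_mono) auto
        then show ?thesis using n0 unfolding rest_def cut_def by simp
      qed
      then show "\<forall>\<^sub>F n in sequentially. ennreal (rest s n q) * ennreal (w (snd q)) = 0"
        unfolding eventually_sequentially by (intro exI[of _ n0]) simp
    qed
  qed measurable
  moreover have "(\<integral>\<^sup>+q. ennreal (rest s n q) * ennreal (w (snd q)) \<partial>(m \<Otimes>\<^sub>M m)) = (\<integral>\<^sup>+z. \<integral>\<^sup>+y. ennreal (rest s n (z, y)) * ennreal (w y) \<partial>m \<partial>m)" for n
    by (subst nn_integral_fst[symmetric]) auto
  ultimately show ?thesis by simp
qed

text \<open>For fixed y the column lies in L_2, so \<open>D j y\<close> tends to 0 by strong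
  continuity and Cauchy-Schwarz with w. All columns are bounded by n w, so one constant dominates
  for all y and j, and the remaining weight w(y) is integrable.\<close>

lemma cut_image_continuous:
  assumes \<sigma>: "0 < \<sigma>" and X: "\<And>j. 0 < X j" "X \<longlonglongrightarrow> \<sigma>"
  shows "(\<lambda>j. \<integral>\<^sup>+q. ennreal \<bar>enn2real (cut_image s n (X j) q) - enn2real (cut_image s n \<sigma> q)\<bar> \<partial>weighted_square) \<longlonglongrightarrow> 0"
proof -
  interpret P: pair_sigma_finite m m ..
  note [measurable] = cut_image_measurable[OF X(1)] cut_image_measurable[OF \<sigma>]
  define D where "D j y = (\<integral>\<^sup>+x. ennreal (w x) * ennreal \<bar>enn2real (cut_image s n (X j) (x, y)) - enn2real (cut_image s n \<sigma> (x, y))\<bar> \<partial>m)" for j y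
  have [measurable]: "D j \<in> borel_measurable m" for j unfolding D_def by measurable
  obtain R where R: "\<And>j. \<bar>X j\<bar> \<le> R" "\<sigma> \<le> R"
  proof -
    obtain R where "\<forall>j. \<bar>X j\<bar> \<le> R" using convergent_imp_Bseq[OF convergentI[OF X(2)]] by (auto simp: Bseq_def)
    then show ?thesis using that[of "max R \<sigma>"] by (simp add: le_max_iff_disj)
  qed
  obtain K where K: "1 \<le> K" "\<And>t u. 0 \<le> t \<Longrightarrow> t \<le> R \<Longrightarrow> u \<in> Lp 2 m \<Longrightarrow> norm2 m (T t u) \<le> K * norm2 m u"
    using T.locally_bounded[of R] by blast
  have Xj: "0 \<le> X j" "X j \<le> R" "0 \<le> \<sigma>" for j using X(1)[of j] R(1)[of j] \<sigma> by auto
  have Dle: "D j y \<le> ennreal (norm2 m w * norm2 m (\<lambda>x. T (X j) (\<lambda>z. cut s n (z, y)) x - T \<sigma> (\<lambda>z. cut s n (z, y)) x))"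
    if y: "y \<in> space m" for j y
  proof -
    let ?g = "\<lambda>z. cut s n (z, y)"
    have g: "?g \<in> Lp 2 m" "\<And>z. 0 \<le> ?g z" using cut_section(1)[OF y] cut_nonneg by auto
    have Tg: "T (X j) ?g \<in> Lp 2 m" "T \<sigma> ?g \<in> Lp 2 m" using g Xj by (auto intro!: T.T_L2)
    note d2 = L2_diff(1)[OF Tg]
    have nn: "AE x in m. 0 \<le> T (X j) ?g x" "AE x in m. 0 \<le> T \<sigma> ?g x" using g Xj by (auto intro!: T.T_nonneg)
    have "D j y = (\<integral>\<^sup>+x. ennreal \<bar>w x * (T (X j) ?g x - T \<sigma> ?g x)\<bar> \<partial>m)"
      unfolding D_def
    proof (rule nn_integral_cong_AE)
      show "AE x in m. ennreal (w x) * ennreal \<bar>enn2real (cut_image s n (X j) (x, y)) - enn2real (cut_image s n \<sigma> (x, y))\<bar> =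
          ennreal \<bar>w x * (T (X j) ?g x - T \<sigma> ?g x)\<bar>"
        using cut_section(2)[OF y X(1)[of j], of n] cut_section(2)[OF y \<sigma>, of n] nn
        by eventually_elim (simp add: abs_mult ennreal_mult)
    qed
    also have "\<dots> = ennreal (LINT x|m. \<bar>w x * (T (X j) ?g x - T \<sigma> ?g x)\<bar>)"
      using L2_mult_integrable[OF w_L2 d2] by (intro nn_integral_eq_integral) auto
    also have "\<dots> \<le> ennreal (norm2 m w * norm2 m (\<lambda>x. T (X j) ?g x - T \<sigma> ?g x))"
      by (intro ennreal_leI L2_Cauchy_Schwarz w_L2 d2)
    finally show ?thesis .
  qed
  define B where "B = norm2 m w * (K * (real n * norm2 m w) + K * (real n * norm2 m w))"
  have gn: "norm2 m (\<lambda>z. cut s n (z, y)) \<le> real n * norm2 m w" if y: "y \<in> space m" for y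
  proof -
    have "norm2 m (\<lambda>z. cut s n (z, y)) \<le> norm2 m (\<lambda>x. real n * w x)"
      using cut_nonneg cut_le L2_measurable[OF cut_section(1)[OF y]]
      by (intro L2_mono(2) L2_cmult(1) w_L2) (auto simp: abs_mult)
    then show ?thesis by (simp add: L2_cmult(2) w_L2)
  qed
  have DB: "D j y \<le> ennreal B" if y: "y \<in> space m" for j y
  proof (rule order_trans[OF Dle[OF y] ennreal_leI])
    let ?g = "\<lambda>z. cut s n (z, y)"
    have g: "?g \<in> Lp 2 m" by (rule cut_section(1)[OF y])
    have b: "norm2 m (T \<tau> ?g) \<le> K * (real n * norm2 m w)" if "0 \<le> \<tau>" "\<tau> \<le> R" for \<tau>
    proof -
      have "norm2 m (T \<tau> ?g) \<le> K * norm2 m ?g" by (intro K that g)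
      also have "\<dots> \<le> K * (real n * norm2 m w)" using K(1) gn[OF y] by (intro mult_left_mono) auto
      finally show ?thesis .
    qed
    have "norm2 m (\<lambda>x. T (X j) ?g x - T \<sigma> ?g x) \<le> norm2 m (T (X j) ?g) + norm2 m (T \<sigma> ?g)"
      using g Xj by (intro L2_diff(2) T.T_L2) auto
    also have "\<dots> \<le> K * (real n * norm2 m w) + K * (real n * norm2 m w)"
      using Xj R by (intro add_mono b) auto
    finally show "norm2 m w * norm2 m (\<lambda>x. T (X j) ?g x - T \<sigma> ?g x) \<le> B"
      unfolding B_def by (intro mult_left_mono) auto
  qed
  have D0: "(\<lambda>j. D j y) \<longlonglongrightarrow> 0" if y: "y \<in> space m" for y
  proof -
    let ?g = "\<lambda>z. cut s n (z, y)"
    have g: "?g \<in> Lp 2 m" by (rule cut_section(1)[OF y])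
    have "(\<lambda>j. norm2 m (\<lambda>x. T (X j) ?g x - T \<sigma> ?g x)) \<longlonglongrightarrow> 0"
    proof (rule LIMSEQ_I)
      fix e :: real assume e: "0 < e"
      obtain \<delta> where \<delta>: "0 < \<delta>" "\<And>r t. 0 \<le> r \<Longrightarrow> r \<le> R \<Longrightarrow> 0 \<le> t \<Longrightarrow> t \<le> R \<Longrightarrow> \<bar>r - t\<bar> < \<delta> \<Longrightarrow>
          norm2 m (\<lambda>x. T r ?g x - T t ?g x) < e"
        by (rule T.uniformly_continuous[OF g e, of R]) blast
      obtain N where "\<forall>j\<ge>N. norm (X j - \<sigma>) < \<delta>" using LIMSEQ_D[OF X(2) \<delta>(1)] by blast
      then show "\<exists>no. \<forall>j\<ge>no. norm (norm2 m (\<lambda>x. T (X j) ?g x - T \<sigma> ?g x) - 0) < e"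
        using \<delta>(2) Xj R by (intro exI[of _ N]) auto
    qed
    then have "(\<lambda>j. ennreal (norm2 m w * norm2 m (\<lambda>x. T (X j) ?g x - T \<sigma> ?g x))) \<longlonglongrightarrow> ennreal (norm2 m w * 0)"
      by (intro tendsto_ennrealI tendsto_mult_left)
    then show ?thesis
      by (intro tendsto_sandwich[where f = "\<lambda>_. 0" and g = "\<lambda>j. D j y" and
            h = "\<lambda>j. ennreal (norm2 m w * norm2 m (\<lambda>x. T (X j) ?g x - T \<sigma> ?g x))"])
        (use Dle[OF y] in \<open>auto intro!: always_eventually\<close>)
  qed
  have "(\<lambda>j. \<integral>\<^sup>+y. D j y * ennreal (w y) \<partial>m) \<longlonglongrightarrow> (\<integral>\<^sup>+y. 0 \<partial>m)"
  proof (rule nn_integral_dominated_convergence[where w = "\<lambda>y. ennreal B * ennreal (w y)"])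
    show "AE y in m. D j y * ennreal (w y) \<le> ennreal B * ennreal (w y)" for j
      by (intro AE_I2 mult_right_mono DB) auto
    show "(\<integral>\<^sup>+y. ennreal B * ennreal (w y) \<partial>m) < \<infinity>"
      using w_integrable by (simp add: nn_integral_cmult nn_integral_eq_integral ennreal_mult_less_top)
    show "AE y in m. (\<lambda>j. D j y * ennreal (w y)) \<longlonglongrightarrow> 0"
    proof (rule AE_I2)
      fix y assume "y \<in> space m"
      then have "(\<lambda>j. ennreal (w y) * D j y) \<longlonglongrightarrow> ennreal (w y) * 0"
        by (intro ennreal_tendsto_cmult D0) auto
      then show "(\<lambda>j. D j y * ennreal (w y)) \<longlonglongrightarrow> 0" by (simp add: mult.commute)
    qed
  qed measurable
  moreover have "(\<integral>\<^sup>+q. ennreal \<bar>enn2real (cut_image s n (X j) q) - enn2real (cut_image s n \<sigma> q)\<bar> \<partial>weighted_square) = (\<integral>\<^sup>+y. D j y * ennreal (w y) \<partial>m)" for j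
  proof -
    define h where "h q = ennreal \<bar>enn2real (cut_image s n (X j) q) - enn2real (cut_image s n \<sigma> q)\<bar>" for q
    have [measurable]: "h \<in> borel_measurable (m \<Otimes>\<^sub>M m)" unfolding h_def by measurable
    have "(\<integral>\<^sup>+q. h q \<partial>weighted_square) = (\<integral>\<^sup>+x. ennreal (w x) * (\<integral>\<^sup>+y. h (x, y) * ennreal (w y) \<partial>m) \<partial>m)"
      by (rule weighted_square_nn_integral) measurable
    also have "\<dots> = (\<integral>\<^sup>+x. \<integral>\<^sup>+y. ennreal (w x) * (h (x, y) * ennreal (w y)) \<partial>m \<partial>m)"
      by (intro nn_integral_cong nn_integral_cmult[symmetric]) measurable
    also have "\<dots> = (\<integral>\<^sup>+y. \<integral>\<^sup>+x. ennreal (w x) * (h (x, y) * ennreal (w y)) \<partial>m \<partial>m)"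
      by (rule P.Fubini'[symmetric]) measurable
    also have "\<dots> = (\<integral>\<^sup>+y. D j y * ennreal (w y) \<partial>m)"
    proof (intro nn_integral_cong)
      fix y assume [measurable]: "y \<in> space m"
      have "(\<integral>\<^sup>+x. ennreal (w x) * (h (x, y) * ennreal (w y)) \<partial>m) = (\<integral>\<^sup>+x. ennreal (w x) * h (x, y) * ennreal (w y) \<partial>m)"
        by (simp add: mult.assoc)
      also have "\<dots> = D j y * ennreal (w y)" unfolding D_def h_def by (rule nn_integral_multc) measurable
      finally show "(\<integral>\<^sup>+x. ennreal (w x) * (h (x, y) * ennreal (w y)) \<partial>m) = D j y * ennreal (w y)" .
    qed
    finally show ?thesis unfolding h_def .
  qed
  ultimately show ?thesis by simp
qed

end

end

section \<open>Continuity in time and the jointly measurable kernel of T\<close>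

context semigroup_comparison
begin

text \<open>The kernel is real valued, so both summands of its splitting are finite almost
  everywhere and the triangle inequality applies to real numbers.\<close>

lemma kT0_distance_le:
  assumes s: "0 < s" and \<sigma>: "0 < \<sigma>" and \<tau>: "0 < \<tau>"
  shows "(\<integral>\<^sup>+q. ennreal \<bar>kT0 (\<sigma> + s) q - kT0 (\<tau> + s) q\<bar> \<partial>weighted_square) \<le>
    (\<integral>\<^sup>+q. ennreal \<bar>enn2real (cut_image s n \<sigma> q) - enn2real (cut_image s n \<tau> q)\<bar> \<partial>weighted_square) +
    (\<integral>\<^sup>+q. rest_image s n \<sigma> q \<partial>weighted_square) + (\<integral>\<^sup>+q. rest_image s n \<tau> q \<partial>weighted_square)"
proof -
  have t: "0 < \<sigma> + s" "0 < \<tau> + s" using s \<sigma> \<tau> by auto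
  have [measurable]: "cut_image s n \<sigma> \<in> borel_measurable weighted_square" "cut_image s n \<tau> \<in> borel_measurable weighted_square"
    "rest_image s n \<sigma> \<in> borel_measurable weighted_square" "rest_image s n \<tau> \<in> borel_measurable weighted_square"
    using cut_image_measurable[OF s] rest_image_measurable[OF s] \<sigma> \<tau> by (simp_all cong: measurable_cong_sets)
  have "(\<integral>\<^sup>+q. ennreal \<bar>kT0 (\<sigma> + s) q - kT0 (\<tau> + s) q\<bar> \<partial>weighted_square) \<le>
    (\<integral>\<^sup>+q. ennreal \<bar>enn2real (cut_image s n \<sigma> q) - enn2real (cut_image s n \<tau> q)\<bar> + rest_image s n \<sigma> q + rest_image s n \<tau> q \<partial>weighted_square)"
  proof (rule nn_integral_mono_AE)
    have "AE q in m \<Otimes>\<^sub>M m. ennreal \<bar>kT0 (\<sigma> + s) q - kT0 (\<tau> + s) q\<bar> \<le>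
      ennreal \<bar>enn2real (cut_image s n \<sigma> q) - enn2real (cut_image s n \<tau> q)\<bar> + rest_image s n \<sigma> q + rest_image s n \<tau> q"
      using kT0_split[OF s \<sigma>, of n] kT0_split[OF s \<tau>, of n]
    proof eventually_elim
      case (elim q)
      have f: "\<exists>a r. 0 \<le> a \<and> 0 \<le> r \<and> cut_image s n \<rho> q = ennreal a \<and> rest_image s n \<rho> q = ennreal r \<and> kT0 (\<rho> + s) q = a + r"
        if \<rho>: "0 < \<rho>" and e: "ennreal (kT0 (\<rho> + s) q) = cut_image s n \<rho> q + rest_image s n \<rho> q" for \<rho>
      proof -
        have "cut_image s n \<rho> q + rest_image s n \<rho> q < \<infinity>" using e[symmetric] by simp
        then have "cut_image s n \<rho> q < \<infinity>" "rest_image s n \<rho> q < \<infinity>" by auto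
        then obtain a r where ar: "0 \<le> a" "0 \<le> r" "cut_image s n \<rho> q = ennreal a" "rest_image s n \<rho> q = ennreal r"
          by (metis ennreal_enn2real enn2real_nonneg infinity_ennreal_def)
        then have "ennreal (kT0 (\<rho> + s) q) = ennreal (a + r)" using e by (simp add: ennreal_plus)
        then have "kT0 (\<rho> + s) q = a + r" using ar kT0_nonneg[of "\<rho> + s" q] \<rho> s by (subst (asm) ennreal_inj) auto
        then show ?thesis using ar by blast
      qed
      obtain a r where 1: "0 \<le> a" "0 \<le> r" "cut_image s n \<sigma> q = ennreal a" "rest_image s n \<sigma> q = ennreal r" "kT0 (\<sigma> + s) q = a + r"
        using f[OF \<sigma> elim(1)] by blast
      obtain a' r' where 2: "0 \<le> a'" "0 \<le> r'" "cut_image s n \<tau> q = ennreal a'" "rest_image s n \<tau> q = ennreal r'" "kT0 (\<tau> + s) q = a' + r'"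
        using f[OF \<tau> elim(2)] by blast
      have "\<bar>(a + r) - (a' + r')\<bar> \<le> \<bar>a - a'\<bar> + r + r'" using 1(2) 2(2) by linarith
      then have "ennreal \<bar>(a + r) - (a' + r')\<bar> \<le> ennreal (\<bar>a - a'\<bar> + r + r')" by (rule ennreal_leI)
      also have "\<dots> = ennreal \<bar>a - a'\<bar> + ennreal r + ennreal r'" using 1(2) 2(2) by (simp add: ennreal_plus)
      finally show ?case unfolding 1(3-5) 2(3-5) using 1(1) 2(1) by simp
    qed
    then show "AE q in weighted_square. ennreal \<bar>kT0 (\<sigma> + s) q - kT0 (\<tau> + s) q\<bar> \<le>
      ennreal \<bar>enn2real (cut_image s n \<sigma> q) - enn2real (cut_image s n \<tau> q)\<bar> + rest_image s n \<sigma> q + rest_image s n \<tau> q"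
      unfolding weighted_square_AE .
  qed
  also have "\<dots> = (\<integral>\<^sup>+q. ennreal \<bar>enn2real (cut_image s n \<sigma> q) - enn2real (cut_image s n \<tau> q)\<bar> \<partial>weighted_square) +
    (\<integral>\<^sup>+q. rest_image s n \<sigma> q \<partial>weighted_square) + (\<integral>\<^sup>+q. rest_image s n \<tau> q \<partial>weighted_square)"
    by (subst nn_integral_add; measurable?)+
  finally show ?thesis .
qed

text \<open>Times near t are written \<sigma> + s with s = t / 2 fixed, so the splitting at s
  applies to all of them and \<sigma> stays in (0, t]. The truncation level n is chosen first, which
  makes the remainders small uniformly in \<sigma>; then the truncated parts converge.\<close>

lemma kT0_continuous:
  assumes t: "0 < t"
  shows "((\<lambda>r. LINT q|weighted_square. \<bar>kT0 r q - kT0 t q\<bar>) \<longlongrightarrow> 0) (at t)"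
  unfolding tendsto_at_iff_sequentially comp_def
proof (intro allI impI)
  fix X :: "nat \<Rightarrow> real" assume X: "X \<longlonglongrightarrow> t"
  define s where "s = t / 2"
  have s: "0 < s" "s < t" using t unfolding s_def by auto
  obtain j0 where j0: "\<And>j. j \<ge> j0 \<Longrightarrow> \<bar>X j - t\<bar> < s"
    using LIMSEQ_D[OF X s(1)] by auto
  \<comment> \<open>Dropping the first j0 terms keeps every \<open>Y j\<close> positive and at most
    \<open>t\<close>.\<close>
  define Y where "Y j = X (j + j0) - s" for j
  have Y: "0 < Y j" "Y j \<le> t" for j
    using j0[of "j + j0"] s unfolding Y_def s_def by (auto simp: abs_if split: if_splits)
  have Yl: "Y \<longlonglongrightarrow> s"
  proof -
    have "(\<lambda>j. X (j + j0) - s) \<longlonglongrightarrow> t - s" by (rule tendsto_diff[OF LIMSEQ_ignore_initial_segment[OF X] tendsto_const])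
    then show ?thesis unfolding Y_def s_def by simp
  qed
  have Yt: "X (j + j0) = Y j + s" "t = s + s" for j unfolding Y_def s_def by auto
  have int: "integrable weighted_square (\<lambda>q. \<bar>kT0 (Y j + s) q - kT0 (s + s) q\<bar>)" for j
    using Y(1)[of j] s by (intro integrable_abs Bochner_Integration.integrable_diff kT0_integrable) auto
  define E where "E = M * exp (\<bar>\<omega>\<bar> * t)"
  have E0: "0 \<le> E" unfolding E_def using M_ge_1 by simp
  have Eb: "M * exp (\<omega> * \<sigma>) \<le> E" if "0 < \<sigma>" "\<sigma> \<le> t" for \<sigma>
  proof -
    have "\<omega> * \<sigma> \<le> \<bar>\<omega>\<bar> * \<sigma>" using that by (intro mult_right_mono) auto
    also have "\<dots> \<le> \<bar>\<omega>\<bar> * t" using that by (intro mult_left_mono) auto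
    finally show ?thesis unfolding E_def using M_ge_1 by (intro mult_left_mono) auto
  qed
  define \<rho> where "\<rho> n = (\<integral>\<^sup>+z. \<integral>\<^sup>+y. ennreal (rest s n (z, y)) * ennreal (w y) \<partial>m \<partial>m)" for n
  have rb: "(\<integral>\<^sup>+q. rest_image s n \<sigma> q \<partial>weighted_square) \<le> ennreal E * \<rho> n" if "0 < \<sigma>" "\<sigma> \<le> t" for \<sigma> n
    unfolding \<rho>_def by (rule order_trans[OF rest_image_bound[OF s(1) that(1)] mult_right_mono[OF ennreal_leI[OF Eb[OF that]]]]) simp
  have "(\<lambda>n. ennreal E * \<rho> n) \<longlonglongrightarrow> ennreal E * 0"
    unfolding \<rho>_def by (intro ennreal_tendsto_cmult rest_tendsto_0 s) simp
  then have \<rho>0: "(\<lambda>n. ennreal E * \<rho> n) \<longlonglongrightarrow> 0" by simp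
  have "(\<lambda>j. \<integral>\<^sup>+q. ennreal \<bar>kT0 (Y j + s) q - kT0 (s + s) q\<bar> \<partial>weighted_square) \<longlonglongrightarrow> 0"
    unfolding order_tendsto_iff
  proof (intro conjI allI impI)
    fix e :: ennreal assume e: "0 < e"
    obtain e' :: real where e': "0 < e'" "ennreal e' < e"
      using e by (metis dense ennreal_cases ennreal_less_zero_iff less_top_ennreal not_less_iff_gr_or_eq top.not_eq_extremum)
    \<comment> \<open>Three contributions of at most e' / 4 each stay below e'.\<close>
    have "\<forall>\<^sub>F n in sequentially. ennreal E * \<rho> n < ennreal (e' / 4)"
      using order_tendstoD(2)[OF \<rho>0, of "ennreal (e' / 4)"] e' by simp
    then obtain n where n: "ennreal E * \<rho> n < ennreal (e' / 4)" by (auto simp: eventually_sequentially)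
    have "\<forall>\<^sub>F j in sequentially. (\<integral>\<^sup>+q. ennreal \<bar>enn2real (cut_image s n (Y j) q) - enn2real (cut_image s n s q)\<bar> \<partial>weighted_square) < ennreal (e' / 4)"
      using order_tendstoD(2)[OF cut_image_continuous[OF s(1) s(1) Y(1) Yl, of n], of "ennreal (e' / 4)"] e' by simp
    then show "\<forall>\<^sub>F j in sequentially. (\<integral>\<^sup>+q. ennreal \<bar>kT0 (Y j + s) q - kT0 (s + s) q\<bar> \<partial>weighted_square) < e"
    proof eventually_elim
      case (elim j)
      have "(\<integral>\<^sup>+q. ennreal \<bar>kT0 (Y j + s) q - kT0 (s + s) q\<bar> \<partial>weighted_square) \<le>
        (\<integral>\<^sup>+q. ennreal \<bar>enn2real (cut_image s n (Y j) q) - enn2real (cut_image s n s q)\<bar> \<partial>weighted_square) +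
        (\<integral>\<^sup>+q. rest_image s n (Y j) q \<partial>weighted_square) + (\<integral>\<^sup>+q. rest_image s n s q \<partial>weighted_square)"
        by (rule kT0_distance_le[OF s(1) Y(1) s(1)])
      also have "\<dots> \<le> ennreal (e' / 4) + ennreal (e' / 4) + ennreal (e' / 4)"
        using rb[OF Y, of n j] rb[of s n] s n elim by (intro add_mono) (auto intro: order_trans less_imp_le)
      also have "\<dots> \<le> ennreal e'" using e' by (simp add: ennreal_plus[symmetric] ennreal_leI del: ennreal_plus)
      finally show ?case using e'(2) by simp
    qed
  qed simp
  then have "(\<lambda>j. ennreal (LINT q|weighted_square. \<bar>kT0 (Y j + s) q - kT0 (s + s) q\<bar>)) \<longlonglongrightarrow> ennreal 0"
    using int by (simp add: nn_integral_eq_integral)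
  then have "(\<lambda>j. LINT q|weighted_square. \<bar>kT0 (Y j + s) q - kT0 (s + s) q\<bar>) \<longlonglongrightarrow> 0"
    by (subst (asm) tendsto_ennreal_iff) (auto intro!: always_eventually integral_nonneg_AE)
  then have "(\<lambda>j. LINT q|weighted_square. \<bar>kT0 (X (j + j0)) q - kT0 t q\<bar>) \<longlonglongrightarrow> 0"
    unfolding Yt(1) using Yt(2) by metis
  then show "(\<lambda>j. LINT q|weighted_square. \<bar>kT0 (X j) q - kT0 t q\<bar>) \<longlonglongrightarrow> 0"
    by (rule LIMSEQ_offset)
qed

text \<open>For each t the measurable version agrees with \<open>kT0 t\<close> off an m^2-null set,
  hence for almost every x at almost every y, which preserves the integral representation. Signed u
  are split into positive and negative parts.\<close>

lemma ex_kernel_T: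
  obtains kT where "is_kernel 1 m T kT"
    "\<And>t. 0 < t \<Longrightarrow> AE q in m \<Otimes>\<^sub>M m. kT t (fst q) (snd q) = kT0 t q"
proof -
  interpret P: pair_sigma_finite m m ..
  obtain U where U: "U \<in> borel_measurable (borel \<Otimes>\<^sub>M weighted_square)" "\<And>t. 0 < t \<Longrightarrow> AE q in weighted_square. U (t, q) = kT0 t q"
    by (rule ex_jointly_measurable_version[OF kT0_integrable kT0_continuous]) auto
  have sp: "sets (borel \<Otimes>\<^sub>M weighted_square) = sets (borel \<Otimes>\<^sub>M (m \<Otimes>\<^sub>M m))" by (rule sets_pair_measure_cong) auto
  have Um[measurable]: "U \<in> borel_measurable (borel \<Otimes>\<^sub>M (m \<Otimes>\<^sub>M m))"
    using U(1) measurable_cong_sets[OF sp refl] by blast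
  define kT where "kT t x y = U (t, x, y)" for t x y
  have ae: "AE q in m \<Otimes>\<^sub>M m. kT t (fst q) (snd q) = kT0 t q" if "0 < t" for t
    using U(2)[OF that] unfolding weighted_square_AE kT_def by simp
  have "is_kernel 1 m T kT"
    unfolding is_kernel_def
  proof (intro conjI allI impI ballI)
    have "(\<lambda>q. (fst q, snd q)) \<in> (restrict_space borel {0<..} \<Otimes>\<^sub>M (m \<Otimes>\<^sub>M m)) \<rightarrow>\<^sub>M ((borel :: real measure) \<Otimes>\<^sub>M (m \<Otimes>\<^sub>M m))"
      by (intro measurable_Pair measurable_compose[OF measurable_fst] measurable_restrict_space1 measurable_ident measurable_snd)
        simp
    from measurable_compose[OF this Um]
    show "(\<lambda>(t, x, y). kT t x y) \<in> borel_measurable (restrict_space borel {0<..} \<Otimes>\<^sub>M (m \<Otimes>\<^sub>M m))"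
      unfolding kT_def by (simp add: case_prod_beta')
    fix t :: real and u :: "'a \<Rightarrow> real" assume t: "0 < t" and u12: "u \<in> Lp 2 m \<inter> Lp 1 m"
    then have u: "u \<in> Lp 2 m" by simp
    have [measurable]: "u \<in> borel_measurable m" by (rule L2_measurable[OF u])
    note [measurable] = kT0_measurable[OF t]
    have kTm[measurable]: "(\<lambda>y. kT t x y) \<in> borel_measurable m" if [measurable]: "x \<in> space m" for x
      unfolding kT_def by measurable
    define u1 where "u1 x = max 0 (u x)" for x
    define u2 where "u2 x = max 0 (- u x)" for x
    have u1: "u1 \<in> Lp 2 m" "\<And>x. 0 \<le> u1 x" and u2: "u2 \<in> Lp 2 m" "\<And>x. 0 \<le> u2 x"
      unfolding u1_def u2_def by (auto intro!: L2_mono(1)[OF u])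
    have ud: "u x = u1 x - u2 x" for x unfolding u1_def u2_def by auto
    have part: "AE x in m. integrable m (\<lambda>y. kT0 t (x, y) * v y) \<and> T t v x = (LINT y|m. kT0 t (x, y) * v y)"
      if v: "v \<in> Lp 2 m" "\<And>x. 0 \<le> v x" for v
    proof -
      have [measurable]: "v \<in> borel_measurable m" by (rule L2_measurable[OF v(1)])
      have "AE x in m. 0 \<le> T t v x" using t v by (intro T.T_nonneg) auto
      with kT0_rep[OF t v] show ?thesis
        using AE_space
      proof eventually_elim
        case (elim x)
        note [measurable] = elim(3)
        have e: "ennreal (T t v x) = (\<integral>\<^sup>+y. ennreal (kT0 t (x, y) * v y) \<partial>m)"
          unfolding elim(1) by (intro nn_integral_cong) (simp add: ennreal_mult kT0_nonneg[OF t] v(2))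
        have i: "integrable m (\<lambda>y. kT0 t (x, y) * v y)"
        proof (rule integrableI_nonneg)
          show "(\<integral>\<^sup>+y. ennreal (kT0 t (x, y) * v y) \<partial>m) < \<infinity>" unfolding e[symmetric] by simp
        qed (auto simp: kT0_nonneg[OF t] v(2))
        have "ennreal (T t v x) = ennreal (LINT y|m. kT0 t (x, y) * v y)"
          unfolding e using i by (intro nn_integral_eq_integral) (auto simp: kT0_nonneg[OF t] v(2))
        then have "T t v x = (LINT y|m. kT0 t (x, y) * v y)"
          using elim(2) by (subst (asm) ennreal_inj) (auto intro!: integral_nonneg_AE simp: kT0_nonneg[OF t] v(2))
        then show ?case using i by simp
      qed
    qed
    have "AE x in m. T t u x = T t u1 x - T t u2 x"
      using positive_operator_L2_diff[OF T.positive_operator u1(1) u2(1), of t] t unfolding ud[symmetric] by simp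
    moreover have "AE x in m. AE y in m. kT t x y = kT0 t (x, y)" using P.AE_pair[OF ae[OF t]] by simp
    ultimately show "AE x in m. integrable m (\<lambda>y. kT t x y * u y) \<and> T t u x = (LINT y|m. kT t x y * u y)"
      using part[OF u1] part[OF u2] AE_space
    proof eventually_elim
      case (elim x)
      note [measurable] = elim(5)
      have q: "(\<lambda>y. kT0 t (x, y) * u y) = (\<lambda>y. kT0 t (x, y) * u1 y - kT0 t (x, y) * u2 y)"
        by (simp only: right_diff_distrib[symmetric] ud[symmetric])
      have i: "integrable m (\<lambda>y. kT0 t (x, y) * u y)"
        and e: "(LINT y|m. kT0 t (x, y) * u y) = T t u x"
        unfolding q using elim(1,3,4) by auto
      have c: "AE y in m. kT0 t (x, y) * u y = kT t x y * u y" using elim(2) by eventually_elim simp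
      have "integrable m (\<lambda>y. kT t x y * u y)" by (rule integrable_cong_AE_imp[OF i _ c]) measurable
      moreover have "(LINT y|m. kT t x y * u y) = (LINT y|m. kT0 t (x, y) * u y)"
        using c by (intro integral_cong_AE) auto
      ultimately show ?case using e by simp
    qed
  qed
  then show ?thesis using that ae by blast
qed

text \<open>Passage from extended to Bochner integrals. Where the inner integral is infinite the
  Bochner integral is 0 by convention, but finiteness of the perturbation at x confines this to a
  null set of times.\<close>

lemma perturbation_eq_integral:
  assumes t: "0 < t"
  shows "AE x in m. 0 \<le> (LINT s:{0<..<t}|lborel. exp (\<omega> * (t - s)) * (LINT z|m. kS s x z * f z)) \<and>
    perturbation t x = ennreal (LINT s:{0<..<t}|lborel. exp (\<omega> * (t - s)) * (LINT z|m. kS s x z * f z))"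
proof -
  interpret P: pair_sigma_finite lborel m ..
  interpret PM: pair_sigma_finite m m ..
  define \<kappa> where "\<kappa> q = (if 0 < fst q then kS (fst q) (fst (snd q)) (snd (snd q)) else 0)" for q
  have [measurable]: "\<kappa> \<in> borel_measurable (borel \<Otimes>\<^sub>M (m \<Otimes>\<^sub>M m))"
    unfolding \<kappa>_def by (rule kS_measurable_joint)
  have \<kappa>: "\<kappa> (s, x, z) = kS s x z" if "0 < s" for s x z using that by (simp add: \<kappa>_def)
  \<comment> \<open>The negative mass of the kernel in z, jointly measurable in (s, x). It vanishes
    for each s off a null set of x; exchanging the quantifiers gives, for almost every x, a
    nonnegative kernel at almost every s.\<close>
  define \<nu> where "\<nu> q = (\<integral>\<^sup>+z. ennreal (- \<kappa> (fst q, snd q, z)) \<partial>m)" for q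
  have [measurable]: "\<nu> \<in> borel_measurable (borel \<Otimes>\<^sub>M m)" unfolding \<nu>_def by measurable
  have "AE s in lborel. AE x in m. \<nu> (s, x) = 0"
  proof (rule AE_I2)
    fix s :: real
    show "AE x in m. \<nu> (s, x) = 0"
    proof (cases "0 < s")
      case True
      have "AE x in m. AE z in m. 0 \<le> kS s x z" using PM.AE_pair[OF kS_nonneg[OF True]] by simp
      then show ?thesis
      proof eventually_elim
        case (elim x)
        have "\<nu> (s, x) = (\<integral>\<^sup>+z. 0 \<partial>m)"
          unfolding \<nu>_def using elim True by (intro nn_integral_cong_AE) (auto simp: ennreal_neg \<kappa>)
        then show ?case by simp
      qed
    qed (simp add: \<nu>_def \<kappa>_def)
  qed
  then have \<nu>0: "AE x in m. AE s in lborel. \<nu> (s, x) = 0"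
    by (subst P.AE_commute[symmetric]) measurable
  have "AE x in m. ennreal (w x) * perturbation t x \<noteq> \<infinity>"
    using perturbation_weight_finite[OF t] by (intro nn_integral_PInf_AE) auto
  with \<nu>0 show ?thesis
    using AE_space
  proof eventually_elim
    case (elim x)
    note [measurable] = elim(3)
    define J where "J s = (\<integral>\<^sup>+z. k (s, x, z) * ennreal (f z) \<partial>m)" for s
    have [measurable]: "J \<in> borel_measurable borel" unfolding J_def by measurable
    have pf: "perturbation t x = (\<integral>\<^sup>+s. indicator {0<..<t} s * (ennreal (exp (\<omega> * (t - s))) * J s) \<partial>lborel)"
      unfolding perturbation_def J_def ..
    have fin: "perturbation t x \<noteq> \<infinity>"
      using elim(2) w_pos[of x] by (auto simp: ennreal_mult_eq_top_iff ennreal_eq_0_iff not_le)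
    have "AE s in lborel. indicator {0<..<t} s * (ennreal (exp (\<omega> * (t - s))) * J s) \<noteq> \<infinity>"
      using fin unfolding pf by (intro nn_integral_PInf_AE) auto
    then have ae: "AE s in lborel. indicator {0<..<t} s * (ennreal (exp (\<omega> * (t - s))) * J s) =
        ennreal (indicator {0<..<t} s *\<^sub>R (exp (\<omega> * (t - s)) * enn2real (J s)))"
    proof eventually_elim
      case (elim s)
      show ?case
      proof (cases "s \<in> {0<..<t}")
        case True
        then have "J s < \<infinity>" using elim by (auto simp: ennreal_mult_eq_top_iff less_top)
        then show ?thesis using True by (simp add: ennreal_mult)
      qed simp
    qed
    have Jk: "AE s in lborel. indicator {0<..<t} s *\<^sub>R (exp (\<omega> * (t - s)) * (LINT z|m. kS s x z * f z)) =
        indicator {0<..<t} s *\<^sub>R (exp (\<omega> * (t - s)) * enn2real (J s))"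
      using elim(1)
    proof eventually_elim
      case (elim s)
      show ?case
      proof (cases "s \<in> {0<..<t}")
        case True
        then have s: "0 < s" by simp
        have [measurable]: "(\<lambda>z. kS s x z) \<in> borel_measurable m"
          using measurable_compose[OF measurable_Pair1' kS_measurable[OF s], of x] \<open>x \<in> space m\<close> by simp
        have "AE z in m. ennreal (- kS s x z) = 0"
          using elim s unfolding \<nu>_def by (subst (asm) nn_integral_0_iff_AE) (auto simp: \<kappa>)
        then have nn: "AE z in m. 0 \<le> kS s x z" by eventually_elim (simp add: ennreal_eq_0_iff)
        have "(LINT z|m. kS s x z * f z) = enn2real (\<integral>\<^sup>+z. ennreal (kS s x z * f z) \<partial>m)"
          using nn by (intro integral_eq_nn_integral) (auto simp: f_nonneg)
        also have "(\<integral>\<^sup>+z. ennreal (kS s x z * f z) \<partial>m) = J s"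
          unfolding J_def
        proof (rule nn_integral_cong_AE)
          show "AE z in m. ennreal (kS s x z * f z) = k (s, x, z) * ennreal (f z)"
            using nn by eventually_elim (use s in \<open>simp add: k_def ennreal_mult f_nonneg\<close>)
        qed
        finally show ?thesis by simp
      qed simp
    qed
    define h where "h s = indicator {0<..<t} s *\<^sub>R (exp (\<omega> * (t - s)) * enn2real (J s))" for s
    have [measurable]: "h \<in> borel_measurable borel" unfolding h_def by measurable
    have "perturbation t x = (\<integral>\<^sup>+s. ennreal (h s) \<partial>lborel)"
      unfolding pf h_def using ae by (rule nn_integral_cong_AE)
    then have "ennreal (LINT s|lborel. h s) = perturbation t x"
      using fin by (subst integral_eq_nn_integral) (auto simp: h_def less_top)
    moreover have "(LINT s:{0<..<t}|lborel. exp (\<omega> * (t - s)) * (LINT z|m. kS s x z * f z)) = (LINT s|lborel. h s)"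
      unfolding set_lebesgue_integral_def
    proof (rule integral_cong_AE)
      have "(\<lambda>s. indicator {0<..<t} s *\<^sub>R (exp (\<omega> * (t - s)) * (LINT z|m. kS s x z * f z))) =
          (\<lambda>s. indicator {0<..<t} s *\<^sub>R (exp (\<omega> * (t - s)) * (LINT z|m. \<kappa> (s, x, z) * f z)))"
        by (auto simp: \<kappa> indicator_def)
      then show "(\<lambda>s. indicator {0<..<t} s *\<^sub>R (exp (\<omega> * (t - s)) * (LINT z|m. kS s x z * f z))) \<in> borel_measurable lborel"
        by simp
    qed (use Jk in \<open>auto simp: h_def\<close>)
    moreover have "0 \<le> (LINT s|lborel. h s)" by (intro integral_nonneg_AE) (simp add: h_def)
    ultimately show ?case by simp
  qed
qed

end

lemma (in sigma_finite_measure) AE_pair_fst: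
  assumes "AE x in M. P x"
  shows "AE q in M \<Otimes>\<^sub>M M. P (fst q)"
proof -
  obtain N where N: "N \<in> null_sets M" "{x \<in> space M. \<not> P x} \<subseteq> N"
    using assms by (auto simp: eventually_ae_filter)
  show ?thesis
  proof (rule AE_I')
    show "N \<times> space M \<in> null_sets (M \<Otimes>\<^sub>M M)" using N(1) by (rule times_in_null_sets1) simp
    show "{q \<in> space (M \<Otimes>\<^sub>M M). \<not> P (fst q)} \<subseteq> N \<times> space M"
      using N(2) by (auto simp: space_pair_measure)
  qed
qed

theorem corollary4p3:
  fixes m :: "'a measure"
    and p p' :: ennreal
    and S T :: "real \<Rightarrow> ('a \<Rightarrow> real) \<Rightarrow> ('a \<Rightarrow> real)"
    and kS :: "real \<Rightarrow> 'a \<Rightarrow> 'a \<Rightarrow> real"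
    and M \<omega> C0 :: real
    and f :: "'a \<Rightarrow> real"
  assumes "sigma_finite_measure m"
    and "1 \<le> p" and "p < \<infinity>" and "1 / p + 1 / p' = 1"
    and "C0_semigroup_L2 m S" and "positive_semigroup_L2 m S"
    and "C0_semigroup_L2 m T" and "positive_semigroup_L2 m T"
    and "acts_on_Lp p m S" and "is_kernel p m S kS"
    and "M \<ge> 1" and "acts_on_Lp_with 1 m T M \<omega>"
    and "f \<in> Lp p m" and "AE x in m. 0 \<le> f x" and "C0 \<ge> 0"
    and "\<And>u Au v' Av'.
      (u, Au) \<in> generator_L2 m T \<Longrightarrow> u \<in> Lp 1 m \<Longrightarrow> (AE x in m. 0 \<le> u x) \<Longrightarrow>
      (v', Av') \<in> weak_star_generator_L2 m S \<Longrightarrow> v' \<in> Lp p' m \<Longrightarrow> (AE x in m. 0 \<le> v' x) \<Longrightarrow>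
      pairing m Au v' \<le> pairing m u Av' + C0 * Lp_norm 1 m u * pairing m f v'"
  shows "\<exists>kT. is_kernel 1 m T kT \<and>
    (\<exists>C\<ge>0. \<forall>t>0. AE (x, y) in m \<Otimes>\<^sub>M m.
       kT t x y \<le> kS t x y +
         C * (LINT s:{0<..<t}|lborel. exp (\<omega> * (t - s)) * (LINT z|m. kS s x z * f z)))"
proof -
  interpret sigma_finite_measure m by fact
  obtain w :: "'a \<Rightarrow> real" where w: "w \<in> borel_measurable m" "\<And>x. 0 < w x" "\<And>x. w x \<le> 1" "integrable m w"
    using ex_bounded_integrable_weight by blast
  have fm[measurable]: "f \<in> borel_measurable m" using assms(13) by (simp add: Lp_def)
  \<comment> \<open>The locale asks for nonnegativity at every point. Changing f on a null set
    alters neither its pairings with functions in L_p' nor its integrals against the kernel.\<close>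
  define g where "g x = max 0 (f x)" for x
  have [measurable]: "g \<in> borel_measurable m" unfolding g_def by measurable
  have fg: "AE x in m. f x = g x" using assms(14) by eventually_elim (simp add: g_def)
  have gp: "g \<in> Lp p m"
  proof -
    have "integrable m (\<lambda>x. \<bar>g x\<bar> powr enn2real p)"
    proof (rule integrable_cong_AE_imp)
      show "integrable m (\<lambda>x. \<bar>f x\<bar> powr enn2real p)" using assms(3,13) by (auto simp: Lp_def)
      show "AE x in m. \<bar>f x\<bar> powr enn2real p = \<bar>g x\<bar> powr enn2real p" using fg by eventually_elim simp
    qed measurable
    then show ?thesis using assms(3) by (simp add: Lp_def)
  qed
  have pg: "pairing m g v = pairing m f v" if "v \<in> Lp p' m" for v
    using that fg by (intro pairing_cong_AE) (auto simp: Lp_def)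
  interpret semigroup_comparison m S w p p' kS T M \<omega> C0 g
  proof unfold_locales
    show "C0_semigroup_L2 m S" "positive_semigroup_L2 m S" "C0_semigroup_L2 m T" "positive_semigroup_L2 m T" by fact+
    show "w \<in> borel_measurable m" "integrable m w" by fact+
    show "0 < w x" "w x \<le> 1" for x by (rule w)+
    show "1 \<le> p" "p < \<infinity>" "1 / p + 1 / p' = 1" "acts_on_Lp p m S" "is_kernel p m S kS" by fact+
    show "1 \<le> M" "acts_on_Lp_with 1 m T M \<omega>" "g \<in> Lp p m" "0 \<le> C0" by fact+
    show "0 \<le> g x" for x unfolding g_def by simp
    fix u Au v' Av'
    assume a: "(u, Au) \<in> generator_L2 m T" "u \<in> Lp 1 m" "AE x in m. 0 \<le> u x"
      "(v', Av') \<in> weak_star_generator_L2 m S" "v' \<in> Lp p' m" "AE x in m. 0 \<le> v' x"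
    from assms(16)[OF this]
    show "pairing m Au v' \<le> pairing m u Av' + C0 * Lp_norm 1 m u * pairing m g v'"
      unfolding pg[OF a(5)] .
  qed
  interpret P: pair_sigma_finite m m ..
  obtain kT where kT: "is_kernel 1 m T kT" "\<And>t. 0 < t \<Longrightarrow> AE q in m \<Otimes>\<^sub>M m. kT t (fst q) (snd q) = kT0 t q"
    by (rule ex_kernel_T) blast
  have "AE (x, y) in m \<Otimes>\<^sub>M m. kT t x y \<le> kS t x y +
      C0 * M * (LINT s:{0<..<t}|lborel. exp (\<omega> * (t - s)) * (LINT z|m. kS s x z * f z))" if t: "0 < t" for t
  proof -
    define I where "I h x = (LINT s:{0<..<t}|lborel. exp (\<omega> * (t - s)) * (LINT z|m. kS s x z * h z))" for h :: "'a \<Rightarrow> real" and x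
    have Ig: "AE q in m \<Otimes>\<^sub>M m. 0 \<le> I g (fst q) \<and> perturbation t (fst q) = ennreal (I g (fst q))"
      unfolding I_def by (rule AE_pair_fst[OF perturbation_eq_integral[OF t]])
    \<comment> \<open>The conclusion speaks of the original f, so the change on a null set is undone
      here.\<close>
    have I: "I g x = I f x" if x: "x \<in> space m" for x
      unfolding I_def
    proof (intro set_lebesgue_integral_cong ballI allI impI)
      fix s assume "s \<in> {0<..<t}"
      then have s: "0 < s" by simp
      have [measurable]: "(\<lambda>z. kS s x z) \<in> borel_measurable m"
        using measurable_compose[OF measurable_Pair1' kS_measurable[OF s], of x] x by simp
      have "(LINT z|m. kS s x z * g z) = (LINT z|m. kS s x z * f z)"
        using fg by (intro integral_cong_AE) auto
      then show "exp (\<omega> * (t - s)) * (LINT z|m. kS s x z * g z) = exp (\<omega> * (t - s)) * (LINT z|m. kS s x z * f z)"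
        by simp
    qed simp
    have "AE q in m \<Otimes>\<^sub>M m. kT t (fst q) (snd q) \<le> kS t (fst q) (snd q) + C0 * M * I f (fst q)"
      using Ig kT(2)[OF t] kT0_le[OF t] kS_nonneg[OF t] AE_space
    proof eventually_elim
      case (elim q)
      have C: "0 \<le> C0 * M" using C0_nonneg M_ge_1 by simp
      have If: "I g (fst q) = I f (fst q)" using elim(5) by (intro I) (auto simp: space_pair_measure)
      have "ennreal (kT0 t q) \<le> ennreal (kS t (fst q) (snd q)) + ennreal (C0 * M) * ennreal (I f (fst q))"
        using elim(1,3) t unfolding bound_kernel_def k_def If by simp
      also have "\<dots> = ennreal (kS t (fst q) (snd q) + C0 * M * I f (fst q))"
        using elim(1,4) C unfolding If by (simp add: ennreal_mult)
      finally have "kT0 t q \<le> kS t (fst q) (snd q) + C0 * M * I f (fst q)"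
        using elim(1,4) C unfolding If by (subst (asm) ennreal_le_iff) auto
      then show ?case using elim(2) by simp
    qed
    then show ?thesis unfolding I_def by (simp add: case_prod_beta')
  qed
  then show ?thesis using kT(1) C0_nonneg M_ge_1 by (intro exI[of _ kT] conjI exI[of _ "C0 * M"]) auto
qed

end
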